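(* Let $X$ be a trawl process with trawl function $a$ and homogeneous Lévy basis $L$ on $\mathbb{R}^2$ with characteristic triplet $(\gamma,b,\nu)$ and Lévy seed $L'$, observed at times $0,\Delta_n,\ldots,(n-1)\Delta_n$. Assume: (i) as $n\uparrow\infty$, $\Delta_n\downarrow0$, $n\Delta_n\to+\infty$, and $n\Delta_n^3\to\mu\in[0,\infty)$; (ii) $a(s)=\int_s^\infty\phi(y)\,dy$ for $s\ge 0$, where $\phi$ is a strictly positive function that is continuous on $[0,\infty)$ and satisfies $\phi(s)=\mathrm{O}(s^{-\alpha-1})$ as $s\to+\infty$ for some $\alpha>1$; (iii) $\mathrm{Var}(L')=1$ and $\mathbb{E}(|L'|^{p_0})<\infty$ for some $p_0>4$. Let $c_4(L')=\int x^4\nu(dx)$ and $Q_n=\frac{1}{2\Delta_n n}\sum_{k=0}^{n-2}(\delta_kX)^4$. If $c_4(L')>0$, then, as $n\to\infty$, $$\sqrt{\frac{n\Delta_n}{Q_n}}\left(\hat a(0)-a(0)-\frac12\Delta_n\hat a'(0)\right)\overset{d}{\to}N(0,1).$$ If $c_4(L')=0$, assume in addition that $n\Delta_n^2\to\mu_0\in[0,\infty)$ and that $(K_n)$ is a sequence in $\mathbb{N}$ with $K_n\uparrow+\infty$ and $K_n\Delta_n\to0$. Then, as $n\to\infty$, $$\sqrt{\frac{n\Delta_n}{Q_n}}\left(\hat a(0)-a(0)-\frac12\Delta_n\tilde a'(0)\right)\overset{d}{\to}N(0,1/3).$$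
   Context: A homogeneous Lévy basis $L$ on $\mathbb{R}^2$ with characteristic triplet $(\gamma,b,\nu)$ is a family of real random variables $L(B)$, indexed by Borel sets $B\subset\mathbb{R}^2$ with $\mathrm{Leb}(B)<\infty$, that is almost surely $\sigma$-additive, has $L(B)$ and $L(C)$ independent for disjoint $B,C$ (independently scattered), each $L(B)$ infinitely divisible, and $\log \mathbb{E}(e^{izL(B)})=\mathrm{Leb}(B)\psi(z)$, where $\psi(z)=i\gamma z-\frac12 b^2z^2+\int_{\mathbb{R}\setminus\{0\}}(e^{izx}-1-izx\mathbf 1_{|x|\le1})\nu(\mathrm{d}x)$, with $\gamma\in\mathbb R$, $b\ge 0$ and $\nu$ a Lévy measure. The Lévy seed $L'$ is an infinitely divisible random variable with $\log\mathbb{E}(e^{izL'})=\psi(z)$. A trawl process: let $a:[0,\infty)\to[0,\infty)$ (the trawl function) be continuous, non-increasing and integrable, let $A=\{(r,y): r\le 0,\ 0\le y\le a(-r)\}$ (the trawl set), $A_t=A+(t,0)$, and $X_t=L(A_t)$, $t\in\mathbb{R}$. Estimators at $0$: with $\delta_kX=X_{(k+1)\Delta_n}-X_{k\Delta_n}$, $$\hat a(0)=\frac{1}{2\Delta_n n}\sum_{k=0}^{n-2}(\delta_kX)^2,\qquad \hat a'(0)=\frac1{n\Delta_n^2}\sum_{k=1}^{n-2}\delta_kX\cdot\delta_{k-1}X.$$ Given $(K_n)$, put $\tilde\Delta_n=K_n\Delta_n$, $M_n=\lfloor(n-1)/K_n\rfloor$, $\tilde\delta_kX=X_{(k+1)\tilde\Delta_n}-X_{k\tilde\Delta_n}$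 for $k=0,\dots,M_n-1$, and $$\tilde a'(0)=\frac{1}{M_n\tilde\Delta_n^2}\sum_{k=1}^{M_n-1}\tilde\delta_kX\cdot\tilde\delta_{k-1}X.$$ *)

theory Defs
  imports "HOL-Probability.Probability"
begin

section \<open>Infinitely divisible laws and Levy-Khintchine triplets\<close>

text \<open>For every \<open>n \<ge> 1\<close>, the law is that of a sum of \<open>n\<close> i.i.d. real random variables.\<close>

definition infinitely_divisible :: "real measure \<Rightarrow> bool" where
  "infinitely_divisible D \<longleftrightarrow>
     (\<forall>n::nat. n \<ge> 1 \<longrightarrow> (\<exists>R. real_distribution R \<and>
        distr (Pi\<^sub>M {..<n} (\<lambda>_. R)) borel (\<lambda>x. \<Sum>i<n. x i) = D))"

definition levy_measure :: "real measure \<Rightarrow> bool" where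
  "levy_measure \<nu> \<longleftrightarrow>
     sets \<nu> = sets borel \<and> emeasure \<nu> {0} = 0 \<and> (\<integral>\<^sup>+x. ennreal (min 1 (x\<^sup>2)) \<partial>\<nu>) < \<infinity>"

definition levy_triplet :: "real \<Rightarrow> real \<Rightarrow> real measure \<Rightarrow> bool" where
  "levy_triplet \<gamma> b \<nu> \<longleftrightarrow> 0 \<le> b \<and> levy_measure \<nu>"

definition levy_exponent :: "real \<Rightarrow> real \<Rightarrow> real measure \<Rightarrow> real \<Rightarrow> complex" where
  "levy_exponent \<gamma> b \<nu> z =
     \<i> * complex_of_real (\<gamma> * z) - complex_of_real (b\<^sup>2 * z\<^sup>2 / 2)
     + (LINT x:- {0}|\<nu>. iexp (z * x) - 1 - \<i> * complex_of_real (z * x * indicator {-1..1} x))"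

text \<open>Taken in \<open>[0, \<infinity>]\<close>, so that the value is meaningful without an integrability side condition.\<close>

definition c4 :: "real measure \<Rightarrow> ennreal" where
  "c4 \<nu> = (\<integral>\<^sup>+x. ennreal (x ^ 4) \<partial>\<nu>)"

text \<open>
  The logarithm of a characteristic function is the distinguished one, so
  ``\<open>log (E exp (i z Y)) = \<psi> z\<close> for all \<open>z\<close>'' is stated as \<open>E exp (i z Y) = exp (\<psi> z)\<close>.
\<close>

locale levy_seed = prob_space N for N :: "'b measure" +
  fixes Y :: "'b \<Rightarrow> real" and \<gamma> b :: real and \<nu> :: "real measure"
  assumes triplet: "levy_triplet \<gamma> b \<nu>"
    and measurable_seed: "random_variable borel Y"
    and infinitely_divisible_seed: "infinitely_divisible (distr N borel Y)"
    and char_seed: "\<And>z. char (distr N borel Y) z = exp (levy_exponent \<gamma> b \<nu> z)"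


section \<open>Homogeneous Levy bases on the plane\<close>

definition finite_borel :: "(real \<times> real) set set" where
  "finite_borel = {B \<in> sets borel. emeasure lborel B < \<infinity>}"

text \<open>
  Independent scattering is the usual notion: for disjoint sets \<open>B 0, B 1, \<dots>\<close> the variables
  \<open>L (B 0), L (B 1), \<dots>\<close> are (mutually) independent.  Finite families are included, as the
  sets may be empty.
\<close>

locale homogeneous_levy_basis = prob_space M for M :: "'a measure" +
  fixes L :: "(real \<times> real) set \<Rightarrow> 'a \<Rightarrow> real"
    and \<gamma> b :: real and \<nu> :: "real measure"
  assumes triplet: "levy_triplet \<gamma> b \<nu>"
    and measurable_basis: "\<And>B. B \<in> finite_borel \<Longrightarrow> random_variable borel (L B)"
    and countably_additive_AE: "\<And>B :: nat \<Rightarrow> (real \<times> real) set.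
          disjoint_family B \<Longrightarrow> range B \<subseteq> finite_borel \<Longrightarrow> (\<Union>i. B i) \<in> finite_borel \<Longrightarrow>
          AE \<omega> in M. (\<lambda>i. L (B i) \<omega>) sums L (\<Union>i. B i) \<omega>"
    and independently_scattered: "\<And>B :: nat \<Rightarrow> (real \<times> real) set.
          disjoint_family B \<Longrightarrow> range B \<subseteq> finite_borel \<Longrightarrow>
          indep_vars (\<lambda>_. borel) (\<lambda>i. L (B i)) UNIV"
    and infinitely_divisible_basis: "\<And>B. B \<in> finite_borel \<Longrightarrow>
          infinitely_divisible (distr M borel (L B))"
    and char_basis: "\<And>B z. B \<in> finite_borel \<Longrightarrow>
          char (distr M borel (L B)) z
            = exp (complex_of_real (measure lborel B) * levy_exponent \<gamma> b \<nu> z)"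


section \<open>Trawl processes\<close>

text \<open>A trawl function lives on \<open>[0, \<infinity>)\<close>; its values at negative arguments are irrelevant.\<close>

definition trawl_function :: "(real \<Rightarrow> real) \<Rightarrow> bool" where
  "trawl_function a \<longleftrightarrow>
     (\<forall>s\<ge>0. 0 \<le> a s) \<and> continuous_on {0..} a \<and> antimono_on {0..} a \<and>
     set_integrable lborel {0..} a"

definition trawl_set :: "(real \<Rightarrow> real) \<Rightarrow> (real \<times> real) set" where
  "trawl_set a = {(r, y). r \<le> 0 \<and> 0 \<le> y \<and> y \<le> a (- r)}"

definition trawl_process ::
  "((real \<times> real) set \<Rightarrow> 'a \<Rightarrow> real) \<Rightarrow> (real \<Rightarrow> real) \<Rightarrow> real \<Rightarrow> 'a \<Rightarrow> real" where
  "trawl_process L a t = L ((\<lambda>p. p + (t, 0)) ` trawl_set a)"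


section \<open>Estimators\<close>

text \<open>
  All of them are functionals of a path \<open>x\<close>, the step size \<open>h\<close> and the number \<open>n\<close> of
  observations \<open>x 0, x h, \<dots>, x ((n - 1) h)\<close>.  The index range \<open>0 \<le> k \<le> n - 2\<close> is
  \<open>{..<n - 1}\<close>, and \<open>1 \<le> k \<le> n - 2\<close> is \<open>{1..<n - 1}\<close>.
\<close>

definition increment :: "(real \<Rightarrow> real) \<Rightarrow> real \<Rightarrow> nat \<Rightarrow> real" where
  "increment x h k = x (real (k + 1) * h) - x (real k * h)"

definition a_hat :: "(real \<Rightarrow> real) \<Rightarrow> real \<Rightarrow> nat \<Rightarrow> real" where
  "a_hat x h n = 1 / (2 * h * real n) * (\<Sum>k<n - 1. (increment x h k)\<^sup>2)"

definition a'_hat :: "(real \<Rightarrow> real) \<Rightarrow> real \<Rightarrow> nat \<Rightarrow> real" where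
  "a'_hat x h n =
     1 / (real n * h\<^sup>2) * (\<Sum>k\<in>{1..<n - 1}. increment x h k * increment x h (k - 1))"

definition Q_stat :: "(real \<Rightarrow> real) \<Rightarrow> real \<Rightarrow> nat \<Rightarrow> real" where
  "Q_stat x h n = 1 / (2 * h * real n) * (\<Sum>k<n - 1. (increment x h k) ^ 4)"

definition a'_tilde :: "(real \<Rightarrow> real) \<Rightarrow> real \<Rightarrow> nat \<Rightarrow> nat \<Rightarrow> real" where
  "a'_tilde x h K n =
     (let m = (n - 1) div K; h' = real K * h
      in 1 / (real m * h'\<^sup>2) * (\<Sum>k\<in>{1..<m}. increment x h' k * increment x h' (k - 1)))"

end

theory Submission
  imports Defs
begin

text \<open>
  Write \<open>u h\<close> for the area of the part of a trawl set that is not covered by its translate by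
  \<open>h\<close>, so that \<open>u h = a 0 * h - \<phi> 0 * h\<^sup>2 / 2 + o(h\<^sup>2)\<close>.  An increment over a step \<open>h\<close> is the
  centred basis on the points that enter the trawl minus the centred basis on the points that
  leave it; both sets have area \<open>u h\<close>, and each of the two families is independent over the
  steps.  Hence a squared increment has mean \<open>2 * u h\<close>, and consecutive increments have
  covariance \<open>- \<phi> 0 * h\<^sup>2 + o(h\<^sup>2)\<close>: the product term removes exactly the bias of order \<open>h\<close>.

  The law of the basis on a set \<open>B\<close> depends only on the area of \<open>B\<close>, and its centred fourth
  moment is \<open>3 |B|\<^sup>2 + \<kappa> |B|\<close>.  If \<open>c4 \<nu> > 0\<close>, then \<open>\<kappa> > 0\<close>, the fluctuations of the
  squared increments are those of twice the squares over the entering sets, to which Lyapunov's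
  central limit theorem applies, and \<open>Q_stat\<close> tends to \<open>\<kappa> * a 0\<close>, the limiting variance.
  If \<open>c4 \<nu> = 0\<close>, the basis is Gaussian.  Gaussian integration by parts shows that the
  characteristic function of the normalised quadratic form nearly solves \<open>f' t = - t * f t\<close>; the
  limiting variance is \<open>2 * (a 0)\<^sup>2\<close>, while \<open>Q_stat / \<Delta>\<close> tends to \<open>6 * (a 0)\<^sup>2\<close>.
\<close>

section \<open>Fourth moments and convergence in probability\<close>

text \<open>Moments exist only slightly above order 4, so squares have barely more than two moments
  and fourth powers barely more than one. Lyapunov's condition then calls for
  \<open>E |Z B|^p = O(|B|)\<close> on small sets \<open>B\<close>. This is obtained without
  decomposing the basis into jumps: the \<open>p\<close>-th moment of a symmetrised basis is
  superadditive in the area, by Clarkson's inequality, hence at most linear on small areas. Likewise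
  \<kappa> (called \<open>excess\<close>) is never computed as \<open>c4 \<nu>\<close>; it suffices
  that it is positive or zero together with \<open>c4 \<nu>\<close>, which is read off the
  characteristic function. Increments are dependent. They are treated as integrals of simple
  functions against the basis; polarisation gives all their fourth order products, so that the
  remainders become quadratic forms with explicit variances. In the Gaussian case the products of
  neighbouring increments at step \<Delta> fluctuate as much as the squares do. Products over blocks
  of \<open>K\<close> steps carry the same mean correction with a variance smaller by the order
  \<open>1 / K\<close>, whence \<open>a'_tilde\<close>.\<close>

context prob_space
begin

text \<open>A class closed under linear combinations in which products of up to four members are
  integrable; the side conditions of quadratic and quartic expansions then become
  mechanical.\<close>

definition fourth_moment :: "('a \<Rightarrow> real) \<Rightarrow> bool" where
  "fourth_moment X \<longleftrightarrow> random_variable borel X \<and> integrable M (\<lambda>\<omega>. X \<omega> ^ 4)"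

lemma fourth_moment_measurable: "fourth_moment X \<Longrightarrow> random_variable borel X"
  by (simp add: fourth_moment_def)

lemma abs_mult4_le:
  fixes a b c d :: real
  shows "\<bar>a * b * c * d\<bar> \<le> a ^ 4 + b ^ 4 + c ^ 4 + d ^ 4"
proof -
  have *: "\<bar>x * y\<bar> \<le> (x\<^sup>2 + y\<^sup>2) / 2" for x y :: real
    using sum_squares_bound[of "\<bar>x\<bar>" "\<bar>y\<bar>"] by (simp add: abs_mult)
  have "\<bar>a * b * c * d\<bar> = \<bar>(a * b) * (c * d)\<bar>"
    by (simp add: mult.assoc)
  also have "\<dots> \<le> ((a * b)\<^sup>2 + (c * d)\<^sup>2) / 2"
    by (rule *)
  also have "(a * b)\<^sup>2 \<le> ((a\<^sup>2)\<^sup>2 + (b\<^sup>2)\<^sup>2) / 2"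
    using *[of "a\<^sup>2" "b\<^sup>2"] by (simp add: power_mult_distrib)
  also have "(c * d)\<^sup>2 \<le> ((c\<^sup>2)\<^sup>2 + (d\<^sup>2)\<^sup>2) / 2"
    using *[of "c\<^sup>2" "d\<^sup>2"] by (simp add: power_mult_distrib)
  finally have "\<bar>a * b * c * d\<bar> \<le> (a ^ 4 + b ^ 4 + c ^ 4 + d ^ 4) / 4"
    by (simp add: field_simps)
  also have "\<dots> \<le> a ^ 4 + b ^ 4 + c ^ 4 + d ^ 4"
  proof -
    have "0 \<le> a ^ 4 + b ^ 4 + c ^ 4 + d ^ 4"
      by (intro add_nonneg_nonneg) auto
    then show ?thesis by simp
  qed
  finally show ?thesis .
qed

lemma fourth_moment_mult4:
  assumes "fourth_moment A" "fourth_moment B" "fourth_moment C" "fourth_moment D"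
  shows "integrable M (\<lambda>\<omega>. A \<omega> * B \<omega> * C \<omega> * D \<omega>)"
proof (rule Bochner_Integration.integrable_bound)
  show "integrable M (\<lambda>\<omega>. A \<omega> ^ 4 + B \<omega> ^ 4 + C \<omega> ^ 4 + D \<omega> ^ 4)"
    using assms by (auto simp: fourth_moment_def)
  show "(\<lambda>\<omega>. A \<omega> * B \<omega> * C \<omega> * D \<omega>) \<in> borel_measurable M"
    using assms by (auto simp: fourth_moment_def)
  show "AE \<omega> in M. norm (A \<omega> * B \<omega> * C \<omega> * D \<omega>) \<le> norm (A \<omega> ^ 4 + B \<omega> ^ 4 + C \<omega> ^ 4 + D \<omega> ^ 4)"
    using abs_mult4_le by (intro AE_I2) (smt (verit) real_norm_def)
qed

lemma fourth_moment_const: "fourth_moment (\<lambda>_. c)"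
  by (simp add: fourth_moment_def)

lemma fourth_moment_mult2:
  assumes "fourth_moment A" "fourth_moment B"
  shows "integrable M (\<lambda>\<omega>. A \<omega> * B \<omega>)"
  using fourth_moment_mult4[OF assms fourth_moment_const[of 1] fourth_moment_const[of 1]] by simp

lemma fourth_moment_integrable:
  assumes "fourth_moment A"
  shows "integrable M A"
  using fourth_moment_mult2[OF assms fourth_moment_const[of 1]] by simp

lemma fourth_moment_power:
  assumes "fourth_moment A" "k \<le> 4"
  shows "integrable M (\<lambda>\<omega>. A \<omega> ^ k)"
proof -
  note c = fourth_moment_const[of 1] and A = assms(1)
  consider "k = 0" | "k = 1" | "k = 2" | "k = 3" | "k = 4"
    using assms(2) by linarith
  then show ?thesis
  proof cases
    case 3
    then show ?thesis using fourth_moment_mult2[OF A A] by (simp add: power2_eq_square)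
  next
    case 4
    then show ?thesis
      using fourth_moment_mult4[OF A A A c] by (simp add: power3_eq_cube)
  next
    case 5
    then show ?thesis using A by (simp add: fourth_moment_def)
  qed (use fourth_moment_integrable[OF A] in auto)
qed

lemma fourth_moment_add:
  assumes "fourth_moment A" "fourth_moment B"
  shows "fourth_moment (\<lambda>\<omega>. A \<omega> + B \<omega>)"
  unfolding fourth_moment_def
proof
  show m: "(\<lambda>\<omega>. A \<omega> + B \<omega>) \<in> borel_measurable M"
    using assms by (auto simp: fourth_moment_def)
  have *: "(a + b) ^ 4 \<le> 8 * (a ^ 4 + b ^ 4)" for a b :: real
  proof -
    have "(a + b)\<^sup>2 \<le> 2 * (a\<^sup>2 + b\<^sup>2)"
      using sum_squares_bound[of a b] by (simp add: power2_eq_square algebra_simps)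
    then have "((a + b)\<^sup>2)\<^sup>2 \<le> (2 * (a\<^sup>2 + b\<^sup>2))\<^sup>2"
      by (intro power_mono) auto
    also have "\<dots> = 4 * (a\<^sup>2 + b\<^sup>2)\<^sup>2"
      by (simp add: power_mult_distrib del: distrib_left_numeral)
    also have "(a\<^sup>2 + b\<^sup>2)\<^sup>2 \<le> 2 * ((a\<^sup>2)\<^sup>2 + (b\<^sup>2)\<^sup>2)"
      using sum_squares_bound[of "a\<^sup>2" "b\<^sup>2"] by (simp add: power2_eq_square algebra_simps)
    finally show ?thesis by simp
  qed
  show "integrable M (\<lambda>\<omega>. (A \<omega> + B \<omega>) ^ 4)"
  proof (rule Bochner_Integration.integrable_bound)
    show "integrable M (\<lambda>\<omega>. 8 * (A \<omega> ^ 4 + B \<omega> ^ 4))"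
      using assms by (auto simp: fourth_moment_def)
    show "AE \<omega> in M. norm ((A \<omega> + B \<omega>) ^ 4) \<le> norm (8 * (A \<omega> ^ 4 + B \<omega> ^ 4))"
      by (intro AE_I2, rule order_trans[OF _ abs_ge_self[THEN order_trans]])
        (use * in \<open>auto simp del: distrib_left_numeral\<close>)
  qed (use m in auto)
qed

lemma fourth_moment_cmult:
  assumes "fourth_moment A"
  shows "fourth_moment (\<lambda>\<omega>. c * A \<omega>)"
  using assms by (auto simp: fourth_moment_def power_mult_distrib)

lemma fourth_moment_diff:
  assumes "fourth_moment A" "fourth_moment B"
  shows "fourth_moment (\<lambda>\<omega>. A \<omega> - B \<omega>)"
  using fourth_moment_add[OF assms(1) fourth_moment_cmult[OF assms(2), of "-1"]] by simp

lemma fourth_moment_sum: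
  assumes "\<And>i. i \<in> I \<Longrightarrow> fourth_moment (A i)"
  shows "fourth_moment (\<lambda>\<omega>. \<Sum>i\<in>I. A i \<omega>)"
  using assms
proof (induction I rule: infinite_finite_induct)
  case (insert x F)
  then show ?case
    using fourth_moment_add[of "A x" "\<lambda>\<omega>. \<Sum>i\<in>F. A i \<omega>"] by simp
qed (auto simp: fourth_moment_const)

lemma indep_var_product_moments:
  assumes ind: "indep_var borel X borel Y"
    and int: "integrable M (\<lambda>\<omega>. X \<omega> ^ j :: real)" "integrable M (\<lambda>\<omega>. Y \<omega> ^ k :: real)"
  shows "expectation (\<lambda>\<omega>. X \<omega> ^ j * Y \<omega> ^ k) = expectation (\<lambda>\<omega>. X \<omega> ^ j) * expectation (\<lambda>\<omega>. Y \<omega> ^ k)"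
    and "integrable M (\<lambda>\<omega>. X \<omega> ^ j * Y \<omega> ^ k)"
proof -
  have "indep_var borel ((\<lambda>x. x ^ j) \<circ> X) borel ((\<lambda>x. x ^ k) \<circ> Y)"
    by (rule indep_var_compose[OF ind]) auto
  then show "expectation (\<lambda>\<omega>. X \<omega> ^ j * Y \<omega> ^ k) = expectation (\<lambda>\<omega>. X \<omega> ^ j) * expectation (\<lambda>\<omega>. Y \<omega> ^ k)"
    and "integrable M (\<lambda>\<omega>. X \<omega> ^ j * Y \<omega> ^ k)"
    using indep_var_lebesgue_integral[of "(\<lambda>x. x ^ j) \<circ> X" "(\<lambda>x. x ^ k) \<circ> Y"]
      indep_var_integrable[of "(\<lambda>x. x ^ j) \<circ> X" "(\<lambda>x. x ^ k) \<circ> Y"] int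
    by (auto simp: comp_def)
qed

text \<open>Centring kills every mixed term with an exponent 1, so only \<open>6 * X^2 * Y^2\<close>
  survives in the fourth power. Equivalently \<open>E X^4 - 3 * (E X^2)^2\<close> is additive over
  independent summands, which later makes the fourth cumulant linear in the area.\<close>

lemma indep_sum_moments:
  assumes ind: "indep_var borel X borel Y"
    and X: "fourth_moment X" "expectation X = 0" and Y: "fourth_moment Y" "expectation Y = 0"
  shows "expectation (\<lambda>\<omega>. (X \<omega> + Y \<omega>)\<^sup>2) = expectation (\<lambda>\<omega>. (X \<omega>)\<^sup>2) + expectation (\<lambda>\<omega>. (Y \<omega>)\<^sup>2)"
    and "expectation (\<lambda>\<omega>. (X \<omega> + Y \<omega>) ^ 4) = expectation (\<lambda>\<omega>. X \<omega> ^ 4) + expectation (\<lambda>\<omega>. Y \<omega> ^ 4)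
      + 6 * expectation (\<lambda>\<omega>. (X \<omega>)\<^sup>2) * expectation (\<lambda>\<omega>. (Y \<omega>)\<^sup>2)"
proof -
  note pX = fourth_moment_power[OF X(1)] and pY = fourth_moment_power[OF Y(1)]
  note m = indep_var_product_moments[OF ind pX pY]
  have XY: "expectation (\<lambda>\<omega>. X \<omega> * Y \<omega>) = 0" "integrable M (\<lambda>\<omega>. X \<omega> * Y \<omega>)"
    and X2Y2: "expectation (\<lambda>\<omega>. (X \<omega>)\<^sup>2 * (Y \<omega>)\<^sup>2) = expectation (\<lambda>\<omega>. (X \<omega>)\<^sup>2) * expectation (\<lambda>\<omega>. (Y \<omega>)\<^sup>2)"
      "integrable M (\<lambda>\<omega>. (X \<omega>)\<^sup>2 * (Y \<omega>)\<^sup>2)"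
    and X3Y: "expectation (\<lambda>\<omega>. X \<omega> ^ 3 * Y \<omega>) = 0" "integrable M (\<lambda>\<omega>. X \<omega> ^ 3 * Y \<omega>)"
    and XY3: "expectation (\<lambda>\<omega>. X \<omega> * Y \<omega> ^ 3) = 0" "integrable M (\<lambda>\<omega>. X \<omega> * Y \<omega> ^ 3)"
    using m[of 1 1] m[of 2 2] m[of 3 1] m[of 1 3] X Y by simp_all
  note sq = pX[of 2] pY[of 2] and qu = pX[of 4] pY[of 4]
  have e2: "(X \<omega> + Y \<omega>)\<^sup>2 = (X \<omega>)\<^sup>2 + (Y \<omega>)\<^sup>2 + 2 * (X \<omega> * Y \<omega>)" for \<omega>
    by (simp add: power2_eq_square algebra_simps)
  show "expectation (\<lambda>\<omega>. (X \<omega> + Y \<omega>)\<^sup>2) = expectation (\<lambda>\<omega>. (X \<omega>)\<^sup>2) + expectation (\<lambda>\<omega>. (Y \<omega>)\<^sup>2)"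
    unfolding e2 using sq XY by simp
  have e4: "(X \<omega> + Y \<omega>) ^ 4 = X \<omega> ^ 4 + Y \<omega> ^ 4 + 6 * ((X \<omega>)\<^sup>2 * (Y \<omega>)\<^sup>2)
      + 4 * (X \<omega> ^ 3 * Y \<omega>) + 4 * (X \<omega> * Y \<omega> ^ 3)" for \<omega>
    by algebra
  show "expectation (\<lambda>\<omega>. (X \<omega> + Y \<omega>) ^ 4) = expectation (\<lambda>\<omega>. X \<omega> ^ 4) + expectation (\<lambda>\<omega>. Y \<omega> ^ 4)
      + 6 * expectation (\<lambda>\<omega>. (X \<omega>)\<^sup>2) * expectation (\<lambda>\<omega>. (Y \<omega>)\<^sup>2)"
    unfolding e4 using qu X2Y2 X3Y XY3 by simp
qed

text \<open>Convergence to \<open>0\<close> in probability, metrised by \<open>E min 1 |X|\<close>.\<close>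

definition vanishing :: "(nat \<Rightarrow> 'a \<Rightarrow> real) \<Rightarrow> bool" where
  "vanishing X \<longleftrightarrow> (\<forall>n. random_variable borel (X n)) \<and>
     (\<lambda>n. expectation (\<lambda>\<omega>. min 1 \<bar>X n \<omega>\<bar>)) \<longlonglongrightarrow> 0"

lemma vanishing_measurable: "vanishing X \<Longrightarrow> random_variable borel (X n)"
  by (simp add: vanishing_def)

lemma integrable_min1:
  assumes "random_variable borel X"
  shows "integrable M (\<lambda>\<omega>. min 1 \<bar>X \<omega> :: real\<bar>)"
  by (rule Bochner_Integration.integrable_bound[of M "\<lambda>_. 1::real"]) (use assms in auto)

lemma vanishingI:
  assumes "\<And>n. random_variable borel (X n)"
    and "\<forall>\<^sub>F n in sequentially. expectation (\<lambda>\<omega>. min 1 \<bar>X n \<omega>\<bar>) \<le> e n" "e \<longlonglongrightarrow> 0"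
  shows "vanishing X"
  unfolding vanishing_def
proof (intro conjI allI)
  show "(\<lambda>n. expectation (\<lambda>\<omega>. min 1 \<bar>X n \<omega>\<bar>)) \<longlonglongrightarrow> 0"
    by (rule tendsto_sandwich[OF _ assms(2) tendsto_const assms(3)]) auto
qed (use assms in auto)

lemma vanishing_mono:
  assumes "vanishing Y" "\<And>n. random_variable borel (X n)"
    and "\<forall>\<^sub>F n in sequentially. AE \<omega> in M. \<bar>X n \<omega>\<bar> \<le> \<bar>Y n \<omega>\<bar>"
  shows "vanishing X"
proof (rule vanishingI[OF assms(2)])
  show "\<forall>\<^sub>F n in sequentially. expectation (\<lambda>\<omega>. min 1 \<bar>X n \<omega>\<bar>) \<le> expectation (\<lambda>\<omega>. min 1 \<bar>Y n \<omega>\<bar>)"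
    using assms(3)
  proof eventually_elim
    case (elim n)
    show ?case
      by (rule integral_mono_AE)
        (use elim assms(1,2) in \<open>auto intro!: integrable_min1 simp: vanishing_def\<close>)
  qed
qed (use assms(1) in \<open>auto simp: vanishing_def\<close>)

lemma vanishing_cong:
  assumes "vanishing Y" "\<And>n. random_variable borel (X n)"
    and "\<forall>\<^sub>F n in sequentially. AE \<omega> in M. X n \<omega> = Y n \<omega>"
  shows "vanishing X"
  by (rule vanishing_mono[OF assms(1,2)]) (use assms(3) in \<open>auto elim!: eventually_mono\<close>)

lemma vanishing_add:
  assumes "vanishing X" "vanishing Y"
  shows "vanishing (\<lambda>n \<omega>. X n \<omega> + Y n \<omega>)"
proof (rule vanishingI)
  show "(\<lambda>\<omega>. X n \<omega> + Y n \<omega>) \<in> borel_measurable M" for n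
    using assms[THEN vanishing_measurable, of n] by measurable
  show "(\<lambda>n. expectation (\<lambda>\<omega>. min 1 \<bar>X n \<omega>\<bar>) + expectation (\<lambda>\<omega>. min 1 \<bar>Y n \<omega>\<bar>)) \<longlonglongrightarrow> 0"
    using assms by (intro tendsto_add_zero) (auto simp: vanishing_def)
  have "expectation (\<lambda>\<omega>. min 1 \<bar>X n \<omega> + Y n \<omega>\<bar>)
      \<le> expectation (\<lambda>\<omega>. min 1 \<bar>X n \<omega>\<bar> + min 1 \<bar>Y n \<omega>\<bar>)" for n
    by (intro integral_mono integrable_min1 Bochner_Integration.integrable_add borel_measurable_add)
      (use assms in \<open>auto simp: vanishing_def\<close>)
  then show "\<forall>\<^sub>F n in sequentially. expectation (\<lambda>\<omega>. min 1 \<bar>X n \<omega> + Y n \<omega>\<bar>)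
      \<le> expectation (\<lambda>\<omega>. min 1 \<bar>X n \<omega>\<bar>) + expectation (\<lambda>\<omega>. min 1 \<bar>Y n \<omega>\<bar>)"
    using assms by (simp add: integrable_min1 vanishing_def)
qed

lemma vanishing_uminus: "vanishing X \<Longrightarrow> vanishing (\<lambda>n \<omega>. - X n \<omega>)"
  by (simp add: vanishing_def)

lemma vanishing_diff:
  "vanishing X \<Longrightarrow> vanishing Y \<Longrightarrow> vanishing (\<lambda>n \<omega>. X n \<omega> - Y n \<omega>)"
  using vanishing_add[OF _ vanishing_uminus] by simp

lemma vanishing_L1:
  assumes "\<And>n. random_variable borel (X n)"
    and "\<forall>\<^sub>F n in sequentially. integrable M (X n) \<and> expectation (\<lambda>\<omega>. \<bar>X n \<omega>\<bar>) \<le> e n"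
    and "e \<longlonglongrightarrow> 0"
  shows "vanishing X"
proof (rule vanishingI[OF assms(1) _ assms(3)])
  show "\<forall>\<^sub>F n in sequentially. expectation (\<lambda>\<omega>. min 1 \<bar>X n \<omega>\<bar>) \<le> e n"
    using assms(2)
  proof eventually_elim
    case (elim n)
    have "expectation (\<lambda>\<omega>. min 1 \<bar>X n \<omega>\<bar>) \<le> expectation (\<lambda>\<omega>. \<bar>X n \<omega>\<bar>)"
      using elim assms(1) by (intro integral_mono integrable_min1) auto
    with elim show ?case by linarith
  qed
qed

lemma expectation_abs_le_sqrt:
  assumes "random_variable borel X" "integrable M (\<lambda>\<omega>. (X \<omega>)\<^sup>2 :: real)"
  shows "integrable M X" "expectation (\<lambda>\<omega>. \<bar>X \<omega>\<bar>) \<le> sqrt (expectation (\<lambda>\<omega>. (X \<omega>)\<^sup>2))"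
proof -
  show "integrable M X"
    using square_integrable_imp_integrable[OF assms] .
  have "0 \<le> variance (\<lambda>\<omega>. \<bar>X \<omega>\<bar>)"
    by (intro Bochner_Integration.integral_nonneg) simp
  moreover have "variance (\<lambda>\<omega>. \<bar>X \<omega>\<bar>)
      = expectation (\<lambda>\<omega>. (\<bar>X \<omega>\<bar>)\<^sup>2) - (expectation (\<lambda>\<omega>. \<bar>X \<omega>\<bar>))\<^sup>2"
    using assms variance_eq[of "\<lambda>\<omega>. \<bar>X \<omega>\<bar>"] \<open>integrable M X\<close> by simp
  ultimately have "(expectation (\<lambda>\<omega>. \<bar>X \<omega>\<bar>))\<^sup>2 \<le> expectation (\<lambda>\<omega>. (\<bar>X \<omega>\<bar>)\<^sup>2)"
    by linarith
  then show "expectation (\<lambda>\<omega>. \<bar>X \<omega>\<bar>) \<le> sqrt (expectation (\<lambda>\<omega>. (X \<omega>)\<^sup>2))"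
    by (intro real_le_rsqrt) auto
qed

lemma vanishing_L2:
  assumes "\<And>n. random_variable borel (X n)"
    and "\<forall>\<^sub>F n in sequentially. integrable M (\<lambda>\<omega>. (X n \<omega>)\<^sup>2) \<and> expectation (\<lambda>\<omega>. (X n \<omega>)\<^sup>2) \<le> e n"
    and "e \<longlonglongrightarrow> 0"
  shows "vanishing X"
proof (rule vanishing_L1[OF assms(1)])
  show "(\<lambda>n. sqrt (e n)) \<longlonglongrightarrow> 0"
    using tendsto_real_sqrt[OF assms(3)] by simp
  show "\<forall>\<^sub>F n in sequentially. integrable M (X n) \<and> expectation (\<lambda>\<omega>. \<bar>X n \<omega>\<bar>) \<le> sqrt (e n)"
    using assms(2)
  proof eventually_elim
    case (elim n)
    then show ?case
      using expectation_abs_le_sqrt[OF assms(1), of n] real_sqrt_le_mono order_trans by blast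
  qed
qed

text \<open>Where \<open>|Y| <= d\<close> the product costs at most \<open>d * |S|\<close>, and
  elsewhere at most \<open>min 1 |Y| / d\<close>. First \<open>d\<close> is chosen from the L1 bound
  of \<open>S\<close>, then \<open>n\<close> is taken large.\<close>

lemma vanishing_mult:
  assumes Y: "vanishing Y" and mS: "\<And>n. random_variable borel (S n)"
    and S: "\<forall>\<^sub>F n in sequentially. integrable M (S n) \<and> expectation (\<lambda>\<omega>. \<bar>S n \<omega>\<bar>) \<le> B"
  shows "vanishing (\<lambda>n \<omega>. S n \<omega> * Y n \<omega>)"
proof -
  have m: "(\<lambda>\<omega>. S n \<omega> * Y n \<omega>) \<in> borel_measurable M" for n
    using mS[of n] vanishing_measurable[OF Y, of n] by measurable
  have key: "min 1 \<bar>s * y\<bar> \<le> d * \<bar>s\<bar> + min 1 \<bar>y\<bar> / d" if "0 < d" "d \<le> 1" for s y d :: real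
  proof (cases "\<bar>y\<bar> \<le> d")
    case True
    then have "\<bar>s * y\<bar> \<le> d * \<bar>s\<bar>"
      by (simp add: abs_mult mult.commute[of d] mult_left_mono)
    moreover have "0 \<le> min 1 \<bar>y\<bar> / d" using that by simp
    ultimately show ?thesis by linarith
  next
    case False
    then have "1 \<le> min 1 \<bar>y\<bar> / d" using that by simp
    moreover have "0 \<le> d * \<bar>s\<bar>" using that by simp
    ultimately show ?thesis by linarith
  qed
  have B: "0 \<le> B"
  proof -
    from S obtain n where "integrable M (S n)" "expectation (\<lambda>\<omega>. \<bar>S n \<omega>\<bar>) \<le> B"
      by (auto simp: eventually_sequentially)
    moreover have "0 \<le> expectation (\<lambda>\<omega>. \<bar>S n \<omega>\<bar>)"
      by (intro Bochner_Integration.integral_nonneg) simp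
    ultimately show ?thesis by linarith
  qed
  show ?thesis
    unfolding vanishing_def
  proof (intro conjI allI m tendstoI)
    fix e :: real assume e: "0 < e"
    define d where "d = min 1 (e / (2 * (B + 1)))"
    have d: "0 < d" "d \<le> 1" "d * B < e / 2"
    proof -
      show "0 < d" "d \<le> 1" using e B by (auto simp: d_def)
      have "d * B \<le> e / (2 * (B + 1)) * B"
        using B by (intro mult_right_mono) (auto simp: d_def)
      also have "\<dots> < e / 2" using e B by (simp add: field_simps)
      finally show "d * B < e / 2" .
    qed
    have "(\<lambda>n. expectation (\<lambda>\<omega>. min 1 \<bar>Y n \<omega>\<bar>)) \<longlonglongrightarrow> 0"
      using Y by (simp add: vanishing_def)
    then have "\<forall>\<^sub>F n in sequentially. expectation (\<lambda>\<omega>. min 1 \<bar>Y n \<omega>\<bar>) < d * (e / 2)"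
      using d e by (intro order_tendstoD(2)) auto
    with S show "\<forall>\<^sub>F n in sequentially. dist (expectation (\<lambda>\<omega>. min 1 \<bar>S n \<omega> * Y n \<omega>\<bar>)) 0 < e"
    proof eventually_elim
      case (elim n)
      have i: "integrable M (\<lambda>\<omega>. min 1 \<bar>Y n \<omega>\<bar>)"
        by (rule integrable_min1[OF vanishing_measurable[OF Y]])
      have "expectation (\<lambda>\<omega>. min 1 \<bar>S n \<omega> * Y n \<omega>\<bar>)
          \<le> expectation (\<lambda>\<omega>. d * \<bar>S n \<omega>\<bar> + min 1 \<bar>Y n \<omega>\<bar> / d)"
        using elim m key d i by (intro integral_mono integrable_min1) auto
      also have "\<dots> = d * expectation (\<lambda>\<omega>. \<bar>S n \<omega>\<bar>) + expectation (\<lambda>\<omega>. min 1 \<bar>Y n \<omega>\<bar>) / d"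
        using elim Y by (simp add: integrable_min1 vanishing_def)
      also have "\<dots> < e"
      proof -
        have "d * expectation (\<lambda>\<omega>. \<bar>S n \<omega>\<bar>) \<le> d * B"
          using elim d by (intro mult_left_mono) auto
        moreover have "expectation (\<lambda>\<omega>. min 1 \<bar>Y n \<omega>\<bar>) / d < e / 2"
          using elim d by (simp add: field_simps)
        ultimately show ?thesis using d by linarith
      qed
      finally show ?case by simp
    qed
  qed
qed

lemma vanishing_scale:
  assumes "vanishing X" "\<forall>\<^sub>F n in sequentially. \<bar>c n\<bar> \<le> B"
  shows "vanishing (\<lambda>n \<omega>. c n * X n \<omega>)"
  by (rule vanishing_mult[OF assms(1)]) (use assms(2) in \<open>auto simp: prob_space\<close>)

lemma vanishing_const:
  assumes "c \<longlonglongrightarrow> 0"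
  shows "vanishing (\<lambda>n \<omega>. c n)"
  by (rule vanishing_L1[where e="\<lambda>n. \<bar>c n\<bar>"]) (use assms in \<open>auto simp: prob_space intro!: tendsto_rabs_zero\<close>)

text \<open>Continuous mapping at a constant limit. Continuity is asked for at \<open>c\<close>
  alone, because the function of interest is \<open>sqrt (1 / q)\<close>, which is discontinuous at
  0.\<close>

lemma vanishing_continuous:
  fixes g :: "real \<Rightarrow> real"
  assumes V: "vanishing (\<lambda>n \<omega>. Q n \<omega> - c)" and g: "isCont g c" and mg: "g \<in> borel_measurable borel"
  shows "vanishing (\<lambda>n \<omega>. g (Q n \<omega>) - g c)"
proof -
  have mQ: "Q n \<in> borel_measurable M" for n
  proof -
    have "(\<lambda>\<omega>. (Q n \<omega> - c) + c) \<in> borel_measurable M"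
      using V by (intro borel_measurable_add) (auto simp: vanishing_def)
    then show ?thesis by simp
  qed
  have m: "(\<lambda>\<omega>. g (Q n \<omega>) - g c) \<in> borel_measurable M" for n
    using measurable_compose[OF mQ mg] by auto
  show ?thesis
    unfolding vanishing_def
  proof (intro conjI allI m tendstoI)
    fix e :: real assume e: "0 < e"
    from g obtain d where d: "0 < d" "\<And>x. \<bar>x - c\<bar> < d \<Longrightarrow> \<bar>g x - g c\<bar> < e / 2"
      using e unfolding isCont_def LIM_def
      by (metis dist_real_def half_gt_zero abs_zero diff_self)
    define d' where "d' = min 1 d"
    have d': "0 < d'" "d' \<le> 1" "d' \<le> d" using d by (auto simp: d'_def)
    have key: "min 1 \<bar>g x - g c\<bar> \<le> e / 2 + min 1 \<bar>x - c\<bar> / d'" for x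
    proof (cases "\<bar>x - c\<bar> < d")
      case True
      then have "\<bar>g x - g c\<bar> < e / 2" by (rule d)
      moreover have "0 \<le> min 1 \<bar>x - c\<bar> / d'" using d' by simp
      ultimately show ?thesis by linarith
    next
      case False
      then have "1 \<le> min 1 \<bar>x - c\<bar> / d'" using d' by simp
      then show ?thesis using e by linarith
    qed
    have "(\<lambda>n. expectation (\<lambda>\<omega>. min 1 \<bar>Q n \<omega> - c\<bar>)) \<longlonglongrightarrow> 0"
      using V by (simp add: vanishing_def)
    then have "\<forall>\<^sub>F n in sequentially. expectation (\<lambda>\<omega>. min 1 \<bar>Q n \<omega> - c\<bar>) < d' * (e / 2)"
      using d' e by (intro order_tendstoD(2)) auto
    then show "\<forall>\<^sub>F n in sequentially. dist (expectation (\<lambda>\<omega>. min 1 \<bar>g (Q n \<omega>) - g c\<bar>)) 0 < e"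
    proof eventually_elim
      case (elim n)
      have i: "integrable M (\<lambda>\<omega>. min 1 \<bar>Q n \<omega> - c\<bar>)"
        using mQ by (intro integrable_min1) auto
      have "expectation (\<lambda>\<omega>. min 1 \<bar>g (Q n \<omega>) - g c\<bar>)
          \<le> expectation (\<lambda>\<omega>. e / 2 + min 1 \<bar>Q n \<omega> - c\<bar> / d')"
        using m key i by (intro integral_mono integrable_min1) auto
      also have "\<dots> = e / 2 + expectation (\<lambda>\<omega>. min 1 \<bar>Q n \<omega> - c\<bar>) / d'"
        using i by (simp add: prob_space)
      also have "\<dots> < e"
        using elim d' by (simp add: field_simps)
      finally show ?case by simp
    qed
  qed
qed

lemma cmod_iexp_diff_le: "cmod (iexp x - iexp y) \<le> \<bar>x - y\<bar>"
proof -
  have "iexp x - iexp y = iexp y * (iexp (x - y) - 1)"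
    by (simp add: algebra_simps flip: exp_add)
  then have "cmod (iexp x - iexp y) = cmod (iexp (x - y) - 1)"
    by (simp add: norm_mult)
  also have "\<dots> \<le> \<bar>x - y\<bar>"
    using iexp_approx1[of "x - y" 0] by simp
  finally show ?thesis .
qed

text \<open>Two values of \<open>iexp (t * x)\<close> differ by at most 2 and by at most
  \<open>|t|\<close> times the distance of the arguments, hence by \<open>max 2 |t|\<close> times
  \<open>min 1\<close> of that distance: the metric behind \<open>vanishing\<close> controls
  characteristic functions.\<close>

lemma char_vanishing:
  assumes V: "vanishing (\<lambda>n \<omega>. B n \<omega> - A n \<omega>)"
    and mA: "\<And>n. random_variable borel (A n)" and mB: "\<And>n. random_variable borel (B n)"
    and lim: "(\<lambda>n. char (distr M borel (A n)) t) \<longlonglongrightarrow> l"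
  shows "(\<lambda>n. char (distr M borel (B n)) t) \<longlonglongrightarrow> l"
proof -
  define K where "K = max 2 \<bar>t\<bar>"
  have "2 \<le> K" by (simp add: K_def)
  have "cmod (char (distr M borel (B n)) t - char (distr M borel (A n)) t)
      \<le> K * expectation (\<lambda>\<omega>. min 1 \<bar>B n \<omega> - A n \<omega>\<bar>)" for n
  proof -
    have i: "integrable M (\<lambda>\<omega>. iexp (t * B n \<omega>))" "integrable M (\<lambda>\<omega>. iexp (t * A n \<omega>))"
      using mA mB by (auto intro!: integrable_iexp)
    have "char (distr M borel (B n)) t - char (distr M borel (A n)) t
        = (CLINT \<omega>|M. iexp (t * B n \<omega>) - iexp (t * A n \<omega>))"
      using mA[of n] mB[of n] i by (simp add: char_def integral_distr)
    also have "cmod \<dots> \<le> expectation (\<lambda>\<omega>. cmod (iexp (t * B n \<omega>) - iexp (t * A n \<omega>)))"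
      by (rule integral_norm_bound)
    also have "\<dots> \<le> expectation (\<lambda>\<omega>. K * min 1 \<bar>B n \<omega> - A n \<omega>\<bar>)"
    proof (rule integral_mono)
      show "integrable M (\<lambda>\<omega>. K * min 1 \<bar>B n \<omega> - A n \<omega>\<bar>)"
        using mA[of n] mB[of n] by (intro integrable_mult_right integrable_min1) auto
      fix \<omega> assume "\<omega> \<in> space M"
      have "cmod (iexp (t * B n \<omega>) - iexp (t * A n \<omega>)) \<le> 2"
        by (rule order_trans[OF norm_triangle_ineq4]) auto
      moreover have "cmod (iexp (t * B n \<omega>) - iexp (t * A n \<omega>)) \<le> \<bar>t\<bar> * \<bar>B n \<omega> - A n \<omega>\<bar>"
        using cmod_iexp_diff_le[of "t * B n \<omega>" "t * A n \<omega>"]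
        by (simp add: abs_mult flip: right_diff_distrib)
      moreover have "\<bar>t\<bar> * \<bar>B n \<omega> - A n \<omega>\<bar> \<le> K * \<bar>B n \<omega> - A n \<omega>\<bar>"
        by (intro mult_right_mono) (auto simp: K_def)
      moreover note \<open>2 \<le> K\<close>
      ultimately have "cmod (iexp (t * B n \<omega>) - iexp (t * A n \<omega>)) \<le> min (K * 1) (K * \<bar>B n \<omega> - A n \<omega>\<bar>)"
        by (intro min.boundedI) linarith+
      also have "\<dots> = K * min 1 \<bar>B n \<omega> - A n \<omega>\<bar>"
        using \<open>2 \<le> K\<close> by (subst mult_min_right) auto
      finally show "cmod (iexp (t * B n \<omega>) - iexp (t * A n \<omega>)) \<le> K * min 1 \<bar>B n \<omega> - A n \<omega>\<bar>" .
    qed (use i in auto)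
    finally show ?thesis by simp
  qed
  moreover have "(\<lambda>n. K * expectation (\<lambda>\<omega>. min 1 \<bar>B n \<omega> - A n \<omega>\<bar>)) \<longlonglongrightarrow> 0"
    using V by (intro tendsto_mult_right_zero) (simp add: vanishing_def)
  ultimately have "(\<lambda>n. char (distr M borel (B n)) t - char (distr M borel (A n)) t) \<longlonglongrightarrow> 0"
    by (rule Lim_null_comparison[OF always_eventually[OF allI]])
  from tendsto_add[OF this lim] show ?thesis by (simp only: diff_add_cancel add_0_left)
qed

end

lemma char_normal:
  assumes "0 < \<sigma>"
  shows "char (density lborel (normal_density 0 \<sigma>)) t = complex_of_real (exp (- (\<sigma>\<^sup>2 * t\<^sup>2 / 2)))"
proof -
  interpret std: real_distribution std_normal_distribution
    by (rule real_dist_normal_dist)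
  have "distributed std_normal_distribution lborel (\<lambda>x. x) std_normal_density"
    by (auto simp: distributed_def distr_id2 intro!: distr_cong)
  then have "distributed std_normal_distribution lborel (\<lambda>x. 0 + \<sigma> * x) (normal_density (0 + \<sigma> * 0) (\<bar>\<sigma>\<bar> * 1))"
    using assms by (intro std.normal_density_affine) auto
  then have "density lborel (normal_density 0 \<sigma>) = distr std_normal_distribution borel (\<lambda>x. \<sigma> * x)"
    using assms by (auto simp: distributed_def cong: distr_cong)
  then have "char (density lborel (normal_density 0 \<sigma>)) t = (CLINT x|std_normal_distribution. iexp (t * (\<sigma> * x)))"
    by (simp add: char_def integral_distr)
  also have "\<dots> = char std_normal_distribution (t * \<sigma>)"
    by (simp add: char_def mult.assoc)
  also have "\<dots> = complex_of_real (exp (- ((t * \<sigma>)\<^sup>2 / 2)))"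
    by (simp add: char_std_normal_distribution)
  finally show ?thesis by (simp add: power_mult_distrib mult.commute)
qed

lemma real_distribution_normal: "0 < \<sigma> \<Longrightarrow> real_distribution (density lborel (normal_density \<mu> \<sigma>))"
  by (auto simp: real_distribution_def real_distribution_axioms_def intro!: prob_space_normal_density)

section \<open>Levy bases: laws and additivity\<close>

lemma indep_vars_reindex_inj:
  assumes "prob_space M" and ind: "prob_space.indep_vars M (\<lambda>_. borel) X (h ` I)" and inj: "inj_on h I"
  shows "prob_space.indep_vars M (\<lambda>_. borel) (\<lambda>i. X (h i) :: 'a \<Rightarrow> real) I"
proof -
  interpret prob_space M by fact
  have "indep_vars (\<lambda>j. PiM {h j} (\<lambda>_. borel)) (\<lambda>j \<omega>. restrict (\<lambda>i. X i \<omega>) {h j}) I"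
    using inj by (intro indep_vars_restrict[OF ind]) (auto simp: disjoint_family_on_def inj_on_def)
  then have "indep_vars (\<lambda>_. borel) (\<lambda>j \<omega>. (\<lambda>f. f (h j)) (restrict (\<lambda>i. X i \<omega>) {h j})) I"
    by (rule indep_vars_compose2) auto
  then show ?thesis by simp
qed

text \<open>Cauchy's equation. Nonnegativity makes \<open>f\<close> monotone, and monotonicity
  squeezes \<open>f w\<close> between the values at the two neighbouring multiples of
  \<open>1 / (n + 1)\<close>.\<close>

lemma additive_nonneg_linear:
  fixes f :: "real \<Rightarrow> real"
  assumes add: "\<And>s t. 0 \<le> s \<Longrightarrow> 0 \<le> t \<Longrightarrow> f (s + t) = f s + f t"
    and nonneg: "\<And>s. 0 \<le> s \<Longrightarrow> 0 \<le> f s" and w: "0 \<le> w"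
  shows "f w = f 1 * w"
proof -
  have mult: "f (real n * x) = real n * f x" if "0 \<le> x" for n x
  proof (induction n)
    case 0
    then show ?case using add[of 0 0] by simp
  next
    case (Suc n)
    have "f (real (Suc n) * x) = f (real n * x + x)" by (simp add: algebra_simps)
    also have "\<dots> = real (Suc n) * f x"
      using that Suc by (subst add) (auto simp: algebra_simps)
    finally show ?case .
  qed
  have mono: "f s \<le> f t" if "0 \<le> s" "s \<le> t" for s t
    using add[of s "t - s"] nonneg[of "t - s"] that by simp
  have bound: "\<bar>f w - f 1 * w\<bar> \<le> f 1 / real (Suc n)" for n
  proof -
    let ?N = "real (Suc n)" and ?m = "nat \<lfloor>real (Suc n) * w\<rfloor>"
    have m: "real ?m \<le> ?N * w" "?N * w < real ?m + 1"
      using w by (auto simp: of_nat_nat intro!: mult_nonneg_nonneg)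
    have fN: "f (1 / ?N) = f 1 / ?N"
    proof -
      have "f (?N * (1 / ?N)) = ?N * f (1 / ?N)" by (rule mult) simp
      moreover have "?N * (1 / ?N) = 1" by simp
      ultimately show ?thesis by (simp add: nonzero_eq_divide_eq mult.commute)
    qed
    have "f (real ?m * (1 / ?N)) \<le> f w"
      using m w by (intro mono) (auto simp: field_simps)
    then have l: "real ?m * f 1 / ?N \<le> f w"
      by (subst (asm) mult) (simp_all only: fN, simp_all)
    have "f w \<le> f (real (Suc ?m) * (1 / ?N))"
      using m w by (intro mono) (auto simp: field_simps)
    then have u: "f w \<le> (real ?m + 1) * f 1 / ?N"
      by (subst (asm) mult) (simp_all only: fN, simp_all add: algebra_simps add_divide_distrib)
    have "real ?m * f 1 / ?N \<le> f 1 * w"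
      using mult_right_mono[OF m(1) nonneg[of 1]] by (simp add: field_simps)
    moreover have "f 1 * w \<le> (real ?m + 1) * f 1 / ?N"
      using mult_right_mono[OF less_imp_le[OF m(2)] nonneg[of 1]] by (simp add: field_simps)
    moreover have "(real ?m + 1) * f 1 / ?N = real ?m * f 1 / ?N + f 1 / ?N"
      by (simp add: distrib_right add_divide_distrib)
    ultimately show ?thesis using l u by (intro abs_leI) linarith+
  qed
  have "(\<lambda>n. f 1 / real (Suc n)) \<longlonglongrightarrow> 0"
    by (rule tendsto_divide_0[OF tendsto_const filterlim_compose[OF filterlim_at_top_imp_at_infinity filterlim_Suc]])
      (rule filterlim_real_sequentially)
  then have "\<bar>f w - f 1 * w\<bar> \<le> 0"
    by (rule tendsto_lowerbound[OF _ always_eventually]) (use bound in auto)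
  then show ?thesis by simp
qed

text \<open>Model sets: since the law of a basis sees only the area, a strip of width
  \<open>w\<close> stands for every set of area \<open>w\<close>, and adjacent strips turn addition
  of areas into disjoint union.\<close>

definition strip :: "real \<Rightarrow> real \<Rightarrow> (real \<times> real) set" where
  "strip x w = {x<..x + w} \<times> {0<..1}"

lemma strip_measure:
  assumes "0 \<le> w"
  shows "emeasure lborel (strip x w) = ennreal w" "measure lborel (strip x w) = w" "strip x w \<in> finite_borel"
proof -
  have s: "strip x w \<in> sets borel"
    unfolding strip_def by (auto simp: borel_prod[symmetric])
  show e: "emeasure lborel (strip x w) = ennreal w"
    unfolding strip_def lborel_prod[symmetric]
    by (subst lborel.emeasure_pair_measure_Times) (use assms in auto)
  then show "measure lborel (strip x w) = w" "strip x w \<in> finite_borel"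
    using assms s by (auto simp: measure_def finite_borel_def)
qed

lemma strip_Un:
  assumes "0 \<le> v" "0 \<le> w"
  shows "strip x v \<union> strip (x + v) w = strip x (v + w)" "strip x v \<inter> strip (x + v) w = {}"
  using assms by (auto simp: strip_def)

lemma finite_borel_closed [intro]:
  assumes "A \<in> finite_borel" "B \<in> finite_borel"
  shows "A \<union> B \<in> finite_borel" "A \<inter> B \<in> finite_borel" "A - B \<in> finite_borel"
proof -
  have *: "C \<in> finite_borel" if "C \<in> sets borel" "C \<subseteq> A \<union> B" for C
  proof -
    have "emeasure lborel C \<le> emeasure lborel (A \<union> B)"
      using that assms by (intro emeasure_mono) (auto simp: finite_borel_def)
    also have "\<dots> \<le> emeasure lborel A + emeasure lborel B"
      using assms by (intro emeasure_subadditive) (auto simp: finite_borel_def)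
    also have "\<dots> < \<infinity>" using assms by (auto simp: finite_borel_def)
    finally show ?thesis using that by (simp add: finite_borel_def)
  qed
  show "A \<union> B \<in> finite_borel" "A \<inter> B \<in> finite_borel" "A - B \<in> finite_borel"
    by (rule *; use assms in \<open>auto simp: finite_borel_def\<close>)+
qed

lemma finite_borel_empty [simp]: "{} \<in> finite_borel"
  by (simp add: finite_borel_def)

lemma finite_borel_Union:
  "finite I \<Longrightarrow> (\<And>i. i \<in> I \<Longrightarrow> C i \<in> finite_borel) \<Longrightarrow> (\<Union>i\<in>I. C i) \<in> finite_borel"
  by (induction I rule: finite_induct) auto

lemma finite_borel_fmeasurable: "A \<in> finite_borel \<longleftrightarrow> A \<in> fmeasurable lborel"
  by (auto simp: finite_borel_def fmeasurable_def)

lemma finite_borel_measure_Un: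
  assumes "A \<in> finite_borel" "B \<in> finite_borel" "A \<inter> B = {}"
  shows "measure lborel (A \<union> B) = measure lborel A + measure lborel B"
  using assms by (intro measure_Un_AE) (auto simp: finite_borel_fmeasurable fmeasurable_def)

context homogeneous_levy_basis
begin

text \<open>Additivity over a sequence of empty sets makes a constant series converge.\<close>

lemma basis_empty: "AE \<omega> in M. L {} \<omega> = 0"
proof -
  have "AE \<omega> in M. (\<lambda>i::nat. L {} \<omega>) sums L (\<Union>i::nat. {}) \<omega>"
    by (rule countably_additive_AE) (auto simp: disjoint_family_on_def)
  then show ?thesis
  proof eventually_elim
    case (elim \<omega>)
    then have "(\<lambda>i::nat. L {} \<omega>) \<longlonglongrightarrow> 0"
      using sums_summable summable_LIMSEQ_zero by blast
    then show ?case by (simp add: LIMSEQ_const_iff)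
  qed
qed

lemma basis_Un:
  assumes "A \<in> finite_borel" "B \<in> finite_borel" "A \<inter> B = {}"
  shows "AE \<omega> in M. L (A \<union> B) \<omega> = L A \<omega> + L B \<omega>"
proof -
  define C where "C i = (if i = 0 then A else if i = 1 then B else {})" for i :: nat
  have U: "(\<Union>i. C i) = A \<union> B"
    by (auto simp: C_def split: if_splits)
  have "AE \<omega> in M. (\<lambda>i. L (C i) \<omega>) sums L (\<Union>i. C i) \<omega>"
    using assms by (intro countably_additive_AE) (auto simp: U disjoint_family_on_def C_def)
  then show ?thesis
    using basis_empty
  proof eventually_elim
    case (elim \<omega>)
    have "(\<lambda>i. L (C i) \<omega>) sums (\<Sum>i\<in>{0,1}. L (C i) \<omega>)"
      by (rule sums_finite) (use elim(2) in \<open>auto simp: C_def\<close>)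
    with elim(1) have "L (\<Union>i. C i) \<omega> = (\<Sum>i\<in>{0,1}. L (C i) \<omega>)"
      by (rule sums_unique2)
    then show ?case unfolding U by (simp add: C_def)
  qed
qed

text \<open>The axiom speaks of sequences of sets; a finite family over any index type is enumerated
  and padded with empty sets.\<close>

lemma basis_indep_vars:
  assumes "finite I" "disjoint_family_on C I" "\<And>i. i \<in> I \<Longrightarrow> C i \<in> finite_borel"
  shows "indep_vars (\<lambda>_. borel) (\<lambda>i. L (C i)) I"
proof -
  obtain h where h: "bij_betw h I {0..<card I}"
    using ex_bij_betw_finite_nat[OF assms(1)] by auto
  define B where "B n = (if n < card I then C (inv_into I h n) else {})" for n
  have Bh: "B (h i) = C i" if "i \<in> I" for i
    using h that by (auto simp: B_def bij_betw_def inv_into_f_f)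
  have inv: "inv_into I h n \<in> I" "h (inv_into I h n) = n" if "n < card I" for n
    using h that by (auto simp: bij_betw_def inv_into_into f_inv_into_f)
  have "disjoint_family B"
    unfolding disjoint_family_on_def
  proof (intro ballI impI)
    fix m n :: nat assume "m \<noteq> n"
    then show "B m \<inter> B n = {}"
      using assms(2) inv[of m] inv[of n] unfolding B_def disjoint_family_on_def
      by (cases "m < card I"; cases "n < card I") (auto, metis IntI emptyE)
  qed
  moreover have "range B \<subseteq> finite_borel"
    using assms(3) inv by (auto simp: B_def)
  ultimately have "indep_vars (\<lambda>_. borel) (\<lambda>i. L (B i)) UNIV"
    by (rule independently_scattered)
  then have "indep_vars (\<lambda>_. borel) (\<lambda>i. L (B i)) (h ` I)"
    by (rule indep_vars_subset) simp
  then have "indep_vars (\<lambda>_. borel) (\<lambda>i. L (B (h i))) I"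
    by (rule indep_vars_reindex_inj[OF prob_space_axioms, where X = "\<lambda>i. L (B i)" and h = h])
      (use h in \<open>simp add: bij_betw_def\<close>)
  then show ?thesis
    using indep_vars_cong[of I I "\<lambda>i. L (B (h i))" "\<lambda>i. L (C i)" "\<lambda>_. borel" "\<lambda>_. borel"] Bh by auto
qed

lemma basis_indep_var:
  assumes "A \<in> finite_borel" "B \<in> finite_borel" "A \<inter> B = {}"
  shows "indep_var borel (L A) borel (L B)"
proof -
  have "indep_vars (\<lambda>_. borel) (\<lambda>b. L (if b then A else B)) UNIV"
    by (rule basis_indep_vars) (use assms in \<open>auto simp: disjoint_family_on_def\<close>)
  also have "(\<lambda>b. L (if b then A else B)) = case_bool (L A) (L B)"
    by (auto simp: fun_eq_iff split: bool.split)
  also have "(\<lambda>_::bool. borel :: real measure) = case_bool borel borel"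
    by (auto simp: fun_eq_iff split: bool.split)
  finally show ?thesis unfolding indep_var_def .
qed

lemma basis_law_cong:
  assumes "A \<in> finite_borel" "B \<in> finite_borel" "measure lborel A = measure lborel B"
  shows "distr M borel (L A) = distr M borel (L B)"
proof (rule Levy_uniqueness)
  show "char (distr M borel (L A)) = char (distr M borel (L B))"
    using assms by (simp add: fun_eq_iff char_basis)
qed (use assms in \<open>auto intro!: real_distribution_distr measurable_basis\<close>)

lemma basis_expectation_cong:
  assumes "A \<in> finite_borel" "B \<in> finite_borel" "measure lborel A = measure lborel B"
    and f: "f \<in> borel_measurable borel"
  shows "expectation (\<lambda>\<omega>. f (L A \<omega>) :: real) = expectation (\<lambda>\<omega>. f (L B \<omega>))"
    and "integrable M (\<lambda>\<omega>. f (L A \<omega>)) \<longleftrightarrow> integrable M (\<lambda>\<omega>. f (L B \<omega>))"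
proof -
  note m = measurable_basis[OF assms(1)] measurable_basis[OF assms(2)]
  show "expectation (\<lambda>\<omega>. f (L A \<omega>) :: real) = expectation (\<lambda>\<omega>. f (L B \<omega>))"
    using integral_distr[OF m(1) f] integral_distr[OF m(2) f] basis_law_cong[OF assms(1-3)] by simp
  show "integrable M (\<lambda>\<omega>. f (L A \<omega>)) \<longleftrightarrow> integrable M (\<lambda>\<omega>. f (L B \<omega>))"
    using integrable_distr_eq[OF m(1) f] integrable_distr_eq[OF m(2) f] basis_law_cong[OF assms(1-3)] by simp
qed

end

section \<open>Powers\<close>

lemma abs_add_powr_le:
  fixes a b p :: real
  assumes "0 \<le> p"
  shows "\<bar>a + b\<bar> powr p \<le> 2 powr p * (\<bar>a\<bar> powr p + \<bar>b\<bar> powr p)"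
proof -
  have "\<bar>a + b\<bar> powr p \<le> (2 * max \<bar>a\<bar> \<bar>b\<bar>) powr p"
    by (rule powr_mono2) (use assms in auto)
  also have "\<dots> = 2 powr p * max \<bar>a\<bar> \<bar>b\<bar> powr p"
    by (simp add: powr_mult)
  also have "max \<bar>a\<bar> \<bar>b\<bar> powr p \<le> \<bar>a\<bar> powr p + \<bar>b\<bar> powr p"
    by (simp add: max_def)
  finally show ?thesis by (simp add: mult_left_mono)
qed

lemma powr_le_self:
  fixes x q :: real
  assumes "0 \<le> x" "x \<le> 1" "1 \<le> q"
  shows "x powr q \<le> x"
  using powr_mono'[of 1 q x] assms by auto

lemma powr_convex_nonneg:
  fixes q x y t :: real
  assumes "1 \<le> q" "0 \<le> x" "0 \<le> y" "0 \<le> t" "t \<le> 1"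
  shows "((1 - t) * x + t * y) powr q \<le> (1 - t) * x powr q + t * y powr q"
proof (cases "x = 0 \<or> y = 0")
  case True
  have *: "(s * z) powr q \<le> s * z powr q" if "0 \<le> s" "s \<le> 1" "0 \<le> z" for s z
    using powr_le_self[of s q] assms(1) that by (simp add: powr_mult mult_right_mono)
  from True show ?thesis
    using *[of "1 - t" x] *[of t y] assms by auto
next
  case False
  then have "x \<in> {0<..}" "y \<in> {0<..}" using assms by auto
  then show ?thesis
    using convex_onD[OF powr_convex[OF assms(1)], of t x y] assms by simp
qed

lemma convex_abs_powr:
  fixes q :: real
  assumes "1 \<le> q"
  shows "convex_on UNIV (\<lambda>x. \<bar>x\<bar> powr q)"
proof (rule convex_onI)
  fix t x y :: real assume t: "0 < t" "t < 1"
  have "\<bar>(1 - t) * x + t * y\<bar> \<le> (1 - t) * \<bar>x\<bar> + t * \<bar>y\<bar>"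
    using t abs_triangle_ineq[of "(1 - t) * x" "t * y"] by (simp add: abs_mult)
  then have "\<bar>(1 - t) * x + t * y\<bar> powr q \<le> ((1 - t) * \<bar>x\<bar> + t * \<bar>y\<bar>) powr q"
    using assms by (intro powr_mono2) auto
  also have "\<dots> \<le> (1 - t) * \<bar>x\<bar> powr q + t * \<bar>y\<bar> powr q"
    using assms t by (intro powr_convex_nonneg) auto
  finally show "\<bar>(1 - t) *\<^sub>R x + t *\<^sub>R y\<bar> powr q \<le> (1 - t) * \<bar>x\<bar> powr q + t * \<bar>y\<bar> powr q"
    by simp
qed auto

lemma powr_superadditive:
  fixes a b q :: real
  assumes "0 \<le> a" "0 \<le> b" "1 \<le> q"
  shows "a powr q + b powr q \<le> (a + b) powr q"
proof (cases "a + b = 0")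
  case False
  let ?s = "a + b"
  have s: "0 < ?s" using False assms by simp
  have "(a / ?s) powr q + (b / ?s) powr q \<le> a / ?s + b / ?s"
    using s assms by (intro add_mono powr_le_self) auto
  also have "\<dots> = 1" using s by (simp flip: add_divide_distrib)
  finally have "(a powr q + b powr q) / ?s powr q \<le> 1"
    using s assms by (simp add: powr_divide add_divide_distrib)
  then show ?thesis using s by (simp add: divide_le_eq)
next
  case True
  then have "a = 0" "b = 0" using assms by auto
  then show ?thesis by simp
qed

text \<open>Clarkson's inequality on the real line. With \<open>q = p / 2\<close> it combines
  superadditivity of \<open>q\<close>-th powers at \<open>u^2\<close> and \<open>v^2\<close>, the
  parallelogram identity, and convexity at \<open>(u + v)^2\<close> and \<open>(u - v)^2\<close>. It
  is the source of \<open>sym_moment_superadditive\<close>.\<close>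

lemma clarkson_real:
  fixes u v p :: real
  assumes "2 \<le> p"
  shows "2 * \<bar>u\<bar> powr p + 2 * \<bar>v\<bar> powr p \<le> \<bar>u + v\<bar> powr p + \<bar>u - v\<bar> powr p"
proof -
  define q where "q = p / 2"
  have q: "1 \<le> q" using assms by (simp add: q_def)
  have sq: "\<bar>x\<bar> powr p = (x\<^sup>2) powr q" for x :: real
  proof -
    have "(x\<^sup>2) powr q = (\<bar>x\<bar> powr 2) powr q"
      by (simp add: powr_numeral)
    also have "\<dots> = \<bar>x\<bar> powr p" by (simp only: powr_powr) (simp add: q_def)
    finally show ?thesis ..
  qed
  have "(u\<^sup>2) powr q + (v\<^sup>2) powr q \<le> (u\<^sup>2 + v\<^sup>2) powr q"
    using q by (intro powr_superadditive) auto
  also have "u\<^sup>2 + v\<^sup>2 = (1 - 1/2) * (u + v)\<^sup>2 + 1/2 * (u - v)\<^sup>2"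
    by (simp add: power2_eq_square algebra_simps)
  also have "\<dots> powr q \<le> (1 - 1/2) * ((u + v)\<^sup>2) powr q + 1/2 * ((u - v)\<^sup>2) powr q"
    using q by (intro powr_convex_nonneg) auto
  finally show ?thesis unfolding sq by simp
qed

section \<open>Moments of a Levy basis\<close>

context prob_space
begin

text \<open>By Fubini, \<open>|X + y|^p\<close> is integrable for at least one fixed
  \<open>y\<close>, and a shift by a constant preserves integrability. This passes moments of the
  basis from the unit strip down to smaller areas.\<close>

lemma indep_summand_powr_integrable:
  fixes X Y :: "'a \<Rightarrow> real"
  assumes ind: "indep_var borel Y borel X" and p: "0 \<le> p"
    and int: "integrable M (\<lambda>\<omega>. \<bar>X \<omega> + Y \<omega>\<bar> powr p)"
  shows "integrable M (\<lambda>\<omega>. \<bar>X \<omega>\<bar> powr p)"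
proof -
  have rv: "random_variable borel X" "random_variable borel Y"
    using ind by (auto dest: indep_var_rv1 indep_var_rv2)
  let ?P = "distr M borel X" and ?Q = "distr M borel Y"
  interpret P: prob_space ?P by (rule prob_space_distr) fact
  interpret Q: prob_space ?Q by (rule prob_space_distr) fact
  interpret QP: pair_prob_space ?Q ?P ..
  have eq: "?Q \<Otimes>\<^sub>M ?P = distr M (borel \<Otimes>\<^sub>M borel) (\<lambda>\<omega>. (Y \<omega>, X \<omega>))"
    using ind unfolding indep_var_distribution_eq by auto
  have "integrable (?Q \<Otimes>\<^sub>M ?P) (\<lambda>z. \<bar>snd z + fst z\<bar> powr p)"
    unfolding eq using rv int by (subst integrable_distr_eq) (auto, measurable)
  from QP.AE_integrable_fst'[OF this]
  have "AE y in ?Q. integrable ?P (\<lambda>x. \<bar>x + y\<bar> powr p)" by simp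
  then obtain y where y: "integrable ?P (\<lambda>x. \<bar>x + y\<bar> powr p)"
    using Q.AE_E_prob Q.not_empty by (metis (mono_tags, lifting) AE_distr_iff Q.AE_False eventually_mono)
  have "integrable ?P (\<lambda>x. \<bar>x\<bar> powr p)"
  proof (rule Bochner_Integration.integrable_bound)
    show "integrable ?P (\<lambda>x. 2 powr p * (\<bar>x + y\<bar> powr p + \<bar>- y\<bar> powr p))"
      using y by auto
    show "AE x in ?P. norm (\<bar>x\<bar> powr p) \<le> norm (2 powr p * (\<bar>x + y\<bar> powr p + \<bar>- y\<bar> powr p))"
      using abs_add_powr_le[OF p, of "_ + y" "- y"] by (intro AE_I2) (auto simp del: abs_minus)
  qed simp
  then show ?thesis
    using rv by (subst (asm) integrable_distr_eq) auto
qed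

text \<open>Jensen's inequality in the variable \<open>Y\<close> for each fixed value of
  \<open>X\<close>, then Fubini: moments of a centred variable are dominated by those of its
  symmetrisation.\<close>

lemma indep_jensen_powr:
  fixes X Y :: "'a \<Rightarrow> real"
  assumes ind: "indep_var borel X borel Y" and p: "1 \<le> p" and Y: "integrable M Y"
    and int: "integrable M (\<lambda>\<omega>. \<bar>X \<omega> - Y \<omega>\<bar> powr p)"
  shows "expectation (\<lambda>\<omega>. \<bar>X \<omega> - expectation Y\<bar> powr p) \<le> expectation (\<lambda>\<omega>. \<bar>X \<omega> - Y \<omega>\<bar> powr p)"
proof -
  have rv: "random_variable borel X" "random_variable borel Y"
    using ind by (auto dest: indep_var_rv1 indep_var_rv2)
  let ?P = "distr M borel X" and ?Q = "distr M borel Y"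
  interpret P: prob_space ?P by (rule prob_space_distr) fact
  interpret Q: prob_space ?Q by (rule prob_space_distr) fact
  interpret PQ: pair_prob_space ?P ?Q ..
  have eq: "?P \<Otimes>\<^sub>M ?Q = distr M (borel \<Otimes>\<^sub>M borel) (\<lambda>\<omega>. (X \<omega>, Y \<omega>))"
    using ind unfolding indep_var_distribution_eq by auto
  let ?f = "\<lambda>z::real \<times> real. \<bar>fst z - snd z\<bar> powr p"
  have i: "integrable (?P \<Otimes>\<^sub>M ?Q) ?f"
    unfolding eq using rv int by (subst integrable_distr_eq) auto
  have EY: "Q.expectation (\<lambda>y. y) = expectation Y" and iY: "integrable ?Q (\<lambda>y. y)"
    using rv Y by (auto simp: integral_distr integrable_distr_eq)
  have Q1: "Q.prob UNIV = 1" using Q.prob_space by simp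
  have step: "\<bar>x - expectation Y\<bar> powr p \<le> (\<integral>y. ?f (x, y) \<partial>?Q)"
    if "integrable ?Q (\<lambda>y. ?f (x, y))" for x
  proof -
    have "\<bar>Q.expectation (\<lambda>y. x - y)\<bar> powr p \<le> Q.expectation (\<lambda>y. \<bar>x - y\<bar> powr p)"
      using Q.jensens_inequality[of "\<lambda>y. x - y" UNIV 0 0 "\<lambda>x. \<bar>x\<bar> powr p"] that iY convex_abs_powr[OF p]
      by auto
    moreover have "Q.expectation (\<lambda>y. x - y) = x - expectation Y"
      using iY by (simp add: EY Q1)
    ultimately show ?thesis by simp
  qed
  have key: "AE x in ?P. \<bar>x - expectation Y\<bar> powr p \<le> (\<integral>y. ?f (x, y) \<partial>?Q)"
    using PQ.AE_integrable_fst'[OF i] by eventually_elim (rule step)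
  have "expectation (\<lambda>\<omega>. \<bar>X \<omega> - expectation Y\<bar> powr p) = P.expectation (\<lambda>x. \<bar>x - expectation Y\<bar> powr p)"
    using rv by (simp add: integral_distr)
  also have "\<dots> \<le> P.expectation (\<lambda>x. \<integral>y. ?f (x, y) \<partial>?Q)"
    by (rule integral_mono_AE'[OF PQ.integrable_fst'[OF i] key])
      (auto intro!: AE_I2 Bochner_Integration.integral_nonneg)
  also have "\<dots> = integral\<^sup>L (?P \<Otimes>\<^sub>M ?Q) ?f"
    by (rule PQ.integral_fst'[OF i])
  also have "\<dots> = expectation (\<lambda>\<omega>. \<bar>X \<omega> - Y \<omega>\<bar> powr p)"
    unfolding eq using rv by (subst integral_distr) auto
  finally show ?thesis .
qed

lemma indep_difference_law:
  fixes X Y X' Y' :: "'a \<Rightarrow> real"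
  assumes "indep_var borel X borel Y" "indep_var borel X' borel Y'"
    and "distr M borel X = distr M borel X'" "distr M borel Y = distr M borel Y'"
    and f: "f \<in> borel_measurable borel"
  shows "expectation (\<lambda>\<omega>. f (X \<omega> - Y \<omega>) :: real) = expectation (\<lambda>\<omega>. f (X' \<omega> - Y' \<omega>))"
proof -
  have *: "expectation (\<lambda>\<omega>. f (X \<omega> - Y \<omega>)) = (\<integral>z. f (fst z - snd z) \<partial>(distr M borel X \<Otimes>\<^sub>M distr M borel Y))"
    if ind: "indep_var borel X borel Y" for X Y
  proof -
    have rv: "random_variable borel X" "random_variable borel Y"
      using ind by (auto dest: indep_var_rv1 indep_var_rv2)
    have eq: "distr M borel X \<Otimes>\<^sub>M distr M borel Y = distr M (borel \<Otimes>\<^sub>M borel) (\<lambda>\<omega>. (X \<omega>, Y \<omega>))"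
      using ind unfolding indep_var_distribution_eq by auto
    note [measurable] = f
    have "(\<lambda>z. f (fst z - snd z)) \<in> borel_measurable (borel \<Otimes>\<^sub>M borel)" by measurable
    then show ?thesis unfolding eq using rv by (subst integral_distr) auto
  qed
  show ?thesis using *[OF assms(1)] *[OF assms(2)] assms(3,4) by simp
qed

lemma fourth_moment_powr:
  assumes "random_variable borel X" "integrable M (\<lambda>\<omega>. \<bar>X \<omega>\<bar> powr p)" "4 \<le> p"
  shows "fourth_moment X"
  unfolding fourth_moment_def
proof
  have *: "\<bar>x ^ 4\<bar> \<le> 1 + \<bar>x\<bar> powr p" for x :: real
  proof (cases "\<bar>x\<bar> \<le> 1")
    case True
    then have "\<bar>x\<bar> ^ 4 \<le> 1" by (intro power_le_one) auto
    moreover have "0 \<le> \<bar>x\<bar> powr p" by simp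
    ultimately show ?thesis unfolding power_abs by linarith
  next
    case False
    then have "\<bar>x\<bar> ^ 4 = \<bar>x\<bar> powr 4" by (simp add: powr_numeral)
    also have "\<dots> \<le> \<bar>x\<bar> powr p" using False assms by (intro powr_mono) auto
    finally show ?thesis by (simp add: power_abs)
  qed
  show "integrable M (\<lambda>\<omega>. X \<omega> ^ 4)"
    by (rule Bochner_Integration.integrable_bound[of M "\<lambda>\<omega>. 1 + \<bar>X \<omega>\<bar> powr p"])
      (use assms * in auto)
qed fact

lemma powr_integrable_add:
  fixes X Y :: "'a \<Rightarrow> real"
  assumes "random_variable borel X" "random_variable borel Y" "0 \<le> p"
    and "integrable M (\<lambda>\<omega>. \<bar>X \<omega>\<bar> powr p)" "integrable M (\<lambda>\<omega>. \<bar>Y \<omega>\<bar> powr p)"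
  shows "integrable M (\<lambda>\<omega>. \<bar>X \<omega> + Y \<omega>\<bar> powr p)"
  by (rule Bochner_Integration.integrable_bound[of M "\<lambda>\<omega>. 2 powr p * (\<bar>X \<omega>\<bar> powr p + \<bar>Y \<omega>\<bar> powr p)"])
    (use assms abs_add_powr_le in auto)

end

text \<open>Squares of the basis enter Lyapunov's theorem with exponent \<open>p / 2\<close>, which
  has to lie in the interval (2, 3]; this is the reason for both bounds on \<open>p\<close>. The
  moments are required on the unit strip, whose law is that of the seed.\<close>

locale levy_basis_moments = homogeneous_levy_basis +
  fixes p :: real
  assumes p_bounds: "4 < p" "p \<le> 6"
    and unit_powr_integrable: "integrable M (\<lambda>\<omega>. \<bar>L (strip 0 1) \<omega>\<bar> powr p)"
    and unit_variance: "variance (L (strip 0 1)) = 1"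
begin

text \<open>A strip of width at most 1 is an independent summand of the unit strip; wider ones are
  reached by adding one unit strip at a time.\<close>

lemma basis_powr_integrable_strip:
  assumes "0 \<le> w" "w \<le> real n"
  shows "integrable M (\<lambda>\<omega>. \<bar>L (strip 0 w) \<omega>\<bar> powr p)"
proof -
  have small: "integrable M (\<lambda>\<omega>. \<bar>L (strip 0 w) \<omega>\<bar> powr p)" if w: "0 \<le> w" "w \<le> 1" for w
  proof (rule indep_summand_powr_integrable)
    note f = strip_measure(3)[of w 0] strip_measure(3)[of "1 - w" w]
    have U: "strip 0 w \<union> strip w (1 - w) = strip 0 1" "strip 0 w \<inter> strip w (1 - w) = {}"
      using strip_Un[of w "1 - w" 0] w by auto
    show "indep_var borel (L (strip w (1 - w))) borel (L (strip 0 w))"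
      using f U w by (intro basis_indep_var) auto
    have "AE \<omega> in M. L (strip 0 1) \<omega> = L (strip 0 w) \<omega> + L (strip w (1 - w)) \<omega>"
      using basis_Un[of "strip 0 w" "strip w (1 - w)"] f U w by auto
    then show "integrable M (\<lambda>\<omega>. \<bar>L (strip 0 w) \<omega> + L (strip w (1 - w)) \<omega>\<bar> powr p)"
      using f w by (intro Bochner_Integration.integrable_cong_AE_imp[OF unit_powr_integrable])
        (auto intro!: powr_real_measurable borel_measurable_abs borel_measurable_add measurable_basis)
  qed (use p_bounds in simp)
  from assms show ?thesis
  proof (induction n arbitrary: w)
  case 0
  then show ?case using small by simp
  next
  case (Suc n)
  show ?case
  proof (cases "w \<le> 1")
    case False
    note f = strip_measure(3)[of "w - 1" 0] strip_measure(3)[of 1 "w - 1"] strip_measure(3)[of 1 0]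
    have U: "strip 0 (w - 1) \<union> strip (w - 1) 1 = strip 0 w" "strip 0 (w - 1) \<inter> strip (w - 1) 1 = {}"
      using strip_Un[of "w - 1" 1 0] False by auto
    have 1: "integrable M (\<lambda>\<omega>. \<bar>L (strip 0 (w - 1)) \<omega>\<bar> powr p)"
      using Suc False by (intro Suc.IH) auto
    have 2: "integrable M (\<lambda>\<omega>. \<bar>L (strip (w - 1) 1) \<omega>\<bar> powr p)"
      using unit_powr_integrable f False
      by (subst basis_expectation_cong(2)[where B = "strip 0 1" and f = "\<lambda>x. \<bar>x\<bar> powr p"])
        (auto simp: strip_measure)
    have "integrable M (\<lambda>\<omega>. \<bar>L (strip 0 (w - 1)) \<omega> + L (strip (w - 1) 1) \<omega>\<bar> powr p)"
      using f False p_bounds 1 2 by (intro powr_integrable_add measurable_basis) auto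
    moreover have "AE \<omega> in M. L (strip 0 w) \<omega> = L (strip 0 (w - 1)) \<omega> + L (strip (w - 1) 1) \<omega>"
      using basis_Un[of "strip 0 (w - 1)" "strip (w - 1) 1"] f U False by auto
    moreover have "L (strip 0 w) \<in> borel_measurable M"
      using Suc by (intro measurable_basis strip_measure)
    ultimately show ?thesis
      using f False
      by (elim Bochner_Integration.integrable_cong_AE_imp)
        (auto intro!: powr_real_measurable borel_measurable_abs)
  qed (use small Suc in auto)
  qed
qed

lemma basis_powr_integrable:
  assumes B: "B \<in> finite_borel"
  shows "integrable M (\<lambda>\<omega>. \<bar>L B \<omega>\<bar> powr p)"
proof -
  define w where "w = measure lborel B"
  have w: "0 \<le> w" by (simp add: w_def)
  obtain n where "w \<le> real n" using real_arch_simple by blast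
  with w have "integrable M (\<lambda>\<omega>. \<bar>L (strip 0 w) \<omega>\<bar> powr p)"
    by (rule basis_powr_integrable_strip)
  then show ?thesis
    by (subst basis_expectation_cong(2)[OF B strip_measure(3)[OF w], where f = "\<lambda>x. \<bar>x\<bar> powr p"])
      (auto simp: strip_measure w w_def)
qed

lemma basis_fourth_moment: "B \<in> finite_borel \<Longrightarrow> fourth_moment (L B)"
  using p_bounds by (intro fourth_moment_powr[OF measurable_basis basis_powr_integrable]) auto

definition Z :: "(real \<times> real) set \<Rightarrow> 'a \<Rightarrow> real" where
  "Z B \<omega> = L B \<omega> - expectation (L B)"

text \<open>The fourth cumulant of the basis on unit area, where the variance is 1.\<close>

definition excess :: real where
  "excess = expectation (\<lambda>\<omega>. Z (strip 0 1) \<omega> ^ 4) - 3"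

lemma Z_fourth_moment: "B \<in> finite_borel \<Longrightarrow> fourth_moment (Z B)"
  unfolding Z_def by (intro fourth_moment_diff fourth_moment_const basis_fourth_moment)

lemma Z_measurable: "B \<in> finite_borel \<Longrightarrow> random_variable borel (Z B)"
  by (rule fourth_moment_measurable[OF Z_fourth_moment])

lemma Z_expectation:
  assumes "B \<in> finite_borel"
  shows "expectation (Z B) = 0"
  using fourth_moment_integrable[OF basis_fourth_moment[OF assms]] by (simp add: Z_def[abs_def] prob_space)

lemma basis_mean_cong:
  "A \<in> finite_borel \<Longrightarrow> B \<in> finite_borel \<Longrightarrow> measure lborel A = measure lborel B \<Longrightarrow>
    expectation (L A) = expectation (L B)"
  using basis_expectation_cong(1)[of A B "\<lambda>x. x"] by simp

lemma Z_expectation_cong: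
  assumes "A \<in> finite_borel" "B \<in> finite_borel" "measure lborel A = measure lborel B"
    and "f \<in> borel_measurable borel"
  shows "expectation (\<lambda>\<omega>. f (Z A \<omega>) :: real) = expectation (\<lambda>\<omega>. f (Z B \<omega>))"
  unfolding Z_def basis_mean_cong[OF assms(1-3)]
  by (rule basis_expectation_cong(1)[OF assms(1-3), where f = "\<lambda>x. f (x - expectation (L B))"])
    (use assms(4) in measurable)

lemma Z_Un:
  assumes "A \<in> finite_borel" "B \<in> finite_borel" "A \<inter> B = {}"
  shows "AE \<omega> in M. Z (A \<union> B) \<omega> = Z A \<omega> + Z B \<omega>"
proof -
  note AB = basis_Un[OF assms]
  have "expectation (L (A \<union> B)) = expectation (\<lambda>\<omega>. L A \<omega> + L B \<omega>)"
    using assms AB by (intro integral_cong_AE borel_measurable_add measurable_basis) auto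
  also have "\<dots> = expectation (L A) + expectation (L B)"
    using assms by (simp add: fourth_moment_integrable basis_fourth_moment)
  finally show ?thesis using AB by (auto simp: Z_def)
qed

lemma Z_indep_vars:
  assumes "finite I" "disjoint_family_on C I" "\<And>i. i \<in> I \<Longrightarrow> C i \<in> finite_borel"
  shows "indep_vars (\<lambda>_. borel) (\<lambda>i. Z (C i)) I"
  using indep_vars_compose2[OF basis_indep_vars[OF assms], where Y = "\<lambda>i x. x - expectation (L (C i))"]
  by (simp add: Z_def[abs_def])

lemma Z_indep_var:
  assumes "A \<in> finite_borel" "B \<in> finite_borel" "A \<inter> B = {}"
  shows "indep_var borel (Z A) borel (Z B)"
  using indep_var_compose[OF basis_indep_var[OF assms], of "\<lambda>x. x - expectation (L A)" borel "\<lambda>x. x - expectation (L B)" borel]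
  by (simp add: Z_def[abs_def] comp_def)

lemma Z_moments_add:
  assumes "0 \<le> s" "0 \<le> t"
  shows "expectation (\<lambda>\<omega>. (Z (strip 0 (s + t)) \<omega>)\<^sup>2)
      = expectation (\<lambda>\<omega>. (Z (strip 0 s) \<omega>)\<^sup>2) + expectation (\<lambda>\<omega>. (Z (strip 0 t) \<omega>)\<^sup>2)"
    and "expectation (\<lambda>\<omega>. Z (strip 0 (s + t)) \<omega> ^ 4)
      = expectation (\<lambda>\<omega>. Z (strip 0 s) \<omega> ^ 4) + expectation (\<lambda>\<omega>. Z (strip 0 t) \<omega> ^ 4)
        + 6 * expectation (\<lambda>\<omega>. (Z (strip 0 s) \<omega>)\<^sup>2) * expectation (\<lambda>\<omega>. (Z (strip 0 t) \<omega>)\<^sup>2)"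
proof -
  let ?A = "strip 0 s" and ?B = "strip s t"
  have f: "?A \<in> finite_borel" "?B \<in> finite_borel" "strip 0 t \<in> finite_borel" "strip 0 (s + t) \<in> finite_borel"
    using assms by (auto intro!: strip_measure)
  have U: "?A \<union> ?B = strip 0 (s + t)" "?A \<inter> ?B = {}"
    using strip_Un[of s t 0] assms by auto
  note add = Z_Un[OF f(1,2) U(2), unfolded U(1)]
  note m = f[THEN Z_measurable]
  note i = indep_sum_moments[OF Z_indep_var[OF f(1,2) U(2)] Z_fourth_moment[OF f(1)] Z_expectation[OF f(1)]
      Z_fourth_moment[OF f(2)] Z_expectation[OF f(2)]]
  have B: "expectation (\<lambda>\<omega>. Z ?B \<omega> ^ k) = expectation (\<lambda>\<omega>. Z (strip 0 t) \<omega> ^ k)" for k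
    using f assms by (intro Z_expectation_cong[where f = "\<lambda>x. x ^ k"]) (auto simp: strip_measure)
  have "expectation (\<lambda>\<omega>. (Z (strip 0 (s + t)) \<omega>)\<^sup>2) = expectation (\<lambda>\<omega>. (Z ?A \<omega> + Z ?B \<omega>)\<^sup>2)"
    using add m by (intro integral_cong_AE) auto
  then show "expectation (\<lambda>\<omega>. (Z (strip 0 (s + t)) \<omega>)\<^sup>2)
      = expectation (\<lambda>\<omega>. (Z (strip 0 s) \<omega>)\<^sup>2) + expectation (\<lambda>\<omega>. (Z (strip 0 t) \<omega>)\<^sup>2)"
    using i(1) B by simp
  have "expectation (\<lambda>\<omega>. Z (strip 0 (s + t)) \<omega> ^ 4) = expectation (\<lambda>\<omega>. (Z ?A \<omega> + Z ?B \<omega>) ^ 4)"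
    using add m by (intro integral_cong_AE) auto
  then show "expectation (\<lambda>\<omega>. Z (strip 0 (s + t)) \<omega> ^ 4)
      = expectation (\<lambda>\<omega>. Z (strip 0 s) \<omega> ^ 4) + expectation (\<lambda>\<omega>. Z (strip 0 t) \<omega> ^ 4)
        + 6 * expectation (\<lambda>\<omega>. (Z (strip 0 s) \<omega>)\<^sup>2) * expectation (\<lambda>\<omega>. (Z (strip 0 t) \<omega>)\<^sup>2)"
    using i(2) B by simp
qed

text \<open>Additive and nonnegative in the area, hence linear, with the unit variance as
  slope.\<close>

lemma Z_second_moment_strip: "0 \<le> w \<Longrightarrow> expectation (\<lambda>\<omega>. (Z (strip 0 w) \<omega>)\<^sup>2) = w"
  using additive_nonneg_linear[of "\<lambda>w. expectation (\<lambda>\<omega>. (Z (strip 0 w) \<omega>)\<^sup>2)" w]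
    Z_moments_add(1) unit_variance
  by (simp add: Z_def)

lemma Z_second_moment:
  assumes "B \<in> finite_borel"
  shows "expectation (\<lambda>\<omega>. (Z B \<omega>)\<^sup>2) = measure lborel B"
  using Z_expectation_cong[OF assms strip_measure(3)[of "measure lborel B" 0], where f = "\<lambda>x. x\<^sup>2"]
    Z_second_moment_strip[of "measure lborel B"]
  by (simp add: strip_measure)

text \<open>The fourth cumulant \<open>k\<close> is additive in the area, so it is linear as soon as
  it is nonnegative.\<close>

lemma Z_fourth_moment_strip:
  assumes "0 \<le> w"
  shows "expectation (\<lambda>\<omega>. Z (strip 0 w) \<omega> ^ 4) = 3 * w\<^sup>2 + excess * w" and "0 \<le> excess"
proof -
  define k where "k w = expectation (\<lambda>\<omega>. Z (strip 0 w) \<omega> ^ 4) - 3 * w\<^sup>2" for w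
  have add: "k (s + t) = k s + k t" if "0 \<le> s" "0 \<le> t" for s t
    using that by (simp add: k_def Z_moments_add Z_second_moment_strip) (simp add: power2_eq_square algebra_simps)
  have lower: "- 3 * w\<^sup>2 \<le> k w" for w
    by (simp add: k_def)
  have mult: "k (real n * x) = real n * k x" if "0 \<le> x" for n x
  proof (induction n)
    case 0
    then show ?case using add[of 0 0] by simp
  next
    case (Suc n)
    have "k (real (Suc n) * x) = k (real n * x + x)" by (simp add: algebra_simps)
    also have "\<dots> = real (Suc n) * k x"
      using that Suc by (subst add) (auto simp: algebra_simps)
    finally show ?case .
  qed
  \<comment> \<open>Trivially \<open>k w >= - 3 * w^2\<close>. Cutting the area into
    \<open>N\<close> equal pieces and adding up improves this to \<open>- 3 * w^2 / N\<close> for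
    every \<open>N\<close>.\<close>
  have nonneg: "0 \<le> k w" if "0 \<le> w" for w
  proof -
    have "- 3 * w\<^sup>2 / real (Suc n) \<le> k w" for n
    proof -
      let ?N = "real (Suc n)"
      have "k w = ?N * k (w / ?N)"
        using mult[of "w / ?N" "Suc n"] that by simp
      moreover have "?N * (- 3 * (w / ?N)\<^sup>2) \<le> ?N * k (w / ?N)"
        by (intro mult_left_mono lower) simp
      moreover have "?N * (- 3 * (w / ?N)\<^sup>2) = - 3 * w\<^sup>2 / ?N"
        by (simp add: power2_eq_square)
      ultimately show ?thesis by simp
    qed
    moreover have "(\<lambda>n. - 3 * w\<^sup>2 / real (Suc n)) \<longlonglongrightarrow> 0"
      by (rule tendsto_divide_0[OF tendsto_const filterlim_compose[OF filterlim_at_top_imp_at_infinity filterlim_Suc]])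
        (rule filterlim_real_sequentially)
    ultimately show ?thesis
      by (intro tendsto_upperbound[OF _ always_eventually]) auto
  qed
  have "k w = k 1 * w"
    using assms by (intro additive_nonneg_linear add nonneg)
  then show "expectation (\<lambda>\<omega>. Z (strip 0 w) \<omega> ^ 4) = 3 * w\<^sup>2 + excess * w"
    by (simp add: k_def excess_def)
  show "0 \<le> excess"
    using nonneg[of 1] by (simp add: k_def excess_def)
qed

lemma excess_nonneg: "0 \<le> excess"
  by (rule Z_fourth_moment_strip(2)[of 0]) simp

lemma Z_fourth_moment_eq:
  assumes "B \<in> finite_borel"
  shows "expectation (\<lambda>\<omega>. Z B \<omega> ^ 4) = 3 * (measure lborel B)\<^sup>2 + excess * measure lborel B"
  using Z_expectation_cong[OF assms strip_measure(3)[of "measure lborel B" 0], where f = "\<lambda>x. x ^ 4"]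
    Z_fourth_moment_strip[of "measure lborel B"]
  by (simp add: strip_measure)

text \<open>A difference of two independent copies of the basis at area \<open>w\<close>; its
  symmetry is what allows the sign change in the superadditivity proof.\<close>

definition sym_moment :: "real \<Rightarrow> real" where
  "sym_moment w = expectation (\<lambda>\<omega>. \<bar>L (strip 0 w) \<omega> - L (strip w w) \<omega>\<bar> powr p)"

lemma sym_moment_cong:
  assumes "A \<in> finite_borel" "B \<in> finite_borel" "A \<inter> B = {}"
    and "measure lborel A = w" "measure lborel B = w"
  shows "expectation (\<lambda>\<omega>. \<bar>L A \<omega> - L B \<omega>\<bar> powr p) = sym_moment w"
proof -
  have w: "0 \<le> w" using assms by auto
  note f = strip_measure(3)[OF w, of 0] strip_measure(3)[OF w, of w]
  have d: "strip 0 w \<inter> strip w w = {}" using strip_Un(2)[of w w 0] w by simp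
  show ?thesis
    unfolding sym_moment_def
    by (rule indep_difference_law[where f = "\<lambda>x. \<bar>x\<bar> powr p"])
      (use assms f d w in \<open>auto intro!: basis_indep_var basis_law_cong simp: strip_measure\<close>)
qed

lemma basis_diff_powr_integrable:
  assumes "A \<in> finite_borel" "B \<in> finite_borel"
  shows "integrable M (\<lambda>\<omega>. \<bar>L A \<omega> - L B \<omega>\<bar> powr p)"
  using powr_integrable_add[of "L A" "\<lambda>\<omega>. - L B \<omega>" p] assms p_bounds
  by (auto intro: measurable_basis basis_powr_integrable)

text \<open>On four disjoint strips, put \<open>u = L A1 - L B1\<close> and
  \<open>v = L A2 - L B2\<close>. Both \<open>u + v\<close> and \<open>u - v\<close> are differences
  over two disjoint sets of area \<open>v + w\<close>, so they have the same \<open>p\<close>-th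
  moment, and Clarkson's inequality can be integrated.\<close>

lemma sym_moment_superadditive:
  assumes "0 \<le> v" "0 \<le> w"
  shows "sym_moment v + sym_moment w \<le> sym_moment (v + w)"
proof -
  define A1 A2 B1 B2 where "A1 = strip 0 v" and "A2 = strip v w"
    and "B1 = strip (v + w) v" and "B2 = strip (v + w + v) w"
  note defs = A1_def A2_def B1_def B2_def
  have f: "A1 \<in> finite_borel" "A2 \<in> finite_borel" "B1 \<in> finite_borel" "B2 \<in> finite_borel"
    using assms by (auto simp: defs intro!: strip_measure)
  have d: "A1 \<inter> A2 = {}" "A1 \<inter> B1 = {}" "A1 \<inter> B2 = {}" "A2 \<inter> B1 = {}" "A2 \<inter> B2 = {}" "B1 \<inter> B2 = {}"
    using assms by (auto simp: defs strip_def)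
  have m: "measure lborel A1 = v" "measure lborel A2 = w" "measure lborel B1 = v" "measure lborel B2 = w"
    using assms by (auto simp: defs strip_measure)
  have mU: "measure lborel (A1 \<union> A2) = v + w" "measure lborel (B1 \<union> B2) = v + w"
     "measure lborel (A1 \<union> B2) = v + w" "measure lborel (B1 \<union> A2) = v + w"
    using f d m by (auto simp: finite_borel_measure_Un Int_commute)
  have 1: "expectation (\<lambda>\<omega>. \<bar>(L A1 \<omega> - L B1 \<omega>) + (L A2 \<omega> - L B2 \<omega>)\<bar> powr p) = sym_moment (v + w)"
  proof -
    have "AE \<omega> in M. (L A1 \<omega> - L B1 \<omega>) + (L A2 \<omega> - L B2 \<omega>) = L (A1 \<union> A2) \<omega> - L (B1 \<union> B2) \<omega>"
      using basis_Un[OF f(1,2) d(1)] basis_Un[OF f(3,4) d(6)] by eventually_elim simp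
    then have "expectation (\<lambda>\<omega>. \<bar>(L A1 \<omega> - L B1 \<omega>) + (L A2 \<omega> - L B2 \<omega>)\<bar> powr p)
        = expectation (\<lambda>\<omega>. \<bar>L (A1 \<union> A2) \<omega> - L (B1 \<union> B2) \<omega>\<bar> powr p)"
      using f by (intro integral_cong_AE powr_real_measurable borel_measurable_abs borel_measurable_add
          borel_measurable_diff measurable_basis) auto
    also have "\<dots> = sym_moment (v + w)"
      using f d mU by (intro sym_moment_cong) auto
    finally show ?thesis .
  qed
  \<comment> \<open>The minus sign merely exchanges the roles of \<open>A2\<close> and
    \<open>B2\<close>, which have equal area.\<close>
  have 2: "expectation (\<lambda>\<omega>. \<bar>(L A1 \<omega> - L B1 \<omega>) - (L A2 \<omega> - L B2 \<omega>)\<bar> powr p) = sym_moment (v + w)"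
  proof -
    have "AE \<omega> in M. (L A1 \<omega> - L B1 \<omega>) - (L A2 \<omega> - L B2 \<omega>) = L (A1 \<union> B2) \<omega> - L (B1 \<union> A2) \<omega>"
      using basis_Un[OF f(1,4) d(3)] basis_Un[OF f(3,2)] d by (auto simp: Int_commute)
    then have "expectation (\<lambda>\<omega>. \<bar>(L A1 \<omega> - L B1 \<omega>) - (L A2 \<omega> - L B2 \<omega>)\<bar> powr p)
        = expectation (\<lambda>\<omega>. \<bar>L (A1 \<union> B2) \<omega> - L (B1 \<union> A2) \<omega>\<bar> powr p)"
      using f by (intro integral_cong_AE powr_real_measurable borel_measurable_abs borel_measurable_add
          borel_measurable_diff measurable_basis) auto
    also have "\<dots> = sym_moment (v + w)"
      using f d mU by (intro sym_moment_cong) auto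
    finally show ?thesis .
  qed
  have i: "integrable M (\<lambda>\<omega>. \<bar>L A1 \<omega> - L B1 \<omega>\<bar> powr p)" "integrable M (\<lambda>\<omega>. \<bar>L A2 \<omega> - L B2 \<omega>\<bar> powr p)"
    using f by (auto intro: basis_diff_powr_integrable)
  have j: "integrable M (\<lambda>\<omega>. \<bar>(L A1 \<omega> - L B1 \<omega>) + (L A2 \<omega> - L B2 \<omega>)\<bar> powr p)"
    "integrable M (\<lambda>\<omega>. \<bar>(L A1 \<omega> - L B1 \<omega>) - (L A2 \<omega> - L B2 \<omega>)\<bar> powr p)"
  proof -
    have mm: "(\<lambda>\<omega>. L A1 \<omega> - L B1 \<omega>) \<in> borel_measurable M" "(\<lambda>\<omega>. L A2 \<omega> - L B2 \<omega>) \<in> borel_measurable M"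
      by (intro borel_measurable_diff measurable_basis f)+
    show "integrable M (\<lambda>\<omega>. \<bar>(L A1 \<omega> - L B1 \<omega>) + (L A2 \<omega> - L B2 \<omega>)\<bar> powr p)"
      using mm i p_bounds by (intro powr_integrable_add) auto
    have "(\<lambda>\<omega>. L B2 \<omega> - L A2 \<omega>) \<in> borel_measurable M"
      by (intro borel_measurable_diff measurable_basis f)
    then show "integrable M (\<lambda>\<omega>. \<bar>(L A1 \<omega> - L B1 \<omega>) - (L A2 \<omega> - L B2 \<omega>)\<bar> powr p)"
      using powr_integrable_add[of "\<lambda>\<omega>. L A1 \<omega> - L B1 \<omega>" "\<lambda>\<omega>. L B2 \<omega> - L A2 \<omega>" p] mm i p_bounds
      by (auto simp: abs_minus_commute algebra_simps)
  qed
  have "expectation (\<lambda>\<omega>. 2 * \<bar>L A1 \<omega> - L B1 \<omega>\<bar> powr p + 2 * \<bar>L A2 \<omega> - L B2 \<omega>\<bar> powr p)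
      \<le> expectation (\<lambda>\<omega>. \<bar>(L A1 \<omega> - L B1 \<omega>) + (L A2 \<omega> - L B2 \<omega>)\<bar> powr p
          + \<bar>(L A1 \<omega> - L B1 \<omega>) - (L A2 \<omega> - L B2 \<omega>)\<bar> powr p)"
    using i j p_bounds by (intro integral_mono clarkson_real) auto
  also have "\<dots> = 2 * sym_moment (v + w)"
    using j 1 2 by simp
  also have "expectation (\<lambda>\<omega>. 2 * \<bar>L A1 \<omega> - L B1 \<omega>\<bar> powr p + 2 * \<bar>L A2 \<omega> - L B2 \<omega>\<bar> powr p)
      = 2 * sym_moment v + 2 * sym_moment w"
    using i f d m by (simp add: sym_moment_cong)
  finally show ?thesis by simp
qed

text \<open>Superadditivity gives
  \<open>n * sym_moment w <= sym_moment (n * w) <= sym_moment 1\<close> whenever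
  \<open>n * w <= 1\<close>.\<close>

lemma sym_moment_le:
  assumes "0 \<le> w" "w \<le> 1"
  shows "sym_moment w \<le> 2 * sym_moment 1 * w"
proof -
  have nonneg: "0 \<le> sym_moment v" for v
    unfolding sym_moment_def by (intro Bochner_Integration.integral_nonneg) simp
  have mult: "real n * sym_moment w \<le> sym_moment (real n * w)" for n
  proof (induction n)
    case (Suc n)
    have "real (Suc n) * sym_moment w \<le> sym_moment (real n * w) + sym_moment w"
      using Suc by (simp add: algebra_simps)
    also have "\<dots> \<le> sym_moment (real n * w + w)"
      using assms by (intro sym_moment_superadditive) auto
    finally show ?case by (simp add: algebra_simps)
  qed (simp add: nonneg)
  show ?thesis
  proof (cases "w = 0")
    case True
    then show ?thesis using sym_moment_superadditive[of 0 0] by simp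
  next
    case False
    then have w: "0 < w" using assms by simp
    \<comment> \<open>The largest admissible \<open>n\<close>. It is at least 1, hence
      \<open>1 / w < n + 1 <= 2 * n\<close>; this is the origin of the factor 2 in the
      bound.\<close>
    define n where "n = nat \<lfloor>1 / w\<rfloor>"
    have n: "real n \<le> 1 / w" "1 / w < real n + 1" "1 \<le> real n"
      using w assms by (auto simp: n_def of_nat_nat le_nat_iff le_floor_iff)
    have "sym_moment (real n * w) \<le> sym_moment (real n * w) + sym_moment (1 - real n * w)"
      using nonneg by simp
    also have "\<dots> \<le> sym_moment 1"
      using sym_moment_superadditive[of "real n * w" "1 - real n * w"] n w by (simp add: field_simps)
    finally have "real n * sym_moment w \<le> sym_moment 1" using mult[of n] by simp
    moreover have "1 / (2 * w) * sym_moment w \<le> real n * sym_moment w"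
      using n by (intro mult_right_mono nonneg) (simp add: field_simps)
    ultimately have "1 / (2 * w) * sym_moment w \<le> sym_moment 1" by simp
    then show ?thesis using w by (simp add: field_simps)
  qed
qed

lemma Z_powr_integrable:
  assumes "B \<in> finite_borel"
  shows "integrable M (\<lambda>\<omega>. \<bar>Z B \<omega>\<bar> powr p)"
  using powr_integrable_add[of "L B" "\<lambda>\<omega>. - expectation (L B)" p] assms p_bounds
  by (auto simp: Z_def intro: measurable_basis basis_powr_integrable)

text \<open>Jensen's inequality compares the centred with the symmetrised moment. Linearity in the
  area is the point: increments over \<open>n\<close> sets of area about \<open>a 0 * h\<close> have
  a total \<open>p\<close>-th moment of order \<open>n * h\<close>.\<close>

lemma Z_powr_bound:
  assumes "B \<in> finite_borel" "measure lborel B \<le> 1"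
  shows "expectation (\<lambda>\<omega>. \<bar>Z B \<omega>\<bar> powr p) \<le> 2 * sym_moment 1 * measure lborel B"
proof -
  define w where "w = measure lborel B"
  have w: "0 \<le> w" "w \<le> 1" using assms by (auto simp: w_def)
  note f = strip_measure(3)[OF w(1), of 0] strip_measure(3)[OF w(1), of w]
  have d: "strip 0 w \<inter> strip w w = {}" using strip_Un(2)[of w w 0] w by simp
  have "expectation (\<lambda>\<omega>. \<bar>Z B \<omega>\<bar> powr p) = expectation (\<lambda>\<omega>. \<bar>Z (strip 0 w) \<omega>\<bar> powr p)"
    using w assms f by (intro Z_expectation_cong[where f = "\<lambda>x. \<bar>x\<bar> powr p"]) (auto simp: strip_measure w_def)
  also have "\<dots> = expectation (\<lambda>\<omega>. \<bar>L (strip 0 w) \<omega> - expectation (L (strip w w))\<bar> powr p)"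
    unfolding Z_def using basis_mean_cong[OF f] w by (simp add: strip_measure)
  also have "\<dots> \<le> sym_moment w"
    unfolding sym_moment_def
    by (rule indep_jensen_powr)
      (use f d p_bounds in \<open>auto intro: basis_indep_var basis_diff_powr_integrable fourth_moment_integrable basis_fourth_moment\<close>)
  also have "\<dots> \<le> 2 * sym_moment 1 * w"
    by (rule sym_moment_le) (use w in auto)
  finally show ?thesis by (simp add: w_def)
qed

end

section \<open>The fourth cumulant and the Levy measure\<close>

context prob_space
begin

text \<open>Given by the characteristic function so that \<open>v = 0\<close> is included; the atoms
  of a partition of the plane may be null sets.\<close>

definition centred_gaussian :: "real \<Rightarrow> ('a \<Rightarrow> real) \<Rightarrow> bool" where
  "centred_gaussian v Y \<longleftrightarrow> 0 \<le> v \<and> random_variable borel Y \<and>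
     (\<forall>t. char (distr M borel Y) t = complex_of_real (exp (- (v * t\<^sup>2 / 2))))"

lemma centred_gaussian_0:
  assumes "centred_gaussian 0 Y"
  shows "AE \<omega> in M. Y \<omega> = 0"
proof -
  have rv: "random_variable borel Y" using assms by (simp add: centred_gaussian_def)
  have "distr M borel Y = return borel 0"
  proof (rule Levy_uniqueness)
    show "real_distribution (return borel (0::real))"
      by (simp add: real_distribution_def real_distribution_axioms_def prob_space_return)
    show "char (distr M borel Y) = char (return borel 0)"
      using assms by (simp add: fun_eq_iff centred_gaussian_def char_def integral_return)
  qed (use rv in simp)
  moreover have "AE y in return borel 0. y = (0::real)" by (subst AE_return) auto
  ultimately have "AE y in distr M borel Y. y = 0" by (simp only:)
  then show ?thesis using rv by (simp add: AE_distr_iff)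
qed

lemma centred_gaussian_pos:
  assumes "centred_gaussian v Y" "0 < v"
  shows "distr M borel Y = density lborel (normal_density 0 (sqrt v))"
proof (rule Levy_uniqueness)
  show "char (distr M borel Y) = char (density lborel (normal_density 0 (sqrt v)))"
    using assms by (simp add: fun_eq_iff centred_gaussian_def char_normal)
qed (use assms in \<open>auto simp: centred_gaussian_def intro!: real_distribution_normal\<close>)

lemma centred_gaussian_even_moment:
  assumes "centred_gaussian v Y"
  shows "integrable M (\<lambda>\<omega>. Y \<omega> ^ (2 * k))"
    and "expectation (\<lambda>\<omega>. Y \<omega> ^ (2 * k)) = fact (2 * k) / (2 ^ k * fact k) * v ^ k"
proof -
  have rv: "random_variable borel Y" using assms by (simp add: centred_gaussian_def)
  have "integrable M (\<lambda>\<omega>. Y \<omega> ^ (2 * k)) \<and> expectation (\<lambda>\<omega>. Y \<omega> ^ (2 * k)) = fact (2 * k) / (2 ^ k * fact k) * v ^ k"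
  proof (cases "v = 0")
    case True
    then have "AE \<omega> in M. Y \<omega> = 0" using assms centred_gaussian_0 by auto
    then have e: "AE \<omega> in M. Y \<omega> ^ (2 * k) = 0 ^ (2 * k)" by eventually_elim simp
    have "integrable M (\<lambda>\<omega>. Y \<omega> ^ (2 * k))"
      using e rv by (subst integrable_cong_AE[where g = "\<lambda>_. 0 ^ (2 * k)"]) auto
    moreover have "expectation (\<lambda>\<omega>. Y \<omega> ^ (2 * k)) = 0 ^ (2 * k)"
      using e rv by (subst integral_cong_AE[where g = "\<lambda>_. 0 ^ (2 * k)"]) (auto simp: prob_space)
    ultimately show ?thesis using True by (cases k) auto
  next
    case False
    with assms have v: "0 < v" by (simp add: centred_gaussian_def)
    note d = centred_gaussian_pos[OF assms v]
    have m: "has_bochner_integral lborel (\<lambda>x. normal_density 0 (sqrt v) x * x ^ (2 * k))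
        (fact (2 * k) / ((2 / (sqrt v)\<^sup>2) ^ k * fact k))"
      using normal_moment_even[of "sqrt v" 0 k] v by simp
    have "integrable (distr M borel Y) (\<lambda>x. x ^ (2 * k))"
      unfolding d using m by (subst integrable_density) (auto simp: has_bochner_integral_iff)
    moreover have "integral\<^sup>L (distr M borel Y) (\<lambda>x. x ^ (2 * k)) = fact (2 * k) / (2 ^ k * fact k) * v ^ k"
      unfolding d using m v by (subst integral_density) (auto simp: has_bochner_integral_iff power_divide)
    ultimately show ?thesis
      using rv by (simp add: integrable_distr_eq integral_distr)
  qed
  then show "integrable M (\<lambda>\<omega>. Y \<omega> ^ (2 * k))"
    and "expectation (\<lambda>\<omega>. Y \<omega> ^ (2 * k)) = fact (2 * k) / (2 ^ k * fact k) * v ^ k" by auto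
qed

lemma centred_gaussian_expectation:
  assumes "centred_gaussian v Y"
  shows "expectation Y = 0"
proof (cases "v = 0")
  case True
  then have "AE \<omega> in M. Y \<omega> = 0" using assms centred_gaussian_0 by auto
  then show ?thesis by (rule integral_eq_zero_AE)
next
  case False
  with assms have v: "0 < v" and rv: "random_variable borel Y" by (auto simp: centred_gaussian_def)
  have "expectation Y = integral\<^sup>L (distr M borel Y) (\<lambda>x. x)"
    using rv by (simp add: integral_distr)
  also have "\<dots> = 0"
    unfolding centred_gaussian_pos[OF assms v] using v
    by (subst integral_density) (auto simp: integral_normal_moment_nz_1)
  finally show ?thesis .
qed

end

section \<open>The Levy exponent and the sign of the fourth cumulant\<close>

definition levy_integrand :: "real \<Rightarrow> real \<Rightarrow> complex" where
  "levy_integrand z x = iexp (z * x) - 1 - \<i> * complex_of_real (z * x * indicator {-1..1} x)"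

text \<open>Inside [-1, 1] the compensator leaves a second order Taylor remainder, outside it the
  integrand is at most 2 in modulus; both are dominated by a multiple of
  \<open>min 1 (x^2)\<close>.\<close>

lemma levy_integrand_integrable:
  assumes "levy_measure \<nu>"
  shows "set_integrable \<nu> (- {0}) (levy_integrand z)"
proof -
  have s [measurable_cong]: "sets \<nu> = sets borel" using assms by (simp add: levy_measure_def)
  have i: "integrable \<nu> (\<lambda>x. min 1 (x\<^sup>2))"
  proof (rule integrableI_bounded)
    have "(\<integral>\<^sup>+ x. ennreal (norm (min 1 (x\<^sup>2) :: real)) \<partial>\<nu>) = (\<integral>\<^sup>+ x. ennreal (min 1 (x\<^sup>2)) \<partial>\<nu>)"
      by (intro nn_integral_cong) auto
    then show "(\<integral>\<^sup>+ x. ennreal (norm (min 1 (x\<^sup>2) :: real)) \<partial>\<nu>) < \<infinity>"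
      using assms by (simp add: levy_measure_def)
  qed measurable
  have "cmod (levy_integrand z x) \<le> (2 + z\<^sup>2) * min 1 (x\<^sup>2)" for x
  proof (cases "\<bar>x\<bar> \<le> 1")
    case True
    then have "x \<in> {-1..1}" by auto
    then have "levy_integrand z x = iexp (z * x) - (\<Sum>k\<le>1. (\<i> * complex_of_real (z * x)) ^ k / fact k)"
      by (simp add: levy_integrand_def)
    also have "cmod \<dots> \<le> \<bar>z * x\<bar> ^ Suc 1 / fact (Suc 1)" by (rule iexp_approx1)
    also have "\<dots> = z\<^sup>2 * x\<^sup>2 / 2" by (simp add: power2_eq_square mult_ac)
    also have "\<dots> \<le> (2 + z\<^sup>2) * x\<^sup>2" by (simp add: algebra_simps)
    also have "x\<^sup>2 = min 1 (x\<^sup>2)" using True by (simp add: abs_square_le_1 min_absorb2)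
    finally show ?thesis .
  next
    case False
    then have "x \<notin> {-1..1}" by auto
    then have "cmod (levy_integrand z x) \<le> 2"
      using norm_triangle_ineq4[of "iexp (z * x)" 1] by (simp add: levy_integrand_def)
    also have "2 \<le> 2 + z\<^sup>2" by simp
    also have "\<dots> = (2 + z\<^sup>2) * min 1 (x\<^sup>2)"
    proof -
      have "1 \<le> x\<^sup>2" using False by (meson abs_square_le_1 less_eq_real_def linear not_le one_le_power power2_abs)
      then show ?thesis by (simp add: min_absorb1)
    qed
    finally show ?thesis .
  qed
  note bound = this
  show ?thesis
    unfolding set_integrable_def
  proof (rule Bochner_Integration.integrable_bound)
    show "integrable \<nu> (\<lambda>x. (2 + z\<^sup>2) * min 1 (x\<^sup>2))" using i by simp
    show "AE x in \<nu>. norm (indicat_real (- {0}) x *\<^sub>R levy_integrand z x) \<le> norm ((2 + z\<^sup>2) * min 1 (x\<^sup>2))"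
      using bound by (intro AE_I2) (auto simp: indicator_def intro: order_trans)
  qed (simp add: levy_integrand_def[abs_def])
qed

lemma levy_exponent_Re:
  assumes "levy_measure \<nu>"
  shows "Re (levy_exponent \<gamma> b \<nu> z) = - (b\<^sup>2 * z\<^sup>2 / 2) + (\<integral>x. indicat_real (- {0}) x * (cos (z * x) - 1) \<partial>\<nu>)"
    and "integrable \<nu> (\<lambda>x. indicat_real (- {0}) x * (cos (z * x) - 1))"
proof -
  note i = levy_integrand_integrable[OF assms, of z, unfolded set_integrable_def]
  have e: "Re (indicat_real (- {0}) x *\<^sub>R levy_integrand z x) = indicat_real (- {0}) x * (cos (z * x) - 1)" for x
    by (simp add: levy_integrand_def Re_exp)
  show "integrable \<nu> (\<lambda>x. indicat_real (- {0}) x * (cos (z * x) - 1))"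
    using integrable_Re[OF i] unfolding e .
  have "Re (LINT x:- {0}|\<nu>. levy_integrand z x) = (\<integral>x. indicat_real (- {0}) x * (cos (z * x) - 1) \<partial>\<nu>)"
    unfolding set_lebesgue_integral_def integral_Re[OF i, symmetric] e ..
  then show "Re (levy_exponent \<gamma> b \<nu> z) = - (b\<^sup>2 * z\<^sup>2 / 2) + (\<integral>x. indicat_real (- {0}) x * (cos (z * x) - 1) \<partial>\<nu>)"
    by (simp add: levy_exponent_def levy_integrand_def[abs_def] Re_divide_numeral flip: of_real_mult of_real_power)
qed

text \<open>The left-hand side is the fourth central difference of the cosine at 0. It annihilates
  quadratic functions, so it removes the Gaussian part of an exponent, and it is nonnegative and
  bounded by \<open>x^4\<close>.\<close>

lemma cos_fourth_difference: "6 - 8 * cos x + 2 * cos (2 * x) = 16 * sin (x / 2) ^ 4" for x :: real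
proof -
  have c: "cos x = 1 - 2 * (sin (x / 2))\<^sup>2"
    using cos_double_sin[of "x / 2"] by simp
  have "cos (2 * x) = 2 * (cos x)\<^sup>2 - 1" by (rule cos_double_cos)
  then show ?thesis unfolding c by (simp add: power2_eq_square power4_eq_xxxx algebra_simps)
qed

text \<open>The derivative of \<open>exp (t * w)\<close> at \<open>t = 0\<close> along
  \<open>t = 1 / (n + 1)\<close>; it recovers an exponent from the characteristic functions on
  shrinking areas.\<close>

lemma exp_difference_quotient_limit:
  fixes w :: complex
  shows "(\<lambda>n. of_nat (Suc n) * (exp (w / of_nat (Suc n)) - 1)) \<longlonglongrightarrow> w"
proof -
  have "((\<lambda>t. exp (t * w)) has_field_derivative w) (at 0)"
    by (auto intro!: derivative_eq_intros)
  then have "((\<lambda>h. (exp (h * w) - 1) / h) \<longlongrightarrow> w) (at 0)"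
    by (simp add: DERIV_def)
  moreover have "filterlim (\<lambda>n. 1 / of_nat (Suc n) :: complex) (at 0) sequentially"
    unfolding filterlim_at
  proof
    show "(\<lambda>n. 1 / of_nat (Suc n) :: complex) \<longlonglongrightarrow> 0"
      using LIMSEQ_inverse_real_of_nat tendsto_of_real[of "\<lambda>n. inverse (real (Suc n))" 0 sequentially, where 'a = complex]
      by (simp add: inverse_eq_divide)
  qed (simp del: of_nat_Suc)
  ultimately have "(\<lambda>n. (exp (1 / of_nat (Suc n) * w) - 1) / (1 / of_nat (Suc n))) \<longlonglongrightarrow> w"
    by (rule filterlim_compose)
  then show ?thesis by (simp add: mult.commute del: of_nat_Suc)
qed

context levy_basis_moments
begin

lemma Z_char:
  assumes "B \<in> finite_borel"
  shows "char (distr M borel (Z B)) t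
    = exp (- (\<i> * complex_of_real (t * expectation (L B)))) * char (distr M borel (L B)) t"
proof -
  note rv = measurable_basis[OF assms] Z_measurable[OF assms]
  have "char (distr M borel (Z B)) t = (CLINT \<omega>|M. iexp (t * Z B \<omega>))"
    using rv by (simp add: char_def integral_distr)
  also have "\<dots> = (CLINT \<omega>|M. exp (- (\<i> * complex_of_real (t * expectation (L B)))) * iexp (t * L B \<omega>))"
    by (intro Bochner_Integration.integral_cong refl) (simp add: Z_def algebra_simps flip: exp_add)
  also have "\<dots> = exp (- (\<i> * complex_of_real (t * expectation (L B)))) * char (distr M borel (L B)) t"
    using rv by (simp add: char_def integral_distr)
  finally show ?thesis .
qed

lemma basis_mean_strip:
  "expectation (L (strip 0 (1 / real (Suc n)))) = expectation (L (strip 0 1)) / real (Suc n)"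
proof -
  have add: "expectation (L (strip 0 (s + t))) = expectation (L (strip 0 s)) + expectation (L (strip 0 t))"
    if "0 \<le> s" "0 \<le> t" for s t
  proof -
    have f: "strip 0 s \<in> finite_borel" "strip s t \<in> finite_borel" "strip 0 t \<in> finite_borel" "strip 0 (s + t) \<in> finite_borel"
      using that by (auto intro!: strip_measure)
    have U: "strip 0 s \<union> strip s t = strip 0 (s + t)" "strip 0 s \<inter> strip s t = {}"
      using strip_Un[of s t 0] that by auto
    have "expectation (L (strip 0 (s + t))) = expectation (\<lambda>\<omega>. L (strip 0 s) \<omega> + L (strip s t) \<omega>)"
      using basis_Un[OF f(1,2) U(2), unfolded U(1)] f
      by (intro integral_cong_AE borel_measurable_add measurable_basis)
    also have "\<dots> = expectation (L (strip 0 s)) + expectation (L (strip s t))"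
      using f by (simp add: fourth_moment_integrable basis_fourth_moment)
    also have "expectation (L (strip s t)) = expectation (L (strip 0 t))"
      using f that by (intro basis_mean_cong) (auto simp: strip_measure)
    finally show ?thesis .
  qed
  have "expectation (L (strip 0 (real m * x))) = real m * expectation (L (strip 0 x))" if "0 \<le> x" for m x
  proof (induction m)
    case 0
    then show ?case using add[of 0 0] by simp
  next
    case (Suc m)
    have "expectation (L (strip 0 (real (Suc m) * x))) = expectation (L (strip 0 (real m * x + x)))"
      by (simp add: algebra_simps)
    then show ?case using Suc that by (simp add: add) (simp add: algebra_simps)
  qed
  from this[of "1 / real (Suc n)" "Suc n"] show ?thesis
    by (simp add: nonzero_eq_divide_eq mult.commute del: of_nat_Suc)
qed

text \<open>On a set of area \<open>1 / N\<close>, the expected fourth difference of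
  \<open>cos (z * Z)\<close> is at most \<open>z^4 * E Z^4\<close>, which is
  \<open>z^4 * (3 / N^2 + excess / N)\<close>. After multiplication by \<open>N\<close>, as
  \<open>N\<close> grows, the left side becomes the fourth difference of the real part of the
  exponent and the Gaussian term 3 disappears on the right.\<close>

lemma levy_integral_le_excess:
  shows "(\<integral>x. indicat_real (- {0}) x * (16 * sin (z * x / 2) ^ 4) \<partial>\<nu>) \<le> excess * z ^ 4"
    and "integrable \<nu> (\<lambda>x. indicat_real (- {0}) x * (16 * sin (z * x / 2) ^ 4))"
proof -
  have lm: "levy_measure \<nu>" using triplet by (simp add: levy_triplet_def)
  note Re1 = levy_exponent_Re(1)[OF lm, of \<gamma> b z] levy_exponent_Re(2)[OF lm, of z]
    and Re2 = levy_exponent_Re(1)[OF lm, of \<gamma> b "2 * z"] levy_exponent_Re(2)[OF lm, of "2 * z"]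
  let ?\<psi> = "levy_exponent \<gamma> b \<nu>" and ?m = "expectation (L (strip 0 1))"
  have e: "indicat_real (- {0}) x * (16 * sin (z * x / 2) ^ 4)
      = - 8 * (indicat_real (- {0}) x * (cos (z * x) - 1)) + 2 * (indicat_real (- {0}) x * (cos (2 * z * x) - 1))" for x
    unfolding cos_fourth_difference[symmetric] by (simp add: algebra_simps)
  show "integrable \<nu> (\<lambda>x. indicat_real (- {0}) x * (16 * sin (z * x / 2) ^ 4))"
    unfolding e using Re1(2) Re2(2)
    by (intro Bochner_Integration.integrable_add integrable_mult_right) auto
  \<comment> \<open>The contributions \<open>4 * b^2 * z^2\<close> and
    \<open>- 4 * b^2 * z^2\<close> of the Gaussian part cancel; only the jump part remains.\<close>
  have S: "(\<integral>x. indicat_real (- {0}) x * (16 * sin (z * x / 2) ^ 4) \<partial>\<nu>) = - 8 * Re (?\<psi> z) + 2 * Re (?\<psi> (2 * z))"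
    unfolding e using Re1 Re2 by (subst Bochner_Integration.integral_add) (auto simp: power_mult_distrib)
  define B where "B n = strip 0 (1 / real (Suc n))" for n
  have B: "B n \<in> finite_borel" "measure lborel (B n) = 1 / real (Suc n)" for n
    by (auto simp: B_def strip_measure simp del: of_nat_Suc)
  have char: "char (distr M borel (Z (B n))) t = exp ((?\<psi> t - \<i> * complex_of_real (t * ?m)) / of_nat (Suc n))" for n t
    unfolding Z_char[OF B(1)] char_basis[OF B(1)] B(2)
    unfolding B_def basis_mean_strip
    by (simp add: mult_exp_exp diff_divide_distrib del: of_nat_Suc)
  \<comment> \<open>Centring adds a purely imaginary term to the exponent, which the real part does
    not see.\<close>
  have lim: "(\<lambda>n. real (Suc n) * (Re (char (distr M borel (Z (B n))) t) - 1)) \<longlonglongrightarrow> Re (?\<psi> t)" for t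
  proof -
    have "(\<lambda>n. Re (of_nat (Suc n) * (exp ((?\<psi> t - \<i> * complex_of_real (t * ?m)) / of_nat (Suc n)) - 1)))
        \<longlonglongrightarrow> Re (?\<psi> t - \<i> * complex_of_real (t * ?m))"
      by (intro tendsto_Re exp_difference_quotient_limit)
    then show ?thesis by (simp add: char del: of_nat_Suc)
  qed
  have le: "- 8 * (real (Suc n) * (Re (char (distr M borel (Z (B n))) z) - 1))
      + 2 * (real (Suc n) * (Re (char (distr M borel (Z (B n))) (2 * z)) - 1))
      \<le> z ^ 4 * (3 / real (Suc n) + excess)" for n
  proof -
    let ?Z = "Z (B n)" and ?N = "real (Suc n)"
    note rv = Z_measurable[OF B(1)]
    have Re_char: "Re (char (distr M borel ?Z) t) = expectation (\<lambda>\<omega>. cos (t * ?Z \<omega>))"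
      and icos: "integrable M (\<lambda>\<omega>. cos (t * ?Z \<omega>))" for t
    proof -
      have i: "integrable M (\<lambda>\<omega>. iexp (t * ?Z \<omega>))" using rv by (auto intro!: integrable_iexp)
      have "char (distr M borel ?Z) t = (CLINT \<omega>|M. iexp (t * ?Z \<omega>))"
        using rv by (simp add: char_def integral_distr)
      then show "Re (char (distr M borel ?Z) t) = expectation (\<lambda>\<omega>. cos (t * ?Z \<omega>))"
        using integral_Re[OF i] by (simp add: Re_exp)
      show "integrable M (\<lambda>\<omega>. cos (t * ?Z \<omega>))" using integrable_Re[OF i] by (simp add: Re_exp)
    qed
    have "expectation (\<lambda>\<omega>. 6 - 8 * cos (z * ?Z \<omega>) + 2 * cos (2 * (z * ?Z \<omega>))) \<le> expectation (\<lambda>\<omega>. z ^ 4 * ?Z \<omega> ^ 4)"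
    proof (rule integral_mono)
      show "integrable M (\<lambda>\<omega>. 6 - 8 * cos (z * ?Z \<omega>) + 2 * cos (2 * (z * ?Z \<omega>)))"
        using icos[of z] icos[of "2 * z"] by (auto simp: mult.assoc)
      show "integrable M (\<lambda>\<omega>. z ^ 4 * ?Z \<omega> ^ 4)"
        using Z_fourth_moment[OF B(1)] by (auto simp: fourth_moment_def)
      fix \<omega>
      have "sin (z * ?Z \<omega> / 2) ^ 4 \<le> (z * ?Z \<omega> / 2) ^ 4"
      proof -
        have "\<bar>y\<bar> ^ 4 = y ^ 4" for y :: real by simp
        then show ?thesis
          using power_mono[OF abs_sin_x_le_abs_x[of "z * ?Z \<omega> / 2"], of 4] by (simp only: abs_ge_zero)
      qed
      then show "6 - 8 * cos (z * ?Z \<omega>) + 2 * cos (2 * (z * ?Z \<omega>)) \<le> z ^ 4 * ?Z \<omega> ^ 4"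
        unfolding cos_fourth_difference by (simp add: power_divide power_mult_distrib)
    qed
    also have "expectation (\<lambda>\<omega>. 6 - 8 * cos (z * ?Z \<omega>) + 2 * cos (2 * (z * ?Z \<omega>)))
        = 6 - 8 * Re (char (distr M borel ?Z) z) + 2 * Re (char (distr M borel ?Z) (2 * z))"
      using icos[of z] icos[of "2 * z"] by (simp add: Re_char mult.assoc prob_space)
    also have "expectation (\<lambda>\<omega>. z ^ 4 * ?Z \<omega> ^ 4) = z ^ 4 * (3 * (1 / ?N)\<^sup>2 + excess * (1 / ?N))"
      using Z_fourth_moment_eq[OF B(1)] by (simp add: B(2) del: of_nat_Suc)
    finally have "?N * (6 - 8 * Re (char (distr M borel ?Z) z) + 2 * Re (char (distr M borel ?Z) (2 * z)))
        \<le> ?N * (z ^ 4 * (3 * (1 / ?N)\<^sup>2 + excess * (1 / ?N)))"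
      by (intro mult_left_mono) auto
    also have "\<dots> = z ^ 4 * (3 / ?N + excess)"
      by (simp add: power2_eq_square distrib_left del: of_nat_Suc)
    finally show ?thesis by (simp add: algebra_simps)
  qed
  have "(\<lambda>n. z ^ 4 * (3 / real (Suc n) + excess)) \<longlonglongrightarrow> z ^ 4 * (0 + excess)"
    by (intro tendsto_intros LIMSEQ_Suc[OF lim_const_over_n])
  moreover have "(\<lambda>n. - 8 * (real (Suc n) * (Re (char (distr M borel (Z (B n))) z) - 1))
      + 2 * (real (Suc n) * (Re (char (distr M borel (Z (B n))) (2 * z)) - 1))) \<longlonglongrightarrow> - 8 * Re (?\<psi> z) + 2 * Re (?\<psi> (2 * z))"
    by (intro tendsto_intros lim)
  ultimately show "(\<integral>x. indicat_real (- {0}) x * (16 * sin (z * x / 2) ^ 4) \<partial>\<nu>) \<le> excess * z ^ 4"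
    unfolding S using le by (intro LIMSEQ_le) (auto simp: mult.commute)
qed

text \<open>Were the cumulant 0, then \<open>sin (z * x / 2) = 0\<close> for \<nu>-almost every
  \<open>x \<noteq> 0\<close>, simultaneously for all \<open>z = 1 / (n + 1)\<close>. For large
  \<open>n\<close> the argument is nonzero and smaller than \<pi> in modulus, which is absurd, so
  \<nu> would live on {0}.\<close>

lemma excess_pos:
  assumes "c4 \<nu> > 0"
  shows "0 < excess"
proof (rule ccontr)
  assume "\<not> 0 < excess"
  with excess_nonneg have 0: "excess = 0" by simp
  have s [measurable_cong]: "sets \<nu> = sets borel" using triplet by (simp add: levy_triplet_def levy_measure_def)
  have "AE x in \<nu>. indicat_real (- {0}) x * (16 * sin (z * x / 2) ^ 4) = 0" for z
  proof -
    have "(\<integral>x. indicat_real (- {0}) x * (16 * sin (z * x / 2) ^ 4) \<partial>\<nu>) = 0"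
      using levy_integral_le_excess(1)[of z] 0
      by (intro antisym Bochner_Integration.integral_nonneg) auto
    then show ?thesis
      using integral_nonneg_eq_0_iff_AE[OF levy_integral_le_excess(2)[of z]] by auto
  qed
  then have "AE x in \<nu>. \<forall>n. indicat_real (- {0}) x * (16 * sin (1 / real (Suc n) * x / 2) ^ 4) = 0"
    unfolding AE_all_countable by blast
  then have "AE x in \<nu>. x = 0"
  proof eventually_elim
    case (elim x)
    show "x = 0"
    proof (rule ccontr)
      assume x: "x \<noteq> 0"
      obtain n where n: "\<bar>x\<bar> \<le> real n" using real_arch_simple by blast
      define y where "y = 1 / real (Suc n) * x / 2"
      have "\<bar>y\<bar> \<le> 1" using n by (simp add: y_def abs_mult field_simps)
      then have "- pi < y" "y < pi" using pi_gt3 by auto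
      moreover have "sin y = 0" using elim x by (auto simp: y_def)
      ultimately have "y = 0" by (rule sin_eq_0_pi)
      then show False using x by (simp add: y_def)
    qed
  qed
  then have "AE x in \<nu>. ennreal (x ^ 4) = 0" by eventually_elim simp
  then have "c4 \<nu> = 0" unfolding c4_def by (subst nn_integral_0_iff_AE) auto
  with assms show False by simp
qed

text \<open>A vanishing fourth moment leaves \<nu> no mass off 0, so the exponent is a quadratic
  polynomial.\<close>

lemma Z_centred_gaussian:
  assumes "c4 \<nu> = 0" "B \<in> finite_borel"
  shows "centred_gaussian (measure lborel B) (Z B)" and "excess = 0"
proof -
  have s [measurable_cong]: "sets \<nu> = sets borel" using triplet by (simp add: levy_triplet_def levy_measure_def)
  have "AE x in \<nu>. ennreal (x ^ 4) = 0"
    using assms(1) unfolding c4_def by (subst (asm) nn_integral_0_iff_AE) auto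
  then have "AE x in \<nu>. x = 0"
  proof eventually_elim
    case (elim x)
    moreover have "0 \<le> x ^ 4" by simp
    ultimately have "x ^ 4 = 0" by (simp only: ennreal_eq_0_iff)
    then show "x = 0" by simp
  qed
  then have "AE x in \<nu>. indicat_real (- {0}) x *\<^sub>R levy_integrand z x = 0" for z
    by eventually_elim simp
  then have "(LINT x:- {0}|\<nu>. levy_integrand z x) = 0" for z
    unfolding set_lebesgue_integral_def by (rule integral_eq_zero_AE)
  moreover have "levy_exponent \<gamma> b \<nu> z = \<i> * complex_of_real (\<gamma> * z) - complex_of_real (b\<^sup>2 * z\<^sup>2 / 2)
      + (LINT x:- {0}|\<nu>. levy_integrand z x)" for z
    by (simp add: levy_exponent_def levy_integrand_def)
  ultimately have \<psi>: "levy_exponent \<gamma> b \<nu> z = \<i> * complex_of_real (\<gamma> * z) - complex_of_real (b\<^sup>2 * z\<^sup>2 / 2)" for z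
    by simp
  have g: "centred_gaussian (b\<^sup>2 * measure lborel C) (\<lambda>\<omega>. L C \<omega> - \<gamma> * measure lborel C)" if "C \<in> finite_borel" for C
    unfolding centred_gaussian_def
  proof (intro conjI allI)
    note rv = measurable_basis[OF that]
    let ?w = "measure lborel C"
    show "0 \<le> b\<^sup>2 * ?w" by simp
    show "random_variable borel (\<lambda>\<omega>. L C \<omega> - \<gamma> * ?w)" using rv by simp
    fix t
    have "char (distr M borel (\<lambda>\<omega>. L C \<omega> - \<gamma> * ?w)) t = (CLINT \<omega>|M. iexp (t * (L C \<omega> - \<gamma> * ?w)))"
      using rv by (simp add: char_def integral_distr)
    also have "\<dots> = (CLINT \<omega>|M. exp (- (\<i> * complex_of_real (t * \<gamma> * ?w))) * iexp (t * L C \<omega>))"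
      by (intro Bochner_Integration.integral_cong refl) (simp add: algebra_simps flip: exp_add)
    also have "\<dots> = exp (- (\<i> * complex_of_real (t * \<gamma> * ?w))) * char (distr M borel (L C)) t"
      using rv by (simp add: char_def integral_distr)
    also have "\<dots> = exp (- complex_of_real (b\<^sup>2 * ?w * t\<^sup>2 / 2))"
      unfolding char_basis[OF that] \<psi> by (simp add: mult_exp_exp algebra_simps)
    also have "\<dots> = complex_of_real (exp (- (b\<^sup>2 * ?w * t\<^sup>2 / 2)))"
      by (simp flip: exp_of_real)
    finally show "char (distr M borel (\<lambda>\<omega>. L C \<omega> - \<gamma> * ?w)) t = complex_of_real (exp (- (b\<^sup>2 * ?w * t\<^sup>2 / 2)))" .
  qed
  have mean: "expectation (L C) = \<gamma> * measure lborel C" if "C \<in> finite_borel" for C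
    using centred_gaussian_expectation[OF g[OF that]] fourth_moment_integrable[OF basis_fourth_moment[OF that]]
    by (simp add: prob_space)
  have g': "centred_gaussian (b\<^sup>2 * measure lborel C) (Z C)" if "C \<in> finite_borel" for C
    using g[OF that] mean[OF that] by (simp add: Z_def[abs_def])
  have u: "strip 0 1 \<in> finite_borel" "measure lborel (strip 0 1) = 1" by (simp_all add: strip_measure)
  \<comment> \<open>The Gaussian coefficient is identified by the unit variance.\<close>
  have b: "b\<^sup>2 = 1"
    using centred_gaussian_even_moment(2)[OF g'[OF u(1)], of 1] Z_second_moment[OF u(1)] by (simp add: u)
  show "centred_gaussian (measure lborel B) (Z B)"
    using g'[OF assms(2)] b by simp
  have "expectation (\<lambda>\<omega>. Z (strip 0 1) \<omega> ^ 4) = 3"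
    using centred_gaussian_even_moment(2)[OF g'[OF u(1)], of 2] b by (simp add: u fact_numeral)
  then show "excess = 0" by (simp add: excess_def)
qed

end

section \<open>Linear functionals of a Levy basis\<close>

text \<open>A signed sum over the 8 choices of the signs of \<open>b\<close>, \<open>c\<close>,
  \<open>d\<close>: only the monomial \<open>a * b * c * d\<close>, with coefficient 24, has the
  right parity, and 8 times 24 is 192.\<close>

lemma fourth_polarisation:
  fixes a b c d :: real
  shows "192 * (a * b * c * d) = (a + b + c + d) ^ 4 - (a + b + c - d) ^ 4 - (a + b - c + d) ^ 4 + (a + b - c - d) ^ 4
    - (a - b + c + d) ^ 4 + (a - b + c - d) ^ 4 + (a - b - c + d) ^ 4 - (a - b - c - d) ^ 4"
  by algebra

text \<open>The same signed sum applied to squared variances: \<open>n\<close> stands for the sum of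
  the four squared norms and \<open>ab\<close>, ..., \<open>cd\<close> for the inner products. Each
  of the three pairings appears with coefficient 8 in each of the 8 squares.\<close>

lemma square_polarisation:
  fixes n ab ac ad bc bd cd :: real
  shows "64 * (ab * cd + ac * bd + ad * bc)
    = (n + 2 * ab + 2 * ac + 2 * ad + 2 * bc + 2 * bd + 2 * cd)\<^sup>2
    - (n + 2 * ab + 2 * ac - 2 * ad + 2 * bc - 2 * bd - 2 * cd)\<^sup>2
    - (n + 2 * ab - 2 * ac + 2 * ad - 2 * bc + 2 * bd - 2 * cd)\<^sup>2
    + (n + 2 * ab - 2 * ac - 2 * ad - 2 * bc - 2 * bd + 2 * cd)\<^sup>2
    - (n - 2 * ab + 2 * ac + 2 * ad - 2 * bc - 2 * bd + 2 * cd)\<^sup>2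
    + (n - 2 * ab + 2 * ac - 2 * ad - 2 * bc + 2 * bd - 2 * cd)\<^sup>2
    + (n - 2 * ab - 2 * ac + 2 * ad + 2 * bc - 2 * bd - 2 * cd)\<^sup>2
    - (n - 2 * ab - 2 * ac - 2 * ad + 2 * bc + 2 * bd + 2 * cd)\<^sup>2"
  by algebra

text \<open>Boundedness makes the class closed under products, so integrands of degree four need no
  separate treatment.\<close>

definition bounded_integrable :: "(real \<times> real \<Rightarrow> real) \<Rightarrow> bool" where
  "bounded_integrable f \<longleftrightarrow> integrable lborel f \<and> (\<exists>K. \<forall>q. \<bar>f q\<bar> \<le> K)"

lemma bounded_integrable_mult:
  assumes "bounded_integrable f" "bounded_integrable g"
  shows "bounded_integrable (\<lambda>q. f q * g q)"
proof -
  obtain K J where K: "\<And>q. \<bar>f q\<bar> \<le> K" and J: "\<And>q. \<bar>g q\<bar> \<le> J"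
    using assms by (auto simp: bounded_integrable_def)
  have "K \<ge> 0" using K[of undefined] by simp
  have "integrable lborel (\<lambda>q. f q * g q)"
  proof (rule Bochner_Integration.integrable_bound)
    show "integrable lborel (\<lambda>q. K * g q)" using assms by (auto simp: bounded_integrable_def)
    show "AE q in lborel. norm (f q * g q) \<le> norm (K * g q)"
      using K by (intro AE_I2) (auto simp: abs_mult intro!: mult_right_mono order_trans[OF K])
    show "(\<lambda>q. f q * g q) \<in> borel_measurable lborel"
      using assms unfolding bounded_integrable_def
      by (intro borel_measurable_times borel_measurable_integrable) auto
  qed
  moreover have "\<bar>f q * g q\<bar> \<le> K * J" for q
    using mult_mono[OF K J \<open>K \<ge> 0\<close>] by (simp add: abs_mult)
  ultimately show ?thesis by (auto simp: bounded_integrable_def)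
qed

lemma bounded_integrable_add:
  assumes "bounded_integrable f" "bounded_integrable g"
  shows "bounded_integrable (\<lambda>q. f q + g q)"
proof -
  obtain K J where "\<And>q. \<bar>f q\<bar> \<le> K" and "\<And>q. \<bar>g q\<bar> \<le> J"
    using assms by (auto simp: bounded_integrable_def)
  then have "\<bar>f q + g q\<bar> \<le> K + J" for q
    using abs_triangle_ineq[of "f q" "g q"] by (meson add_mono order_trans)
  then show ?thesis using assms by (auto simp: bounded_integrable_def)
qed

lemma bounded_integrable_scale:
  assumes "bounded_integrable f"
  shows "bounded_integrable (\<lambda>q. c * f q)"
proof -
  obtain K where "\<And>q. \<bar>f q\<bar> \<le> K"
    using assms by (auto simp: bounded_integrable_def)
  then have "\<bar>c * f q\<bar> \<le> \<bar>c\<bar> * K" for q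
    by (simp add: abs_mult mult_left_mono)
  then show ?thesis using assms by (auto simp: bounded_integrable_def)
qed

lemma bounded_integrable_sum:
  "(\<And>k. k \<in> K \<Longrightarrow> bounded_integrable (f k)) \<Longrightarrow> bounded_integrable (\<lambda>q. \<Sum>k\<in>K. f k q)"
  by (induction K rule: infinite_finite_induct)
    (auto intro: bounded_integrable_add simp: bounded_integrable_def[of "\<lambda>_. 0"])

lemma bounded_integrable_indicator: "B \<in> finite_borel \<Longrightarrow> bounded_integrable (indicator B)"
  by (auto simp: bounded_integrable_def finite_borel_def intro!: exI[of _ 1] integrable_real_indicator)

lemma bounded_integrable_power:
  assumes "bounded_integrable f"
  shows "bounded_integrable (\<lambda>q. f q ^ Suc n)"
  by (induction n) (use assms bounded_integrable_mult[OF assms] in auto)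

lemma bounded_integrableD: "bounded_integrable f \<Longrightarrow> integrable lborel f"
  by (simp add: bounded_integrable_def)

definition ip :: "(real \<times> real \<Rightarrow> real) \<Rightarrow> (real \<times> real \<Rightarrow> real) \<Rightarrow> real" where
  "ip f g = (\<integral>q. f q * g q \<partial>lborel)"

lemma ip_commute: "ip f g = ip g f"
  by (simp add: ip_def mult.commute)

lemma ip_add:
  assumes "bounded_integrable f" "bounded_integrable g" "bounded_integrable h"
  shows "ip (\<lambda>q. f q + g q) h = ip f h + ip g h"
  using bounded_integrable_mult[OF assms(1,3)] bounded_integrable_mult[OF assms(2,3)]
  by (simp add: ip_def distrib_right bounded_integrableD)

lemma ip_add_right:
  assumes "bounded_integrable f" "bounded_integrable g" "bounded_integrable h"
  shows "ip h (\<lambda>q. f q + g q) = ip h f + ip h g"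
  using ip_add[OF assms] by (simp add: ip_commute[of h])

lemma ip_scale: "ip (\<lambda>q. c * f q) h = c * ip f h"
  by (simp add: ip_def mult.assoc)

lemma ip_scale_right: "ip h (\<lambda>q. c * f q) = c * ip h f"
  using ip_scale[of c f h] by (simp add: ip_commute[of h])

lemma ip_nonneg: "0 \<le> ip f f"
  unfolding ip_def by (intro Bochner_Integration.integral_nonneg) simp

text \<open>The cell of the Venn diagram of \<open>S\<close> whose points lie in exactly the members
  of \<open>P\<close>. The cell of the empty pattern is the outside of all sets and can have
  infinite area.\<close>

definition atom :: "'b set set \<Rightarrow> 'b set set \<Rightarrow> 'b set" where
  "atom S P = {q. {B \<in> S. q \<in> B} = P}"

lemma atom_disjoint: "disjoint_family_on (atom S) I"
  by (auto simp: disjoint_family_on_def atom_def)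

lemma atom_Union:
  assumes "B \<in> S"
  shows "(\<Union>P\<in>{P \<in> Pow S. B \<in> P}. atom S P) = B"
proof
  show "(\<Union>P\<in>{P \<in> Pow S. B \<in> P}. atom S P) \<subseteq> B" unfolding atom_def by blast
  show "B \<subseteq> (\<Union>P\<in>{P \<in> Pow S. B \<in> P}. atom S P)"
  proof
    fix q assume "q \<in> B"
    then show "q \<in> (\<Union>P\<in>{P \<in> Pow S. B \<in> P}. atom S P)"
      using assms by (intro UN_I[of "{B \<in> S. q \<in> B}"]) (auto simp: atom_def)
  qed
qed

lemma atom_finite_borel:
  assumes "finite S" "S \<subseteq> finite_borel" "P \<in> Pow S" "P \<noteq> {}"
  shows "atom S P \<in> finite_borel"
proof -
  obtain B where B: "B \<in> P" using assms by auto
  have fin: "finite P" "finite (S - P)" using assms finite_subset by auto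
  have "atom S P = (\<Inter>B\<in>P. B) - (\<Union>B\<in>S - P. B)"
    using assms(3) by (auto simp: atom_def)
  also have "\<dots> \<in> sets borel"
    using fin assms by (intro sets.Diff sets.finite_INT sets.finite_UN) (auto simp: finite_borel_def)
  finally have s: "atom S P \<in> sets borel" .
  have "B \<in> finite_borel" using B assms by auto
  then have "B \<inter> atom S P \<in> sets borel" "emeasure lborel (B \<inter> atom S P) \<le> emeasure lborel B"
    using s by (auto simp: finite_borel_def intro!: emeasure_mono)
  moreover have "B \<inter> atom S P = atom S P" using B by (auto simp: atom_def)
  ultimately show ?thesis using \<open>B \<in> finite_borel\<close> by (auto simp: finite_borel_def)
qed

lemma disjoint_indicator_sum_mult:
  assumes "finite I" "disjoint_family_on C I"
  shows "(\<Sum>i\<in>I. d i * indicator (C i) q) * (\<Sum>i\<in>I. e i * indicator (C i) q)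
    = (\<Sum>i\<in>I. d i * e i * indicator (C i) q :: real)"
proof -
  have "(\<Sum>i\<in>I. d i * indicator (C i) q) * (\<Sum>i\<in>I. e i * indicator (C i) q)
      = (\<Sum>i\<in>I. \<Sum>j\<in>I. (d i * indicator (C i) q) * (e j * indicator (C j) q))"
    by (simp add: sum_product)
  also have "\<dots> = (\<Sum>i\<in>I. \<Sum>j\<in>I. if i = j then d i * e i * indicator (C i) q else 0)"
  proof (intro sum.cong refl)
    fix i j assume "i \<in> I" "j \<in> I"
    then show "(d i * indicator (C i) q) * (e j * indicator (C j) q)
        = (if i = j then d i * e i * indicator (C i) q else 0 :: real)"
      using assms(2) by (auto simp: disjoint_family_on_def indicator_def)
  qed
  also have "\<dots> = (\<Sum>i\<in>I. d i * e i * indicator (C i) q)"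
    using assms(1) by simp
  finally show ?thesis .
qed

section \<open>Integrals of simple functions against the centred basis\<close>

context levy_basis_moments
begin

lemma Z_empty: "AE \<omega> in M. Z {} \<omega> = 0"
  using Z_Un[of "{}" "{}"] by simp

lemma Z_Union:
  assumes "finite I" "disjoint_family_on C I" "\<And>i. i \<in> I \<Longrightarrow> C i \<in> finite_borel"
  shows "AE \<omega> in M. Z (\<Union>i\<in>I. C i) \<omega> = (\<Sum>i\<in>I. Z (C i) \<omega>)"
  using assms
proof (induction I rule: finite_induct)
  case empty
  then show ?case using Z_empty by simp
next
  case (insert i I)
  have "AE \<omega> in M. Z (\<Union>i\<in>I. C i) \<omega> = (\<Sum>i\<in>I. Z (C i) \<omega>)"
    using insert by (intro insert.IH) (auto simp: disjoint_family_on_def)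
  moreover have "AE \<omega> in M. Z (C i \<union> (\<Union>i\<in>I. C i)) \<omega> = Z (C i) \<omega> + Z (\<Union>i\<in>I. C i) \<omega>"
  proof (rule Z_Un)
    show "(\<Union>i\<in>I. C i) \<in> finite_borel" using insert by (intro finite_borel_Union) auto
    show "C i \<inter> (\<Union>i\<in>I. C i) = {}"
      using insert by (auto simp: disjoint_family_on_def)
  qed (use insert in auto)
  ultimately show ?case using insert.hyps by (auto elim!: eventually_elim2)
qed

text \<open>\<open>X\<close> is a version of the integral of the simple function \<open>f\<close>
  against the basis. A relation rather than an operator, because \<open>f\<close> has many
  representations and the integral is fixed only almost surely; \<open>lin_AE_eq\<close> gives
  uniqueness.\<close>

definition lin :: "(real \<times> real \<Rightarrow> real) \<Rightarrow> ('a \<Rightarrow> real) \<Rightarrow> bool" where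
  "lin f X \<longleftrightarrow> random_variable borel X \<and>
     (\<exists>S c. finite S \<and> S \<subseteq> finite_borel \<and> f = (\<lambda>q. \<Sum>B\<in>S. c B * indicator B q) \<and>
        (AE \<omega> in M. X \<omega> = (\<Sum>B\<in>S. c B * Z B \<omega>)))"

lemma lin_measurable: "lin f X \<Longrightarrow> random_variable borel X"
  by (simp add: lin_def)

text \<open>Padding with zero coefficients: a representation survives on every larger finite family,
  so that several functionals can share one family.\<close>

lemma lin_extend:
  assumes "lin f X"
  shows "\<exists>S. finite S \<and> S \<subseteq> finite_borel \<and>
    (\<forall>T. finite T \<longrightarrow> S \<subseteq> T \<longrightarrow> (\<exists>c. f = (\<lambda>q. \<Sum>B\<in>T. c B * indicator B q) \<and>
        (AE \<omega> in M. X \<omega> = (\<Sum>B\<in>T. c B * Z B \<omega>))))"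
proof -
  obtain S c where S: "finite S" "S \<subseteq> finite_borel" "f = (\<lambda>q. \<Sum>B\<in>S. c B * indicator B q)"
     "AE \<omega> in M. X \<omega> = (\<Sum>B\<in>S. c B * Z B \<omega>)"
    using assms unfolding lin_def by (elim exE conjE)
  have "\<exists>c. f = (\<lambda>q. \<Sum>B\<in>T. c B * indicator B q) \<and> (AE \<omega> in M. X \<omega> = (\<Sum>B\<in>T. c B * Z B \<omega>))"
    if T: "finite T" "S \<subseteq> T" for T
  proof -
    define e where "e B = (if B \<in> S then c B else 0)" for B
    have "(\<Sum>B\<in>T. e B * u B) = (\<Sum>B\<in>S. c B * u B)" for u :: "(real \<times> real) set \<Rightarrow> real"
    proof -
      have "(\<Sum>B\<in>S. c B * u B) = (\<Sum>B\<in>S. e B * u B)" by (intro sum.cong) (auto simp: e_def)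
      also have "\<dots> = (\<Sum>B\<in>T. e B * u B)"
        using T by (intro sum.mono_neutral_left) (auto simp: e_def)
      finally show ?thesis ..
    qed
    then show ?thesis using S by (intro exI[of _ e]) simp
  qed
  with S(1,2) show ?thesis by (intro exI[of _ S]) simp
qed

lemma lin_add:
  assumes "lin f X" "lin g Y"
  shows "lin (\<lambda>q. f q + g q) (\<lambda>\<omega>. X \<omega> + Y \<omega>)"
proof -
  obtain S where S: "finite S" "S \<subseteq> finite_borel"
    "\<forall>T. finite T \<longrightarrow> S \<subseteq> T \<longrightarrow> (\<exists>c. f = (\<lambda>q. \<Sum>B\<in>T. c B * indicator B q) \<and>
        (AE \<omega> in M. X \<omega> = (\<Sum>B\<in>T. c B * Z B \<omega>)))"
    using lin_extend[OF assms(1)] by (elim exE conjE)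
  obtain S' where S': "finite S'" "S' \<subseteq> finite_borel"
    "\<forall>T. finite T \<longrightarrow> S' \<subseteq> T \<longrightarrow> (\<exists>c. g = (\<lambda>q. \<Sum>B\<in>T. c B * indicator B q) \<and>
        (AE \<omega> in M. Y \<omega> = (\<Sum>B\<in>T. c B * Z B \<omega>)))"
    using lin_extend[OF assms(2)] by (elim exE conjE)
  let ?T = "S \<union> S'"
  obtain c where c: "f = (\<lambda>q. \<Sum>B\<in>?T. c B * indicator B q)" "AE \<omega> in M. X \<omega> = (\<Sum>B\<in>?T. c B * Z B \<omega>)"
    using S(3)[rule_format, of ?T] S(1) S'(1) by auto
  obtain d where d: "g = (\<lambda>q. \<Sum>B\<in>?T. d B * indicator B q)" "AE \<omega> in M. Y \<omega> = (\<Sum>B\<in>?T. d B * Z B \<omega>)"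
    using S'(3)[rule_format, of ?T] S(1) S'(1) by auto
  have e: "(\<Sum>B\<in>?T. c B * u B) + (\<Sum>B\<in>?T. d B * u B) = (\<Sum>B\<in>?T. (c B + d B) * u B)"
    for u :: "(real \<times> real) set \<Rightarrow> real"
    by (simp add: distrib_right sum.distrib)
  have "AE \<omega> in M. X \<omega> + Y \<omega> = (\<Sum>B\<in>?T. (c B + d B) * Z B \<omega>)"
    using c(2) d(2) by eventually_elim (simp add: e)
  moreover have "(\<lambda>q. f q + g q) = (\<lambda>q. \<Sum>B\<in>?T. (c B + d B) * indicator B q)"
    unfolding c(1) d(1) e ..
  moreover have "(\<lambda>\<omega>. X \<omega> + Y \<omega>) \<in> borel_measurable M"
    using assms by (intro borel_measurable_add) (auto simp: lin_def)
  moreover have "finite ?T" "?T \<subseteq> finite_borel" using S(1,2) S'(1,2) by auto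
  ultimately show ?thesis
    unfolding lin_def by (intro conjI exI[of _ ?T] exI[of _ "\<lambda>B. c B + d B"])
qed

lemma lin_scale:
  assumes "lin f X"
  shows "lin (\<lambda>q. s * f q) (\<lambda>\<omega>. s * X \<omega>)"
proof -
  obtain S c where S: "finite S" "S \<subseteq> finite_borel" "f = (\<lambda>q. \<Sum>B\<in>S. c B * indicator B q)"
     "AE \<omega> in M. X \<omega> = (\<Sum>B\<in>S. c B * Z B \<omega>)"
    using assms unfolding lin_def by (elim exE conjE)
  have "AE \<omega> in M. s * X \<omega> = (\<Sum>B\<in>S. (s * c B) * Z B \<omega>)"
    using S(4) by eventually_elim (simp only: sum_distrib_left mult.assoc)
  moreover have "(\<lambda>q. s * f q) = (\<lambda>q. \<Sum>B\<in>S. (s * c B) * indicator B q)"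
    unfolding S(3) by (simp only: sum_distrib_left mult.assoc)
  moreover have "(\<lambda>\<omega>. s * X \<omega>) \<in> borel_measurable M"
    using lin_measurable[OF assms] by simp
  ultimately show ?thesis
    unfolding lin_def using S(1,2) by (intro conjI exI[of _ S] exI[of _ "\<lambda>B. s * c B"])
qed

lemma lin_diff: "lin f X \<Longrightarrow> lin g Y \<Longrightarrow> lin (\<lambda>q. f q - g q) (\<lambda>\<omega>. X \<omega> - Y \<omega>)"
  using lin_add[OF _ lin_scale[of g Y "-1"]] by simp

lemma lin_indicator:
  assumes "B \<in> finite_borel"
  shows "lin (indicator B) (Z B)"
  unfolding lin_def
  by (intro conjI exI[of _ "{B}"] exI[of _ "\<lambda>_. 1"]) (use assms Z_measurable in auto)

lemma lin_bounded_integrable: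
  assumes "lin f X"
  shows "bounded_integrable f"
  using assms unfolding lin_def
  by (auto intro!: bounded_integrable_sum bounded_integrable_scale bounded_integrable_indicator)

text \<open>Passing to the cells of the Venn diagram of all the sets involved expresses finitely
  many functionals through the same independent variables.\<close>

lemma lin_common_atoms:
  assumes "finite K" "\<And>k. k \<in> K \<Longrightarrow> lin (f k) (X k)"
  obtains I :: "(real \<times> real) set set set" and C d where "finite I" "disjoint_family_on C I"
    "\<And>i. i \<in> I \<Longrightarrow> C i \<in> finite_borel"
    "\<And>k. k \<in> K \<Longrightarrow> f k = (\<lambda>q. \<Sum>i\<in>I. d k i * indicator (C i) q)"
    "\<And>k. k \<in> K \<Longrightarrow> AE \<omega> in M. X k \<omega> = (\<Sum>i\<in>I. d k i * Z (C i) \<omega>)"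
proof -
  have "\<forall>k\<in>K. \<exists>S. finite S \<and> S \<subseteq> finite_borel \<and> (\<forall>T. finite T \<longrightarrow> S \<subseteq> T \<longrightarrow>
      (\<exists>c. f k = (\<lambda>q. \<Sum>B\<in>T. c B * indicator B q) \<and> (AE \<omega> in M. X k \<omega> = (\<Sum>B\<in>T. c B * Z B \<omega>))))"
    using lin_extend[OF assms(2)] by simp
  from bchoice[OF this] obtain S where
    S0: "\<forall>k\<in>K. finite (S k) \<and> S k \<subseteq> finite_borel \<and> (\<forall>T. finite T \<longrightarrow> S k \<subseteq> T \<longrightarrow>
      (\<exists>c. f k = (\<lambda>q. \<Sum>B\<in>T. c B * indicator B q) \<and> (AE \<omega> in M. X k \<omega> = (\<Sum>B\<in>T. c B * Z B \<omega>))))" ..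
  have S: "finite (S k)" "S k \<subseteq> finite_borel" if "k \<in> K" for k
    using S0 that by auto
  define T where "T = (\<Union>k\<in>K. S k)"
  have T: "finite T" "T \<subseteq> finite_borel" using S assms(1) by (auto simp: T_def)
  have "\<forall>k\<in>K. \<exists>c. f k = (\<lambda>q. \<Sum>B\<in>T. c B * indicator B q) \<and> (AE \<omega> in M. X k \<omega> = (\<Sum>B\<in>T. c B * Z B \<omega>))"
  proof
    fix k assume k: "k \<in> K"
    then have "S k \<subseteq> T" by (auto simp: T_def)
    with S0 k T(1) show "\<exists>c. f k = (\<lambda>q. \<Sum>B\<in>T. c B * indicator B q) \<and> (AE \<omega> in M. X k \<omega> = (\<Sum>B\<in>T. c B * Z B \<omega>))"
      by blast
  qed
  from bchoice[OF this] obtain c where c0: "\<forall>k\<in>K. f k = (\<lambda>q. \<Sum>B\<in>T. c k B * indicator B q) \<and>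
     (AE \<omega> in M. X k \<omega> = (\<Sum>B\<in>T. c k B * Z B \<omega>))" ..
  have c: "f k = (\<lambda>q. \<Sum>B\<in>T. c k B * indicator B q)" "AE \<omega> in M. X k \<omega> = (\<Sum>B\<in>T. c k B * Z B \<omega>)"
    if "k \<in> K" for k
    using c0[rule_format, OF that] by auto
  \<comment> \<open>The empty pattern is excluded: its cell need not have finite area, and no set of
    the family contains it.\<close>
  define I where "I = Pow T - {{}}"
  have I: "finite I" using T by (simp add: I_def)
  have fb: "atom T P \<in> finite_borel" if "P \<in> I" for P
    using atom_finite_borel[OF T] that by (auto simp: I_def)
  have IB: "{P \<in> Pow T. B \<in> P} = {P \<in> I. B \<in> P}" for B by (auto simp: I_def)
  have BU: "(\<Union>P\<in>{P \<in> I. B \<in> P}. atom T P) = B" if "B \<in> T" for B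
    using atom_Union[OF that] unfolding IB .
  \<comment> \<open>The coefficient of a cell is the sum of the coefficients of the sets that
    contain it.\<close>
  have swap: "(\<Sum>B\<in>T. e B * (\<Sum>P\<in>{P \<in> I. B \<in> P}. u P)) = (\<Sum>P\<in>I. (\<Sum>B\<in>P. e B) * u P)"
    for e :: "(real \<times> real) set \<Rightarrow> real" and u
  proof -
    have "(\<Sum>B\<in>T. e B * (\<Sum>P\<in>{P \<in> I. B \<in> P}. u P)) = (\<Sum>B\<in>T. \<Sum>P\<in>{P \<in> I. B \<in> P}. e B * u P)"
      by (simp add: sum_distrib_left)
    also have "\<dots> = (\<Sum>P\<in>I. \<Sum>B\<in>{B \<in> T. B \<in> P}. e B * u P)"
      using T I by (intro sum.swap_restrict) auto
    also have "\<dots> = (\<Sum>P\<in>I. (\<Sum>B\<in>P. e B) * u P)"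
    proof (rule sum.cong[OF refl])
      fix P assume "P \<in> I"
      then have "{B \<in> T. B \<in> P} = P" by (auto simp: I_def)
      then show "(\<Sum>B\<in>{B \<in> T. B \<in> P}. e B * u P) = (\<Sum>B\<in>P. e B) * u P"
        by (simp add: sum_distrib_right)
    qed
    finally show ?thesis .
  qed
  show thesis
  proof (rule that[OF I atom_disjoint fb])
    fix k assume k: "k \<in> K"
    have ind: "indicator B q = (\<Sum>P\<in>{P \<in> I. B \<in> P}. indicator (atom T P) q :: real)" if "B \<in> T" for B q
    proof -
      have "indicator (\<Union>P\<in>{P \<in> I. B \<in> P}. atom T P) q = (\<Sum>P\<in>{P \<in> I. B \<in> P}. indicator (atom T P) q :: real)"
        using I atom_disjoint[of T] by (intro indicator_UN_disjoint) auto
      then show ?thesis using BU[OF that] by simp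
    qed
    have "f k = (\<lambda>q. \<Sum>B\<in>T. c k B * (\<Sum>P\<in>{P \<in> I. B \<in> P}. indicator (atom T P) q))"
      unfolding c(1)[OF k] using ind by (auto intro!: sum.cong)
    then show "f k = (\<lambda>q. \<Sum>P\<in>I. (\<Sum>B\<in>P. c k B) * indicator (atom T P) q)"
      unfolding swap .
    have "AE \<omega> in M. \<forall>B\<in>T. Z B \<omega> = (\<Sum>P\<in>{P \<in> I. B \<in> P}. Z (atom T P) \<omega>)"
    proof (rule AE_finite_allI[OF T(1)])
      fix B assume "B \<in> T"
      have "AE \<omega> in M. Z (\<Union>P\<in>{P \<in> I. B \<in> P}. atom T P) \<omega> = (\<Sum>P\<in>{P \<in> I. B \<in> P}. Z (atom T P) \<omega>)"
        using I fb atom_disjoint[of T] by (intro Z_Union) auto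
      then show "AE \<omega> in M. Z B \<omega> = (\<Sum>P\<in>{P \<in> I. B \<in> P}. Z (atom T P) \<omega>)"
        using BU[OF \<open>B \<in> T\<close>] by simp
    qed
    with c(2)[OF k] show "AE \<omega> in M. X k \<omega> = (\<Sum>P\<in>I. (\<Sum>B\<in>P. c k B) * Z (atom T P) \<omega>)"
    proof eventually_elim
      case (elim \<omega>)
      then have "X k \<omega> = (\<Sum>B\<in>T. c k B * (\<Sum>P\<in>{P \<in> I. B \<in> P}. Z (atom T P) \<omega>))"
        by (auto intro!: sum.cong)
      then show ?case unfolding swap .
    qed
  qed
qed

lemma Z_scaled_indep_vars:
  assumes "finite I" "disjoint_family_on C I" "\<And>i. i \<in> I \<Longrightarrow> C i \<in> finite_borel"
  shows "indep_vars (\<lambda>_. borel) (\<lambda>i \<omega>. d i * Z (C i) \<omega>) I"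
  using indep_vars_compose2[OF Z_indep_vars[OF assms], where Y = "\<lambda>i x. d i * x"] by simp

lemma Z_sum_moments:
  assumes "finite I" "disjoint_family_on C I" "\<And>i. i \<in> I \<Longrightarrow> C i \<in> finite_borel"
  shows "expectation (\<lambda>\<omega>. (\<Sum>i\<in>I. d i * Z (C i) \<omega>)\<^sup>2) = (\<Sum>i\<in>I. (d i)\<^sup>2 * measure lborel (C i)) \<and>
    expectation (\<lambda>\<omega>. (\<Sum>i\<in>I. d i * Z (C i) \<omega>) ^ 4)
      = 3 * (\<Sum>i\<in>I. (d i)\<^sup>2 * measure lborel (C i))\<^sup>2 + excess * (\<Sum>i\<in>I. d i ^ 4 * measure lborel (C i))"
  using assms
proof (induction I rule: finite_induct)
  case (insert i I)
  let ?X = "\<lambda>\<omega>. d i * Z (C i) \<omega>" and ?Y = "\<lambda>\<omega>. \<Sum>i\<in>I. d i * Z (C i) \<omega>"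
  have IH: "expectation (\<lambda>\<omega>. (?Y \<omega>)\<^sup>2) = (\<Sum>i\<in>I. (d i)\<^sup>2 * measure lborel (C i))"
    "expectation (\<lambda>\<omega>. ?Y \<omega> ^ 4)
      = 3 * (\<Sum>i\<in>I. (d i)\<^sup>2 * measure lborel (C i))\<^sup>2 + excess * (\<Sum>i\<in>I. d i ^ 4 * measure lborel (C i))"
    using insert by (auto simp: disjoint_family_on_def)
  have Ci: "C i \<in> finite_borel" using insert by auto
  have ind: "indep_var borel ?X borel ?Y"
    by (rule indep_vars_sum[where X = "\<lambda>i \<omega>. d i * Z (C i) \<omega>"])
      (use insert in \<open>auto intro!: Z_scaled_indep_vars\<close>)
  have fX: "fourth_moment ?X" and fY: "fourth_moment ?Y"
    using insert by (auto intro!: fourth_moment_sum fourth_moment_cmult Z_fourth_moment)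
  have eX: "expectation ?X = 0" using Ci by (simp add: Z_expectation)
  have eY: "expectation ?Y = 0"
    using insert by (subst Bochner_Integration.integral_sum)
      (auto simp: Z_expectation intro!: fourth_moment_integrable fourth_moment_cmult Z_fourth_moment)
  note m = indep_sum_moments[OF ind fX eX fY eY]
  have X: "expectation (\<lambda>\<omega>. (?X \<omega>)\<^sup>2) = (d i)\<^sup>2 * measure lborel (C i)"
    "expectation (\<lambda>\<omega>. ?X \<omega> ^ 4) = d i ^ 4 * (3 * (measure lborel (C i))\<^sup>2 + excess * measure lborel (C i))"
    using Ci by (simp_all add: power_mult_distrib Z_second_moment Z_fourth_moment_eq)
  show ?case
    using m insert.hyps unfolding X IH
    by (simp add: power_mult_distrib power2_sum algebra_simps flip: power_mult)
qed (simp add: prob_space)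

lemma lin_moments:
  assumes "lin f X"
  shows "fourth_moment X" "expectation X = 0" "expectation (\<lambda>\<omega>. (X \<omega>)\<^sup>2) = ip f f"
    "expectation (\<lambda>\<omega>. X \<omega> ^ 4) = 3 * (ip f f)\<^sup>2 + excess * (\<integral>q. f q ^ 4 \<partial>lborel)"
proof -
  obtain I :: "(real \<times> real) set set set" and C e where I: "finite I" "disjoint_family_on C I"
    "\<And>i. i \<in> I \<Longrightarrow> C i \<in> finite_borel"
    and fe: "\<And>k. k \<in> {()} \<Longrightarrow> f = (\<lambda>q. \<Sum>i\<in>I. e k i * indicator (C i) q)"
    and Xe: "\<And>k. k \<in> {()} \<Longrightarrow> AE \<omega> in M. X \<omega> = (\<Sum>i\<in>I. e k i * Z (C i) \<omega>)"
    by (rule lin_common_atoms[of "{()}" "\<lambda>_. f" "\<lambda>_. X"]) (use assms in auto)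
  define d where "d = e ()"
  have f: "f = (\<lambda>q. \<Sum>i\<in>I. d i * indicator (C i) q)"
    and X: "AE \<omega> in M. X \<omega> = (\<Sum>i\<in>I. d i * Z (C i) \<omega>)"
    using fe[of "()"] Xe[of "()"] by (simp_all add: d_def)
  let ?Y = "\<lambda>\<omega>. \<Sum>i\<in>I. d i * Z (C i) \<omega>"
  have fY: "fourth_moment ?Y"
    using I by (auto intro!: fourth_moment_sum fourth_moment_cmult Z_fourth_moment)
  note rX = lin_measurable[OF assms] and rY = fourth_moment_measurable[OF fY]
  have e: "expectation (\<lambda>\<omega>. X \<omega> ^ k) = expectation (\<lambda>\<omega>. ?Y \<omega> ^ k)" for k
    using X rX rY by (intro integral_cong_AE) auto
  have Y4: "integrable M (\<lambda>\<omega>. ?Y \<omega> ^ 4)" using fY by (simp only: fourth_moment_def)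
  have "integrable M (\<lambda>\<omega>. X \<omega> ^ 4)"
  proof (rule Bochner_Integration.integrable_cong_AE_imp[OF Y4])
    show "AE \<omega> in M. ?Y \<omega> ^ 4 = X \<omega> ^ 4" using X by eventually_elim simp
  qed (use rX in simp)
  with rX show "fourth_moment X" by (simp add: fourth_moment_def)
  have "expectation ?Y = 0"
    using I by (subst Bochner_Integration.integral_sum)
      (auto simp: Z_expectation intro!: fourth_moment_integrable fourth_moment_cmult Z_fourth_moment)
  then show "expectation X = 0" using e[of 1] by simp
  have int: "(\<integral>q. (\<Sum>i\<in>I. w i * indicator (C i) q) \<partial>lborel) = (\<Sum>i\<in>I. w i * measure lborel (C i))" for w
    using I by (subst Bochner_Integration.integral_sum)
      (auto simp: finite_borel_def intro!: integrable_mult_right integrable_real_indicator)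
  have f2: "f q * f q = (\<Sum>i\<in>I. (d i)\<^sup>2 * indicator (C i) q)" for q
    unfolding f using disjoint_indicator_sum_mult[OF I(1,2), of d q d] by (simp add: power2_eq_square)
  have f4: "f q ^ 4 = (\<Sum>i\<in>I. d i ^ 4 * indicator (C i) q)" for q
  proof -
    have "f q ^ 4 = (f q * f q) * (f q * f q)" by (simp add: power4_eq_xxxx)
    also have "\<dots> = (\<Sum>i\<in>I. (d i)\<^sup>2 * (d i)\<^sup>2 * indicator (C i) q)"
      unfolding f2 using disjoint_indicator_sum_mult[OF I(1,2), of "\<lambda>i. (d i)\<^sup>2" q "\<lambda>i. (d i)\<^sup>2"] by simp
    finally show ?thesis by (simp flip: power_add)
  qed
  have ip: "ip f f = (\<Sum>i\<in>I. (d i)\<^sup>2 * measure lborel (C i))"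
    unfolding ip_def f2 int ..
  show "expectation (\<lambda>\<omega>. (X \<omega>)\<^sup>2) = ip f f"
    unfolding e ip using Z_sum_moments[OF I, where d = d] by simp
  show "expectation (\<lambda>\<omega>. X \<omega> ^ 4) = 3 * (ip f f)\<^sup>2 + excess * (\<integral>q. f q ^ 4 \<partial>lborel)"
    unfolding e ip f4 int using Z_sum_moments[OF I, where d = d] by simp
qed

lemma lin_covariance:
  assumes "lin f X" "lin g Y"
  shows "expectation (\<lambda>\<omega>. X \<omega> * Y \<omega>) = ip f g"
proof -
  note fX = lin_moments(1)[OF assms(1)] and fY = lin_moments(1)[OF assms(2)]
  note bf = lin_bounded_integrable[OF assms(1)] and bg = lin_bounded_integrable[OF assms(2)]
  have "expectation (\<lambda>\<omega>. (X \<omega> + Y \<omega>)\<^sup>2)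
      = expectation (\<lambda>\<omega>. (X \<omega>)\<^sup>2 + (Y \<omega>)\<^sup>2 + 2 * (X \<omega> * Y \<omega>))"
    by (simp add: power2_sum mult.assoc)
  also have "\<dots> = ip f f + ip g g + 2 * expectation (\<lambda>\<omega>. X \<omega> * Y \<omega>)"
    using fourth_moment_power[OF fX, of 2] fourth_moment_power[OF fY, of 2] fourth_moment_mult2[OF fX fY]
    by (simp add: lin_moments(3)[OF assms(1)] lin_moments(3)[OF assms(2)])
  finally have "ip (\<lambda>q. f q + g q) (\<lambda>q. f q + g q) = ip f f + ip g g + 2 * expectation (\<lambda>\<omega>. X \<omega> * Y \<omega>)"
    using lin_moments(3)[OF lin_add[OF assms]] by simp
  moreover have "ip (\<lambda>q. f q + g q) (\<lambda>q. f q + g q) = ip f f + ip g g + 2 * ip f g"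
    using bf bg bounded_integrable_add[OF bf bg]
    by (simp add: ip_add ip_add_right ip_commute[of g f])
  ultimately show ?thesis by simp
qed

text \<open>The difference has integrand 0 and hence second moment 0. Identities between functionals
  thus reduce to pointwise identities between indicator sums.\<close>

lemma lin_AE_eq:
  assumes "lin f X" "lin f Y"
  shows "AE \<omega> in M. X \<omega> = Y \<omega>"
proof -
  have l: "lin (\<lambda>q. f q - f q) (\<lambda>\<omega>. X \<omega> - Y \<omega>)" using lin_diff[OF assms] .
  have "expectation (\<lambda>\<omega>. (X \<omega> - Y \<omega>)\<^sup>2) = 0"
    using lin_moments(3)[OF l] by (simp add: ip_def)
  then have "AE \<omega> in M. (X \<omega> - Y \<omega>)\<^sup>2 = 0"
    using fourth_moment_power[OF lin_moments(1)[OF l], of 2]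
    by (subst (asm) integral_nonneg_eq_0_iff_AE) auto
  then show ?thesis by eventually_elim simp
qed

lemma lin_fourth_product:
  assumes "lin f1 A" "lin f2 B" "lin f3 C" "lin f4 D"
  shows "expectation (\<lambda>\<omega>. A \<omega> * B \<omega> * C \<omega> * D \<omega>)
    = ip f1 f2 * ip f3 f4 + ip f1 f3 * ip f2 f4 + ip f1 f4 * ip f2 f3 + excess * (\<integral>q. f1 q * f2 q * f3 q * f4 q \<partial>lborel)"
proof -
  note l = assms
  define F where "F s t u = expectation (\<lambda>\<omega>. (A \<omega> + s * B \<omega> + t * C \<omega> + u * D \<omega>) ^ 4)" for s t u
  define G where "G s t u = (\<integral>q. (f1 q + s * f2 q + t * f3 q + u * f4 q) ^ 4 \<partial>lborel)" for s t u
  define Q where "Q s t u = ip f1 f1 + s\<^sup>2 * ip f2 f2 + t\<^sup>2 * ip f3 f3 + u\<^sup>2 * ip f4 f4 + 2 * s * ip f1 f2 + 2 * t * ip f1 f3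
      + 2 * u * ip f1 f4 + 2 * s * t * ip f2 f3 + 2 * s * u * ip f2 f4 + 2 * t * u * ip f3 f4" for s t u
  have L: "lin (\<lambda>q. f1 q + s * f2 q + t * f3 q + u * f4 q) (\<lambda>\<omega>. A \<omega> + s * B \<omega> + t * C \<omega> + u * D \<omega>)" for s t u
    by (intro lin_add lin_scale l)
  note bi = l[THEN lin_bounded_integrable]
  have FQ: "F s t u = 3 * (Q s t u)\<^sup>2 + excess * G s t u" for s t u
  proof -
    let ?h = "\<lambda>q. f1 q + s * f2 q + t * f3 q + u * f4 q"
    have "ip ?h ?h = Q s t u"
      unfolding Q_def
      by (simp add: ip_add ip_add_right ip_scale ip_scale_right bi bounded_integrable_add bounded_integrable_scale
          ip_commute[of f2 f1] ip_commute[of f3 f1] ip_commute[of f4 f1] ip_commute[of f3 f2]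
          ip_commute[of f4 f2] ip_commute[of f4 f3]) (simp add: power2_eq_square algebra_simps)
    then show ?thesis
      using lin_moments(4)[OF L[of s t u]] by (simp add: F_def G_def)
  qed
  have i4: "integrable M (\<lambda>\<omega>. (A \<omega> + s * B \<omega> + t * C \<omega> + u * D \<omega>) ^ 4)" for s t u
    using lin_moments(1)[OF L[of s t u]] by (simp add: fourth_moment_def)
  have g4: "integrable lborel (\<lambda>q. (f1 q + s * f2 q + t * f3 q + u * f4 q) ^ 4)" for s t u
    using bounded_integrableD[OF bounded_integrable_power[OF lin_bounded_integrable[OF L[of s t u]], of 3]]
    by (simp add: numeral_eq_Suc)
  have pol: "192 * (w * x * y * z) = (w + 1 * x + 1 * y + 1 * z) ^ 4 - (w + 1 * x + 1 * y + (-1) * z) ^ 4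
      - (w + 1 * x + (-1) * y + 1 * z) ^ 4 + (w + 1 * x + (-1) * y + (-1) * z) ^ 4
      - (w + (-1) * x + 1 * y + 1 * z) ^ 4 + (w + (-1) * x + 1 * y + (-1) * z) ^ 4
      + (w + (-1) * x + (-1) * y + 1 * z) ^ 4 - (w + (-1) * x + (-1) * y + (-1) * z) ^ 4" for w x y z :: real
    using fourth_polarisation[of w x y z] by simp
  have "192 * expectation (\<lambda>\<omega>. A \<omega> * B \<omega> * C \<omega> * D \<omega>) = expectation (\<lambda>\<omega>. 192 * (A \<omega> * B \<omega> * C \<omega> * D \<omega>))"
    by simp
  also have "\<dots> = F 1 1 1 - F 1 1 (-1) - F 1 (-1) 1 + F 1 (-1) (-1) - F (-1) 1 1 + F (-1) 1 (-1)
      + F (-1) (-1) 1 - F (-1) (-1) (-1)"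
    unfolding pol F_def by (simp only: Bochner_Integration.integral_add Bochner_Integration.integral_diff
        Bochner_Integration.integrable_add Bochner_Integration.integrable_diff i4)
  finally have EF: "192 * expectation (\<lambda>\<omega>. A \<omega> * B \<omega> * C \<omega> * D \<omega>)
    = F 1 1 1 - F 1 1 (-1) - F 1 (-1) 1 + F 1 (-1) (-1) - F (-1) 1 1 + F (-1) 1 (-1)
      + F (-1) (-1) 1 - F (-1) (-1) (-1)" .
  have "192 * (\<integral>q. f1 q * f2 q * f3 q * f4 q \<partial>lborel) = (\<integral>q. 192 * (f1 q * f2 q * f3 q * f4 q) \<partial>lborel)"
    by simp
  also have "\<dots> = G 1 1 1 - G 1 1 (-1) - G 1 (-1) 1 + G 1 (-1) (-1) - G (-1) 1 1 + G (-1) 1 (-1)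
      + G (-1) (-1) 1 - G (-1) (-1) (-1)"
    unfolding pol G_def by (simp only: Bochner_Integration.integral_add Bochner_Integration.integral_diff
        Bochner_Integration.integrable_add Bochner_Integration.integrable_diff g4)
  finally have GG: "192 * (\<integral>q. f1 q * f2 q * f3 q * f4 q \<partial>lborel)
    = G 1 1 1 - G 1 1 (-1) - G 1 (-1) 1 + G 1 (-1) (-1) - G (-1) 1 1 + G (-1) 1 (-1)
      + G (-1) (-1) 1 - G (-1) (-1) (-1)" .
  have QQ: "64 * (ip f1 f2 * ip f3 f4 + ip f1 f3 * ip f2 f4 + ip f1 f4 * ip f2 f3)
    = (Q 1 1 1)\<^sup>2 - (Q 1 1 (-1))\<^sup>2 - (Q 1 (-1) 1)\<^sup>2 + (Q 1 (-1) (-1))\<^sup>2 - (Q (-1) 1 1)\<^sup>2 + (Q (-1) 1 (-1))\<^sup>2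
      + (Q (-1) (-1) 1)\<^sup>2 - (Q (-1) (-1) (-1))\<^sup>2"
    unfolding square_polarisation[where n = "ip f1 f1 + ip f2 f2 + ip f3 f3 + ip f4 f4"] by (simp add: Q_def)
  have "192 * expectation (\<lambda>\<omega>. A \<omega> * B \<omega> * C \<omega> * D \<omega>)
      = 3 * (64 * (ip f1 f2 * ip f3 f4 + ip f1 f3 * ip f2 f4 + ip f1 f4 * ip f2 f3))
        + excess * (192 * (\<integral>q. f1 q * f2 q * f3 q * f4 q \<partial>lborel))"
    unfolding EF FQ QQ GG by (simp add: algebra_simps)
  then show ?thesis by simp
qed

text \<open>The common source of the L2 bounds for quadratic forms in the increments. The Gaussian
  part is a double sum of covariances; the cumulant part collapses to the integral of one squared
  function, which can be evaluated point by point in the plane.\<close>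

lemma quadratic_variance:
  fixes s :: "'k \<Rightarrow> real"
  assumes K: "finite K" and f: "\<And>k. k \<in> K \<Longrightarrow> lin (f k) (A k)" and g: "\<And>k. k \<in> K \<Longrightarrow> lin (g k) (B k)"
  defines "V \<equiv> \<lambda>\<omega>. \<Sum>k\<in>K. s k * (A k \<omega> * B k \<omega> - ip (f k) (g k))"
  shows "integrable M (\<lambda>\<omega>. (V \<omega>)\<^sup>2)"
    and "expectation (\<lambda>\<omega>. (V \<omega>)\<^sup>2)
      = (\<Sum>k\<in>K. \<Sum>l\<in>K. s k * s l * (ip (f k) (f l) * ip (g k) (g l) + ip (f k) (g l) * ip (g k) (f l)))
        + excess * (\<integral>q. (\<Sum>k\<in>K. s k * (f k q * g k q))\<^sup>2 \<partial>lborel)"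
proof -
  let ?t = "\<lambda>k l \<omega>. s k * s l * (A k \<omega> * B k \<omega> * A l \<omega> * B l \<omega> - ip (f l) (g l) * (A k \<omega> * B k \<omega>)
      - ip (f k) (g k) * (A l \<omega> * B l \<omega>) + ip (f k) (g k) * ip (f l) (g l))"
  have V2: "(V \<omega>)\<^sup>2 = (\<Sum>k\<in>K. \<Sum>l\<in>K. ?t k l \<omega>)" for \<omega>
    unfolding V_def power2_eq_square sum_product
    by (intro sum.cong refl) (simp add: algebra_simps)
  note fA = lin_moments(1)[OF f] and fB = lin_moments(1)[OF g]
  have i: "integrable M (?t k l)" if "k \<in> K" "l \<in> K" for k l
    using that by (intro integrable_mult_right Bochner_Integration.integrable_add
        Bochner_Integration.integrable_diff fourth_moment_mult4 fourth_moment_mult2[OF fA fB] fA fB) auto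
  show "integrable M (\<lambda>\<omega>. (V \<omega>)\<^sup>2)"
    unfolding V2 by (intro Bochner_Integration.integrable_sum i)
  have e: "expectation (?t k l) = s k * s l * (ip (f k) (f l) * ip (g k) (g l) + ip (f k) (g l) * ip (g k) (f l))
      + excess * (\<integral>q. (s k * (f k q * g k q)) * (s l * (f l q * g l q)) \<partial>lborel)" if k: "k \<in> K" "l \<in> K" for k l
  proof -
    note m4 = fourth_moment_mult4[OF fA[OF k(1)] fB[OF k(1)] fA[OF k(2)] fB[OF k(2)]]
      and m2 = fourth_moment_mult2[OF fA[OF k(1)] fB[OF k(1)]] fourth_moment_mult2[OF fA[OF k(2)] fB[OF k(2)]]
    have "expectation (?t k l) = s k * s l * (expectation (\<lambda>\<omega>. A k \<omega> * B k \<omega> * A l \<omega> * B l \<omega>) - ip (f k) (g k) * ip (f l) (g l))"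
      using m4 m2 by (simp add: lin_covariance[OF f[OF k(1)] g[OF k(1)]] lin_covariance[OF f[OF k(2)] g[OF k(2)]] prob_space)
    also have "\<dots> = s k * s l * (ip (f k) (f l) * ip (g k) (g l) + ip (f k) (g l) * ip (g k) (f l))
       + excess * (s k * s l * (\<integral>q. f k q * g k q * f l q * g l q \<partial>lborel))"
      unfolding lin_fourth_product[OF f[OF k(1)] g[OF k(1)] f[OF k(2)] g[OF k(2)]] by (simp add: algebra_simps)
    also have "s k * s l * (\<integral>q. f k q * g k q * f l q * g l q \<partial>lborel)
        = (\<integral>q. (s k * (f k q * g k q)) * (s l * (f l q * g l q)) \<partial>lborel)"
      by (subst integral_mult_right_zero[symmetric]) (simp add: mult_ac)
    finally show ?thesis .
  qed
  have bi: "integrable lborel (\<lambda>q. (s k * (f k q * g k q)) * (s l * (f l q * g l q)))" if "k \<in> K" "l \<in> K" for k l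
    using that f g by (intro bounded_integrableD bounded_integrable_mult bounded_integrable_scale lin_bounded_integrable) auto
  have "expectation (\<lambda>\<omega>. (V \<omega>)\<^sup>2) = (\<Sum>k\<in>K. expectation (\<lambda>\<omega>. \<Sum>l\<in>K. ?t k l \<omega>))"
    unfolding V2 by (intro Bochner_Integration.integral_sum Bochner_Integration.integrable_sum i)
  also have "\<dots> = (\<Sum>k\<in>K. \<Sum>l\<in>K. expectation (?t k l))"
    by (intro sum.cong refl Bochner_Integration.integral_sum i)
  also have "\<dots> = (\<Sum>k\<in>K. \<Sum>l\<in>K. s k * s l * (ip (f k) (f l) * ip (g k) (g l) + ip (f k) (g l) * ip (g k) (f l))
      + excess * (\<integral>q. (s k * (f k q * g k q)) * (s l * (f l q * g l q)) \<partial>lborel))"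
    by (intro sum.cong refl e)
  also have "\<dots> = (\<Sum>k\<in>K. \<Sum>l\<in>K. s k * s l * (ip (f k) (f l) * ip (g k) (g l) + ip (f k) (g l) * ip (g k) (f l)))
      + excess * (\<Sum>k\<in>K. \<Sum>l\<in>K. (\<integral>q. (s k * (f k q * g k q)) * (s l * (f l q * g l q)) \<partial>lborel))"
    by (simp only: sum.distrib sum_distrib_left)
  also have "(\<Sum>k\<in>K. \<Sum>l\<in>K. (\<integral>q. (s k * (f k q * g k q)) * (s l * (f l q * g l q)) \<partial>lborel))
      = (\<integral>q. (\<Sum>k\<in>K. s k * (f k q * g k q))\<^sup>2 \<partial>lborel)"
    unfolding power2_eq_square sum_product
    by (simp add: Bochner_Integration.integral_sum Bochner_Integration.integrable_sum bi)
  finally show "expectation (\<lambda>\<omega>. (V \<omega>)\<^sup>2)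
      = (\<Sum>k\<in>K. \<Sum>l\<in>K. s k * s l * (ip (f k) (f l) * ip (g k) (g l) + ip (f k) (g l) * ip (g k) (f l)))
        + excess * (\<integral>q. (\<Sum>k\<in>K. s k * (f k q * g k q))\<^sup>2 \<partial>lborel)" .
qed

end

section \<open>Trawl sets\<close>

locale trawl_kernel =
  fixes a \<phi> :: "real \<Rightarrow> real" and \<alpha> :: real
  assumes trawl: "trawl_function a"
    and a_eq: "\<And>s. s \<ge> 0 \<Longrightarrow> a s = (LINT y:{s..}|lborel. \<phi> y)"
    and phi_pos: "\<And>s. s \<ge> 0 \<Longrightarrow> \<phi> s > 0"
    and phi_cont: "continuous_on {0..} \<phi>"
    and alpha: "\<alpha> > 1"
    and phi_bigo: "\<phi> \<in> O[at_top](\<lambda>s. s powr (- \<alpha> - 1))"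
begin

lemma phi_set_measurable:
  assumes "S \<in> sets borel" "S \<subseteq> {0..}"
  shows "set_borel_measurable lborel S \<phi>"
proof -
  have "(\<lambda>x. indicator S x *\<^sub>R \<phi> x) \<in> borel_measurable borel"
    using assms phi_cont by (intro borel_measurable_continuous_on_indicator continuous_on_subset[OF phi_cont]) auto
  then show ?thesis unfolding set_borel_measurable_def by simp
qed

lemma phi_tail:
  obtains S c where "1 \<le> S" "0 < c" "\<And>s. s \<ge> S \<Longrightarrow> \<phi> s \<le> c * s powr (- \<alpha> - 1)"
proof -
  obtain c where c: "0 < c" "\<forall>\<^sub>F s in at_top. norm (\<phi> s) \<le> c * norm (s powr (- \<alpha> - 1))"
    using phi_bigo by (elim landau_o.bigE)
  then obtain N where N: "\<And>s. s \<ge> N \<Longrightarrow> norm (\<phi> s) \<le> c * norm (s powr (- \<alpha> - 1))"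
    by (auto simp: eventually_at_top_linorder)
  show thesis
    by (rule that[of "max 1 N" c]) (use N c in \<open>auto intro: order_trans[OF abs_ge_self]\<close>)
qed

lemma phi_bounded: "\<exists>C>0. \<forall>s\<ge>0. \<phi> s \<le> C"
proof -
  obtain S c where S: "1 \<le> S" "0 < c" "\<And>s. s \<ge> S \<Longrightarrow> \<phi> s \<le> c * s powr (- \<alpha> - 1)"
    by (rule phi_tail) (rule that)
  have "compact (\<phi> ` {0..S})"
    by (intro compact_continuous_image continuous_on_subset[OF phi_cont]) auto
  then obtain B where B: "\<And>s. s \<in> {0..S} \<Longrightarrow> \<phi> s \<le> B"
    by (metis bdd_above.E bounded_imp_bdd_above compact_imp_bounded imageI)
  have "\<phi> s \<le> max B c" if "s \<ge> 0" for s
  proof (cases "s \<le> S")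
    case False
    then have "s powr (- \<alpha> - 1) \<le> s powr 0"
      using S alpha by (intro powr_mono) auto
    then have "c * s powr (- \<alpha> - 1) \<le> c * 1"
      using S False by (intro mult_left_mono) auto
    with S(3)[of s] False show ?thesis by auto
  qed (use B that in \<open>auto simp: le_max_iff_disj\<close>)
  then show ?thesis using S by (intro exI[of _ "max B c"]) auto
qed

definition phi_sup :: real where
  "phi_sup = (SOME C. C > 0 \<and> (\<forall>s\<ge>0. \<phi> s \<le> C))"

lemma phi_sup: "0 < phi_sup" "s \<ge> 0 \<Longrightarrow> \<phi> s \<le> phi_sup"
  using someI_ex[OF phi_bounded[unfolded Bex_def]] unfolding phi_sup_def by auto

lemma phi_integrable: "set_integrable lborel {0..} \<phi>"
proof -
  obtain S c where S: "1 \<le> S" "0 < c" "\<And>s. s \<ge> S \<Longrightarrow> \<phi> s \<le> c * s powr (- \<alpha> - 1)"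
    by (rule phi_tail) (rule that)
  define f where "f s = c * s powr (- \<alpha> - 1)" for s
  have "(\<integral>\<^sup>+x. ennreal (f x) * indicator {S..} x \<partial>lborel) = 0 - (- (c / \<alpha>) * S powr (- \<alpha>))"
  proof (rule nn_integral_FTC_atLeast)
    show "((\<lambda>x. - (c / \<alpha>) * x powr (- \<alpha>)) \<longlongrightarrow> 0) at_top"
      using alpha by (intro tendsto_mult_right_zero tendsto_neg_powr filterlim_ident) auto
    fix x assume "S \<le> x"
    then have x: "0 < x" using S by simp
    show "((\<lambda>x. - (c / \<alpha>) * x powr (- \<alpha>)) has_real_derivative f x) (at x)"
      using x alpha by (auto intro!: derivative_eq_intros simp: f_def)
    show "0 \<le> f x" using S by (simp add: f_def)
  qed (simp add: f_def[abs_def])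
  moreover have "(\<integral>\<^sup>+x. ennreal (norm (indicator {S..} x *\<^sub>R f x)) \<partial>lborel)
      = (\<integral>\<^sup>+x. ennreal (f x) * indicator {S..} x \<partial>lborel)"
    by (intro nn_integral_cong) (use S in \<open>auto simp: f_def indicator_def\<close>)
  ultimately have fi: "set_integrable lborel {S..} f"
    unfolding set_integrable_def
    by (intro integrableI_bounded) (auto simp: f_def[abs_def])
  have "set_integrable lborel {S..} \<phi>"
  proof (rule set_integrable_bound[OF fi])
    show "AE x in lborel. x \<in> {S..} \<longrightarrow> norm (\<phi> x) \<le> norm (f x)"
    proof (intro AE_I2 impI)
      fix x assume x: "x \<in> {S..}"
      then have "0 < \<phi> x" "\<phi> x \<le> f x" using S phi_pos[of x] by (auto simp: f_def)
      then show "norm (\<phi> x) \<le> norm (f x)" by simp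
    qed
  qed (use S in \<open>auto intro!: phi_set_measurable\<close>)
  moreover have "set_integrable lborel {0..S} \<phi>"
    by (intro borel_integrable_atLeastAtMost' continuous_on_subset[OF phi_cont]) auto
  ultimately have "set_integrable lborel ({0..S} \<union> {S..}) \<phi>"
    by (intro set_integrable_Un) auto
  moreover have "{0..S} \<union> {S..} = {0..}" using S by auto
  ultimately show ?thesis by simp
qed

lemma a_nonneg: "s \<ge> 0 \<Longrightarrow> 0 \<le> a s"
  using trawl by (simp add: trawl_function_def)

lemma a_antimono: "0 \<le> s \<Longrightarrow> s \<le> t \<Longrightarrow> a t \<le> a s"
  using trawl by (auto simp: trawl_function_def monotone_on_def)

lemma a_cont: "continuous_on {0..} a"
  using trawl by (simp add: trawl_function_def)

lemma a_integrable: "set_integrable lborel {0..} a"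
  using trawl by (simp add: trawl_function_def)

lemma set_integral_split_Ici:
  fixes f :: "real \<Rightarrow> real"
  assumes "set_integrable lborel {0..} f" "0 \<le> s" "s \<le> t"
  shows "(LINT y:{s..}|lborel. f y) = (LINT y:{s..<t}|lborel. f y) + (LINT y:{t..}|lborel. f y)"
proof -
  have "{s..} = {s..<t} \<union> {t..}" using assms by auto
  then show ?thesis
    using assms by (simp only:) (intro set_integral_Un set_integrable_subset[OF assms(1)], auto)
qed

lemma a_diff:
  assumes "0 \<le> s" "s \<le> t"
  shows "a s - a t = (LINT y:{s..<t}|lborel. \<phi> y)"
  using set_integral_split_Ici[OF phi_integrable assms] a_eq assms by simp

lemma set_integral_Ico_bounds:
  fixes f :: "real \<Rightarrow> real"
  assumes "set_integrable lborel {0..} f" "0 \<le> s" "s \<le> t"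
  shows "(\<And>y. s \<le> y \<Longrightarrow> y < t \<Longrightarrow> f y \<le> B) \<Longrightarrow> (LINT y:{s..<t}|lborel. f y) \<le> B * (t - s)"
    and "(\<And>y. s \<le> y \<Longrightarrow> y < t \<Longrightarrow> B \<le> f y) \<Longrightarrow> B * (t - s) \<le> (LINT y:{s..<t}|lborel. f y)"
proof -
  have i: "set_integrable lborel {s..<t} f"
    by (rule set_integrable_subset[OF assms(1)]) (use assms in auto)
  have c: "set_integrable lborel {s..<t} (\<lambda>_. B)" "(LINT y:{s..<t}|lborel. B) = B * (t - s)"
    using assms by (auto simp: set_integrable_def set_lebesgue_integral_def)
  show "(LINT y:{s..<t}|lborel. f y) \<le> B * (t - s)" if "\<And>y. s \<le> y \<Longrightarrow> y < t \<Longrightarrow> f y \<le> B"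
    unfolding c(2)[symmetric] using that by (intro set_integral_mono i c) auto
  show "B * (t - s) \<le> (LINT y:{s..<t}|lborel. f y)" if "\<And>y. s \<le> y \<Longrightarrow> y < t \<Longrightarrow> B \<le> f y"
    unfolding c(2)[symmetric] using that by (intro set_integral_mono i c) auto
qed

lemma a_lipschitz:
  assumes "0 \<le> s" "s \<le> t"
  shows "a s - a t \<le> phi_sup * (t - s)"
  unfolding a_diff[OF assms]
  by (rule set_integral_Ico_bounds[OF phi_integrable assms]) (use assms phi_sup in auto)

lemma a_0_pos: "0 < a 0"
proof -
  have "\<exists>x\<in>{0..1}. \<forall>y\<in>{0..1}. \<phi> x \<le> \<phi> y"
    by (rule continuous_attains_inf) (auto intro: continuous_on_subset[OF phi_cont])
  then obtain x where x: "x \<in> {0..1}" "\<And>y. y \<in> {0..1} \<Longrightarrow> \<phi> x \<le> \<phi> y"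
    by blast
  have "\<phi> x * (1 - 0) \<le> a 0 - a 1"
    unfolding a_diff[of 0 1, simplified]
    by (rule set_integral_Ico_bounds(2)[OF phi_integrable]) (use x in auto)
  then show ?thesis using phi_pos[of x] x a_nonneg[of 1] by auto
qed

text \<open>The area of the overlap of two translates of the trawl set at distance \<open>t\<close>;
  see \<open>A_Int\<close>.\<close>

definition R :: "real \<Rightarrow> real" where
  "R t = (LINT s:{t..}|lborel. a s)"

lemma R_diff:
  assumes "0 \<le> s" "s \<le> t"
  shows "R s - R t = (LINT y:{s..<t}|lborel. a y)"
  using set_integral_split_Ici[OF a_integrable assms] by (simp add: R_def)

lemma R_diff_bounds:
  assumes "0 \<le> s" "s \<le> t"
  shows "a t * (t - s) \<le> R s - R t" "R s - R t \<le> a s * (t - s)"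
  unfolding R_diff[OF assms]
  by (rule set_integral_Ico_bounds[OF a_integrable assms]; use assms a_antimono in auto)+

lemma R_nonneg: "0 \<le> t \<Longrightarrow> 0 \<le> R t"
  unfolding R_def set_lebesgue_integral_def
  by (intro Bochner_Integration.integral_nonneg) (auto simp: indicator_def intro: a_nonneg)

definition u :: "real \<Rightarrow> real" where "u h = R 0 - R h"

text \<open>A second difference of the overlap area. For \<open>m >= 1\<close> it is minus the
  covariance of two increments that are \<open>m\<close> steps apart, as \<open>incr_cov_off\<close>
  shows.\<close>

definition w :: "real \<Rightarrow> nat \<Rightarrow> real" where
  "w h m = R ((real m - 1) * h) - 2 * R (real m * h) + R ((real m + 1) * h)"

lemma u_bounds:
  assumes "0 \<le> h"
  shows "a h * h \<le> u h" "u h \<le> a 0 * h" "0 \<le> u h"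
proof -
  show "a h * h \<le> u h" "u h \<le> a 0 * h"
    using R_diff_bounds[of 0 h] assms by (auto simp: u_def)
  moreover have "0 \<le> a h * h" using assms a_nonneg[of h] by simp
  ultimately show "0 \<le> u h" by linarith
qed

text \<open>\<open>R\<close> is convex because \<open>a\<close> decreases, which gives the sign; a
  Lipschitz bound for \<open>a\<close> over two steps gives the order \<open>h^2\<close>.\<close>

lemma w_bounds:
  assumes "0 \<le> h" "1 \<le> m"
  shows "0 \<le> w h m" "w h m \<le> 2 * phi_sup * h\<^sup>2"
proof -
  define s where "s = (real m - 1) * h"
  have eq: "real m * h = s + h" "(real m + 1) * h = s + 2 * h"
    by (auto simp: s_def algebra_simps)
  have s: "0 \<le> s" unfolding s_def using assms by (intro mult_nonneg_nonneg) auto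
  have b1: "a (s + h) * h \<le> R s - R (s + h)" "R s - R (s + h) \<le> a s * h"
    using R_diff_bounds[of s "s + h"] s assms by auto
  have b2: "a (s + 2 * h) * h \<le> R (s + h) - R (s + 2 * h)" "R (s + h) - R (s + 2 * h) \<le> a (s + h) * h"
    using R_diff_bounds[of "s + h" "s + 2 * h"] s assms by auto
  have w: "w h m = (R s - R (s + h)) - (R (s + h) - R (s + 2 * h))"
    unfolding w_def eq s_def[symmetric] by simp
  show "0 \<le> w h m" using b1 b2 unfolding w by linarith
  have "w h m \<le> a s * h - a (s + 2 * h) * h"
    using b1 b2 unfolding w by linarith
  also have "\<dots> = (a s - a (s + 2 * h)) * h" by (simp add: left_diff_distrib)
  also have "\<dots> \<le> phi_sup * (2 * h) * h"
    using a_lipschitz[of s "s + 2 * h"] s assms by (intro mult_right_mono) auto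
  finally show "w h m \<le> 2 * phi_sup * h\<^sup>2" by (simp add: power2_eq_square)
qed

text \<open>Second differences telescope to \<open>u h\<close> minus a nonnegative first difference.
  So an increment has covariances of total size at most \<open>u h\<close> with all increments on
  one side of it, however many there are.\<close>

lemma w_sum:
  assumes "0 \<le> h"
  shows "(\<Sum>m\<in>{1..n}. w h m) \<le> u h"
proof -
  have "(\<Sum>m\<in>{1..n}. w h m) = u h - (R (real n * h) - R ((real n + 1) * h))"
  proof (induction n)
    case (Suc n)
    have "(\<Sum>m\<in>{1..Suc n}. w h m) = (\<Sum>m\<in>{1..n}. w h m) + w h (Suc n)" by simp
    then show ?case unfolding Suc by (simp add: w_def algebra_simps)
  qed (simp add: u_def)
  moreover have "0 \<le> R (real n * h) - R ((real n + 1) * h)"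
  proof -
    have "a ((real n + 1) * h) * ((real n + 1) * h - real n * h) \<le> R (real n * h) - R ((real n + 1) * h)"
      using assms by (intro R_diff_bounds) (auto intro!: mult_right_mono)
    moreover have "0 \<le> a ((real n + 1) * h) * ((real n + 1) * h - real n * h)"
      using assms by (intro mult_nonneg_nonneg a_nonneg) (auto simp: algebra_simps)
    ultimately show ?thesis by simp
  qed
  ultimately show ?thesis by simp
qed

lemma w_le_u:
  assumes "0 \<le> h" "1 \<le> m"
  shows "w h m \<le> u h"
proof -
  have "w h m \<le> (\<Sum>m\<in>{1..m}. w h m)"
    using assms w_bounds by (intro member_le_sum) auto
  also have "\<dots> \<le> u h" by (rule w_sum) fact
  finally show ?thesis .
qed

lemma u_over_h: "((\<lambda>h. u h / h) \<longlongrightarrow> a 0) (at_right 0)"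
proof (rule tendsto_sandwich)
  show "\<forall>\<^sub>F h in at_right 0. a 0 - phi_sup * h \<le> u h / h"
  proof (rule eventually_at_rightI[of 0 1])
    fix h :: real assume h: "h \<in> {0<..<1}"
    have "a 0 - phi_sup * h \<le> a h" using a_lipschitz[of 0 h] h by simp
    also have "a h \<le> u h / h" using u_bounds[of h] h by (simp add: le_divide_eq)
    finally show "a 0 - phi_sup * h \<le> u h / h" .
  qed simp
  show "\<forall>\<^sub>F h in at_right 0. u h / h \<le> a 0"
    by (rule eventually_at_rightI[of 0 1]) (use u_bounds in \<open>auto simp: divide_le_eq\<close>)
  have "((\<lambda>h. a 0 - phi_sup * h) \<longlongrightarrow> a 0 - phi_sup * 0) (at_right 0)"
    by (intro tendsto_intros)
  then show "((\<lambda>h. a 0 - phi_sup * h) \<longlongrightarrow> a 0) (at_right 0)" by simp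
qed simp

text \<open>\<open>u h\<close> is the integral of \<open>a\<close> over [0, h].\<close>

lemma u_second_order: "((\<lambda>h. (u h - a 0 * h) / h\<^sup>2) \<longlongrightarrow> - \<phi> 0 / 2) (at_right 0)"
proof (rule tendstoI)
  fix e :: real assume e: "0 < e"
  obtain d where d: "0 < d" "\<And>y. y \<in> {0..} \<Longrightarrow> dist y 0 < d \<Longrightarrow> dist (\<phi> y) (\<phi> 0) < e"
    using phi_cont e unfolding continuous_on_iff by (metis atLeast_iff order_refl)
  show "\<forall>\<^sub>F h in at_right 0. dist ((u h - a 0 * h) / h\<^sup>2) (- \<phi> 0 / 2) < e"
  proof (rule eventually_at_rightI[of 0 d])
    fix h assume h: "h \<in> {0<..<d}"
    \<comment> \<open>Continuity of \<phi> at 0 traps \<open>a\<close> between two lines near 0;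
      integrating the lines gives the quadratic term up to \<open>e * h^2 / 2\<close>.\<close>
    have dev: "(\<phi> 0 - e) * s \<le> a 0 - a s \<and> a 0 - a s \<le> (\<phi> 0 + e) * s" if s: "0 \<le> s" "s \<le> h" for s
    proof -
      have *: "\<phi> 0 - e \<le> \<phi> y \<and> \<phi> y \<le> \<phi> 0 + e" if "0 \<le> y" "y < s" for y
        using d(2)[of y] that s h by (auto simp: dist_real_def abs_less_iff)
      show ?thesis
        unfolding a_diff[OF order_refl s(1)]
        using set_integral_Ico_bounds[OF phi_integrable order_refl s(1), of "\<phi> 0 + e"]
          set_integral_Ico_bounds(2)[OF phi_integrable order_refl s(1), of "\<phi> 0 - e"] * by auto
    qed
    have lin: "set_integrable lborel {0..<h} (\<lambda>s. a 0 - c * s)"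
      "(LINT s:{0..<h}|lborel. a 0 - c * s) = a 0 * h - c * h\<^sup>2 / 2" for c
    proof -
      have i: "set_integrable lborel {0..h} (\<lambda>s. a 0 - c * s)"
        by (intro borel_integrable_atLeastAtMost' continuous_intros)
      then show "set_integrable lborel {0..<h} (\<lambda>s. a 0 - c * s)"
        by (rule set_integrable_subset) auto
      have "(LINT s:{0..<h}|lborel. a 0 - c * s) = (LINT s:{0..h}|lborel. a 0 - c * s)"
        unfolding set_lebesgue_integral_def
        by (intro integral_cong_AE) (auto intro!: AE_mp[OF AE_lborel_singleton[of h] AE_I2] simp: indicator_def)
      also have "\<dots> = (\<integral>s. (a 0 - c * s) * indicator {0..h} s \<partial>lborel)"
        by (simp add: set_lebesgue_integral_def mult.commute)
      also have "\<dots> = (a 0 * h - c * h\<^sup>2 / 2) - (a 0 * 0 - c * 0\<^sup>2 / 2)"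
        using h by (intro integral_FTC_Icc_real) (auto intro!: derivative_eq_intros continuous_intros)
      finally show "(LINT s:{0..<h}|lborel. a 0 - c * s) = a 0 * h - c * h\<^sup>2 / 2" by simp
    qed
    have ai: "set_integrable lborel {0..<h} a"
      by (rule set_integrable_subset[OF a_integrable]) auto
    have uh: "u h = (LINT s:{0..<h}|lborel. a s)"
      using h by (simp add: u_def R_diff)
    have "(LINT s:{0..<h}|lborel. a 0 - (\<phi> 0 + e) * s) \<le> u h"
      unfolding uh using dev by (intro set_integral_mono lin ai) (auto simp: algebra_simps)
    then have l: "a 0 * h - (\<phi> 0 + e) * h\<^sup>2 / 2 \<le> u h" unfolding lin .
    have "u h \<le> (LINT s:{0..<h}|lborel. a 0 - (\<phi> 0 - e) * s)"
      unfolding uh using dev by (intro set_integral_mono lin ai) (auto simp: algebra_simps)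
    then have r: "u h \<le> a 0 * h - (\<phi> 0 - e) * h\<^sup>2 / 2" unfolding lin .
    have h2: "0 < h\<^sup>2" using h by simp
    have "(u h - a 0 * h) / h\<^sup>2 + \<phi> 0 / 2 = ((u h - a 0 * h) + \<phi> 0 / 2 * h\<^sup>2) / h\<^sup>2"
      using h2 by (simp add: add_divide_distrib)
    then have "\<bar>(u h - a 0 * h) / h\<^sup>2 + \<phi> 0 / 2\<bar> = \<bar>(u h - a 0 * h) + \<phi> 0 / 2 * h\<^sup>2\<bar> / h\<^sup>2"
      by (simp only: abs_divide abs_power2)
    also have "\<dots> \<le> (e / 2 * h\<^sup>2) / h\<^sup>2"
    proof (intro divide_right_mono abs_leI)
      show "(u h - a 0 * h) + \<phi> 0 / 2 * h\<^sup>2 \<le> e / 2 * h\<^sup>2"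
        using r by (simp add: algebra_simps diff_divide_distrib)
      show "- ((u h - a 0 * h) + \<phi> 0 / 2 * h\<^sup>2) \<le> e / 2 * h\<^sup>2"
        using l by (simp add: algebra_simps add_divide_distrib)
    qed (use h2 in simp)
    also have "\<dots> < e" using e h2 by simp
    finally show "dist ((u h - a 0 * h) / h\<^sup>2) (- \<phi> 0 / 2) < e" by (simp add: dist_real_def)
  qed fact
qed

lemma w_eq_u: "w h 1 = 2 * u h - u (2 * h)"
  by (simp add: w_def u_def)

text \<open>In \<open>2 * u h - u (2 * h)\<close> the linear terms cancel and the quadratic ones
  leave \<open>- \<phi> 0 + 2 * \<phi> 0\<close>.\<close>

lemma w_second_order: "((\<lambda>h. w h 1 / h\<^sup>2) \<longlongrightarrow> \<phi> 0) (at_right 0)"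
proof -
  have "filterlim (\<lambda>h::real. 2 * h) (at_right 0) (at_right 0)"
    by (auto simp: filterlim_at eventually_at_filter intro!: tendsto_eq_intros)
  note u2 = filterlim_compose[OF u_second_order this]
  have "((\<lambda>h. 2 * ((u h - a 0 * h) / h\<^sup>2) - 4 * ((u (2 * h) - a 0 * (2 * h)) / (2 * h)\<^sup>2)) \<longlongrightarrow>
      2 * (- \<phi> 0 / 2) - 4 * (- \<phi> 0 / 2)) (at_right 0)"
    by (intro tendsto_intros u_second_order u2)
  moreover have "2 * ((u h - a 0 * h) / h\<^sup>2) - 4 * ((u (2 * h) - a 0 * (2 * h)) / (2 * h)\<^sup>2) = w h 1 / h\<^sup>2" for h
    unfolding w_eq_u by (simp add: power_mult_distrib diff_divide_distrib)
  ultimately show ?thesis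
    by simp
qed

section \<open>The moving trawl set and its overlaps\<close>

definition A :: "real \<Rightarrow> (real \<times> real) set" where
  "A t = (\<lambda>p. p + (t, 0)) ` trawl_set a"

lemma A_iff: "(r, y) \<in> A t \<longleftrightarrow> r \<le> t \<and> 0 \<le> y \<and> y \<le> a (t - r)"
proof
  assume "(r, y) \<in> A t"
  then show "r \<le> t \<and> 0 \<le> y \<and> y \<le> a (t - r)"
    by (auto simp: A_def trawl_set_def)
next
  assume "r \<le> t \<and> 0 \<le> y \<and> y \<le> a (t - r)"
  then show "(r, y) \<in> A t"
    unfolding A_def trawl_set_def by (intro image_eqI[of _ _ "(r - t, y)"]) auto
qed

text \<open>A fixed point (r, y) lies in the trawl while \<open>r <= t\<close> and
  \<open>y <= a (t - r)\<close>; since \<open>a\<close> decreases, these times form an interval.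
  Hence along a grid a point enters at most once and leaves at most once.\<close>

lemma A_interval:
  assumes "q \<in> A s" "q \<in> A v" "s \<le> t" "t \<le> v"
  shows "q \<in> A t"
proof -
  obtain r y where q: "q = (r, y)" by force
  then have "y \<le> a (v - r)" "r \<le> s" "0 \<le> y" using assms by (auto simp: A_iff)
  moreover have "a (v - r) \<le> a (t - r)"
    using assms \<open>r \<le> s\<close> by (intro a_antimono) auto
  ultimately show ?thesis using assms q by (auto simp: A_iff)
qed

text \<open>The overlap consists of the points born before \<open>s\<close> that are still below the
  curve at time \<open>t\<close>; its vertical slices are intervals of length
  \<open>a (t - r)\<close>.\<close>

lemma A_Int_measure:
  assumes "s \<le> t"
  shows "A s \<inter> A t \<in> sets borel" "emeasure lborel (A s \<inter> A t) = ennreal (R (t - s))"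
proof -
  \<comment> \<open>Constant extension to negative arguments, so that continuity on the whole line
    yields a closed set and a measurable slice length.\<close>
  define c where "c x = a (max 0 x)" for x
  have cc: "continuous_on UNIV c"
    unfolding c_def by (intro continuous_on_compose2[OF a_cont] continuous_intros) auto
  have eq: "A s \<inter> A t = {q. fst q \<le> s} \<inter> {q. 0 \<le> snd q} \<inter> {q. snd q \<le> c (t - fst q)}"
  proof (intro set_eqI)
    fix q :: "real \<times> real"
    obtain r y where q: "q = (r, y)" by force
    have "a (t - r) \<le> a (s - r)" if "r \<le> s" using that assms by (intro a_antimono) auto
    then show "q \<in> A s \<inter> A t \<longleftrightarrow> q \<in> {q. fst q \<le> s} \<inter> {q. 0 \<le> snd q} \<inter> {q. snd q \<le> c (t - fst q)}"
      using assms by (auto simp: q A_iff c_def)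
  qed
  have "closed (A s \<inter> A t)"
    unfolding eq
    by (intro closed_Int closed_Collect_le continuous_intros continuous_on_compose2[OF cc]) auto
  then show S: "A s \<inter> A t \<in> sets borel" by simp
  have cm: "c \<in> borel_measurable borel" using borel_measurable_continuous_onI[OF cc] .
  have "emeasure lborel (A s \<inter> A t) = emeasure (lborel \<Otimes>\<^sub>M lborel) (A s \<inter> A t)"
    by (simp add: lborel_prod)
  also have "\<dots> = (\<integral>\<^sup>+r. emeasure lborel (Pair r -` (A s \<inter> A t)) \<partial>lborel)"
    using S by (intro lborel.emeasure_pair_measure_alt) (metis lborel_prod sets_lborel)
  also have "\<dots> = (\<integral>\<^sup>+r. ennreal (indicator {..s} r * c (t - r)) \<partial>lborel)"
  proof (intro nn_integral_cong)
    fix r :: real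
    show "emeasure lborel (Pair r -` (A s \<inter> A t)) = ennreal (indicator {..s} r * c (t - r))"
    proof (cases "r \<le> s")
      case True
      then have "Pair r -` (A s \<inter> A t) = {0..c (t - r)}" unfolding eq by auto
      moreover have "0 \<le> c (t - r)" by (auto simp: c_def intro: a_nonneg)
      ultimately show ?thesis using True by simp
    next
      case False
      then have "Pair r -` (A s \<inter> A t) = {}" unfolding eq by auto
      then show ?thesis using False by simp
    qed
  qed
  also have "\<dots> = (\<integral>\<^sup>+x. ennreal (indicator {t - s..} x * c x) \<partial>lborel)"
  proof -
    have "(\<integral>\<^sup>+x. ennreal (indicator {t - s..} x * c x) \<partial>lborel)
        = ennreal \<bar>-1\<bar> * (\<integral>\<^sup>+r. ennreal (indicator {t - s..} (t + (-1) * r) * c (t + (-1) * r)) \<partial>lborel)"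
      using cm by (intro nn_integral_real_affine) auto
    also have "\<dots> = (\<integral>\<^sup>+r. ennreal (indicator {..s} r * c (t - r)) \<partial>lborel)"
      by (auto simp: indicator_def intro!: nn_integral_cong)
    finally show ?thesis ..
  qed
  also have "\<dots> = (\<integral>\<^sup>+x. ennreal (indicator {t - s..} x *\<^sub>R a x) \<partial>lborel)"
    using assms by (intro nn_integral_cong) (auto simp: indicator_def c_def max_def)
  also have "\<dots> = ennreal (R (t - s))"
  proof -
    have "set_integrable lborel {t - s..} a"
      by (rule set_integrable_subset[OF a_integrable]) (use assms in auto)
    then show ?thesis
      unfolding R_def set_lebesgue_integral_def set_integrable_def
      using assms by (intro nn_integral_eq_integral AE_I2) (auto simp: indicator_def intro: a_nonneg)
  qed
  finally show "emeasure lborel (A s \<inter> A t) = ennreal (R (t - s))" .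
qed

lemma A_finite_borel: "A t \<in> finite_borel"
  using A_Int_measure[of t t] by (simp add: finite_borel_def)

lemma A_Int: "measure lborel (A s \<inter> A t) = R \<bar>t - s\<bar>"
proof -
  have "measure lborel (A s \<inter> A t) = R (t - s)" if "s \<le> t" for s t
    using A_Int_measure(2)[OF that] R_nonneg[of "t - s"] that by (simp add: measure_def)
  from this[of s t] this[of t s] show ?thesis
    by (cases "s \<le> t") (auto simp: Int_commute abs_minus_commute)
qed

end

section \<open>Increments of a trawl process\<close>

lemma bounded_integrable_diff:
  "bounded_integrable f \<Longrightarrow> bounded_integrable g \<Longrightarrow> bounded_integrable (\<lambda>q. f q - g q)"
  using bounded_integrable_add[OF _ bounded_integrable_scale[of g "-1"]] by simp

lemma ip_diff:
  assumes "bounded_integrable f" "bounded_integrable g" "bounded_integrable h"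
  shows "ip (\<lambda>q. f q - g q) h = ip f h - ip g h"
  using ip_add[OF assms(1) bounded_integrable_scale[OF assms(2), of "-1"] assms(3)] ip_scale[of "-1" g h] by simp

lemma ip_diff_right:
  assumes "bounded_integrable f" "bounded_integrable g" "bounded_integrable h"
  shows "ip h (\<lambda>q. f q - g q) = ip h f - ip h g"
  using ip_diff[OF assms] by (simp add: ip_commute[of h])

locale trawl_basis = levy_basis_moments M L \<gamma> b \<nu> p + trawl_kernel a \<phi> \<alpha>
  for M :: "'a measure" and L \<gamma> b \<nu> p a \<phi> \<alpha>
begin

definition dX :: "real \<Rightarrow> nat \<Rightarrow> 'a \<Rightarrow> real" where
  "dX h k \<omega> = Z (A (real (k + 1) * h)) \<omega> - Z (A (real k * h)) \<omega>"

definition dF :: "real \<Rightarrow> nat \<Rightarrow> real \<times> real \<Rightarrow> real" where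
  "dF h k q = indicator (A (real (k + 1) * h)) q - indicator (A (real k * h)) q"

definition birth :: "real \<Rightarrow> nat \<Rightarrow> (real \<times> real) set" where
  "birth h k = A (real (k + 1) * h) - A (real k * h)"

definition death :: "real \<Rightarrow> nat \<Rightarrow> (real \<times> real) set" where
  "death h k = A (real k * h) - A (real (k + 1) * h)"

lemma birth_death_finite_borel: "birth h k \<in> finite_borel" "death h k \<in> finite_borel"
  by (auto simp: birth_def death_def intro!: finite_borel_closed A_finite_borel)

text \<open>All translates have the same area, so the means cancel in the difference. The identity
  holds at every \<omega>, which lets the estimators be rewritten literally.\<close>

lemma increment_eq_dX: "increment (\<lambda>t. trawl_process L a t \<omega>) h k = dX h k \<omega>"
proof -
  have "expectation (L (A s)) = expectation (L (A t))" for s t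
    using A_Int[of s s] A_Int[of t t] by (intro basis_mean_cong A_finite_borel) simp
  then show ?thesis
    by (simp add: increment_def dX_def trawl_process_def Z_def flip: A_def)
qed

lemma lin_dX: "lin (dF h k) (dX h k)"
proof -
  have "lin (\<lambda>q. indicator (A (real (k + 1) * h)) q - indicator (A (real k * h)) q) (\<lambda>\<omega>. Z (A (real (k + 1) * h)) \<omega> - Z (A (real k * h)) \<omega>)"
    by (intro lin_diff lin_indicator A_finite_borel)
  then show ?thesis by (simp add: dF_def[abs_def] dX_def[abs_def])
qed

lemma dF_birth_death: "dF h k q = indicator (birth h k) q - indicator (death h k) q"
  by (auto simp: dF_def birth_def death_def indicator_def)

lemma dX_birth_death: "AE \<omega> in M. dX h k \<omega> = Z (birth h k) \<omega> - Z (death h k) \<omega>"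
proof (rule lin_AE_eq[OF lin_dX])
  show "lin (dF h k) (\<lambda>\<omega>. Z (birth h k) \<omega> - Z (death h k) \<omega>)"
    using lin_diff[OF lin_indicator lin_indicator, OF birth_death_finite_borel(1,2)[of h k]]
    by (simp add: dF_birth_death[abs_def])
qed

lemma grid_interval:
  assumes "0 \<le> h" "q \<in> A (real i * h)" "q \<in> A (real l * h)" "i \<le> j" "j \<le> l"
  shows "q \<in> A (real j * h)"
  by (rule A_interval[OF assms(2,3)]) (use assms in \<open>auto intro!: mult_right_mono\<close>)

text \<open>A point entering in two different steps would have left in between, contrary to
  \<open>A_interval\<close>.\<close>

lemma birth_disjoint:
  assumes "0 \<le> h"
  shows "disjoint_family_on (birth h) I"
proof -
  have "q \<notin> birth h l" if "k < l" "q \<in> birth h k" for k l q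
    using grid_interval[OF assms, of q "k + 1" "l + 1" l] that by (auto simp: birth_def)
  then show ?thesis
    unfolding disjoint_family_on_def by (metis disjoint_iff linorder_neqE_nat)
qed

lemma death_disjoint:
  assumes "0 \<le> h"
  shows "disjoint_family_on (death h) I"
proof -
  have "q \<notin> death h l" if "k < l" "q \<in> death h k" for k l q
    using grid_interval[OF assms, of q k l "k + 1"] that by (auto simp: death_def)
  then show ?thesis
    unfolding disjoint_family_on_def by (metis disjoint_iff linorder_neqE_nat)
qed

lemma birth_death_Int: "birth h k \<inter> death h k = {}"
  by (auto simp: birth_def death_def)

lemma ip_indicator:
  "ip (indicator B) (indicator C) = measure lborel (B \<inter> C)"
  unfolding ip_def by (simp flip: indicator_inter_arith)

lemma birth_death_measure:
  assumes "0 \<le> h"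
  shows "measure lborel (birth h k) = u h" "measure lborel (death h k) = u h"
proof -
  let ?s = "real k * h" and ?t = "real (k + 1) * h"
  have ts: "?t - ?s = h" by (simp add: algebra_simps)
  have diff: "measure lborel (B - C) = measure lborel B - measure lborel (B \<inter> C)"
    if "B \<in> finite_borel" "C \<in> finite_borel" for B C
  proof -
    have "B - C \<union> B \<inter> C = B" "(B - C) \<inter> (B \<inter> C) = {}" by auto
    then show ?thesis
      using finite_borel_measure_Un[of "B - C" "B \<inter> C"] finite_borel_closed[OF that] by simp
  qed
  have "measure lborel (A ?t - A ?s) = measure lborel (A ?t) - measure lborel (A ?t \<inter> A ?s)"
    by (rule diff[OF A_finite_borel A_finite_borel])
  then show "measure lborel (birth h k) = u h"
    using A_Int[of ?t ?t] A_Int[of ?t ?s] ts assms by (simp add: birth_def u_def)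
  have "measure lborel (A ?s - A ?t) = measure lborel (A ?s) - measure lborel (A ?s \<inter> A ?t)"
    by (rule diff[OF A_finite_borel A_finite_borel])
  then show "measure lborel (death h k) = u h"
    using A_Int[of ?s ?s] A_Int[of ?s ?t] ts assms by (simp add: death_def u_def)
qed

section \<open>The covariance matrix of the increments\<close>

definition incr_cov :: "real \<Rightarrow> nat \<Rightarrow> nat \<Rightarrow> real" where
  "incr_cov h k l = ip (dF h k) (dF h l)"

lemma incr_cov_commute: "incr_cov h k l = incr_cov h l k"
  by (simp add: incr_cov_def ip_commute)

lemma dF_bounded_integrable: "bounded_integrable (dF h k)"
  by (rule lin_bounded_integrable[OF lin_dX])

lemma incr_cov_eq_R:
  assumes "0 \<le> h"
  shows "incr_cov h k l = 2 * R (\<bar>real l - real k\<bar> * h)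
    - R (\<bar>real l - (1 + real k)\<bar> * h) - R (\<bar>1 + real l - real k\<bar> * h)"
proof -
  have J: "ip (indicator (A (real i * h))) (indicator (A (real j * h))) = R (\<bar>real j - real i\<bar> * h)" for i j
    unfolding ip_indicator A_Int using assms by (simp add: abs_mult flip: left_diff_distrib)
  have bi: "bounded_integrable (indicator (A t))" for t
    by (rule bounded_integrable_indicator[OF A_finite_borel])
  have "incr_cov h k l = ip (indicator (A (real (k + 1) * h))) (indicator (A (real (l + 1) * h)))
      - ip (indicator (A (real (k + 1) * h))) (indicator (A (real l * h)))
      - ip (indicator (A (real k * h))) (indicator (A (real (l + 1) * h)))
      + ip (indicator (A (real k * h))) (indicator (A (real l * h)))"
    unfolding incr_cov_def dF_def[abs_def]
    by (simp add: ip_diff ip_diff_right bi bounded_integrable_diff del: of_nat_add of_nat_Suc)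
  then show ?thesis unfolding J by simp
qed

lemma incr_cov_diag:
  assumes "0 \<le> h"
  shows "incr_cov h k k = 2 * u h"
  using incr_cov_eq_R[OF assms, of k k] by (simp add: u_def)

lemma incr_cov_off:
  assumes "0 \<le> h" "k < l"
  shows "incr_cov h k l = - w h (l - k)"
  using incr_cov_eq_R[OF assms(1), of k l] assms(2)
  by (simp add: w_def of_nat_diff algebra_simps)

lemma incr_cov_off':
  assumes "0 \<le> h" "l < k"
  shows "incr_cov h k l = - w h (k - l)"
  using incr_cov_off[OF assms] incr_cov_commute by simp

lemma abs_incr_cov_le:
  assumes "0 \<le> h"
  shows "\<bar>incr_cov h k l\<bar> \<le> 2 * u h"
proof -
  have "\<bar>incr_cov h k l\<bar> \<le> u h" if "k < l" for k l
    using incr_cov_off[OF assms that] w_bounds(1)[OF assms, of "l - k"] w_le_u[OF assms, of "l - k"] that by simp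
  then show ?thesis
    using incr_cov_diag[OF assms, of k] u_bounds(3)[OF assms]
    by (cases k l rule: linorder_cases) (fastforce simp: incr_cov_commute[of h k l])+
qed

text \<open>The diagonal entry is \<open>2 * u h\<close> and each side contributes at most
  \<open>u h\<close> by \<open>w_sum\<close>. For the squares, one factor of an off-diagonal entry
  is replaced by its bound of order \<open>h^2\<close>.\<close>

lemma incr_cov_row:
  assumes "0 \<le> h" "k < m"
  shows "(\<Sum>l<m. \<bar>incr_cov h k l\<bar>) \<le> 4 * u h"
    and "(\<Sum>l<m. (incr_cov h k l)\<^sup>2) \<le> 4 * (u h)\<^sup>2 + 4 * phi_sup * h\<^sup>2 * u h"
proof -
  have split: "{..<m} = {..<k} \<union> ({k} \<union> {k<..<m})" using assms by auto
  have sum_split: "(\<Sum>l<m. f l) = (\<Sum>l<k. f l) + (f k + (\<Sum>l\<in>{k<..<m}. f l))" for f :: "nat \<Rightarrow> real"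
    unfolding split by (subst sum.union_disjoint; (subst sum.union_disjoint)?) auto
  have left: "(\<Sum>l<k. g (k - l)) = (\<Sum>j\<in>{1..k}. g j)" for g :: "nat \<Rightarrow> real"
    by (rule sum.reindex_bij_witness[of _ "\<lambda>j. k - j" "\<lambda>l. k - l"]) auto
  have right: "(\<Sum>l\<in>{k<..<m}. g (l - k)) = (\<Sum>j\<in>{1..m - k - 1}. g j)" for g :: "nat \<Rightarrow> real"
    by (rule sum.reindex_bij_witness[of _ "\<lambda>j. k + j" "\<lambda>l. l - k"]) auto
  have nn: "0 \<le> w h j" if "1 \<le> j" for j using w_bounds[OF assms(1) that] by simp
  have "(\<Sum>l<k. \<bar>incr_cov h k l\<bar>) = (\<Sum>l<k. w h (k - l))"
    using nn by (intro sum.cong) (auto simp: incr_cov_off'[OF assms(1)])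
  also have "\<dots> \<le> u h" unfolding left by (rule w_sum) fact
  finally have 1: "(\<Sum>l<k. \<bar>incr_cov h k l\<bar>) \<le> u h" .
  have "(\<Sum>l\<in>{k<..<m}. \<bar>incr_cov h k l\<bar>) = (\<Sum>l\<in>{k<..<m}. w h (l - k))"
    using nn by (intro sum.cong) (auto simp: incr_cov_off[OF assms(1)])
  also have "\<dots> \<le> u h" unfolding right by (rule w_sum) fact
  finally have 2: "(\<Sum>l\<in>{k<..<m}. \<bar>incr_cov h k l\<bar>) \<le> u h" .
  show "(\<Sum>l<m. \<bar>incr_cov h k l\<bar>) \<le> 4 * u h"
    unfolding sum_split using 1 2 incr_cov_diag[OF assms(1)] u_bounds(3)[OF assms(1)] by simp
  have sq: "(incr_cov h k l)\<^sup>2 \<le> 2 * phi_sup * h\<^sup>2 * \<bar>incr_cov h k l\<bar>" if "l \<noteq> k" for l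
  proof -
    have "\<bar>incr_cov h k l\<bar> \<le> 2 * phi_sup * h\<^sup>2"
    proof (cases "k < l")
      case True
      then show ?thesis using incr_cov_off[OF assms(1) True] w_bounds[OF assms(1), of "l - k"] by simp
    next
      case False
      then have "l < k" using that by simp
      then show ?thesis using incr_cov_off'[OF assms(1)] w_bounds[OF assms(1), of "k - l"] by simp
    qed
    then have "\<bar>incr_cov h k l\<bar> * \<bar>incr_cov h k l\<bar> \<le> 2 * phi_sup * h\<^sup>2 * \<bar>incr_cov h k l\<bar>"
      by (rule mult_right_mono) simp
    then show ?thesis by (simp add: power2_eq_square)
  qed
  have "(\<Sum>l<k. (incr_cov h k l)\<^sup>2) \<le> (\<Sum>l<k. 2 * phi_sup * h\<^sup>2 * \<bar>incr_cov h k l\<bar>)"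
    by (intro sum_mono sq) auto
  also have "\<dots> \<le> 2 * phi_sup * h\<^sup>2 * u h"
    unfolding sum_distrib_left[symmetric] using 1 phi_sup(1) by (intro mult_left_mono) auto
  finally have 3: "(\<Sum>l<k. (incr_cov h k l)\<^sup>2) \<le> 2 * phi_sup * h\<^sup>2 * u h" .
  have "(\<Sum>l\<in>{k<..<m}. (incr_cov h k l)\<^sup>2) \<le> (\<Sum>l\<in>{k<..<m}. 2 * phi_sup * h\<^sup>2 * \<bar>incr_cov h k l\<bar>)"
    by (intro sum_mono sq) auto
  also have "\<dots> \<le> 2 * phi_sup * h\<^sup>2 * u h"
    unfolding sum_distrib_left[symmetric] using 2 phi_sup(1) by (intro mult_left_mono) auto
  finally have 4: "(\<Sum>l\<in>{k<..<m}. (incr_cov h k l)\<^sup>2) \<le> 2 * phi_sup * h\<^sup>2 * u h" .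
  show "(\<Sum>l<m. (incr_cov h k l)\<^sup>2) \<le> 4 * (u h)\<^sup>2 + 4 * phi_sup * h\<^sup>2 * u h"
    unfolding sum_split using 3 4 incr_cov_diag[OF assms(1)] by (simp add: power_mult_distrib)
qed

text \<open>The first bound absorbs error terms. The other two differ by
  \<open>4 * phi_sup * h^2 * u h\<close> per row and pin the sum to its diagonal, which is what
  fixes the limiting variance in the Gaussian case.\<close>

lemma incr_cov_square_sum:
  assumes "0 \<le> h"
  shows "(\<Sum>k<m. \<Sum>l<m. (incr_cov h k l)\<^sup>2) \<le> 8 * real m * (u h)\<^sup>2"
    and "(\<Sum>k<m. \<Sum>l<m. (incr_cov h k l)\<^sup>2) \<le> real m * (4 * (u h)\<^sup>2 + 4 * phi_sup * h\<^sup>2 * u h)"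
    and "real m * (4 * (u h)\<^sup>2) \<le> (\<Sum>k<m. \<Sum>l<m. (incr_cov h k l)\<^sup>2)"
proof -
  have row: "(\<Sum>l<m. (incr_cov h k l)\<^sup>2) \<le> 8 * (u h)\<^sup>2" if "k < m" for k
  proof -
    have "(incr_cov h k l)\<^sup>2 \<le> 2 * u h * \<bar>incr_cov h k l\<bar>" for l
      using mult_right_mono[OF abs_incr_cov_le[OF assms, of k l], of "\<bar>incr_cov h k l\<bar>"] by (simp add: power2_eq_square)
    then have "(\<Sum>l<m. (incr_cov h k l)\<^sup>2) \<le> 2 * u h * (\<Sum>l<m. \<bar>incr_cov h k l\<bar>)"
      unfolding sum_distrib_left by (intro sum_mono) auto
    also have "\<dots> \<le> 2 * u h * (4 * u h)"
      using u_bounds(3)[OF assms] by (intro mult_left_mono incr_cov_row(1)[OF assms that]) auto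
    finally show ?thesis by (simp add: power2_eq_square)
  qed
  show "(\<Sum>k<m. \<Sum>l<m. (incr_cov h k l)\<^sup>2) \<le> 8 * real m * (u h)\<^sup>2"
    using sum_bounded_above[of "{..<m}" "\<lambda>k. \<Sum>l<m. (incr_cov h k l)\<^sup>2" "8 * (u h)\<^sup>2"] row by (simp add: mult_ac)
  show "(\<Sum>k<m. \<Sum>l<m. (incr_cov h k l)\<^sup>2) \<le> real m * (4 * (u h)\<^sup>2 + 4 * phi_sup * h\<^sup>2 * u h)"
    using sum_bounded_above[of "{..<m}" "\<lambda>k. \<Sum>l<m. (incr_cov h k l)\<^sup>2"] incr_cov_row(2)[OF assms] by simp
  have "4 * (u h)\<^sup>2 \<le> (\<Sum>l<m. (incr_cov h k l)\<^sup>2)" if "k < m" for k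
    using member_le_sum[of k "{..<m}" "\<lambda>l. (incr_cov h k l)\<^sup>2"] that incr_cov_diag[OF assms, of k]
    by (simp add: power_mult_distrib)
  then show "real m * (4 * (u h)\<^sup>2) \<le> (\<Sum>k<m. \<Sum>l<m. (incr_cov h k l)\<^sup>2)"
    using sum_bounded_below[of "{..<m}" "4 * (u h)\<^sup>2" "\<lambda>k. \<Sum>l<m. (incr_cov h k l)\<^sup>2"] by simp
qed

text \<open>
  Every point of the basis enters the trawl once and leaves it once, so up to boundary terms
  the deaths contribute to the sum of squared increments as much as the births do.
\<close>

lemma squared_increments_vs_births:
  fixes m :: nat
  assumes "0 \<le> h"
  defines "V \<equiv> \<lambda>\<omega>. (\<Sum>k<m. (dX h k \<omega>)\<^sup>2) - 2 * (\<Sum>k<m. (Z (birth h k) \<omega>)\<^sup>2)"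
  shows "integrable M (\<lambda>\<omega>. (V \<omega>)\<^sup>2)"
    and "expectation (\<lambda>\<omega>. (V \<omega>)\<^sup>2) \<le> 24 * real m * (u h)\<^sup>2 + 2 * excess * R 0"
proof -
  \<comment> \<open>Index pairs with \<open>True\<close> carry an increment with weight 1, those
    with \<open>False\<close> a birth variable with weight -2, so that \<open>V\<close> becomes one
    centred quadratic form.\<close>
  define K where "K = {..<m} \<times> (UNIV :: bool set)"
  define X where "X x = (if snd x then dX h (fst x) else Z (birth h (fst x)))" for x :: "nat \<times> bool"
  define f where "f x = (if snd x then dF h (fst x) else indicator (birth h (fst x)))" for x :: "nat \<times> bool"
  define s where "s x = (if snd x then 1 else - 2 :: real)" for x :: "nat \<times> bool"
  have K: "finite K" by (simp add: K_def)
  have sumK: "(\<Sum>x\<in>K. g x) = (\<Sum>k<m. g (k, True) + g (k, False))" for g :: "nat \<times> bool \<Rightarrow> real"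
    unfolding K_def by (simp add: sum.cartesian_product' UNIV_bool add.commute)
  have l: "lin (f x) (X x)" for x
    by (auto simp: f_def X_def intro: lin_dX lin_indicator birth_death_finite_borel)
  have bb: "ip (indicator (birth h k)) (indicator (birth h l)) = (if k = l then u h else 0)" for k l
    using birth_disjoint[OF assms(1), of UNIV] birth_death_measure(1)[OF assms(1)]
    by (auto simp: ip_indicator disjoint_family_on_def)
  have V: "V \<omega> = (\<Sum>x\<in>K. s x * (X x \<omega> * X x \<omega> - ip (f x) (f x)))" for \<omega>
    unfolding sumK V_def
    by (simp add: s_def X_def f_def bb incr_cov_diag[OF assms(1)] flip: incr_cov_def)
      (simp add: power2_eq_square sum_subtractf sum.distrib sum_distrib_left algebra_simps)
  note q = quadratic_variance[OF K l l, of s]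
  show "integrable M (\<lambda>\<omega>. (V \<omega>)\<^sup>2)" unfolding V by (rule q(1))
  have "(\<Sum>x\<in>K. \<Sum>y\<in>K. s x * s y * (ip (f x) (f y) * ip (f x) (f y) + ip (f x) (f y) * ip (f x) (f y)))
      = (\<Sum>k<m. \<Sum>l<m. 2 * (incr_cov h k l)\<^sup>2 - 4 * (ip (dF h k) (indicator (birth h l)))\<^sup>2
          - 4 * (ip (indicator (birth h k)) (dF h l))\<^sup>2 + 8 * (if k = l then (u h)\<^sup>2 else 0))"
    unfolding sumK sum.distrib[symmetric]
    by (intro sum.cong refl) (simp add: s_def f_def bb incr_cov_def power2_eq_square)
  also have "\<dots> \<le> (\<Sum>k<m. \<Sum>l<m. 2 * (incr_cov h k l)\<^sup>2 + 8 * (if k = l then (u h)\<^sup>2 else 0))"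
    by (intro sum_mono) simp
  also have "\<dots> = 2 * (\<Sum>k<m. \<Sum>l<m. (incr_cov h k l)\<^sup>2) + 8 * (real m * (u h)\<^sup>2)"
    by (simp add: sum.distrib sum_distrib_left[symmetric])
  also have "\<dots> \<le> 24 * real m * (u h)\<^sup>2"
    using incr_cov_square_sum(1)[OF assms(1), of m] by simp
  finally have 1: "(\<Sum>x\<in>K. \<Sum>y\<in>K. s x * s y * (ip (f x) (f y) * ip (f x) (f y) + ip (f x) (f y) * ip (f x) (f y)))
      \<le> 24 * real m * (u h)\<^sup>2" .
  \<comment> \<open>Pointwise, \<open>dF^2\<close> is births plus deaths, so subtracting twice the
    births leaves deaths minus births, that is \<open>- dF\<close>. The sum over the steps
    telescopes, and the cumulant part stays bounded in \<open>m\<close>.\<close>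
  have pw: "(\<Sum>x\<in>K. s x * (f x q * f x q)) = indicator (A 0) q - indicator (A (real m * h)) q" for q
  proof -
    have "(\<Sum>x\<in>K. s x * (f x q * f x q)) = (\<Sum>k<m. - dF h k q)"
      unfolding sumK
      by (intro sum.cong refl) (auto simp: s_def f_def dF_birth_death birth_def death_def indicator_def)
    also have "\<dots> = - (\<Sum>k<m. indicator (A (real (Suc k) * h)) q - indicator (A (real k * h)) q)"
      unfolding sum_negf by (simp add: dF_def)
    also have "\<dots> = indicator (A 0) q - indicator (A (real m * h)) q"
      by (subst sum_lessThan_telescope) simp
    finally show ?thesis .
  qed
  have i: "integrable lborel (indicator (A t) :: _ \<Rightarrow> real)" "(\<integral>q. indicator (A t) q \<partial>lborel) = R 0" for t
    using A_finite_borel[of t] A_Int[of t t] by (auto simp: finite_borel_def)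
  have "(\<integral>q. (\<Sum>x\<in>K. s x * (f x q * f x q))\<^sup>2 \<partial>lborel) \<le> (\<integral>q. indicator (A 0) q + indicator (A (real m * h)) q \<partial>lborel)"
    unfolding pw
    by (rule integral_mono', intro Bochner_Integration.integrable_add i) (auto simp: indicator_def)
  also have "\<dots> = 2 * R 0" using i by simp
  finally have 2: "(\<integral>q. (\<Sum>x\<in>K. s x * (f x q * f x q))\<^sup>2 \<partial>lborel) \<le> 2 * R 0" .
  show "expectation (\<lambda>\<omega>. (V \<omega>)\<^sup>2) \<le> 24 * real m * (u h)\<^sup>2 + 2 * excess * R 0"
    unfolding V q(2) using 1 mult_left_mono[OF 2 excess_nonneg] by simp
qed

text \<open>Of the two parts of the variance, the Gaussian one is a sum of products of covariances.
  The cumulant one charges only points that enter in one step and leave in the next, an area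
  \<open>w h 1\<close> of order \<open>h^2\<close> per step.\<close>

lemma increment_products:
  fixes m :: nat
  assumes "0 \<le> h"
  defines "V \<equiv> \<lambda>\<omega>. \<Sum>k\<in>{1..<m}. dX h k \<omega> * dX h (k - 1) \<omega> + w h 1"
  shows "integrable M (\<lambda>\<omega>. (V \<omega>)\<^sup>2)"
    and "expectation (\<lambda>\<omega>. (V \<omega>)\<^sup>2) \<le> 16 * real m * (u h)\<^sup>2 + excess * (real m * (2 * phi_sup * h\<^sup>2))"
proof -
  let ?K = "{1..<m}"
  have r1: "ip (dF h k) (dF h (k - 1)) = - w h 1" if "k \<in> ?K" for k
    using incr_cov_off'[OF assms(1), of "k - 1" k] that by (simp add: incr_cov_def)
  have V: "V \<omega> = (\<Sum>k\<in>?K. 1 * (dX h k \<omega> * dX h (k - 1) \<omega> - ip (dF h k) (dF h (k - 1))))" for \<omega>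
    unfolding V_def by (intro sum.cong refl) (simp add: r1[simplified])
  have K: "finite ?K" by simp
  note q = quadratic_variance[where f = "dF h" and A = "dX h" and g = "\<lambda>k. dF h (k - 1)" and B = "\<lambda>k. dX h (k - 1)"
      and s = "\<lambda>_. 1", OF K lin_dX lin_dX]
  show "integrable M (\<lambda>\<omega>. (V \<omega>)\<^sup>2)" unfolding V by (rule q(1))
  have sub: "(\<Sum>k\<in>?K. \<Sum>l\<in>?K. (incr_cov h (i k) (j l))\<^sup>2) \<le> (\<Sum>k<m. \<Sum>l<m. (incr_cov h k l)\<^sup>2)"
    if ij: "inj_on i ?K" "i ` ?K \<subseteq> {..<m}" "inj_on j ?K" "j ` ?K \<subseteq> {..<m}" for i j
  proof -
    have "(\<Sum>k\<in>?K. \<Sum>l\<in>?K. (incr_cov h (i k) (j l))\<^sup>2) = (\<Sum>k\<in>i ` ?K. \<Sum>l\<in>j ` ?K. (incr_cov h k l)\<^sup>2)"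
      using ij by (simp add: sum.reindex)
    also have "\<dots> \<le> (\<Sum>k\<in>i ` ?K. \<Sum>l<m. (incr_cov h k l)\<^sup>2)"
      using ij by (intro sum_mono sum_mono2) auto
    also have "\<dots> \<le> (\<Sum>k<m. \<Sum>l<m. (incr_cov h k l)\<^sup>2)"
      using ij by (intro sum_mono2 sum_nonneg) auto
    finally show ?thesis .
  qed
  have inj: "inj_on (\<lambda>k. k - 1) ?K" "(\<lambda>k. k - 1) ` ?K \<subseteq> {..<m}" "inj_on (\<lambda>k. k) ?K" "(\<lambda>k. k) ` ?K \<subseteq> {..<m}"
    by (auto simp: inj_on_def)
  have ab: "x * y \<le> (x\<^sup>2 + y\<^sup>2) / 2" for x y :: real
    using sum_squares_bound[of x y] by simp
  have "(\<Sum>k\<in>?K. \<Sum>l\<in>?K. 1 * 1 * (ip (dF h k) (dF h l) * ip (dF h (k - 1)) (dF h (l - 1))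
       + ip (dF h k) (dF h (l - 1)) * ip (dF h (k - 1)) (dF h l)))
     \<le> (\<Sum>k\<in>?K. \<Sum>l\<in>?K. ((incr_cov h k l)\<^sup>2 + (incr_cov h (k - 1) (l - 1))\<^sup>2) / 2
        + ((incr_cov h k (l - 1))\<^sup>2 + (incr_cov h (k - 1) l)\<^sup>2) / 2)"
    unfolding incr_cov_def[symmetric] mult_1_left by (intro sum_mono add_mono ab)
  also have "\<dots> = ((\<Sum>k\<in>?K. \<Sum>l\<in>?K. (incr_cov h k l)\<^sup>2) + (\<Sum>k\<in>?K. \<Sum>l\<in>?K. (incr_cov h (k - 1) (l - 1))\<^sup>2)
      + (\<Sum>k\<in>?K. \<Sum>l\<in>?K. (incr_cov h k (l - 1))\<^sup>2) + (\<Sum>k\<in>?K. \<Sum>l\<in>?K. (incr_cov h (k - 1) l)\<^sup>2)) / 2"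
    by (simp add: sum.distrib add_divide_distrib sum_divide_distrib)
  also have "\<dots> \<le> 16 * real m * (u h)\<^sup>2"
    using sub[OF inj(3,4,3,4)] sub[OF inj(1,2,1,2)] sub[OF inj(3,4,1,2)] sub[OF inj(1,2,3,4)]
      incr_cov_square_sum(1)[OF assms(1), of m] by simp
  finally have 1: "(\<Sum>k\<in>?K. \<Sum>l\<in>?K. 1 * 1 * (ip (dF h k) (dF h l) * ip (dF h (k - 1)) (dF h (l - 1))
       + ip (dF h k) (dF h (l - 1)) * ip (dF h (k - 1)) (dF h l))) \<le> 16 * real m * (u h)\<^sup>2" .
  define g where "g q k = dF h k q * dF h (k - 1) q" for q k
  \<comment> \<open>\<open>g q k\<close> is -1 if \<open>q\<close> enters in step
    \<open>k - 1\<close> and leaves in step \<open>k\<close>, and 0 otherwise: the pattern inside,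
    outside, inside is impossible.\<close>
  have g1: "g q k * g q k = - g q k" if "k \<in> ?K" for q k
  proof -
    have "real (k - 1 + 1) = real k" using that by simp
    moreover have "q \<in> A (real k * h)" if "q \<in> A (real (k - 1) * h)" "q \<in> A (real (k + 1) * h)"
      using grid_interval[OF assms(1) that] by simp
    ultimately show ?thesis
      by (auto simp: g_def dF_def indicator_def)
  qed
  \<comment> \<open>A point leaves at most once, so the short-lived points of different steps are
    distinct and the square of the sum has no cross terms.\<close>
  have g2: "g q k * g q l = 0" if "k \<in> ?K" "l \<in> ?K" "k < l" for q k l
  proof (rule ccontr)
    assume "g q k * g q l \<noteq> 0"
    then have nz: "g q k \<noteq> 0" "g q l \<noteq> 0" by auto
    have in1: "q \<in> A (real j * h) \<and> q \<notin> A (real (j + 1) * h)" if "j \<in> ?K" "g q j \<noteq> 0" for j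
    proof -
      have j: "real (j - 1 + 1) = real j" using that by simp
      have "q \<in> A (real j * h)" if "q \<in> A (real (j - 1) * h)" "q \<in> A (real (j + 1) * h)"
        using grid_interval[OF assms(1) that] by simp
      then show ?thesis
        using that(2) unfolding g_def dF_def j
        by (cases "q \<in> A (real (j - 1) * h)"; cases "q \<in> A (real j * h)"; cases "q \<in> A (real (j + 1) * h)")
          (simp_all only: indicator_simps, simp_all)
    qed
    have "q \<in> A (real (k + 1) * h)"
      using grid_interval[OF assms(1), of q k l "k + 1"] in1[OF that(1) nz(1)] in1[OF that(2) nz(2)] that(3) by auto
    with in1[OF that(1) nz(1)] show False by simp
  qed
  have pw: "(\<Sum>k\<in>?K. 1 * (dF h k q * dF h (k - 1) q))\<^sup>2 = (\<Sum>k\<in>?K. - g q k)" for q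
  proof -
    have "(\<Sum>k\<in>?K. 1 * (dF h k q * dF h (k - 1) q))\<^sup>2 = (\<Sum>k\<in>?K. \<Sum>l\<in>?K. g q k * g q l)"
      by (simp add: power2_eq_square sum_product g_def)
    also have "\<dots> = (\<Sum>k\<in>?K. \<Sum>l\<in>?K. if k = l then - g q k else 0)"
    proof (intro sum.cong refl)
      fix k l assume kl: "k \<in> ?K" "l \<in> ?K"
      show "g q k * g q l = (if k = l then - g q k else 0)"
        using g1[OF kl(1)] g2[OF kl] g2[OF kl(2,1)] by (cases k l rule: linorder_cases) (auto simp: mult.commute)
    qed
    also have "\<dots> = (\<Sum>k\<in>?K. - g q k)" by simp
    finally show ?thesis .
  qed
  have "(\<integral>q. (\<Sum>k\<in>?K. 1 * (dF h k q * dF h (k - 1) q))\<^sup>2 \<partial>lborel) = (\<Sum>k\<in>?K. - ip (dF h k) (dF h (k - 1)))"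
    unfolding pw g_def ip_def
    by (subst Bochner_Integration.integral_sum)
      (auto intro!: bounded_integrableD bounded_integrable_mult dF_bounded_integrable)
  also have "\<dots> = real (m - 1) * w h 1" by (simp add: r1[simplified])
  also have "\<dots> \<le> real m * (2 * phi_sup * h\<^sup>2)"
    using w_bounds[OF assms(1), of 1] by (intro mult_mono) auto
  finally have 2: "(\<integral>q. (\<Sum>k\<in>?K. 1 * (dF h k q * dF h (k - 1) q))\<^sup>2 \<partial>lborel) \<le> real m * (2 * phi_sup * h\<^sup>2)" .
  show "expectation (\<lambda>\<omega>. (V \<omega>)\<^sup>2) \<le> 16 * real m * (u h)\<^sup>2 + excess * (real m * (2 * phi_sup * h\<^sup>2))"
    unfolding V q(2) using 1 mult_left_mono[OF 2 excess_nonneg] by simp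
qed

end

section \<open>Limit theorems for triangular arrays\<close>

lemma exp_minus_quadratic_bound:
  fixes x :: real
  assumes "0 \<le> x"
  shows "\<bar>exp (- x) - (1 - x)\<bar> \<le> x\<^sup>2 / 2"
proof -
  let ?f = "\<lambda>x::real. 1 - x + x\<^sup>2 / 2 - exp (- x)"
  have "?f 0 \<le> ?f x"
  proof (rule DERIV_nonneg_imp_nondecreasing[OF assms])
    fix y :: real assume "0 \<le> y" "y \<le> x"
    have "(?f has_real_derivative (- 1 + y + exp (- y))) (at y)"
      by (auto intro!: derivative_eq_intros)
    moreover have "0 \<le> - 1 + y + exp (- y)" using exp_ge_add_one_self[of "- y"] by linarith
    ultimately show "\<exists>z. (?f has_real_derivative z) (at y) \<and> 0 \<le> z" by blast
  qed
  moreover have "1 - x \<le> exp (- x)" using exp_ge_add_one_self[of "- x"] by linarith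
  ultimately show ?thesis by simp
qed

context prob_space
begin

lemma vanishing_mult2:
  assumes "vanishing X" "vanishing Y"
  shows "vanishing (\<lambda>n \<omega>. X n \<omega> * Y n \<omega>)"
proof (rule vanishingI)
  note mX = vanishing_measurable[OF assms(1)] and mY = vanishing_measurable[OF assms(2)]
  show "(\<lambda>\<omega>. X n \<omega> * Y n \<omega>) \<in> borel_measurable M" for n
    using mX[of n] mY[of n] by measurable
  show "(\<lambda>n. expectation (\<lambda>\<omega>. min 1 \<bar>X n \<omega>\<bar>) + expectation (\<lambda>\<omega>. min 1 \<bar>Y n \<omega>\<bar>)) \<longlonglongrightarrow> 0"
    using assms by (intro tendsto_add_zero) (auto simp: vanishing_def)
  have key: "min 1 \<bar>x * y\<bar> \<le> min 1 \<bar>x\<bar> + min 1 \<bar>y\<bar>" for x y :: real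
  proof (cases "\<bar>x\<bar> \<le> 1 \<and> \<bar>y\<bar> \<le> 1")
    case True
    then have "\<bar>x * y\<bar> \<le> \<bar>x\<bar> * 1" unfolding abs_mult by (intro mult_left_mono) auto
    moreover have "min 1 \<bar>x * y\<bar> \<le> \<bar>x * y\<bar>" "min 1 \<bar>x\<bar> = \<bar>x\<bar>" "0 \<le> min 1 \<bar>y\<bar>"
      using True by auto
    ultimately show ?thesis by linarith
  qed (auto simp: min_def)
  have "expectation (\<lambda>\<omega>. min 1 \<bar>X n \<omega> * Y n \<omega>\<bar>)
      \<le> expectation (\<lambda>\<omega>. min 1 \<bar>X n \<omega>\<bar> + min 1 \<bar>Y n \<omega>\<bar>)" for n
    using mX[of n] mY[of n] key
    by (intro integral_mono integrable_min1 Bochner_Integration.integrable_add) auto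
  then show "\<forall>\<^sub>F n in sequentially. expectation (\<lambda>\<omega>. min 1 \<bar>X n \<omega> * Y n \<omega>\<bar>)
      \<le> expectation (\<lambda>\<omega>. min 1 \<bar>X n \<omega>\<bar>) + expectation (\<lambda>\<omega>. min 1 \<bar>Y n \<omega>\<bar>)"
    using mX mY by (simp add: integrable_min1)
qed

text \<open>The common final step of both cases: \<open>W\<close> has a normal limit,
  \<open>S\<close> is close to \<open>W\<close>, and the statistic \<open>T\<close> is
  \<open>S\<close> over the square root of the random \<open>Q\<close>. The L1 bound of
  \<open>W\<close> provides the tightness that lets it be multiplied by a vanishing factor.\<close>

lemma slutsky_ratio:
  fixes W S Q T :: "nat \<Rightarrow> 'a \<Rightarrow> real"
  assumes W: "\<And>n. random_variable borel (W n)"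
    and charW: "\<And>t. (\<lambda>n. char (distr M borel (W n)) t) \<longlonglongrightarrow> complex_of_real (exp (- (v * t\<^sup>2 / 2)))"
    and L1: "\<forall>\<^sub>F n in sequentially. integrable M (W n) \<and> expectation (\<lambda>\<omega>. \<bar>W n \<omega>\<bar>) \<le> B"
    and SW: "vanishing (\<lambda>n \<omega>. S n \<omega> - W n \<omega>)"
    and Q: "vanishing (\<lambda>n \<omega>. Q n \<omega> - c)"
    and T: "\<And>n. random_variable borel (T n)" "\<forall>\<^sub>F n in sequentially. \<forall>\<omega>. T n \<omega> = sqrt (1 / Q n \<omega>) * S n \<omega>"
    and pos: "0 < c" "0 < v"
  shows "weak_conv_m (\<lambda>n. distr M borel (T n)) (density lborel (normal_density 0 (sqrt (v / c))))"
proof -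
  define g where "g q = sqrt (1 / q)" for q :: real
  have g: "vanishing (\<lambda>n \<omega>. g (Q n \<omega>) - g c)"
  proof (rule vanishing_continuous[OF Q])
    show "isCont g c" unfolding g_def using pos by (intro continuous_intros) auto
    show "g \<in> borel_measurable borel" unfolding g_def by measurable
  qed
  \<comment> \<open>The expansion of \<open>S * g Q - g c * W\<close> around \<open>W\<close> and
    \<open>g c\<close>.\<close>
  have "vanishing (\<lambda>n \<omega>. (S n \<omega> - W n \<omega>) * (g (Q n \<omega>) - g c) + (g c * (S n \<omega> - W n \<omega>) + W n \<omega> * (g (Q n \<omega>) - g c)))"
    by (intro vanishing_add vanishing_mult2 SW g vanishing_mult[OF g W L1] vanishing_scale[OF SW, of _ "\<bar>g c\<bar>"]) auto
  then have V: "vanishing (\<lambda>n \<omega>. T n \<omega> - g c * W n \<omega>)"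
  proof (rule vanishing_cong)
    show "(\<lambda>\<omega>. T n \<omega> - g c * W n \<omega>) \<in> borel_measurable M" for n
      using T(1)[of n] W[of n] by measurable
    show "\<forall>\<^sub>F n in sequentially. AE \<omega> in M. T n \<omega> - g c * W n \<omega>
        = (S n \<omega> - W n \<omega>) * (g (Q n \<omega>) - g c) + (g c * (S n \<omega> - W n \<omega>) + W n \<omega> * (g (Q n \<omega>) - g c))"
      using T(2) by eventually_elim (simp add: g_def[symmetric] algebra_simps)
  qed
  show ?thesis
  proof (rule levy_continuity)
    show "real_distribution (distr M borel (T n))" for n using T(1) by (rule real_distribution_distr)
    show "real_distribution (density lborel (normal_density 0 (sqrt (v / c))))"
      using pos by (intro real_distribution_normal) simp
    fix t
    show "(\<lambda>n. char (distr M borel (T n)) t) \<longlonglongrightarrow> char (density lborel (normal_density 0 (sqrt (v / c)))) t"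
    proof (rule char_vanishing[OF V])
      show "(\<lambda>\<omega>. g c * W n \<omega>) \<in> borel_measurable M" for n using W[of n] by measurable
      have "char (distr M borel (\<lambda>\<omega>. g c * W n \<omega>)) t = char (distr M borel (W n)) (t * g c)" for n
        using W[of n] by (simp add: char_def integral_distr mult.assoc)
      moreover have "char (density lborel (normal_density 0 (sqrt (v / c)))) t = complex_of_real (exp (- (v * (t * g c)\<^sup>2 / 2)))"
        using pos by (subst char_normal) (auto simp: g_def power_mult_distrib)
      ultimately show "(\<lambda>n. char (distr M borel (\<lambda>\<omega>. g c * W n \<omega>)) t) \<longlonglongrightarrow> char (density lborel (normal_density 0 (sqrt (v / c)))) t"
        using charW[of "t * g c"] by simp
    qed (rule T(1))
  qed
qed

text \<open>Lyapunov's theorem by comparing characteristic functions factor by factor: factors of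
  modulus at most 1 make the difference of two products at most the sum of the differences.\<close>

lemma triangular_clt:
  fixes X :: "nat \<Rightarrow> nat \<Rightarrow> 'a \<Rightarrow> real" and m :: "nat \<Rightarrow> nat"
  assumes ev: "\<forall>\<^sub>F n in sequentially. 0 \<le> v n \<and> indep_vars (\<lambda>_. borel) (X n) {..<m n} \<and>
      (\<forall>k<m n. integrable M (\<lambda>\<omega>. (X n k \<omega>)\<^sup>2) \<and> expectation (X n k) = 0 \<and> expectation (\<lambda>\<omega>. (X n k \<omega>)\<^sup>2) = v n \<and>
        integrable M (\<lambda>\<omega>. \<bar>X n k \<omega>\<bar> powr q) \<and> expectation (\<lambda>\<omega>. \<bar>X n k \<omega>\<bar> powr q) \<le> e n)"
    and q: "2 < q" "q \<le> 3"
    and mv: "(\<lambda>n. real (m n) * v n) \<longlonglongrightarrow> s" and v: "v \<longlonglongrightarrow> 0" and me: "(\<lambda>n. real (m n) * e n) \<longlonglongrightarrow> 0"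
  shows "(\<lambda>n. char (distr M borel (\<lambda>\<omega>. \<Sum>k<m n. X n k \<omega>)) t) \<longlonglongrightarrow> complex_of_real (exp (- (s * t\<^sup>2 / 2)))"
proof -
  \<comment> \<open>The first term is the Taylor error of the characteristic function of one
    summand, the second the error of replacing \<open>1 - x\<close> by
    \<open>exp (- x)\<close>.\<close>
  define err where "err n = t\<^sup>2 / 6 * (6 + \<bar>t\<bar>) * (real (m n) * e n) + t ^ 4 / 8 * (real (m n) * v n * v n)" for n
  have "(\<lambda>n. real (m n) * v n * v n) \<longlonglongrightarrow> s * 0"
    by (intro tendsto_mult mv v)
  then have err0: "err \<longlonglongrightarrow> 0"
    unfolding err_def using me by (intro tendsto_add_zero tendsto_mult_right_zero) auto
  have bound: "\<forall>\<^sub>F n in sequentially. cmod (char (distr M borel (\<lambda>\<omega>. \<Sum>k<m n. X n k \<omega>)) t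
      - complex_of_real (exp (- (real (m n) * v n * t\<^sup>2 / 2)))) \<le> err n"
    using ev
  proof eventually_elim
    case (elim n)
    then have v0: "0 \<le> v n" and ind: "indep_vars (\<lambda>_. borel) (X n) {..<m n}" by auto
    have rv: "random_variable borel (X n k)" if "k < m n" for k
      using ind that by (auto simp: indep_vars_def)
    define \<phi> where "\<phi> k = char (distr M borel (X n k)) t" for k
    define z where "z = complex_of_real (exp (- (t\<^sup>2 * v n / 2)))"
    have one: "cmod (\<phi> k - z) \<le> t\<^sup>2 / 6 * ((6 + \<bar>t\<bar>) * e n) + t ^ 4 / 8 * (v n * v n)" if k: "k < m n" for k
    proof -
      have i2: "integrable M (\<lambda>\<omega>. (X n k \<omega>)\<^sup>2)" and e0: "expectation (X n k) = 0"
        and e2: "expectation (\<lambda>\<omega>. (X n k \<omega>)\<^sup>2) = v n"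
        and iq: "integrable M (\<lambda>\<omega>. \<bar>X n k \<omega>\<bar> powr q)" and eq: "expectation (\<lambda>\<omega>. \<bar>X n k \<omega>\<bar> powr q) \<le> e n"
        using elim k by auto
      have i1: "integrable M (X n k)" using square_integrable_imp_integrable[OF rv[OF k] i2] .
      \<comment> \<open>An exponent \<open>q\<close> between 2 and 3 interpolates between the
        quadratic and the cubic remainder: the cube is used for \<open>|x| <= 1\<close>, the square
        beyond.\<close>
      have pw: "min (6 * x\<^sup>2) (\<bar>t\<bar> * \<bar>x\<bar> ^ 3) \<le> (6 + \<bar>t\<bar>) * \<bar>x\<bar> powr q" for x :: real
      proof (cases "\<bar>x\<bar> \<le> 1")
        case True
        have "\<bar>x\<bar> ^ 3 \<le> \<bar>x\<bar> powr q"
        proof (cases "x = 0")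
          case False
          then have "\<bar>x\<bar> ^ 3 = \<bar>x\<bar> powr 3" by (simp add: powr_numeral)
          also have "\<dots> \<le> \<bar>x\<bar> powr q" using True False q by (intro powr_mono') auto
          finally show ?thesis .
        qed simp
        then have "\<bar>t\<bar> * \<bar>x\<bar> ^ 3 \<le> (6 + \<bar>t\<bar>) * \<bar>x\<bar> powr q" by (intro mult_mono) auto
        then show ?thesis by simp
      next
        case False
        then have "\<bar>x\<bar>\<^sup>2 = \<bar>x\<bar> powr 2" by (simp add: powr_numeral)
        also have "\<dots> \<le> \<bar>x\<bar> powr q" using False q by (intro powr_mono) auto
        finally have "6 * x\<^sup>2 \<le> (6 + \<bar>t\<bar>) * \<bar>x\<bar> powr q" by (intro mult_mono) auto
        then show ?thesis by simp
      qed
      have "cmod (\<phi> k - (1 - t\<^sup>2 * v n / 2)) \<le> t\<^sup>2 / 6 * expectation (\<lambda>\<omega>. min (6 * (X n k \<omega>)\<^sup>2) (\<bar>t\<bar> * \<bar>X n k \<omega>\<bar> ^ 3))"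
        unfolding \<phi>_def by (rule char_approx3'[OF rv[OF k] i1 i2 e0]) (use e0 e2 in auto)
      also have "\<dots> \<le> t\<^sup>2 / 6 * expectation (\<lambda>\<omega>. (6 + \<bar>t\<bar>) * \<bar>X n k \<omega>\<bar> powr q)"
        using pw iq by (intro mult_left_mono integral_mono') auto
      also have "\<dots> \<le> t\<^sup>2 / 6 * ((6 + \<bar>t\<bar>) * e n)"
        using eq by (auto intro!: mult_left_mono)
      finally have 1: "cmod (\<phi> k - (1 - t\<^sup>2 * v n / 2)) \<le> t\<^sup>2 / 6 * ((6 + \<bar>t\<bar>) * e n)" .
      have "cmod (z - (1 - t\<^sup>2 * v n / 2)) = \<bar>exp (- (t\<^sup>2 * v n / 2)) - (1 - t\<^sup>2 * v n / 2)\<bar>"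
        unfolding z_def by (metis (no_types) norm_of_real of_real_1 of_real_diff)
      also have "\<dots> \<le> (t\<^sup>2 * v n / 2)\<^sup>2 / 2"
        using v0 by (intro exp_minus_quadratic_bound) auto
      also have "\<dots> = t ^ 4 / 8 * (v n * v n)"
        by (simp add: power2_eq_square power4_eq_xxxx)
      finally have 2: "cmod (z - (1 - t\<^sup>2 * v n / 2)) \<le> t ^ 4 / 8 * (v n * v n)" .
      have "cmod (\<phi> k - z) \<le> cmod (\<phi> k - (1 - t\<^sup>2 * v n / 2)) + cmod (z - (1 - t\<^sup>2 * v n / 2))"
        using norm_triangle_ineq4[of "\<phi> k - (1 - t\<^sup>2 * v n / 2)" "z - (1 - t\<^sup>2 * v n / 2)"] by simp
      then show ?thesis using 1 2 by linarith
    qed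
    have "char (distr M borel (\<lambda>\<omega>. \<Sum>k<m n. X n k \<omega>)) t = (\<Prod>k<m n. \<phi> k)"
      unfolding \<phi>_def by (rule char_distr_sum[OF ind])
    moreover have "complex_of_real (exp (- (real (m n) * v n * t\<^sup>2 / 2))) = (\<Prod>k<m n. z)"
      unfolding z_def by (simp add: exp_of_nat_mult[symmetric] mult_ac flip: of_real_power)
    ultimately have "cmod (char (distr M borel (\<lambda>\<omega>. \<Sum>k<m n. X n k \<omega>)) t - complex_of_real (exp (- (real (m n) * v n * t\<^sup>2 / 2))))
        = cmod ((\<Prod>k<m n. \<phi> k) - (\<Prod>k<m n. z))" by simp
    also have "\<dots> \<le> (\<Sum>k<m n. cmod (\<phi> k - z))"
    proof (rule norm_prod_diff)
      fix k assume "k \<in> {..<m n}"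
      then interpret D: real_distribution "distr M borel (X n k)"
        using rv by (intro real_distribution_distr) auto
      show "cmod (\<phi> k) \<le> 1" unfolding \<phi>_def by (rule D.cmod_char_le_1)
      show "cmod z \<le> 1" unfolding z_def using v0 by simp
    qed
    also have "\<dots> \<le> (\<Sum>k<m n. t\<^sup>2 / 6 * ((6 + \<bar>t\<bar>) * e n) + t ^ 4 / 8 * (v n * v n))"
      using one by (intro sum_mono) auto
    also have "\<dots> = err n" by (simp add: err_def algebra_simps)
    finally show ?case .
  qed
  have lim: "(\<lambda>n. complex_of_real (exp (- (real (m n) * v n * t\<^sup>2 / 2)))) \<longlonglongrightarrow> complex_of_real (exp (- (s * t\<^sup>2 / 2)))"
    by (intro tendsto_of_real tendsto_intros mv) auto
  have "(\<lambda>n. char (distr M borel (\<lambda>\<omega>. \<Sum>k<m n. X n k \<omega>)) t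
      - complex_of_real (exp (- (real (m n) * v n * t\<^sup>2 / 2)))) \<longlonglongrightarrow> 0"
    by (rule Lim_null_comparison[OF bound err0])
  from tendsto_add[OF this lim] show ?thesis by (simp only: diff_add_cancel add_0_left)
qed

lemma indep_sum_square:
  fixes X :: "'k \<Rightarrow> 'a \<Rightarrow> real"
  assumes "finite I" "indep_vars (\<lambda>_. borel) X I"
    and "\<And>i. i \<in> I \<Longrightarrow> integrable M (\<lambda>\<omega>. (X i \<omega>)\<^sup>2)" "\<And>i. i \<in> I \<Longrightarrow> expectation (X i) = 0"
  shows "integrable M (\<lambda>\<omega>. (\<Sum>i\<in>I. X i \<omega>)\<^sup>2) \<and> expectation (\<lambda>\<omega>. (\<Sum>i\<in>I. X i \<omega>)\<^sup>2) = (\<Sum>i\<in>I. expectation (\<lambda>\<omega>. (X i \<omega>)\<^sup>2))"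
  using assms
proof (induction I rule: finite_induct)
  case (insert i I)
  let ?Y = "\<lambda>\<omega>. \<Sum>i\<in>I. X i \<omega>"
  have ind: "indep_var borel (X i) borel ?Y" by (rule indep_vars_sum) (use insert in auto)
  have indI: "indep_vars (\<lambda>_. borel) X I" using insert by (auto intro: indep_vars_subset)
  have IH: "integrable M (\<lambda>\<omega>. (?Y \<omega>)\<^sup>2)" "expectation (\<lambda>\<omega>. (?Y \<omega>)\<^sup>2) = (\<Sum>i\<in>I. expectation (\<lambda>\<omega>. (X i \<omega>)\<^sup>2))"
    using insert.IH[OF indI] insert.prems by auto
  have rv: "random_variable borel (X j)" if "j \<in> insert i I" for j
    using insert.prems(1) that by (auto simp: indep_vars_def)
  have i1: "integrable M (X i)" using square_integrable_imp_integrable[OF rv insert.prems(2)] by simp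
  have iY: "integrable M ?Y"
    using indep_var_rv2[OF ind] IH(1) by (rule square_integrable_imp_integrable)
  have c: "expectation (\<lambda>\<omega>. X i \<omega> * ?Y \<omega>) = 0" "integrable M (\<lambda>\<omega>. X i \<omega> * ?Y \<omega>)"
    using indep_var_lebesgue_integral[OF ind i1 iY] indep_var_integrable[OF ind i1 iY] insert.prems(3)[of i] by auto
  have e: "(\<Sum>j\<in>insert i I. X j \<omega>)\<^sup>2 = (X i \<omega>)\<^sup>2 + (?Y \<omega>)\<^sup>2 + 2 * (X i \<omega> * ?Y \<omega>)" for \<omega>
    using insert.hyps by (simp add: power2_sum mult.assoc)
  show ?case unfolding e using c IH insert.prems(2)[of i] insert.hyps by simp
qed simp

text \<open>Fourth powers have only slightly more than a first moment, so they are truncated at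
  level \<open>K\<close>. The truncated part is handled in L2, its squares being at most
  \<open>K^4 * x^4\<close>; the tail in L1, being at most \<open>K^(4 - p) * |x|^p\<close>. The
  level stays free so as to balance the two terms later.\<close>

lemma truncated_fourth_moment_lln:
  fixes X :: "nat \<Rightarrow> 'a \<Rightarrow> real"
  assumes ind: "indep_vars (\<lambda>_. borel) X {..<m}" and p: "4 < p" and K: "0 < K"
    and ip: "\<And>k. k < m \<Longrightarrow> integrable M (\<lambda>\<omega>. \<bar>X k \<omega>\<bar> powr p)"
    and B: "\<And>k. k < m \<Longrightarrow> expectation (\<lambda>\<omega>. \<bar>X k \<omega>\<bar> powr p) \<le> B"
    and D: "\<And>k. k < m \<Longrightarrow> expectation (\<lambda>\<omega>. X k \<omega> ^ 4) \<le> D"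
  shows "integrable M (\<lambda>\<omega>. \<Sum>k<m. X k \<omega> ^ 4 - expectation (\<lambda>\<omega>. X k \<omega> ^ 4))"
    and "expectation (\<lambda>\<omega>. \<bar>\<Sum>k<m. X k \<omega> ^ 4 - expectation (\<lambda>\<omega>. X k \<omega> ^ 4)\<bar>)
      \<le> sqrt (real m * (K ^ 4 * D)) + 2 * real m * (K powr (4 - p) * B)"
proof -
  have rv: "random_variable borel (X k)" if "k < m" for k
    using ind that by (auto simp: indep_vars_def)
  have i4: "integrable M (\<lambda>\<omega>. X k \<omega> ^ 4)" if "k < m" for k
    using fourth_moment_powr[OF rv ip] p that by (simp add: fourth_moment_def)
  define \<tau> where "\<tau> x = (if \<bar>x\<bar> \<le> K then x ^ 4 else 0)" for x :: real
  have \<tau>m: "\<tau> \<in> borel_measurable borel" unfolding \<tau>_def by measurable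
  have \<tau>b: "0 \<le> \<tau> x" "\<tau> x \<le> x ^ 4" "\<tau> x \<le> K ^ 4" for x
    using K power_mono[of "\<bar>x\<bar>" K 4] by (auto simp: \<tau>_def)
  have \<tau>r: "x ^ 4 - \<tau> x \<le> K powr (4 - p) * \<bar>x\<bar> powr p" for x
  proof (cases "\<bar>x\<bar> \<le> K")
    case False
    then have "x ^ 4 = \<bar>x\<bar> powr 4" using K by (simp add: powr_numeral)
    also have "\<dots> = \<bar>x\<bar> powr (4 - p) * \<bar>x\<bar> powr p" by (simp flip: powr_add)
    also have "\<dots> \<le> K powr (4 - p) * \<bar>x\<bar> powr p"
      using False K p by (intro mult_right_mono powr_mono2') auto
    finally show ?thesis using False by (simp add: \<tau>_def)
  qed (simp add: \<tau>_def)
  have rvT: "random_variable borel (\<lambda>\<omega>. \<tau> (X k \<omega>))" if "k < m" for k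
    using measurable_compose[OF rv[OF that] \<tau>m] .
  have iT: "integrable M (\<lambda>\<omega>. \<tau> (X k \<omega>))" if "k < m" for k
    by (rule Bochner_Integration.integrable_bound[OF i4[OF that] rvT[OF that]]) (use \<tau>b in auto)
  have iT2: "integrable M (\<lambda>\<omega>. (\<tau> (X k \<omega>))\<^sup>2)" "expectation (\<lambda>\<omega>. (\<tau> (X k \<omega>))\<^sup>2) \<le> K ^ 4 * D" if k: "k < m" for k
  proof -
    have b: "(\<tau> x)\<^sup>2 \<le> K ^ 4 * x ^ 4" for x
      unfolding power2_eq_square using \<tau>b by (intro mult_mono) auto
    have i: "integrable M (\<lambda>\<omega>. K ^ 4 * X k \<omega> ^ 4)" using i4[OF k] by simp
    show "integrable M (\<lambda>\<omega>. (\<tau> (X k \<omega>))\<^sup>2)"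
      by (rule Bochner_Integration.integrable_bound[OF i]) (use rvT[OF k] b in auto)
    have "expectation (\<lambda>\<omega>. (\<tau> (X k \<omega>))\<^sup>2) \<le> expectation (\<lambda>\<omega>. K ^ 4 * X k \<omega> ^ 4)"
      using b by (intro integral_mono' i) auto
    also have "\<dots> \<le> K ^ 4 * D" using D[OF k] K by (simp add: mult_left_mono)
    finally show "expectation (\<lambda>\<omega>. (\<tau> (X k \<omega>))\<^sup>2) \<le> K ^ 4 * D" .
  qed
  define T where "T k \<omega> = \<tau> (X k \<omega>) - expectation (\<lambda>\<omega>. \<tau> (X k \<omega>))" for k \<omega>
  define T' where "T' k \<omega> = (X k \<omega> ^ 4 - \<tau> (X k \<omega>)) - expectation (\<lambda>\<omega>. X k \<omega> ^ 4 - \<tau> (X k \<omega>))" for k \<omega>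
  have split: "X k \<omega> ^ 4 - expectation (\<lambda>\<omega>. X k \<omega> ^ 4) = T k \<omega> + T' k \<omega>" if "k < m" for k \<omega>
    using iT[OF that] i4[OF that] by (simp add: T_def T'_def)
  have indT: "indep_vars (\<lambda>_. borel) T {..<m}"
    unfolding T_def
    by (rule indep_vars_compose2[OF ind, where Y = "\<lambda>k x. \<tau> x - expectation (\<lambda>\<omega>. \<tau> (X k \<omega>))"])
      (use \<tau>m in measurable)
  have T2: "integrable M (\<lambda>\<omega>. (T k \<omega>)\<^sup>2)" "expectation (T k) = 0" "expectation (\<lambda>\<omega>. (T k \<omega>)\<^sup>2) \<le> K ^ 4 * D" if k: "k < m" for k
  proof -
    have e: "(T k \<omega>)\<^sup>2 = (\<tau> (X k \<omega>))\<^sup>2 - 2 * expectation (\<lambda>\<omega>. \<tau> (X k \<omega>)) * \<tau> (X k \<omega>) + (expectation (\<lambda>\<omega>. \<tau> (X k \<omega>)))\<^sup>2" for \<omega>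
      by (simp add: T_def power2_diff)
    show "integrable M (\<lambda>\<omega>. (T k \<omega>)\<^sup>2)" unfolding e using iT2[OF k] iT[OF k] by simp
    show "expectation (T k) = 0" unfolding T_def[abs_def] using iT[OF k] by (simp add: prob_space)
    have "expectation (\<lambda>\<omega>. (T k \<omega>)\<^sup>2) = expectation (\<lambda>\<omega>. (\<tau> (X k \<omega>))\<^sup>2) - (expectation (\<lambda>\<omega>. \<tau> (X k \<omega>)))\<^sup>2"
      unfolding e using iT2[OF k] iT[OF k] by (simp add: prob_space power2_eq_square)
    then show "expectation (\<lambda>\<omega>. (T k \<omega>)\<^sup>2) \<le> K ^ 4 * D"
      using iT2(2)[OF k] zero_le_power2[of "expectation (\<lambda>\<omega>. \<tau> (X k \<omega>))"] by linarith
  qed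
  have ST: "integrable M (\<lambda>\<omega>. (\<Sum>k<m. T k \<omega>)\<^sup>2)" "expectation (\<lambda>\<omega>. (\<Sum>k<m. T k \<omega>)\<^sup>2) \<le> real m * (K ^ 4 * D)"
    using indep_sum_square[OF _ indT] T2 sum_bounded_above[of "{..<m}" "\<lambda>k. expectation (\<lambda>\<omega>. (T k \<omega>)\<^sup>2)" "K ^ 4 * D"] by auto
  have mT: "(\<lambda>\<omega>. \<Sum>k<m. T k \<omega>) \<in> borel_measurable M"
    using indT by (intro borel_measurable_sum) (auto simp: indep_vars_def)
  have aT: "integrable M (\<lambda>\<omega>. \<Sum>k<m. T k \<omega>)" "expectation (\<lambda>\<omega>. \<bar>\<Sum>k<m. T k \<omega>\<bar>) \<le> sqrt (real m * (K ^ 4 * D))"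
    using expectation_abs_le_sqrt[OF mT ST(1)] order_trans[OF _ real_sqrt_le_mono[OF ST(2)]] by auto
  have iD: "integrable M (\<lambda>\<omega>. X k \<omega> ^ 4 - \<tau> (X k \<omega>))" if "k < m" for k
    using i4 iT that by auto
  have eD: "expectation (\<lambda>\<omega>. X k \<omega> ^ 4 - \<tau> (X k \<omega>)) \<le> K powr (4 - p) * B"
    "0 \<le> expectation (\<lambda>\<omega>. X k \<omega> ^ 4 - \<tau> (X k \<omega>))" if k: "k < m" for k
  proof -
    have "expectation (\<lambda>\<omega>. X k \<omega> ^ 4 - \<tau> (X k \<omega>)) \<le> expectation (\<lambda>\<omega>. K powr (4 - p) * \<bar>X k \<omega>\<bar> powr p)"
      using \<tau>r ip[OF k] iD[OF k] by (intro integral_mono) auto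
    also have "\<dots> \<le> K powr (4 - p) * B" using B[OF k] by (simp add: mult_left_mono)
    finally show "expectation (\<lambda>\<omega>. X k \<omega> ^ 4 - \<tau> (X k \<omega>)) \<le> K powr (4 - p) * B" .
    show "0 \<le> expectation (\<lambda>\<omega>. X k \<omega> ^ 4 - \<tau> (X k \<omega>))"
      using \<tau>b by (intro Bochner_Integration.integral_nonneg) auto
  qed
  have iT': "integrable M (T' k)" "expectation (\<lambda>\<omega>. \<bar>T' k \<omega>\<bar>) \<le> 2 * (K powr (4 - p) * B)" if k: "k < m" for k
  proof -
    show "integrable M (T' k)" unfolding T'_def[abs_def] using iD[OF k] by simp
    have "expectation (\<lambda>\<omega>. \<bar>T' k \<omega>\<bar>) \<le> expectation (\<lambda>\<omega>. (X k \<omega> ^ 4 - \<tau> (X k \<omega>)) + expectation (\<lambda>\<omega>. X k \<omega> ^ 4 - \<tau> (X k \<omega>)))"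
    proof (rule integral_mono')
      show "integrable M (\<lambda>\<omega>. (X k \<omega> ^ 4 - \<tau> (X k \<omega>)) + expectation (\<lambda>\<omega>. X k \<omega> ^ 4 - \<tau> (X k \<omega>)))"
        by (intro Bochner_Integration.integrable_add[OF iD[OF k]]) simp
      fix \<omega>
      have "0 \<le> X k \<omega> ^ 4 - \<tau> (X k \<omega>)" using \<tau>b(2)[of "X k \<omega>"] by simp
      then show "\<bar>T' k \<omega>\<bar> \<le> (X k \<omega> ^ 4 - \<tau> (X k \<omega>)) + expectation (\<lambda>\<omega>. X k \<omega> ^ 4 - \<tau> (X k \<omega>))"
        unfolding T'_def using eD(2)[OF k] by linarith
      show "0 \<le> (X k \<omega> ^ 4 - \<tau> (X k \<omega>)) + expectation (\<lambda>\<omega>. X k \<omega> ^ 4 - \<tau> (X k \<omega>))"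
        using \<open>0 \<le> X k \<omega> ^ 4 - \<tau> (X k \<omega>)\<close> eD(2)[OF k] by linarith
    qed
    also have "\<dots> = expectation (\<lambda>\<omega>. X k \<omega> ^ 4 - \<tau> (X k \<omega>)) + expectation (\<lambda>\<omega>. X k \<omega> ^ 4 - \<tau> (X k \<omega>))"
      by (subst Bochner_Integration.integral_add[OF iD[OF k]]) (auto simp: prob_space)
    finally show "expectation (\<lambda>\<omega>. \<bar>T' k \<omega>\<bar>) \<le> 2 * (K powr (4 - p) * B)" using eD(1)[OF k] by linarith
  qed
  have sum_eq: "(\<Sum>k<m. X k \<omega> ^ 4 - expectation (\<lambda>\<omega>. X k \<omega> ^ 4)) = (\<Sum>k<m. T k \<omega>) + (\<Sum>k<m. T' k \<omega>)" for \<omega>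
    using split by (simp add: sum.distrib[symmetric])
  have iS: "integrable M (\<lambda>\<omega>. \<Sum>k<m. T' k \<omega>)" using iT' by auto
  show "integrable M (\<lambda>\<omega>. \<Sum>k<m. X k \<omega> ^ 4 - expectation (\<lambda>\<omega>. X k \<omega> ^ 4))"
    unfolding sum_eq using aT iS by simp
  have "expectation (\<lambda>\<omega>. \<bar>\<Sum>k<m. T' k \<omega>\<bar>) \<le> expectation (\<lambda>\<omega>. \<Sum>k<m. \<bar>T' k \<omega>\<bar>)"
    using iT' by (intro integral_mono') auto
  also have "\<dots> = (\<Sum>k<m. expectation (\<lambda>\<omega>. \<bar>T' k \<omega>\<bar>))"
    using iT' by (intro Bochner_Integration.integral_sum) auto
  also have "\<dots> \<le> real m * (2 * (K powr (4 - p) * B))"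
    using iT'(2) sum_bounded_above[of "{..<m}" "\<lambda>k. expectation (\<lambda>\<omega>. \<bar>T' k \<omega>\<bar>)" "2 * (K powr (4 - p) * B)"] by auto
  finally have aT': "expectation (\<lambda>\<omega>. \<bar>\<Sum>k<m. T' k \<omega>\<bar>) \<le> 2 * real m * (K powr (4 - p) * B)" by simp
  have "expectation (\<lambda>\<omega>. \<bar>(\<Sum>k<m. T k \<omega>) + (\<Sum>k<m. T' k \<omega>)\<bar>) \<le> expectation (\<lambda>\<omega>. \<bar>\<Sum>k<m. T k \<omega>\<bar> + \<bar>\<Sum>k<m. T' k \<omega>\<bar>)"
    using aT(1) iS by (intro integral_mono') auto
  also have "\<dots> = expectation (\<lambda>\<omega>. \<bar>\<Sum>k<m. T k \<omega>\<bar>) + expectation (\<lambda>\<omega>. \<bar>\<Sum>k<m. T' k \<omega>\<bar>)"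
    using aT(1) iS by (intro Bochner_Integration.integral_add) auto
  finally show "expectation (\<lambda>\<omega>. \<bar>\<Sum>k<m. X k \<omega> ^ 4 - expectation (\<lambda>\<omega>. X k \<omega> ^ 4)\<bar>)
      \<le> sqrt (real m * (K ^ 4 * D)) + 2 * real m * (K powr (4 - p) * B)"
    unfolding sum_eq using aT(2) aT' by linarith
qed

end

section \<open>Bases with positive fourth cumulant\<close>

text \<open>The mixed terms of the binomial expansion factorise by independence, with
  \<open>E |U| <= sqrt u\<close> and \<open>E |U|^3 <= (u + v) / 2\<close>. If \<open>v\<close> is
  of order \<open>u\<close>, as on small sets, the error is of order \<open>u^(3/2)\<close>, hence
  negligible against \<open>u\<close>.\<close>

lemma (in prob_space) indep_difference_fourth_power:
  fixes U V :: "'a \<Rightarrow> real"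
  assumes ind: "indep_var borel U borel V" and f: "fourth_moment U" "fourth_moment V"
    and m2: "expectation (\<lambda>\<omega>. (U \<omega>)\<^sup>2) = u" "expectation (\<lambda>\<omega>. (V \<omega>)\<^sup>2) = u"
    and m4: "expectation (\<lambda>\<omega>. U \<omega> ^ 4) = v" "expectation (\<lambda>\<omega>. V \<omega> ^ 4) = v"
  shows "expectation (\<lambda>\<omega>. \<bar>(U \<omega> - V \<omega>) ^ 4 - U \<omega> ^ 4 - V \<omega> ^ 4\<bar>) \<le> 4 * (u + v) * sqrt u + 6 * u\<^sup>2"
proof -
  note rv = fourth_moment_measurable[OF f(1)] fourth_moment_measurable[OF f(2)]
  have abs1: "integrable M (\<lambda>\<omega>. \<bar>X \<omega>\<bar>)" "expectation (\<lambda>\<omega>. \<bar>X \<omega>\<bar>) \<le> sqrt u"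
    and abs3: "integrable M (\<lambda>\<omega>. \<bar>X \<omega>\<bar> ^ 3)" "expectation (\<lambda>\<omega>. \<bar>X \<omega>\<bar> ^ 3) \<le> (u + v) / 2"
    if X: "fourth_moment X" "expectation (\<lambda>\<omega>. (X \<omega>)\<^sup>2) = u" "expectation (\<lambda>\<omega>. X \<omega> ^ 4) = v" for X
  proof -
    note r = fourth_moment_measurable[OF X(1)] and i2 = fourth_moment_power[OF X(1), of 2]
    show "integrable M (\<lambda>\<omega>. \<bar>X \<omega>\<bar>)" "expectation (\<lambda>\<omega>. \<bar>X \<omega>\<bar>) \<le> sqrt u"
      using expectation_abs_le_sqrt[OF r] i2 X(2) by auto
    show "integrable M (\<lambda>\<omega>. \<bar>X \<omega>\<bar> ^ 3)"
      using integrable_abs[OF fourth_moment_power[OF X(1), of 3]] by (simp add: power_abs)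
    have "\<bar>x\<bar> ^ 3 \<le> (x\<^sup>2 + x ^ 4) / 2" for x :: real
      using sum_squares_bound[of "\<bar>x\<bar>" "x\<^sup>2"] by (simp add: power2_eq_square power3_eq_cube power4_eq_xxxx)
    then have "expectation (\<lambda>\<omega>. \<bar>X \<omega>\<bar> ^ 3) \<le> expectation (\<lambda>\<omega>. ((X \<omega>)\<^sup>2 + X \<omega> ^ 4) / 2)"
      using i2 fourth_moment_power[OF X(1), of 4] by (intro integral_mono') auto
    also have "\<dots> = (u + v) / 2"
      using i2 fourth_moment_power[OF X(1), of 4] X by simp
    finally show "expectation (\<lambda>\<omega>. \<bar>X \<omega>\<bar> ^ 3) \<le> (u + v) / 2" .
  qed
  have indabs: "indep_var borel (\<lambda>\<omega>. \<bar>U \<omega>\<bar>) borel (\<lambda>\<omega>. \<bar>V \<omega>\<bar>)"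
    using indep_var_compose[OF ind, of abs borel abs borel] by (simp add: comp_def)
  note U = abs1[OF f(1) m2(1) m4(1)] abs3[OF f(1) m2(1) m4(1)] and V = abs1[OF f(2) m2(2) m4(2)] abs3[OF f(2) m2(2) m4(2)]
  note c13 = indep_var_product_moments[OF indabs, of 1 3] and c31 = indep_var_product_moments[OF indabs, of 3 1]
    and c22 = indep_var_product_moments[OF ind, of 2 2]
  have i2: "integrable M (\<lambda>\<omega>. (U \<omega>)\<^sup>2)" "integrable M (\<lambda>\<omega>. (V \<omega>)\<^sup>2)"
    using fourth_moment_power[OF f(1), of 2] fourth_moment_power[OF f(2), of 2] by auto
  have u0: "0 \<le> u" "0 \<le> v"
    unfolding m2(1)[symmetric] m4(1)[symmetric] by (intro Bochner_Integration.integral_nonneg; simp)+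
  have pw: "\<bar>(x - y) ^ 4 - x ^ 4 - y ^ 4\<bar> \<le> 4 * (\<bar>x\<bar> ^ 3 * \<bar>y\<bar> ^ 1) + 6 * (x\<^sup>2 * y\<^sup>2) + 4 * (\<bar>x\<bar> ^ 1 * \<bar>y\<bar> ^ 3)" for x y :: real
  proof -
    have "(x - y) ^ 4 - x ^ 4 - y ^ 4 = - 4 * (x ^ 3 * y) + 6 * (x\<^sup>2 * y\<^sup>2) + (- 4) * (x * y ^ 3)" by algebra
    also have "\<bar>\<dots>\<bar> \<le> \<bar>- 4 * (x ^ 3 * y)\<bar> + \<bar>6 * (x\<^sup>2 * y\<^sup>2)\<bar> + \<bar>(- 4) * (x * y ^ 3)\<bar>"
      by (rule order_trans[OF abs_triangle_ineq add_right_mono[OF abs_triangle_ineq]])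
    also have "\<dots> = 4 * (\<bar>x\<bar> ^ 3 * \<bar>y\<bar> ^ 1) + 6 * (x\<^sup>2 * y\<^sup>2) + 4 * (\<bar>x\<bar> ^ 1 * \<bar>y\<bar> ^ 3)"
      by (simp add: abs_mult power_abs)
    finally show ?thesis .
  qed
  have i: "integrable M (\<lambda>\<omega>. \<bar>U \<omega>\<bar> ^ 3 * \<bar>V \<omega>\<bar> ^ 1)" "integrable M (\<lambda>\<omega>. \<bar>U \<omega>\<bar> ^ 1 * \<bar>V \<omega>\<bar> ^ 3)"
      "integrable M (\<lambda>\<omega>. (U \<omega>)\<^sup>2 * (V \<omega>)\<^sup>2)"
    using c13 c31 c22 U V i2 by auto
  have e31: "expectation (\<lambda>\<omega>. \<bar>U \<omega>\<bar> ^ 3 * \<bar>V \<omega>\<bar> ^ 1) \<le> (u + v) / 2 * sqrt u"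
  proof -
    have "expectation (\<lambda>\<omega>. \<bar>U \<omega>\<bar> ^ 3 * \<bar>V \<omega>\<bar> ^ 1) = expectation (\<lambda>\<omega>. \<bar>U \<omega>\<bar> ^ 3) * expectation (\<lambda>\<omega>. \<bar>V \<omega>\<bar>)"
      using c31(1) U V by simp
    also have "\<dots> \<le> (u + v) / 2 * sqrt u"
      by (intro mult_mono U V Bochner_Integration.integral_nonneg) (use u0 in auto)
    finally show ?thesis .
  qed
  have e13: "expectation (\<lambda>\<omega>. \<bar>U \<omega>\<bar> ^ 1 * \<bar>V \<omega>\<bar> ^ 3) \<le> sqrt u * ((u + v) / 2)"
  proof -
    have "expectation (\<lambda>\<omega>. \<bar>U \<omega>\<bar> ^ 1 * \<bar>V \<omega>\<bar> ^ 3) = expectation (\<lambda>\<omega>. \<bar>U \<omega>\<bar>) * expectation (\<lambda>\<omega>. \<bar>V \<omega>\<bar> ^ 3)"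
      using c13(1) U V by simp
    also have "\<dots> \<le> sqrt u * ((u + v) / 2)"
      by (intro mult_mono U V Bochner_Integration.integral_nonneg) (use u0 in auto)
    finally show ?thesis .
  qed
  have e22: "expectation (\<lambda>\<omega>. (U \<omega>)\<^sup>2 * (V \<omega>)\<^sup>2) = u * u"
    using c22(1)[OF i2] m2 by simp
  have "expectation (\<lambda>\<omega>. \<bar>(U \<omega> - V \<omega>) ^ 4 - U \<omega> ^ 4 - V \<omega> ^ 4\<bar>)
      \<le> expectation (\<lambda>\<omega>. 4 * (\<bar>U \<omega>\<bar> ^ 3 * \<bar>V \<omega>\<bar> ^ 1) + 6 * ((U \<omega>)\<^sup>2 * (V \<omega>)\<^sup>2) + 4 * (\<bar>U \<omega>\<bar> ^ 1 * \<bar>V \<omega>\<bar> ^ 3))"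
    using i pw by (intro integral_mono' Bochner_Integration.integrable_add integrable_mult_right) auto
  also have "\<dots> = 4 * expectation (\<lambda>\<omega>. \<bar>U \<omega>\<bar> ^ 3 * \<bar>V \<omega>\<bar> ^ 1) + 6 * expectation (\<lambda>\<omega>. (U \<omega>)\<^sup>2 * (V \<omega>)\<^sup>2)
      + 4 * expectation (\<lambda>\<omega>. \<bar>U \<omega>\<bar> ^ 1 * \<bar>V \<omega>\<bar> ^ 3)"
    by (simp only: Bochner_Integration.integral_add Bochner_Integration.integrable_add integrable_mult_right i
        integral_mult_right_zero)
  also have "\<dots> \<le> 4 * ((u + v) / 2 * sqrt u) + 6 * (u * u) + 4 * (sqrt u * ((u + v) / 2))"
    using e31 e13 e22 by linarith
  also have "\<dots> = 4 * (u + v) * sqrt u + 6 * u\<^sup>2" by (simp add: power2_eq_square algebra_simps)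
  finally show ?thesis .
qed

locale trawl_limit = trawl_basis M L \<gamma> b \<nu> p a \<phi> \<alpha>
  for M :: "'a measure" and L \<gamma> b \<nu> p a \<phi> \<alpha> +
  fixes \<Delta> :: "nat \<Rightarrow> real" and \<mu> :: real
  assumes step_pos: "\<And>n. n \<ge> 1 \<Longrightarrow> \<Delta> n > 0"
    and step_lim: "\<Delta> \<longlonglongrightarrow> 0"
    and horizon: "filterlim (\<lambda>n. real n * \<Delta> n) at_top sequentially"
    and mu_lim: "(\<lambda>n. real n * \<Delta> n ^ 3) \<longlonglongrightarrow> \<mu>"
begin

lemma step_at_right: "filterlim \<Delta> (at_right 0) sequentially"
  unfolding filterlim_at
proof
  show "\<forall>\<^sub>F n in sequentially. \<Delta> n \<in> {0<..} \<and> \<Delta> n \<noteq> 0"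
    by (rule eventually_sequentiallyI[of 1]) (use step_pos less_imp_neq in fastforce)
qed (rule step_lim)

lemma ev_step: "\<forall>\<^sub>F n in sequentially. 2 \<le> n \<and> 0 < \<Delta> n \<and> \<Delta> n < 1 \<and> u (\<Delta> n) \<le> 1 \<and> 1 \<le> real n * \<Delta> n"
proof -
  have u0: "(\<lambda>n. a 0 * \<Delta> n) \<longlonglongrightarrow> a 0 * 0" by (intro tendsto_intros step_lim)
  then have "\<forall>\<^sub>F n in sequentially. a 0 * \<Delta> n < 1" by (intro order_tendstoD(2)) auto
  moreover have "\<forall>\<^sub>F n in sequentially. \<Delta> n < 1" using step_lim by (intro order_tendstoD(2)) auto
  moreover have "\<forall>\<^sub>F n in sequentially. 1 \<le> real n * \<Delta> n" using horizon by (simp add: filterlim_at_top)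
  ultimately show ?thesis
    using eventually_ge_at_top[of 2]
  proof eventually_elim
    case (elim n)
    then have "0 < \<Delta> n" using step_pos[of n] by simp
    with elim u_bounds(2)[of "\<Delta> n"] show ?case by auto
  qed
qed

lemma u_lim: "(\<lambda>n. u (\<Delta> n) / \<Delta> n) \<longlonglongrightarrow> a 0"
  by (rule filterlim_compose[OF u_over_h step_at_right])

lemma u_lim0: "(\<lambda>n. u (\<Delta> n)) \<longlonglongrightarrow> 0"
proof -
  have "(\<lambda>n. u (\<Delta> n) / \<Delta> n * \<Delta> n) \<longlonglongrightarrow> a 0 * 0" by (intro tendsto_mult u_lim step_lim)
  moreover have "\<forall>\<^sub>F n in sequentially. u (\<Delta> n) / \<Delta> n * \<Delta> n = u (\<Delta> n)"
    using ev_step by eventually_elim simp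
  ultimately show ?thesis by (simp add: tendsto_cong)
qed

lemma w_lim: "(\<lambda>n. w (\<Delta> n) 1 / (\<Delta> n)\<^sup>2) \<longlonglongrightarrow> \<phi> 0"
  by (rule filterlim_compose[OF w_second_order step_at_right])

lemma u2_lim: "(\<lambda>n. (u (\<Delta> n) - a 0 * \<Delta> n) / (\<Delta> n)\<^sup>2) \<longlonglongrightarrow> - \<phi> 0 / 2"
  by (rule filterlim_compose[OF u_second_order step_at_right])

lemma inverse_horizon: "(\<lambda>n. 1 / (real n * \<Delta> n)) \<longlonglongrightarrow> 0"
  by (rule tendsto_divide_0[OF tendsto_const filterlim_at_top_imp_at_infinity[OF horizon]])

lemma pred_ratio: "(\<lambda>n. real (n - 1) / real n) \<longlonglongrightarrow> 1"
proof -
  have "(\<lambda>n. 1 - 1 / real n) \<longlonglongrightarrow> 1 - 0" by (intro tendsto_intros lim_const_over_n)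
  moreover have "\<forall>\<^sub>F n in sequentially. 1 - 1 / real n = real (n - 1) / real n"
    using eventually_ge_at_top[of 1] by eventually_elim (simp add: of_nat_diff diff_divide_distrib)
  ultimately show ?thesis by (simp add: tendsto_cong)
qed

lemma sqrt_horizon: "filterlim (\<lambda>n. sqrt (real n * \<Delta> n)) at_top sequentially"
  by (rule filterlim_compose[OF sqrt_at_top horizon])

text \<open>\<open>2 * u h - 2 * a 0 * h\<close> is about \<open>- \<phi> 0 * h^2\<close> and
  \<open>w h 1\<close> about \<open>\<phi> 0 * h^2\<close>, so the means cancel to second order. The
  prefactor of what remains is \<open>sqrt (n * \<Delta>^3) / 2\<close>, which converges: this is
  where the rate condition on \<Delta> is used.\<close>

lemma bias_lim: "(\<lambda>n. 1 / (2 * sqrt (real n * \<Delta> n)) *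
    (2 * real (n - 1) * u (\<Delta> n) - 2 * real n * \<Delta> n * a 0 + real (n - 2) * w (\<Delta> n) 1)) \<longlonglongrightarrow> 0"
proof -
  let ?h = \<Delta> and ?s = "\<lambda>n. sqrt (real n * \<Delta> n)"
  have "(\<lambda>n. sqrt (real n * \<Delta> n ^ 3)) \<longlonglongrightarrow> sqrt \<mu>" by (rule tendsto_real_sqrt[OF mu_lim])
  then have "(\<lambda>n. 1 / 2 * sqrt (real n * \<Delta> n ^ 3) * (2 * ((u (?h n) - a 0 * ?h n) / (?h n)\<^sup>2) + w (?h n) 1 / (?h n)\<^sup>2))
     \<longlonglongrightarrow> 1 / 2 * sqrt \<mu> * (2 * (- \<phi> 0 / 2) + \<phi> 0)"
    by (intro tendsto_mult tendsto_add tendsto_const u2_lim w_lim)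
  then have 1: "(\<lambda>n. 1 / 2 * sqrt (real n * \<Delta> n ^ 3) * (2 * ((u (?h n) - a 0 * ?h n) / (?h n)\<^sup>2) + w (?h n) 1 / (?h n)\<^sup>2)) \<longlonglongrightarrow> 0"
    by simp
  have "(\<lambda>n. w (?h n) 1 / (?h n)\<^sup>2 * (?h n)\<^sup>2) \<longlonglongrightarrow> \<phi> 0 * 0\<^sup>2" by (intro tendsto_intros w_lim step_lim)
  moreover have "\<forall>\<^sub>F n in sequentially. w (?h n) 1 / (?h n)\<^sup>2 * (?h n)\<^sup>2 = w (?h n) 1"
    using ev_step by eventually_elim simp
  ultimately have w0: "(\<lambda>n. w (?h n) 1) \<longlonglongrightarrow> 0" by (simp add: tendsto_cong)
  \<comment> \<open>The sums have \<open>n - 1\<close> and \<open>n - 2\<close> terms instead of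
    \<open>n\<close>; the missing ones amount to \<open>2 * (u + w)\<close>.\<close>
  have "(\<lambda>n. (u (?h n) + w (?h n) 1) / ?s n) \<longlonglongrightarrow> 0"
    by (rule tendsto_divide_0[OF tendsto_add[OF u_lim0 w0] filterlim_at_top_imp_at_infinity[OF sqrt_horizon]])
  from tendsto_diff[OF 1 this] have lim: "(\<lambda>n. 1 / 2 * sqrt (real n * \<Delta> n ^ 3) * (2 * ((u (?h n) - a 0 * ?h n) / (?h n)\<^sup>2) + w (?h n) 1 / (?h n)\<^sup>2)
      - (u (?h n) + w (?h n) 1) / ?s n) \<longlonglongrightarrow> 0" by simp
  show ?thesis
  proof (rule Lim_transform_eventually[OF lim])
    show "\<forall>\<^sub>F n in sequentially. 1 / 2 * sqrt (real n * \<Delta> n ^ 3) * (2 * ((u (?h n) - a 0 * ?h n) / (?h n)\<^sup>2) + w (?h n) 1 / (?h n)\<^sup>2)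
      - (u (?h n) + w (?h n) 1) / ?s n
      = 1 / (2 * ?s n) * (2 * real (n - 1) * u (\<Delta> n) - 2 * real n * \<Delta> n * a 0 + real (n - 2) * w (\<Delta> n) 1)"
      using ev_step
    proof eventually_elim
      case (elim n)
      define s where "s = ?s n"
      have s: "0 < s" "s\<^sup>2 = real n * ?h n" using elim by (auto simp: s_def)
      have h: "0 < ?h n" using elim by simp
      have nn: "real n = s\<^sup>2 / ?h n" using s h by simp
      have "real n * ?h n ^ 3 = (s * ?h n)\<^sup>2"
        using s(2) by (simp add: power_mult_distrib power2_eq_square power3_eq_cube)
      then have sq: "sqrt (real n * ?h n ^ 3) = s * ?h n" using s h by simp
      have r: "real (n - 1) = real n - 1" "real (n - 2) = real n - 2" using elim by (auto simp: of_nat_diff)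
      show ?case
        unfolding sq s_def[symmetric] r unfolding nn using s(1) h
        by (simp add: field_simps power2_eq_square)
    qed
  qed
qed

section \<open>Lyapunov's theorem for squares over the entering sets\<close>

definition birth_statistic :: "nat \<Rightarrow> 'a \<Rightarrow> real" where
  "birth_statistic n \<omega> = (\<Sum>k<n - 1. ((Z (birth (\<Delta> n) k) \<omega>)\<^sup>2 - u (\<Delta> n)) / sqrt (real n * \<Delta> n))"

lemma Z_birth_moments:
  assumes "0 \<le> h"
  shows "expectation (\<lambda>\<omega>. (Z (birth h k) \<omega>)\<^sup>2) = u h" "expectation (\<lambda>\<omega>. Z (birth h k) \<omega> ^ 4) = 3 * (u h)\<^sup>2 + excess * u h"
    "expectation (\<lambda>\<omega>. (Z (death h k) \<omega>)\<^sup>2) = u h" "expectation (\<lambda>\<omega>. Z (death h k) \<omega> ^ 4) = 3 * (u h)\<^sup>2 + excess * u h"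
  using birth_death_finite_borel birth_death_measure[OF assms] by (simp_all add: Z_second_moment Z_fourth_moment_eq)

lemma Z_birth_square_centred:
  assumes "0 \<le> h"
  shows "integrable M (\<lambda>\<omega>. ((Z (birth h k) \<omega>)\<^sup>2 - u h)\<^sup>2)"
    and "expectation (\<lambda>\<omega>. (Z (birth h k) \<omega>)\<^sup>2 - u h) = 0"
    and "expectation (\<lambda>\<omega>. ((Z (birth h k) \<omega>)\<^sup>2 - u h)\<^sup>2) = 2 * (u h)\<^sup>2 + excess * u h"
proof -
  note f = Z_fourth_moment[OF birth_death_finite_borel(1)[of h k]]
  note i = fourth_moment_power[OF f, of 2] fourth_moment_power[OF f, of 4]
  have e: "((Z (birth h k) \<omega>)\<^sup>2 - u h)\<^sup>2 = Z (birth h k) \<omega> ^ 4 - 2 * u h * (Z (birth h k) \<omega>)\<^sup>2 + (u h)\<^sup>2" for \<omega>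
    by (simp add: power2_diff mult_ac flip: power_mult)
  show "integrable M (\<lambda>\<omega>. ((Z (birth h k) \<omega>)\<^sup>2 - u h)\<^sup>2)" unfolding e using i by simp
  show "expectation (\<lambda>\<omega>. (Z (birth h k) \<omega>)\<^sup>2 - u h) = 0"
    using i Z_birth_moments[OF assms] by (simp add: prob_space)
  show "expectation (\<lambda>\<omega>. ((Z (birth h k) \<omega>)\<^sup>2 - u h)\<^sup>2) = 2 * (u h)\<^sup>2 + excess * u h"
    unfolding e using i Z_birth_moments[OF assms] by (simp add: prob_space power2_eq_square)
qed

text \<open>The linear moment bound of order \<open>p\<close> for the basis, read as a bound of
  order \<open>p / 2\<close> for its square; the centring \<open>u h\<close> is harmless since it is
  at most 1.\<close>

lemma Z_birth_square_powr:
  assumes "0 \<le> h" "u h \<le> 1"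
  shows "integrable M (\<lambda>\<omega>. \<bar>(Z (birth h k) \<omega>)\<^sup>2 - u h\<bar> powr (p / 2))"
    and "expectation (\<lambda>\<omega>. \<bar>(Z (birth h k) \<omega>)\<^sup>2 - u h\<bar> powr (p / 2)) \<le> 2 powr (p / 2) * (2 * sym_moment 1 + 1) * u h"
proof -
  let ?U = "Z (birth h k)" and ?q = "p / 2"
  note fb = birth_death_finite_borel(1)[of h k]
  have sq: "\<bar>x\<^sup>2\<bar> powr ?q = \<bar>x\<bar> powr p" for x :: real
  proof -
    have "\<bar>x\<^sup>2\<bar> powr ?q = (\<bar>x\<bar> powr 2) powr ?q" by (simp add: powr_numeral)
    also have "\<dots> = \<bar>x\<bar> powr p" by (simp only: powr_powr) simp
    finally show ?thesis .
  qed
  have u0: "0 \<le> u h" using u_bounds(3)[OF assms(1)] .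
  have pw: "\<bar>x\<^sup>2 - u h\<bar> powr ?q \<le> 2 powr ?q * (\<bar>x\<bar> powr p + u h)" for x
  proof -
    have "\<bar>x\<^sup>2 - u h\<bar> powr ?q \<le> 2 powr ?q * (\<bar>x\<^sup>2\<bar> powr ?q + \<bar>- u h\<bar> powr ?q)"
      using abs_add_powr_le[of ?q "x\<^sup>2" "- u h"] p_bounds by simp
    also have "\<bar>- u h\<bar> powr ?q \<le> u h" using u0 assms(2) p_bounds powr_le_self[of "u h" ?q] by simp
    finally show ?thesis unfolding sq by (simp add: mult_left_mono)
  qed
  have i: "integrable M (\<lambda>\<omega>. 2 powr ?q * (\<bar>?U \<omega>\<bar> powr p + u h))"
    using Z_powr_integrable[OF fb] by simp
  show "integrable M (\<lambda>\<omega>. \<bar>(?U \<omega>)\<^sup>2 - u h\<bar> powr ?q)"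
    by (rule Bochner_Integration.integrable_bound[OF i])
      (use Z_measurable[OF fb] in measurable, use pw in \<open>auto intro!: AE_I2 order_trans[OF _ abs_ge_self]\<close>)
  have "expectation (\<lambda>\<omega>. \<bar>(?U \<omega>)\<^sup>2 - u h\<bar> powr ?q) \<le> expectation (\<lambda>\<omega>. 2 powr ?q * (\<bar>?U \<omega>\<bar> powr p + u h))"
    using u0 pw by (intro integral_mono' i) auto
  also have "\<dots> = 2 powr ?q * (expectation (\<lambda>\<omega>. \<bar>?U \<omega>\<bar> powr p) + u h)"
    using Z_powr_integrable[OF fb] by (simp add: prob_space)
  also have "\<dots> \<le> 2 powr ?q * (2 * sym_moment 1 * u h + u h)"
    using Z_powr_bound[OF fb] birth_death_measure(1)[OF assms(1)] assms(2) by (intro mult_left_mono) auto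
  finally show "expectation (\<lambda>\<omega>. \<bar>(?U \<omega>)\<^sup>2 - u h\<bar> powr ?q) \<le> 2 powr ?q * (2 * sym_moment 1 + 1) * u h"
    by (simp add: algebra_simps)
qed

text \<open>At the scale \<open>n * \<Delta>\<close> the Gaussian part \<open>2 * u^2\<close> of the
  variance is of lower order and only the cumulant part survives.\<close>

lemma birth_statistic_variance_lim:
  "(\<lambda>n. real (n - 1) * ((2 * (u (\<Delta> n))\<^sup>2 + excess * u (\<Delta> n)) / (real n * \<Delta> n))) \<longlonglongrightarrow> excess * a 0"
proof -
  have "(\<lambda>n. real (n - 1) / real n * (2 * (u (\<Delta> n) / \<Delta> n) * u (\<Delta> n) + excess * (u (\<Delta> n) / \<Delta> n)))
      \<longlonglongrightarrow> 1 * (2 * a 0 * 0 + excess * a 0)"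
    by (intro tendsto_intros pred_ratio u_lim u_lim0)
  moreover have "real (n - 1) / real n * (2 * (u (\<Delta> n) / \<Delta> n) * u (\<Delta> n) + excess * (u (\<Delta> n) / \<Delta> n))
      = real (n - 1) * ((2 * (u (\<Delta> n))\<^sup>2 + excess * u (\<Delta> n)) / (real n * \<Delta> n))" for n
    by (simp add: power2_eq_square add_divide_distrib distrib_left mult.assoc)
  ultimately show ?thesis by simp
qed

text \<open>The Lyapunov sum is of order \<open>(n * \<Delta>) powr (1 - p / 4)\<close>, which
  vanishes because \<open>p > 4\<close> and the horizon is infinite.\<close>

lemma birth_statistic_char:
  "(\<lambda>n. char (distr M borel (birth_statistic n)) t) \<longlonglongrightarrow> complex_of_real (exp (- (excess * a 0 * t\<^sup>2 / 2)))"
proof -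
  define X where "X n k \<omega> = ((Z (birth (\<Delta> n) k) \<omega>)\<^sup>2 - u (\<Delta> n)) / sqrt (real n * \<Delta> n)" for n k \<omega>
  define C where "C = 2 powr (p / 2) * (2 * sym_moment 1 + 1)"
  define v where "v n = (2 * (u (\<Delta> n))\<^sup>2 + excess * u (\<Delta> n)) / (real n * \<Delta> n)" for n
  define e where "e n = C * u (\<Delta> n) / (real n * \<Delta> n) powr (p / 4)" for n
  have birth_statistic: "birth_statistic n = (\<lambda>\<omega>. \<Sum>k<n - 1. X n k \<omega>)" for n
    by (simp add: birth_statistic_def X_def fun_eq_iff)
  show ?thesis
    unfolding birth_statistic
  proof (rule triangular_clt[where q = "p / 2" and v = v and e = e and m = "\<lambda>n. n - 1"])
    show "2 < p / 2" "p / 2 \<le> 3" using p_bounds by auto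
    show "(\<lambda>n. real (n - 1) * v n) \<longlonglongrightarrow> excess * a 0"
      unfolding v_def by (rule birth_statistic_variance_lim)
    have "(\<lambda>n. (2 * (u (\<Delta> n))\<^sup>2 + excess * u (\<Delta> n)) * (1 / (real n * \<Delta> n))) \<longlonglongrightarrow> (2 * 0\<^sup>2 + excess * 0) * 0"
      by (intro tendsto_intros u_lim0 inverse_horizon)
    then show "v \<longlonglongrightarrow> 0" by (simp add: v_def[abs_def])
    have "(\<lambda>n. (real n * \<Delta> n) powr (1 - p / 4)) \<longlonglongrightarrow> 0"
      using p_bounds by (intro tendsto_neg_powr horizon) auto
    then have "(\<lambda>n. C * (real (n - 1) / real n) * (u (\<Delta> n) / \<Delta> n) * (real n * \<Delta> n) powr (1 - p / 4)) \<longlonglongrightarrow> C * 1 * a 0 * 0"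
      by (intro tendsto_intros pred_ratio u_lim)
    moreover have "\<forall>\<^sub>F n in sequentially. C * (real (n - 1) / real n) * (u (\<Delta> n) / \<Delta> n) * (real n * \<Delta> n) powr (1 - p / 4)
        = real (n - 1) * e n"
      using ev_step
    proof eventually_elim
      case (elim n)
      then have "(real n * \<Delta> n) powr (1 - p / 4) = real n * \<Delta> n / (real n * \<Delta> n) powr (p / 4)"
        by (simp add: powr_diff)
      then show ?case using elim by (simp add: e_def)
    qed
    ultimately show "(\<lambda>n. real (n - 1) * e n) \<longlonglongrightarrow> 0" by (simp add: tendsto_cong)
    show "\<forall>\<^sub>F n in sequentially. 0 \<le> v n \<and> indep_vars (\<lambda>_. borel) (X n) {..<n - 1} \<and>
      (\<forall>k<n - 1. integrable M (\<lambda>\<omega>. (X n k \<omega>)\<^sup>2) \<and> expectation (X n k) = 0 \<and> expectation (\<lambda>\<omega>. (X n k \<omega>)\<^sup>2) = v n \<and>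
        integrable M (\<lambda>\<omega>. \<bar>X n k \<omega>\<bar> powr (p / 2)) \<and> expectation (\<lambda>\<omega>. \<bar>X n k \<omega>\<bar> powr (p / 2)) \<le> e n)"
      using ev_step
    proof eventually_elim
      case (elim n)
      let ?h = "\<Delta> n" and ?s = "sqrt (real n * \<Delta> n)"
      have h: "0 \<le> ?h" and uh: "u ?h \<le> 1" and s: "0 < ?s" "?s\<^sup>2 = real n * ?h" and nh: "1 \<le> real n * ?h"
        using elim by auto
      have "indep_vars (\<lambda>_. borel) (\<lambda>k. Z (birth ?h k)) {..<n - 1}"
        by (rule Z_indep_vars) (use birth_disjoint[OF h] birth_death_finite_borel in auto)
      then have ind: "indep_vars (\<lambda>_. borel) (X n) {..<n - 1}"
        unfolding X_def by (rule indep_vars_compose2[where Y = "\<lambda>k x. (x\<^sup>2 - u ?h) / ?s"]) auto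
      have sp: "?s powr (p / 2) = (real n * ?h) powr (p / 4)"
        using nh by (simp add: powr_half_sqrt[symmetric] powr_powr)
      have ab: "\<bar>X n k \<omega>\<bar> powr (p / 2) = \<bar>(Z (birth ?h k) \<omega>)\<^sup>2 - u ?h\<bar> powr (p / 2) / (real n * ?h) powr (p / 4)" for k \<omega>
        unfolding X_def abs_divide sp[symmetric] using s(1) by (simp add: powr_divide)
      have x2: "(X n k \<omega>)\<^sup>2 = ((Z (birth ?h k) \<omega>)\<^sup>2 - u ?h)\<^sup>2 / (real n * ?h)" for k \<omega>
        unfolding X_def power_divide s(2) ..
      have "0 \<le> v n" unfolding v_def using nh excess_nonneg u_bounds(3)[OF h] by simp
      moreover have "integrable M (\<lambda>\<omega>. (X n k \<omega>)\<^sup>2)" "expectation (\<lambda>\<omega>. (X n k \<omega>)\<^sup>2) = v n" for k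
        unfolding x2 v_def using Z_birth_square_centred[OF h, of k] by simp_all
      moreover have "expectation (X n k) = 0" for k
        unfolding X_def[abs_def] using Z_birth_square_centred(2)[OF h, of k] by simp
      moreover have "integrable M (\<lambda>\<omega>. \<bar>X n k \<omega>\<bar> powr (p / 2))" for k
        unfolding ab using Z_birth_square_powr(1)[OF h uh, of k] by simp
      moreover have "expectation (\<lambda>\<omega>. \<bar>X n k \<omega>\<bar> powr (p / 2)) \<le> e n" for k
        unfolding ab e_def C_def using Z_birth_square_powr(2)[OF h uh, of k]
        by (simp add: divide_right_mono)
      ultimately show ?case using ind by auto
    qed
  qed
qed

lemma birth_statistic_measurable: "random_variable borel (birth_statistic n)"
proof -
  note [measurable] = Z_measurable[OF birth_death_finite_borel(1)]
  show ?thesis unfolding birth_statistic_def[abs_def] by measurable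
qed

lemma birth_statistic_L1: "\<exists>B. \<forall>\<^sub>F n in sequentially. integrable M (birth_statistic n) \<and> expectation (\<lambda>\<omega>. \<bar>birth_statistic n \<omega>\<bar>) \<le> B"
proof -
  define v where "v n = (2 * (u (\<Delta> n))\<^sup>2 + excess * u (\<Delta> n)) / (real n * \<Delta> n)" for n
  have "\<forall>\<^sub>F n in sequentially. real (n - 1) * v n < excess * a 0 + 1"
    unfolding v_def by (rule order_tendstoD(2)[OF birth_statistic_variance_lim]) simp
  then have "\<forall>\<^sub>F n in sequentially. integrable M (birth_statistic n) \<and> expectation (\<lambda>\<omega>. \<bar>birth_statistic n \<omega>\<bar>) \<le> sqrt (excess * a 0 + 1)"
    using ev_step
  proof eventually_elim
    case (elim n)
    let ?h = "\<Delta> n" and ?s = "sqrt (real n * \<Delta> n)"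
    have h: "0 \<le> ?h" and s: "?s\<^sup>2 = real n * ?h" using elim by auto
    let ?X = "\<lambda>k \<omega>. ((Z (birth ?h k) \<omega>)\<^sup>2 - u ?h) / ?s"
    have "indep_vars (\<lambda>_. borel) (\<lambda>k. Z (birth ?h k)) {..<n - 1}"
      by (rule Z_indep_vars) (use birth_disjoint[OF h] birth_death_finite_borel in auto)
    then have ind: "indep_vars (\<lambda>_. borel) ?X {..<n - 1}"
      by (rule indep_vars_compose2[where Y = "\<lambda>k x. (x\<^sup>2 - u ?h) / ?s"]) auto
    have x2: "(?X k \<omega>)\<^sup>2 = ((Z (birth ?h k) \<omega>)\<^sup>2 - u ?h)\<^sup>2 / (real n * ?h)" for k \<omega>
      unfolding power_divide s ..
    have m: "integrable M (\<lambda>\<omega>. (?X k \<omega>)\<^sup>2)" "expectation (\<lambda>\<omega>. (?X k \<omega>)\<^sup>2) = v n" "expectation (?X k) = 0" for k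
      unfolding x2 v_def using Z_birth_square_centred[OF h, of k] by simp_all
    have "integrable M (\<lambda>\<omega>. (birth_statistic n \<omega>)\<^sup>2)" "expectation (\<lambda>\<omega>. (birth_statistic n \<omega>)\<^sup>2) = real (n - 1) * v n"
      using indep_sum_square[OF finite_lessThan ind m(1,3)] unfolding m(2) birth_statistic_def by auto
    then show ?case
      using expectation_abs_le_sqrt[OF birth_statistic_measurable, of n] elim(1)
        order_trans[OF _ real_sqrt_le_mono[of "real (n - 1) * v n" "excess * a 0 + 1"]] by auto
  qed
  then show ?thesis ..
qed

lemma dX_measurable: "random_variable borel (dX h k)"
  by (rule lin_measurable[OF lin_dX])

section \<open>Reduction of the unnormalised estimator to the sum over entering sets\<close>

definition levy_statistic :: "nat \<Rightarrow> 'a \<Rightarrow> real" where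
  "levy_statistic n \<omega> = (let x = (\<lambda>t. trawl_process L a t \<omega>); h = \<Delta> n in
     sqrt (real n * h) * (a_hat x h n - a 0 - 1 / 2 * h * a'_hat x h n))"

text \<open>Squares and products enter with the same factor
  \<open>c n = 1 / (2 * sqrt (n * \<Delta>))\<close>. The difference is therefore exactly
  \<open>c * V1 - c * V2 + bias\<close>: the exchange of deaths for births, the centred products,
  and the means. The first two vanish in L2, the last by \<open>bias_lim\<close>.\<close>

lemma levy_statistic_approx: "vanishing (\<lambda>n \<omega>. levy_statistic n \<omega> - birth_statistic n \<omega>)"
proof -
  define V1 where "V1 n \<omega> = (\<Sum>k<n - 1. (dX (\<Delta> n) k \<omega>)\<^sup>2) - 2 * (\<Sum>k<n - 1. (Z (birth (\<Delta> n) k) \<omega>)\<^sup>2)" for n \<omega>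
  define V2 where "V2 n \<omega> = (\<Sum>k\<in>{1..<n - 1}. dX (\<Delta> n) k \<omega> * dX (\<Delta> n) (k - 1) \<omega> + w (\<Delta> n) 1)" for n \<omega>
  define c where "c n = 1 / (2 * sqrt (real n * \<Delta> n))" for n
  define bias where "bias n = c n * (2 * real (n - 1) * u (\<Delta> n) - 2 * real n * \<Delta> n * a 0 + real (n - 2) * w (\<Delta> n) 1)" for n
  note [measurable] = Z_measurable[OF birth_death_finite_borel(1)] dX_measurable
  have m: "V1 n \<in> borel_measurable M" "V2 n \<in> borel_measurable M" for n
    unfolding V1_def[abs_def] V2_def[abs_def] by measurable
  have mS: "levy_statistic n \<in> borel_measurable M" for n
    unfolding levy_statistic_def[abs_def] Let_def a_hat_def a'_hat_def increment_eq_dX by measurable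
  have c2: "(c n)\<^sup>2 = 1 / (4 * (real n * \<Delta> n))" if "0 \<le> real n * \<Delta> n" for n
    using that by (simp add: c_def power_divide power_mult_distrib)
  have v1: "vanishing (\<lambda>n \<omega>. c n * V1 n \<omega>)"
  proof (rule vanishing_L2)
    let ?e = "\<lambda>n. 6 * (u (\<Delta> n) / \<Delta> n) * u (\<Delta> n) + excess * R 0 / 2 * (1 / (real n * \<Delta> n))"
    have "?e \<longlonglongrightarrow> 6 * a 0 * 0 + excess * R 0 / 2 * 0"
      by (intro tendsto_intros u_lim u_lim0 inverse_horizon)
    then show "?e \<longlonglongrightarrow> 0" by simp
    show "\<forall>\<^sub>F n in sequentially. integrable M (\<lambda>\<omega>. (c n * V1 n \<omega>)\<^sup>2) \<and> expectation (\<lambda>\<omega>. (c n * V1 n \<omega>)\<^sup>2) \<le> ?e n"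
      using ev_step
    proof eventually_elim
      case (elim n)
      then have h: "0 \<le> \<Delta> n" by simp
      note V = squared_increments_vs_births[OF h, of "n - 1", folded V1_def]
      have "expectation (\<lambda>\<omega>. (c n * V1 n \<omega>)\<^sup>2) = 1 / (4 * (real n * \<Delta> n)) * expectation (\<lambda>\<omega>. (V1 n \<omega>)\<^sup>2)"
        using c2 elim by (simp add: power_mult_distrib)
      also have "\<dots> \<le> 1 / (4 * (real n * \<Delta> n)) * (24 * real (n - 1) * (u (\<Delta> n))\<^sup>2 + 2 * excess * R 0)"
        using V(2) elim by (intro mult_left_mono) auto
      also have "\<dots> \<le> 1 / (4 * (real n * \<Delta> n)) * (24 * real n * (u (\<Delta> n))\<^sup>2 + 2 * excess * R 0)"
        using elim by (intro mult_left_mono add_right_mono mult_right_mono) auto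
      also have "\<dots> = ?e n" using elim by (simp add: field_simps power2_eq_square)
      finally show ?case using V(1) by (simp add: power_mult_distrib)
    qed
  qed (use m in measurable)
  have v2: "vanishing (\<lambda>n \<omega>. c n * V2 n \<omega>)"
  proof (rule vanishing_L2)
    let ?e = "\<lambda>n. 4 * (u (\<Delta> n) / \<Delta> n) * u (\<Delta> n) + excess * phi_sup / 2 * \<Delta> n"
    have "?e \<longlonglongrightarrow> 4 * a 0 * 0 + excess * phi_sup / 2 * 0"
      by (intro tendsto_intros u_lim u_lim0 step_lim)
    then show "?e \<longlonglongrightarrow> 0" by simp
    show "\<forall>\<^sub>F n in sequentially. integrable M (\<lambda>\<omega>. (c n * V2 n \<omega>)\<^sup>2) \<and> expectation (\<lambda>\<omega>. (c n * V2 n \<omega>)\<^sup>2) \<le> ?e n"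
      using ev_step
    proof eventually_elim
      case (elim n)
      then have h: "0 \<le> \<Delta> n" by simp
      note V = increment_products[OF h, of "n - 1", folded V2_def]
      have "expectation (\<lambda>\<omega>. (c n * V2 n \<omega>)\<^sup>2) = 1 / (4 * (real n * \<Delta> n)) * expectation (\<lambda>\<omega>. (V2 n \<omega>)\<^sup>2)"
        using c2 elim by (simp add: power_mult_distrib)
      also have "\<dots> \<le> 1 / (4 * (real n * \<Delta> n)) * (16 * real (n - 1) * (u (\<Delta> n))\<^sup>2 + excess * (real (n - 1) * (2 * phi_sup * (\<Delta> n)\<^sup>2)))"
        using V(2) elim by (intro mult_left_mono) auto
      also have "\<dots> \<le> 1 / (4 * (real n * \<Delta> n)) * (16 * real n * (u (\<Delta> n))\<^sup>2 + excess * (real n * (2 * phi_sup * (\<Delta> n)\<^sup>2)))"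
        using elim excess_nonneg phi_sup(1) by (intro mult_left_mono add_mono mult_right_mono) auto
      also have "\<dots> = ?e n" using elim by (simp add: field_simps power2_eq_square)
      finally show ?case using V(1) by (simp add: power_mult_distrib)
    qed
  qed (use m in measurable)
  have "bias \<longlonglongrightarrow> 0" unfolding bias_def c_def using bias_lim by simp
  then have "vanishing (\<lambda>n \<omega>. c n * V1 n \<omega> - c n * V2 n \<omega> + bias n)"
    by (intro vanishing_add vanishing_diff v1 v2 vanishing_const)
  then show ?thesis
  proof (rule vanishing_cong)
    show "(\<lambda>\<omega>. levy_statistic n \<omega> - birth_statistic n \<omega>) \<in> borel_measurable M" for n
      using mS[of n] birth_statistic_measurable[of n] by measurable
    show "\<forall>\<^sub>F n in sequentially. AE \<omega> in M. levy_statistic n \<omega> - birth_statistic n \<omega> = c n * V1 n \<omega> - c n * V2 n \<omega> + bias n"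
      using ev_step
    proof eventually_elim
      case (elim n)
      define s where "s = sqrt (real n * \<Delta> n)"
      define h where "h = \<Delta> n"
      have s: "0 < s" "s * s = real n * h" and h: "0 < h" using elim by (auto simp: s_def h_def)
      have nn: "real n = s * s / h" using s h by simp
      have r: "real (n - 1 - 1) = real n - 2" "real (n - 1) = real n - 1" "real (n - 2) = real n - 2"
        using elim by (auto simp: of_nat_diff)
      show ?case
      proof (intro AE_I2)
        fix \<omega>
        define D where "D = (\<Sum>k<n - 1. (dX h k \<omega>)\<^sup>2)"
        define U where "U = (\<Sum>k<n - 1. (Z (birth h k) \<omega>)\<^sup>2)"
        define P where "P = (\<Sum>k\<in>{1..<n - 1}. dX h k \<omega> * dX h (k - 1) \<omega>)"
        have levy_statistic: "levy_statistic n \<omega> = s * (1 / (2 * h * real n) * D - a 0 - 1 / 2 * h * (1 / (real n * h\<^sup>2) * P))"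
          by (simp add: levy_statistic_def Let_def a_hat_def a'_hat_def increment_eq_dX D_def P_def s_def h_def)
        have birth_statistic: "birth_statistic n \<omega> = (U - real (n - 1) * u h) / s"
          by (simp add: birth_statistic_def U_def s_def h_def sum_subtractf flip: sum_divide_distrib)
        have V1: "V1 n \<omega> = D - 2 * U" by (simp add: V1_def D_def U_def h_def)
        have V2: "V2 n \<omega> = P + (real n - 2) * w h 1"
          using r(1) by (simp add: V2_def P_def h_def sum.distrib)
        have c: "c n = 1 / (2 * s)" by (simp add: c_def s_def)
        have "s * (1 / (2 * h * real n) * D) = D / (2 * s)" "s * (1 / 2 * h * (1 / (real n * h\<^sup>2) * P)) = P / (2 * s)"
          "s * a 0 = real n * h * a 0 / s"
          unfolding nn using s(1) h by (simp_all add: field_simps power2_eq_square)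
        then have "levy_statistic n \<omega> = D / (2 * s) - real n * h * a 0 / s - P / (2 * s)"
          unfolding levy_statistic by (simp add: right_diff_distrib)
        then show "levy_statistic n \<omega> - birth_statistic n \<omega> = c n * V1 n \<omega> - c n * V2 n \<omega> + bias n"
        proof -
          define i where "i = 1 / (2 * s)"
          have e: "x / (2 * s) = x * i" "x / s = 2 * x * i" for x by (simp_all add: i_def)
          show ?thesis
            unfolding \<open>levy_statistic n \<omega> = D / (2 * s) - real n * h * a 0 / s - P / (2 * s)\<close> birth_statistic V1 V2 bias_def c h_def[symmetric] r e
            by (simp add: algebra_simps)
        qed
      qed
    qed
  qed
qed

section \<open>The random normalisation in the presence of jumps\<close>

lemma Q_measurable: "random_variable borel (\<lambda>\<omega>. Q_stat (\<lambda>t. trawl_process L a t \<omega>) h n)"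
proof -
  note [measurable] = dX_measurable
  show ?thesis unfolding Q_stat_def increment_eq_dX by measurable
qed

text \<open>Formulated for any disjoint family of sets of area \<open>u h\<close>, to serve the
  entering and the leaving sets alike.\<close>

lemma fourth_power_lln:
  assumes C: "\<And>h k. C h k \<in> finite_borel" "\<And>h k. 0 \<le> h \<Longrightarrow> measure lborel (C h k) = u h"
    "\<And>h I. 0 \<le> h \<Longrightarrow> disjoint_family_on (C h) I"
  shows "vanishing (\<lambda>n \<omega>. 1 / (2 * \<Delta> n * real n) * (\<Sum>k<n - 1. Z (C (\<Delta> n) k) \<omega> ^ 4 - (3 * (u (\<Delta> n))\<^sup>2 + excess * u (\<Delta> n))))"
proof (rule vanishing_L1)
  note [measurable] = Z_measurable[OF C(1)]
  show "(\<lambda>\<omega>. 1 / (2 * \<Delta> n * real n) * (\<Sum>k<n - 1. Z (C (\<Delta> n) k) \<omega> ^ 4 - (3 * (u (\<Delta> n))\<^sup>2 + excess * u (\<Delta> n)))) \<in> borel_measurable M" for n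
    by measurable
  let ?e = "\<lambda>n. 1 / 2 * sqrt ((3 + excess) * (u (\<Delta> n) / \<Delta> n)) * (real n * \<Delta> n) powr (- 1 / 4)
      + 2 * sym_moment 1 * (u (\<Delta> n) / \<Delta> n) * (real n * \<Delta> n) powr ((4 - p) / 8)"
  have "?e \<longlonglongrightarrow> 1 / 2 * sqrt ((3 + excess) * a 0) * 0 + 2 * sym_moment 1 * a 0 * 0"
    using p_bounds by (intro tendsto_intros u_lim tendsto_neg_powr horizon) auto
  then show "?e \<longlonglongrightarrow> 0" by simp
  show "\<forall>\<^sub>F n in sequentially. integrable M (\<lambda>\<omega>. 1 / (2 * \<Delta> n * real n) * (\<Sum>k<n - 1. Z (C (\<Delta> n) k) \<omega> ^ 4 - (3 * (u (\<Delta> n))\<^sup>2 + excess * u (\<Delta> n))))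
     \<and> expectation (\<lambda>\<omega>. \<bar>1 / (2 * \<Delta> n * real n) * (\<Sum>k<n - 1. Z (C (\<Delta> n) k) \<omega> ^ 4 - (3 * (u (\<Delta> n))\<^sup>2 + excess * u (\<Delta> n)))\<bar>) \<le> ?e n"
    using ev_step
  proof eventually_elim
    case (elim n)
    define h where "h = \<Delta> n"
    define T where "T = real n * h"
    \<comment> \<open>The truncated part is of order \<open>sqrt (T * K^4) / T = T^(-1/4)\<close>
      and the tail of order \<open>K^(4 - p)\<close>. Every exponent strictly between 0 and 1/4
      would balance them.\<close>
    define K where "K = T powr (1 / 8)"
    have h: "0 < h" "u h \<le> 1" and T: "1 \<le> T" using elim by (auto simp: h_def T_def)
    have u0: "0 \<le> u h" using u_bounds(3) h by simp
    have e4: "expectation (\<lambda>\<omega>. Z (C h k) \<omega> ^ 4) = 3 * (u h)\<^sup>2 + excess * u h" for k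
      using C h by (simp add: Z_fourth_moment_eq)
    have D: "3 * (u h)\<^sup>2 + excess * u h \<le> (3 + excess) * u h"
    proof -
      have "u h * u h \<le> 1 * u h" using u0 h by (intro mult_right_mono) auto
      then show ?thesis by (simp add: power2_eq_square algebra_simps)
    qed
    have ind: "indep_vars (\<lambda>_. borel) (\<lambda>k. Z (C h k)) {..<n - 1}"
      by (rule Z_indep_vars) (use C h in auto)
    note lln = truncated_fourth_moment_lln[OF ind p_bounds(1), of K "2 * sym_moment 1 * u h" "(3 + excess) * u h"]
    have K: "0 < K" using T by (simp add: K_def)
    have K4: "K ^ 4 = T powr (1 / 2)" using T by (simp add: K_def powr_power)
    have Kp: "K powr (4 - p) = T powr ((4 - p) / 8)" using T by (simp add: K_def powr_powr)
    have L: "integrable M (\<lambda>\<omega>. \<Sum>k<n - 1. Z (C h k) \<omega> ^ 4 - (3 * (u h)\<^sup>2 + excess * u h))"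
      "expectation (\<lambda>\<omega>. \<bar>\<Sum>k<n - 1. Z (C h k) \<omega> ^ 4 - (3 * (u h)\<^sup>2 + excess * u h)\<bar>)
       \<le> sqrt (real (n - 1) * (K ^ 4 * ((3 + excess) * u h))) + 2 * real (n - 1) * (K powr (4 - p) * (2 * sym_moment 1 * u h))"
    proof -
      have B: "expectation (\<lambda>\<omega>. \<bar>Z (C h k) \<omega>\<bar> powr p) \<le> 2 * sym_moment 1 * u h" for k
        using Z_powr_bound[OF C(1), of h k] C(2)[of h k] h by simp
      show "integrable M (\<lambda>\<omega>. \<Sum>k<n - 1. Z (C h k) \<omega> ^ 4 - (3 * (u h)\<^sup>2 + excess * u h))"
        using lln(1)[unfolded e4, OF K Z_powr_integrable[OF C(1)] B D] .
      show "expectation (\<lambda>\<omega>. \<bar>\<Sum>k<n - 1. Z (C h k) \<omega> ^ 4 - (3 * (u h)\<^sup>2 + excess * u h)\<bar>)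
        \<le> sqrt (real (n - 1) * (K ^ 4 * ((3 + excess) * u h))) + 2 * real (n - 1) * (K powr (4 - p) * (2 * sym_moment 1 * u h))"
        using lln(2)[unfolded e4, OF K Z_powr_integrable[OF C(1)] B D] .
    qed
    have sm: "0 \<le> sym_moment 1" unfolding sym_moment_def by (intro Bochner_Integration.integral_nonneg) simp
    have c: "0 < 1 / (2 * T)" using T by simp
    have "expectation (\<lambda>\<omega>. \<bar>1 / (2 * T) * (\<Sum>k<n - 1. Z (C h k) \<omega> ^ 4 - (3 * (u h)\<^sup>2 + excess * u h))\<bar>)
       = 1 / (2 * T) * expectation (\<lambda>\<omega>. \<bar>\<Sum>k<n - 1. Z (C h k) \<omega> ^ 4 - (3 * (u h)\<^sup>2 + excess * u h)\<bar>)"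
      using T by (simp add: abs_mult)
    also have "\<dots> \<le> 1 / (2 * T) * (sqrt (real n * (K ^ 4 * ((3 + excess) * u h))) + 2 * real n * (K powr (4 - p) * (2 * sym_moment 1 * u h)))"
      using c u0 sm excess_nonneg
      by (intro mult_left_mono order_trans[OF L(2)] add_mono real_sqrt_le_mono mult_right_mono) auto
    also have "\<dots> = 1 / (2 * T) * sqrt (real n * (K ^ 4 * ((3 + excess) * u h))) + 2 * sym_moment 1 * (u h / h) * T powr ((4 - p) / 8)"
      unfolding Kp T_def using h elim by (simp add: field_simps)
    also have "1 / (2 * T) * sqrt (real n * (K ^ 4 * ((3 + excess) * u h))) = 1 / 2 * sqrt ((3 + excess) * (u h / h)) * T powr (- 1 / 4)"
    proof -
      have "real n * (K ^ 4 * ((3 + excess) * u h)) = ((3 + excess) * (u h / h)) * (T * T powr (1 / 2))"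
        unfolding K4 T_def using h by simp
      also have "T * T powr (1 / 2) = T powr (3 / 4) * T powr (3 / 4)"
      proof -
        have "T * T powr (1 / 2) = T powr 1 * T powr (1 / 2)" using T by simp
        also have "\<dots> = T powr (3 / 4) * T powr (3 / 4)" by (simp only: powr_add[symmetric]) simp
        finally show ?thesis .
      qed
      finally have "sqrt (real n * (K ^ 4 * ((3 + excess) * u h))) = sqrt ((3 + excess) * (u h / h)) * T powr (3 / 4)"
        by (simp only: real_sqrt_mult) simp
      moreover have "T powr (3 / 4) / T = T powr (- 1 / 4)"
      proof -
        have "T powr (3 / 4) / T = T powr (3 / 4) / T powr 1" using T by simp
        also have "\<dots> = T powr (- 1 / 4)" by (simp only: powr_diff[symmetric]) simp
        finally show ?thesis .
      qed
      moreover have "1 / (2 * T) * (x * y) = 1 / 2 * x * (y / T)" for x y by simp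
      ultimately show ?thesis by (simp only:)
    qed
    finally have "expectation (\<lambda>\<omega>. \<bar>1 / (2 * T) * (\<Sum>k<n - 1. Z (C h k) \<omega> ^ 4 - (3 * (u h)\<^sup>2 + excess * u h))\<bar>)
      \<le> 1 / 2 * sqrt ((3 + excess) * (u h / h)) * T powr (- 1 / 4) + 2 * sym_moment 1 * (u h / h) * T powr ((4 - p) / 8)" .
    moreover have "1 / (2 * T) = 1 / (2 * h * real n)" by (simp add: T_def)
    ultimately show ?case using L(1) unfolding h_def[symmetric] T_def[symmetric] by simp
  qed
qed

text \<open>The fourth power of an increment is replaced by those of its entering and its leaving
  part, at a cost of order \<open>u^(3/2)\<close>. Each part then contributes half of the limit
  because of the factor \<open>1 / 2\<close> in \<open>Q_stat\<close>.\<close>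

lemma Q_lim: "vanishing (\<lambda>n \<omega>. Q_stat (\<lambda>t. trawl_process L a t \<omega>) (\<Delta> n) n - excess * a 0)"
proof -
  define f where "f h = 3 * (u h)\<^sup>2 + excess * u h" for h
  define c where "c n = 1 / (2 * \<Delta> n * real n)" for n
  define D where "D n \<omega> = (\<Sum>k<n - 1. dX (\<Delta> n) k \<omega> ^ 4 - Z (birth (\<Delta> n) k) \<omega> ^ 4 - Z (death (\<Delta> n) k) \<omega> ^ 4)" for n \<omega>
  note [measurable] = Z_measurable[OF birth_death_finite_borel(1)] Z_measurable[OF birth_death_finite_borel(2)] dX_measurable
  have mD: "D n \<in> borel_measurable M" for n unfolding D_def[abs_def] by measurable
  have vD: "vanishing (\<lambda>n \<omega>. c n * D n \<omega>)"
  proof (rule vanishing_L1)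
    show "(\<lambda>\<omega>. c n * D n \<omega>) \<in> borel_measurable M" for n using mD[of n] by measurable
    let ?r = "\<lambda>n. u (\<Delta> n) / \<Delta> n"
    let ?e = "\<lambda>n. 2 * (?r n + ?r n * (3 * u (\<Delta> n) + excess)) * sqrt (u (\<Delta> n)) + 3 * u (\<Delta> n) * ?r n"
    have "?e \<longlonglongrightarrow> 2 * (a 0 + a 0 * (3 * 0 + excess)) * sqrt 0 + 3 * 0 * a 0"
      by (intro tendsto_intros u_lim u_lim0)
    then show "?e \<longlonglongrightarrow> 0" by simp
    show "\<forall>\<^sub>F n in sequentially. integrable M (\<lambda>\<omega>. c n * D n \<omega>) \<and> expectation (\<lambda>\<omega>. \<bar>c n * D n \<omega>\<bar>) \<le> ?e n"
      using ev_step
    proof eventually_elim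
      case (elim n)
      define h where "h = \<Delta> n"
      have h: "0 < h" "0 \<le> h" and n: "0 < real n" using elim by (auto simp: h_def)
      let ?d = "\<lambda>k \<omega>. dX h k \<omega> ^ 4 - Z (birth h k) \<omega> ^ 4 - Z (death h k) \<omega> ^ 4"
      have i: "integrable M (?d k)" for k
        using lin_moments(1)[OF lin_dX[of h k]] Z_fourth_moment[OF birth_death_finite_borel(1)[of h k]]
          Z_fourth_moment[OF birth_death_finite_borel(2)[of h k]]
        by (intro Bochner_Integration.integrable_diff) (auto simp: fourth_moment_def)
      have e: "expectation (\<lambda>\<omega>. \<bar>?d k \<omega>\<bar>) \<le> 4 * (u h + f h) * sqrt (u h) + 6 * (u h)\<^sup>2" for k
      proof -
        have "expectation (\<lambda>\<omega>. \<bar>?d k \<omega>\<bar>)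
            = expectation (\<lambda>\<omega>. \<bar>(Z (birth h k) \<omega> - Z (death h k) \<omega>) ^ 4 - Z (birth h k) \<omega> ^ 4 - Z (death h k) \<omega> ^ 4\<bar>)"
          using dX_birth_death[of h k] by (intro integral_cong_AE) auto
        also have "\<dots> \<le> 4 * (u h + f h) * sqrt (u h) + 6 * (u h)\<^sup>2"
          using Z_birth_moments[OF h(2)]
          by (intro indep_difference_fourth_power Z_indep_var birth_death_finite_borel Z_fourth_moment birth_death_Int)
            (auto simp: f_def)
        finally show ?thesis .
      qed
      have iD: "integrable M (D n)" unfolding D_def[abs_def] h_def[symmetric] by (intro Bochner_Integration.integrable_sum i)
      have "expectation (\<lambda>\<omega>. \<bar>D n \<omega>\<bar>) \<le> expectation (\<lambda>\<omega>. \<Sum>k<n - 1. \<bar>?d k \<omega>\<bar>)"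
        unfolding D_def h_def[symmetric] using i by (intro integral_mono' Bochner_Integration.integrable_sum) auto
      also have "\<dots> = (\<Sum>k<n - 1. expectation (\<lambda>\<omega>. \<bar>?d k \<omega>\<bar>))"
        using i by (intro Bochner_Integration.integral_sum) auto
      also have "\<dots> \<le> real (n - 1) * (4 * (u h + f h) * sqrt (u h) + 6 * (u h)\<^sup>2)"
        using sum_bounded_above[of "{..<n - 1}" "\<lambda>k. expectation (\<lambda>\<omega>. \<bar>?d k \<omega>\<bar>)", OF e] by simp
      also have "\<dots> \<le> real n * (4 * (u h + f h) * sqrt (u h) + 6 * (u h)\<^sup>2)"
        using u_bounds(3)[OF h(2)] excess_nonneg by (intro mult_right_mono) (auto simp: f_def)
      finally have "1 / (2 * h * real n) * expectation (\<lambda>\<omega>. \<bar>D n \<omega>\<bar>) \<le> 1 / (2 * h * real n) * (real n * (4 * (u h + f h) * sqrt (u h) + 6 * (u h)\<^sup>2))"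
        using h n by (intro mult_left_mono) auto
      also have "\<dots> = ?e n"
        unfolding h_def[symmetric] f_def using h n by (simp add: field_simps power2_eq_square)
      finally show ?case using iD h n by (simp add: c_def abs_mult h_def)
    qed
  qed
  have vB: "vanishing (\<lambda>n \<omega>. c n * (\<Sum>k<n - 1. Z (birth (\<Delta> n) k) \<omega> ^ 4 - f (\<Delta> n)))"
    unfolding c_def f_def by (rule fourth_power_lln)
      (auto intro: birth_death_finite_borel birth_disjoint birth_death_measure)
  have vE: "vanishing (\<lambda>n \<omega>. c n * (\<Sum>k<n - 1. Z (death (\<Delta> n) k) \<omega> ^ 4 - f (\<Delta> n)))"
    unfolding c_def f_def by (rule fourth_power_lln)
      (auto intro: birth_death_finite_borel death_disjoint birth_death_measure)
  define d where "d n = c n * (2 * real (n - 1) * f (\<Delta> n)) - excess * a 0" for n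
  have "(\<lambda>n. real (n - 1) / real n * ((u (\<Delta> n) / \<Delta> n) * (3 * u (\<Delta> n) + excess)) - excess * a 0) \<longlonglongrightarrow> 1 * (a 0 * (3 * 0 + excess)) - excess * a 0"
    by (intro tendsto_intros pred_ratio u_lim u_lim0)
  moreover have "real (n - 1) / real n * ((u (\<Delta> n) / \<Delta> n) * (3 * u (\<Delta> n) + excess)) - excess * a 0 = d n" for n
    by (simp add: d_def c_def f_def power2_eq_square algebra_simps)
  ultimately have "d \<longlonglongrightarrow> 0" by simp
  then have "vanishing (\<lambda>n \<omega>. c n * D n \<omega> + c n * (\<Sum>k<n - 1. Z (birth (\<Delta> n) k) \<omega> ^ 4 - f (\<Delta> n))
      + c n * (\<Sum>k<n - 1. Z (death (\<Delta> n) k) \<omega> ^ 4 - f (\<Delta> n)) + d n)"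
    by (intro vanishing_add vD vB vE vanishing_const)
  also have "(\<lambda>n \<omega>. c n * D n \<omega> + c n * (\<Sum>k<n - 1. Z (birth (\<Delta> n) k) \<omega> ^ 4 - f (\<Delta> n))
      + c n * (\<Sum>k<n - 1. Z (death (\<Delta> n) k) \<omega> ^ 4 - f (\<Delta> n)) + d n)
    = (\<lambda>n \<omega>. Q_stat (\<lambda>t. trawl_process L a t \<omega>) (\<Delta> n) n - excess * a 0)"
  proof (intro ext)
    fix n \<omega>
    define x where "x = (\<Sum>k<n - 1. dX (\<Delta> n) k \<omega> ^ 4)"
    define y where "y = (\<Sum>k<n - 1. Z (birth (\<Delta> n) k) \<omega> ^ 4)"
    define z where "z = (\<Sum>k<n - 1. Z (death (\<Delta> n) k) \<omega> ^ 4)"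
    have Dx: "D n \<omega> = x - y - z" by (simp add: D_def x_def y_def z_def sum_subtractf)
    have Qx: "Q_stat (\<lambda>t. trawl_process L a t \<omega>) (\<Delta> n) n = c n * x"
      by (simp add: Q_stat_def increment_eq_dX x_def c_def)
    show "c n * D n \<omega> + c n * (\<Sum>k<n - 1. Z (birth (\<Delta> n) k) \<omega> ^ 4 - f (\<Delta> n))
      + c n * (\<Sum>k<n - 1. Z (death (\<Delta> n) k) \<omega> ^ 4 - f (\<Delta> n)) + d n
      = Q_stat (\<lambda>t. trawl_process L a t \<omega>) (\<Delta> n) n - excess * a 0"
      unfolding Dx Qx sum_subtractf y_def[symmetric] z_def[symmetric] by (simp add: d_def algebra_simps)
  qed
  finally show ?thesis .
qed

theorem levy_case:
  assumes "0 < c4 \<nu>"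
  shows "weak_conv_m
           (\<lambda>n. distr M borel (\<lambda>\<omega>.
              let x = (\<lambda>t. trawl_process L a t \<omega>); h = \<Delta> n in
              sqrt (real n * h / Q_stat x h n) * (a_hat x h n - a 0 - 1 / 2 * h * a'_hat x h n)))
           (density lborel (normal_density 0 1))"
proof -
  obtain B where B: "\<forall>\<^sub>F n in sequentially. integrable M (birth_statistic n) \<and> expectation (\<lambda>\<omega>. \<bar>birth_statistic n \<omega>\<bar>) \<le> B"
    using birth_statistic_L1 by blast
  have pos: "0 < excess * a 0" using excess_pos[OF assms] a_0_pos by simp
  note [measurable] = dX_measurable
  have "weak_conv_m (\<lambda>n. distr M borel (\<lambda>\<omega>.
              let x = (\<lambda>t. trawl_process L a t \<omega>); h = \<Delta> n in
              sqrt (real n * h / Q_stat x h n) * (a_hat x h n - a 0 - 1 / 2 * h * a'_hat x h n)))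
      (density lborel (normal_density 0 (sqrt (excess * a 0 / (excess * a 0)))))"
  proof (rule slutsky_ratio[OF birth_statistic_measurable birth_statistic_char B levy_statistic_approx Q_lim _ _ pos pos])
    show "(\<lambda>\<omega>. let x = (\<lambda>t. trawl_process L a t \<omega>); h = \<Delta> n in
              sqrt (real n * h / Q_stat x h n) * (a_hat x h n - a 0 - 1 / 2 * h * a'_hat x h n)) \<in> borel_measurable M" for n
      unfolding Let_def Q_stat_def a_hat_def a'_hat_def increment_eq_dX by measurable
    show "\<forall>\<^sub>F n in sequentially. \<forall>\<omega>. (let x = (\<lambda>t. trawl_process L a t \<omega>); h = \<Delta> n in
              sqrt (real n * h / Q_stat x h n) * (a_hat x h n - a 0 - 1 / 2 * h * a'_hat x h n))
          = sqrt (1 / Q_stat (\<lambda>t. trawl_process L a t \<omega>) (\<Delta> n) n) * levy_statistic n \<omega>"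
      by (intro always_eventually allI) (simp add: levy_statistic_def Let_def real_sqrt_divide)
  qed
  moreover have "sqrt (excess * a 0 / (excess * a 0)) = 1"
    using pos by (subst divide_self) (simp_all only: real_sqrt_one less_imp_neq[THEN not_sym] not_False_eq_True)
  ultimately show ?thesis by (simp only:)
qed

end

section \<open>Gaussian integration by parts\<close>

text \<open>Stein's identity. The density satisfies \<open>\<phi>' y = - (y / v) * \<phi> y\<close>,
  so the difference of the two integrands is the derivative of \<open>- v * \<phi> * g\<close>,
  which vanishes at both ends.\<close>

lemma normal_density_FTC:
  fixes g g' :: "real \<Rightarrow> complex"
  assumes v: "0 < v"
    and deriv: "\<And>y. (g has_vector_derivative g' y) (at y)" and cont: "\<And>y. isCont g' y"
    and bound: "\<And>y. cmod (g y) \<le> B * (1 + \<bar>y\<bar>)"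
    and int: "integrable (density lborel (normal_density 0 (sqrt v))) (\<lambda>y. of_real y * g y)"
      "integrable (density lborel (normal_density 0 (sqrt v))) g'"
  shows "(CLINT y|density lborel (normal_density 0 (sqrt v)). of_real y * g y)
    = of_real v * (CLINT y|density lborel (normal_density 0 (sqrt v)). g' y)"
proof -
  let ?\<phi> = "normal_density 0 (sqrt v)"
  define F where "F y = (- v * ?\<phi> y) *\<^sub>R g y" for y
  define f where "f y = (y * ?\<phi> y) *\<^sub>R g y - (v * ?\<phi> y) *\<^sub>R g' y" for y
  have B: "0 \<le> B" using order_trans[OF norm_ge_zero bound[of 0]] by simp
  have \<phi>d: "(?\<phi> has_real_derivative (- (y / v) * ?\<phi> y)) (at y)" for y
    unfolding normal_density_def using v
    by (auto intro!: derivative_eq_intros simp: field_simps power2_eq_square)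
  have Fd: "(F has_vector_derivative f y) (at y)" for y
  proof -
    have "((\<lambda>y. - v * ?\<phi> y) has_real_derivative (y * ?\<phi> y)) (at y)"
      using v by (auto intro!: derivative_eq_intros \<phi>d)
    from has_vector_derivative_scaleR[OF this deriv[of y]]
    show ?thesis unfolding F_def f_def by (simp add: algebra_simps)
  qed
  have gc: "isCont g y" for y
    using deriv has_vector_derivative_continuous by blast
  have \<phi>c: "isCont ?\<phi> y" for y using \<phi>d DERIV_isCont by blast
  have fc: "isCont f y" for y
    unfolding f_def by (intro continuous_intros \<phi>c gc cont)
  have mg: "g \<in> borel_measurable borel" "g' \<in> borel_measurable borel"
    using gc cont by (auto intro!: borel_measurable_continuous_onI continuous_at_imp_continuous_on)
  have i1: "integrable lborel (\<lambda>y. ?\<phi> y *\<^sub>R (of_real y * g y))" "integrable lborel (\<lambda>y. ?\<phi> y *\<^sub>R g' y)"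
    using int mg by (auto simp: integrable_density)
  have fi: "integrable lborel f"
  proof -
    have "integrable lborel (\<lambda>y. ?\<phi> y *\<^sub>R (of_real y * g y) - v *\<^sub>R (?\<phi> y *\<^sub>R g' y))"
      by (intro Bochner_Integration.integrable_diff integrable_scaleR_right i1)
    then show ?thesis unfolding f_def[abs_def] by (simp add: scaleR_conv_of_real mult_ac)
  qed
  have lim: "(F \<longlongrightarrow> 0) at_infinity"
  proof (rule Lim_null_comparison)
    \<comment> \<open>From \<open>exp (- x) <= 1 / x\<close> the density decays at least like
      \<open>1 / y^2\<close>, enough against the linear growth of \<open>g\<close>.\<close>
    define C where "C = v / sqrt (2 * pi * v) * (2 * v) * (2 * B)"
    show "((\<lambda>y. C / norm y) \<longlongrightarrow> 0) at_infinity"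
      by (rule tendsto_divide_0[OF tendsto_const filterlim_at_top_imp_at_infinity[OF filterlim_norm_at_top]])
    have "norm (F y) \<le> C / norm y" if y: "1 \<le> norm y" for y
    proof -
      have y0: "0 < \<bar>y\<bar>" "0 < y\<^sup>2" using y by (auto simp: power2_eq_square zero_less_mult_iff)
      have "exp (- y\<^sup>2 / (2 * v)) = inverse (exp (y\<^sup>2 / (2 * v)))" by (simp add: exp_minus[symmetric])
      also have "\<dots> \<le> inverse (y\<^sup>2 / (2 * v))"
      proof (rule le_imp_inverse_le)
        show "y\<^sup>2 / (2 * v) \<le> exp (y\<^sup>2 / (2 * v))"
          using exp_ge_add_one_self[of "y\<^sup>2 / (2 * v)"] by linarith
      qed (use y0 v in simp)
      finally have ex: "exp (- y\<^sup>2 / (2 * v)) \<le> 2 * v / y\<^sup>2" by simp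
      have \<phi>: "?\<phi> y \<le> 1 / sqrt (2 * pi * v) * (2 * v / y\<^sup>2)"
        unfolding normal_density_def using v ex by (intro mult_mono) auto
      have "norm (F y) = v * ?\<phi> y * cmod (g y)" using v by (simp add: F_def abs_mult)
      also have "\<dots> \<le> v * (1 / sqrt (2 * pi * v) * (2 * v / y\<^sup>2)) * (B * (2 * \<bar>y\<bar>))"
      proof (intro mult_mono mult_left_mono \<phi>)
        show "cmod (g y) \<le> B * (2 * \<bar>y\<bar>)"
          using y by (intro order_trans[OF bound] mult_left_mono B) auto
      qed (use v B in auto)
      also have "\<dots> = C / norm y"
      proof -
        have "y\<^sup>2 = \<bar>y\<bar> * \<bar>y\<bar>" by (simp add: power2_eq_square)
        then show ?thesis unfolding C_def real_norm_def using y0(1) by (simp only:) (simp del: abs_mult_self_eq)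
      qed
      finally show ?thesis .
    qed
    then show "\<forall>\<^sub>F y in at_infinity. norm (F y) \<le> C / norm y"
      by (auto simp: eventually_at_infinity)
  qed
  have "(LBINT y=-\<infinity>..\<infinity>. f y) = 0 - 0"
  proof (rule interval_integral_FTC_integrable[where F = F])
    show "set_integrable lborel (einterval (- \<infinity>) \<infinity>) f" using fi by (simp add: set_integrable_def)
    have "(F \<longlongrightarrow> 0) at_bot" "(F \<longlongrightarrow> 0) at_top"
      using lim tendsto_mono[OF at_bot_le_at_infinity] tendsto_mono[OF at_top_le_at_infinity] by blast+
    then show "((F \<circ> real_of_ereal) \<longlongrightarrow> 0) (at_right (- \<infinity>))" "((F \<circ> real_of_ereal) \<longlongrightarrow> 0) (at_left \<infinity>)"
      by (simp_all add: ereal_tendsto_simps)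
  qed (use Fd fc in auto)
  then have "(CLINT y|lborel. f y) = 0"
    by (simp add: interval_lebesgue_integral_def set_lebesgue_integral_def)
  moreover have "(CLINT y|lborel. f y) = (CLINT y|lborel. ?\<phi> y *\<^sub>R (of_real y * g y)) - v *\<^sub>R (CLINT y|lborel. ?\<phi> y *\<^sub>R g' y)"
  proof -
    have "f = (\<lambda>y. ?\<phi> y *\<^sub>R (of_real y * g y) - v *\<^sub>R (?\<phi> y *\<^sub>R g' y))"
      by (simp add: f_def fun_eq_iff scaleR_conv_of_real mult_ac)
    then show ?thesis
      by (simp only: Bochner_Integration.integral_diff i1 integrable_scaleR_right integral_scaleR_right)
  qed
  moreover have "(CLINT y|density lborel ?\<phi>. of_real y * g y) = (CLINT y|lborel. ?\<phi> y *\<^sub>R (of_real y * g y))"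
    using mg by (intro integral_density) auto
  moreover have "(CLINT y|density lborel ?\<phi>. g' y) = (CLINT y|lborel. ?\<phi> y *\<^sub>R g' y)"
    using mg by (intro integral_density) auto
  ultimately show ?thesis by (simp add: scaleR_conv_of_real)
qed

context prob_space
begin

lemma centred_gaussian_integrable_power:
  assumes "centred_gaussian v Y"
  shows "integrable M (\<lambda>\<omega>. \<bar>Y \<omega>\<bar> ^ k)"
proof (rule Bochner_Integration.integrable_bound)
  show "integrable M (\<lambda>\<omega>. 1 + Y \<omega> ^ (2 * k))"
    using centred_gaussian_even_moment(1)[OF assms] by simp
  have "\<bar>y\<bar> ^ k \<le> 1 + y ^ (2 * k)" for y :: real
  proof (cases "\<bar>y\<bar> \<le> 1")
    case True
    then have "\<bar>y\<bar> ^ k \<le> 1" by (intro power_le_one) auto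
    moreover have "0 \<le> y ^ (2 * k)" by simp
    ultimately show ?thesis by linarith
  next
    case False
    then have "\<bar>y\<bar> ^ k \<le> \<bar>y\<bar> ^ (2 * k)" by (intro power_increasing) auto
    then show ?thesis by (simp add: power_mult)
  qed
  then show "AE \<omega> in M. norm (\<bar>Y \<omega>\<bar> ^ k) \<le> norm (1 + Y \<omega> ^ (2 * k))"
    by (intro AE_I2) simp
  show "(\<lambda>\<omega>. \<bar>Y \<omega>\<bar> ^ k) \<in> borel_measurable M"
    using assms by (auto simp: centred_gaussian_def)
qed

text \<open>These test functions are what a linear form times the exponential of a quadratic form
  becomes once all coordinates but one are frozen. The degenerate case \<open>v = 0\<close> is
  covered for the sake of null atoms.\<close>

lemma gaussian_stein:
  assumes Y: "centred_gaussian v Y"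
  shows "(CLINT y|distr M borel Y. of_real y * (of_real (b * y + b') * iexp (\<alpha> * y\<^sup>2 + \<beta> * y + \<gamma>)))
    = of_real v * (CLINT y|distr M borel Y.
        (of_real b + of_real (b * y + b') * (\<i> * of_real (2 * \<alpha> * y + \<beta>))) * iexp (\<alpha> * y\<^sup>2 + \<beta> * y + \<gamma>))"
proof (cases "v = 0")
  case True
  have rv: "random_variable borel Y" using Y by (simp add: centred_gaussian_def)
  have "AE \<omega> in M. Y \<omega> = 0" using centred_gaussian_0 Y True by auto
  then have "AE y in distr M borel Y. y = 0" using rv by (simp add: AE_distr_iff)
  then have "AE y in distr M borel Y. of_real y * (of_real (b * y + b') * iexp (\<alpha> * y\<^sup>2 + \<beta> * y + \<gamma>)) = 0"
    by eventually_elim simp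
  then have "(CLINT y|distr M borel Y. of_real y * (of_real (b * y + b') * iexp (\<alpha> * y\<^sup>2 + \<beta> * y + \<gamma>))) = 0"
    by (rule integral_eq_zero_AE)
  then show ?thesis using True by simp
next
  case False
  have rv: "random_variable borel Y" using Y by (simp add: centred_gaussian_def)
  from False Y have v: "0 < v" by (simp add: centred_gaussian_def)
  define g where "g y = of_real (b * y + b') * iexp (\<alpha> * y\<^sup>2 + \<beta> * y + \<gamma>)" for y
  define g' where "g' y = (of_real b + of_real (b * y + b') * (\<i> * of_real (2 * \<alpha> * y + \<beta>))) * iexp (\<alpha> * y\<^sup>2 + \<beta> * y + \<gamma>)" for y
  have ipow: "integrable (distr M borel Y) (\<lambda>y. \<bar>y\<bar> ^ k)" for k
    using centred_gaussian_integrable_power[OF Y, of k] rv by (simp add: integrable_distr_eq)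
  let ?K = "\<bar>b\<bar> + \<bar>b'\<bar>"
  have lin: "\<bar>b * y + b'\<bar> \<le> ?K * (1 + \<bar>y\<bar>)" for y
  proof -
    have "\<bar>b * y + b'\<bar> \<le> \<bar>b\<bar> * \<bar>y\<bar> + \<bar>b'\<bar>" using abs_triangle_ineq[of "b * y" b'] by (simp add: abs_mult)
    also have "\<dots> \<le> ?K * (1 + \<bar>y\<bar>)" by (simp add: algebra_simps)
    finally show ?thesis .
  qed
  have lin2: "\<bar>2 * \<alpha> * y + \<beta>\<bar> \<le> (2 * \<bar>\<alpha>\<bar> + \<bar>\<beta>\<bar>) * (1 + \<bar>y\<bar>)" for y
  proof -
    have "\<bar>2 * \<alpha> * y + \<beta>\<bar> \<le> 2 * \<bar>\<alpha>\<bar> * \<bar>y\<bar> + \<bar>\<beta>\<bar>" using abs_triangle_ineq[of "2 * \<alpha> * y" \<beta>] by (simp add: abs_mult)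
    also have "\<dots> \<le> (2 * \<bar>\<alpha>\<bar> + \<bar>\<beta>\<bar>) * (1 + \<bar>y\<bar>)" by (simp add: algebra_simps)
    finally show ?thesis .
  qed
  have gb: "cmod (g y) \<le> ?K * (1 + \<bar>y\<bar>)" for y
    using lin[of y] by (simp add: g_def norm_mult flip: of_real_mult of_real_add of_real_power)
  have gm: "g \<in> borel_measurable borel" "g' \<in> borel_measurable borel"
    unfolding g_def g'_def by measurable
  show ?thesis
    unfolding g_def[symmetric] g'_def[symmetric] centred_gaussian_pos[OF Y v]
  proof (rule normal_density_FTC[OF v _ _ gb])
    fix y
    show "(g has_vector_derivative g' y) (at y)"
      unfolding g_def g'_def
      by (auto intro!: derivative_eq_intros has_vector_derivative_real_field simp: algebra_simps)
    show "isCont g' y" unfolding g'_def by (intro continuous_intros)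
  next
    have "integrable (distr M borel Y) (\<lambda>y. of_real y * g y)"
    proof (rule Bochner_Integration.integrable_bound)
      show "integrable (distr M borel Y) (\<lambda>y. ?K * (\<bar>y\<bar> ^ 1 + \<bar>y\<bar> ^ 2))"
        by (intro integrable_mult_right Bochner_Integration.integrable_add ipow)
      have "norm (of_real y * g y) \<le> ?K * (\<bar>y\<bar> ^ 1 + \<bar>y\<bar> ^ 2)" for y
        using mult_left_mono[OF gb[of y], of "\<bar>y\<bar>"] by (simp add: norm_mult power2_eq_square algebra_simps)
      then show "AE y in distr M borel Y. norm (of_real y * g y) \<le> norm (?K * (\<bar>y\<bar> ^ 1 + \<bar>y\<bar> ^ 2))"
        by (intro AE_I2) (metis abs_ge_self order_trans real_norm_def)
    qed (use gm in measurable)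
    then show "integrable (density lborel (normal_density 0 (sqrt v))) (\<lambda>y. of_real y * g y)"
      unfolding centred_gaussian_pos[OF Y v] .
    have "integrable (distr M borel Y) g'"
    proof (rule Bochner_Integration.integrable_bound)
      let ?J = "2 * \<bar>\<alpha>\<bar> + \<bar>\<beta>\<bar>"
      show "integrable (distr M borel Y) (\<lambda>y. \<bar>b\<bar> * \<bar>y\<bar> ^ 0 + ?K * ?J * (\<bar>y\<bar> ^ 0 + 2 * \<bar>y\<bar> ^ 1 + \<bar>y\<bar> ^ 2))"
        by (intro integrable_mult_right Bochner_Integration.integrable_add ipow)
      have "norm (g' y) \<le> \<bar>b\<bar> * \<bar>y\<bar> ^ 0 + ?K * ?J * (\<bar>y\<bar> ^ 0 + 2 * \<bar>y\<bar> ^ 1 + \<bar>y\<bar> ^ 2)" for y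
      proof -
        have "norm (g' y) = cmod (of_real b + of_real (b * y + b') * (\<i> * of_real (2 * \<alpha> * y + \<beta>)))"
          unfolding g'_def norm_mult by simp
        also have "\<dots> \<le> \<bar>b\<bar> + \<bar>b * y + b'\<bar> * \<bar>2 * \<alpha> * y + \<beta>\<bar>"
          by (rule order_trans[OF norm_triangle_ineq]) (simp only: norm_mult norm_of_real norm_ii mult_1)
        also have "\<bar>b * y + b'\<bar> * \<bar>2 * \<alpha> * y + \<beta>\<bar> \<le> (?K * (1 + \<bar>y\<bar>)) * (?J * (1 + \<bar>y\<bar>))"
          by (intro mult_mono lin lin2) auto
        also have "\<bar>b\<bar> + (?K * (1 + t)) * (?J * (1 + t)) = \<bar>b\<bar> * t ^ 0 + ?K * ?J * (t ^ 0 + 2 * t ^ 1 + t ^ 2)" for t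
          by (simp add: power2_eq_square algebra_simps)
        finally show ?thesis by simp
      qed
      then show "AE y in distr M borel Y. norm (g' y) \<le> norm (\<bar>b\<bar> * \<bar>y\<bar> ^ 0 + ?K * ?J * (\<bar>y\<bar> ^ 0 + 2 * \<bar>y\<bar> ^ 1 + \<bar>y\<bar> ^ 2))"
        by (intro AE_I2) (metis abs_ge_self order_trans real_norm_def)
    qed (use gm in simp)
    then show "integrable (density lborel (normal_density 0 (sqrt v))) g'"
      unfolding centred_gaussian_pos[OF Y v] .
  qed
qed

text \<open>Fubini isolates the \<open>j\<close>-th coordinate of the product law, in which the
  identity is \<open>gaussian_stein\<close>.\<close>

lemma gaussian_integration_by_parts:
  fixes \<xi> :: "'i \<Rightarrow> 'a \<Rightarrow> real" and c :: "'k \<Rightarrow> 'i \<Rightarrow> real" and b :: "'i \<Rightarrow> real"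
  assumes I: "finite I" "j \<in> I" and ind: "indep_vars (\<lambda>_. borel) \<xi> I"
    and g: "\<And>i. i \<in> I \<Longrightarrow> centred_gaussian (v i) (\<xi> i)"
  defines "\<delta> \<equiv> \<lambda>k \<omega>. \<Sum>i\<in>I. c k i * \<xi> i \<omega>" and "Y \<equiv> \<lambda>\<omega>. \<Sum>i\<in>I. b i * \<xi> i \<omega>"
  shows "(CLINT \<omega>|M. of_real (\<xi> j \<omega> * Y \<omega>) * iexp (\<theta> * (\<Sum>k\<in>K. (\<delta> k \<omega>)\<^sup>2)))
    = of_real (v j) * (CLINT \<omega>|M. (of_real (b j) + \<i> * of_real (2 * \<theta> * (\<Sum>k\<in>K. Y \<omega> * (\<delta> k \<omega> * c k j))))
        * iexp (\<theta> * (\<Sum>k\<in>K. (\<delta> k \<omega>)\<^sup>2)))"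
proof -
  have rv: "random_variable borel (\<xi> i)" if "i \<in> I" for i using g[OF that] by (simp add: centred_gaussian_def)
  \<comment> \<open>A point mass outside \<open>I\<close> makes every factor a probability measure,
    as the product construction over all indices demands.\<close>
  define \<nu> where "\<nu> i = (if i \<in> I then distr M borel (\<xi> i) else return borel 0)" for i
  have ps: "prob_space (\<nu> i)" for i
    unfolding \<nu>_def using rv by (auto intro!: prob_space_distr prob_space_return)
  interpret product_sigma_finite \<nu>
    by (intro product_sigma_finite.intro prob_space_imp_sigma_finite ps)
  have sets\<nu>[measurable_cong]: "sets (\<nu> i) = sets borel" for i by (simp add: \<nu>_def)
  let ?P = "PiM I \<nu>"
  let ?r = "\<lambda>\<omega>. \<lambda>i\<in>I. \<xi> i \<omega>"
  have mr: "?r \<in> measurable M (PiM I (\<lambda>_. borel))"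
    using rv by (intro measurable_restrict) auto
  have "distr M (PiM I (\<lambda>_. borel)) ?r = PiM I (\<lambda>i. distr M borel (\<xi> i))"
    using indep_vars_iff_distr_eq_PiM'[where I = I and M' = "\<lambda>_. borel" and X = \<xi>] I ind rv by auto
  also have "\<dots> = ?P" by (intro PiM_cong) (auto simp: \<nu>_def)
  finally have P: "distr M (PiM I (\<lambda>_. borel)) ?r = ?P" .
  define dx where "dx k x = (\<Sum>i\<in>I. c k i * x i)" for k and x :: "'i \<Rightarrow> real"
  define yx where "yx x = (\<Sum>i\<in>I. b i * x i)" for x :: "'i \<Rightarrow> real"
  define F where "F x = of_real (x j * yx x) * iexp (\<theta> * (\<Sum>k\<in>K. (dx k x)\<^sup>2))" for x
  define G where "G x = (of_real (b j) + \<i> * of_real (2 * \<theta> * (\<Sum>k\<in>K. yx x * (dx k x * c k j)))) * iexp (\<theta> * (\<Sum>k\<in>K. (dx k x)\<^sup>2))" for x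
  have dm: "dx k \<in> borel_measurable (PiM I (\<lambda>_. borel))" for k
    unfolding dx_def by (intro borel_measurable_sum borel_measurable_times measurable_component_singleton) auto
  have ym: "yx \<in> borel_measurable (PiM I (\<lambda>_. borel))"
    unfolding yx_def by (intro borel_measurable_sum borel_measurable_times measurable_component_singleton) auto
  have xm: "(\<lambda>x. x j) \<in> borel_measurable (PiM I (\<lambda>_. borel))"
    using I by (intro measurable_component_singleton)
  note [measurable] = dm ym xm
  have Fm: "F \<in> borel_measurable (PiM I (\<lambda>_. borel))" "G \<in> borel_measurable (PiM I (\<lambda>_. borel))"
    unfolding F_def G_def by measurable
  have dr: "dx k (?r \<omega>) = \<delta> k \<omega>" "yx (?r \<omega>) = Y \<omega>" "?r \<omega> j = \<xi> j \<omega>" for k \<omega>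
    using I by (auto simp: dx_def \<delta>_def yx_def Y_def intro!: sum.cong)
  have f\<xi>: "fourth_moment (\<xi> i)" if "i \<in> I" for i
    using rv[OF that] centred_gaussian_even_moment(1)[OF g[OF that], of 2] by (simp add: fourth_moment_def)
  have fY: "fourth_moment Y" and f\<delta>: "fourth_moment (\<delta> k)" for k
    unfolding Y_def \<delta>_def by (intro fourth_moment_sum fourth_moment_cmult f\<xi>; assumption)+
  have iF: "integrable M (\<lambda>\<omega>. F (?r \<omega>))"
  proof (rule Bochner_Integration.integrable_bound[OF fourth_moment_mult2[OF f\<xi>[OF I(2)] fY]])
    show "(\<lambda>\<omega>. F (?r \<omega>)) \<in> borel_measurable M" by (rule measurable_compose[OF mr Fm(1)])
    show "AE \<omega> in M. norm (F (?r \<omega>)) \<le> norm (\<xi> j \<omega> * Y \<omega>)"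
      unfolding F_def dr by (simp add: norm_mult)
  qed
  have iG: "integrable M (\<lambda>\<omega>. G (?r \<omega>))"
  proof (rule Bochner_Integration.integrable_bound)
    let ?g = "\<lambda>\<omega>. \<bar>b j\<bar> + \<bar>2 * \<theta> * (\<Sum>k\<in>K. Y \<omega> * \<delta> k \<omega> * c k j)\<bar>"
    show "integrable M ?g"
      by (intro Bochner_Integration.integrable_add integrable_abs integrable_mult_right Bochner_Integration.integrable_sum
          integrable_mult_left fourth_moment_mult2 fY f\<delta>) auto
    show "(\<lambda>\<omega>. G (?r \<omega>)) \<in> borel_measurable M" by (rule measurable_compose[OF mr Fm(2)])
    have "norm (G (?r \<omega>)) \<le> ?g \<omega>" for \<omega>
    proof -
      have "norm (G (?r \<omega>)) = cmod (of_real (b j) + \<i> * of_real (2 * \<theta> * (\<Sum>k\<in>K. Y \<omega> * (\<delta> k \<omega> * c k j))))"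
        unfolding G_def dr norm_mult by simp
      also have "\<dots> \<le> \<bar>b j\<bar> + \<bar>2 * \<theta> * (\<Sum>k\<in>K. Y \<omega> * (\<delta> k \<omega> * c k j))\<bar>"
        by (rule order_trans[OF norm_triangle_ineq]) (simp only: norm_mult norm_of_real norm_ii mult_1)
      finally show ?thesis by (simp only: mult.assoc)
    qed
    then show "AE \<omega> in M. norm (G (?r \<omega>)) \<le> norm (?g \<omega>)"
      by (intro AE_I2) (metis abs_ge_self order_trans real_norm_def)
  qed
  have iFP: "integrable ?P F" "integrable ?P G"
    unfolding P[symmetric] using iF iG mr Fm by (simp_all add: integrable_distr_eq)
  define J where "J = I - {j}"
  have IJ: "I = insert j J" "finite J" "j \<notin> J" using I by (auto simp: J_def)
  \<comment> \<open>With the other coordinates fixed, the exponent is the quadratic polynomial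
    \<open>A * y^2 + B * y + C\<close> and the linear form is \<open>b j * y + b'\<close>.\<close>
  have inner: "(\<integral>y. F (x(j := y)) \<partial>\<nu> j) = of_real (v j) * (\<integral>y. G (x(j := y)) \<partial>\<nu> j)" for x
  proof -
    define b' where "b' = (\<Sum>i\<in>J. b i * x i)"
    define q where "q k = (\<Sum>i\<in>J. c k i * x i)" for k
    define A where "A = \<theta> * (\<Sum>k\<in>K. (c k j)\<^sup>2)"
    define B where "B = 2 * \<theta> * (\<Sum>k\<in>K. c k j * q k)"
    define C where "C = \<theta> * (\<Sum>k\<in>K. (q k)\<^sup>2)"
    have d: "dx k (x(j := y)) = c k j * y + q k" for k y
      unfolding dx_def q_def IJ(1) using IJ(2,3) by (auto intro!: sum.cong)
    have yy: "yx (x(j := y)) = b j * y + b'" for y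
      unfolding yx_def b'_def IJ(1) using IJ(2,3) by (auto intro!: sum.cong)
    have Q: "\<theta> * (\<Sum>k\<in>K. (dx k (x(j := y)))\<^sup>2) = A * y\<^sup>2 + B * y + C" for y
      unfolding d A_def B_def C_def
      by (simp add: power2_sum power_mult_distrib sum.distrib sum_distrib_left sum_distrib_right algebra_simps)
    have Q': "2 * \<theta> * (\<Sum>k\<in>K. yx (x(j := y)) * (dx k (x(j := y)) * c k j)) = (b j * y + b') * (2 * A * y + B)" for y
      unfolding d yy A_def B_def
      by (simp add: sum.distrib sum_distrib_left sum_distrib_right algebra_simps power2_eq_square)
    have "F (x(j := y)) = of_real y * (of_real (b j * y + b') * iexp (A * y\<^sup>2 + B * y + C))" for y
      unfolding F_def Q yy by simp
    moreover have "G (x(j := y)) = (of_real (b j) + of_real (b j * y + b') * (\<i> * of_real (2 * A * y + B))) * iexp (A * y\<^sup>2 + B * y + C)" for y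
      unfolding G_def Q Q' by simp
    moreover have "\<nu> j = distr M borel (\<xi> j)" using I by (simp add: \<nu>_def)
    ultimately show ?thesis
      using gaussian_stein[OF g[OF I(2)], of "b j" b' A B C] by simp
  qed
  have "(CLINT \<omega>|M. F (?r \<omega>)) = integral\<^sup>L ?P F"
    unfolding P[symmetric] using mr Fm by (simp add: integral_distr)
  also have "\<dots> = (\<integral>x. (\<integral>y. F (x(j := y)) \<partial>\<nu> j) \<partial>PiM J \<nu>)"
    unfolding IJ(1) using IJ(2,3) iFP(1)[unfolded IJ(1)] by (rule product_integral_insert)
  also have "\<dots> = of_real (v j) * (\<integral>x. (\<integral>y. G (x(j := y)) \<partial>\<nu> j) \<partial>PiM J \<nu>)"
    unfolding inner by simp
  also have "(\<integral>x. (\<integral>y. G (x(j := y)) \<partial>\<nu> j) \<partial>PiM J \<nu>) = integral\<^sup>L ?P G"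
    unfolding IJ(1) using IJ(2,3) iFP(2)[unfolded IJ(1)] by (rule product_integral_insert[symmetric])
  also have "\<dots> = (CLINT \<omega>|M. G (?r \<omega>))"
    unfolding P[symmetric] using mr Fm by (simp add: integral_distr)
  finally show ?thesis unfolding F_def G_def dr .
qed

end

section \<open>Quadratic functionals of Gaussian increments\<close>

context prob_space
begin

text \<open>The second order Taylor remainder of the exponential is at most
  \<open>h^2 * S^2 / 2\<close>; a finite second moment makes it o(h) after integration.\<close>

lemma char_has_derivative:
  assumes S: "random_variable borel S" and S2: "integrable M (\<lambda>\<omega>. (S \<omega>)\<^sup>2)"
  shows "(char (distr M borel S) has_vector_derivative (CLINT \<omega>|M. \<i> * of_real (S \<omega>) * iexp (t * S \<omega>))) (at t)"
proof -
  note i1 = square_integrable_imp_integrable[OF S S2]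
  define D where "D = (CLINT \<omega>|M. \<i> * of_real (S \<omega>) * iexp (t * S \<omega>))"
  define f where "f t = (CLINT \<omega>|M. iexp (t * S \<omega>))" for t
  have char: "char (distr M borel S) = f"
    using S by (simp add: fun_eq_iff char_def integral_distr f_def)
  have ie: "integrable M (\<lambda>\<omega>. iexp (s * S \<omega>))" for s using S by (auto intro!: integrable_iexp)
  have iD: "integrable M (\<lambda>\<omega>. \<i> * of_real (S \<omega>) * iexp (t * S \<omega>))"
    by (rule Bochner_Integration.integrable_bound[OF i1]) (use S in \<open>auto simp: norm_mult\<close>)
  have est: "cmod (f (t + h) - f t - h *\<^sub>R D) \<le> h\<^sup>2 / 2 * expectation (\<lambda>\<omega>. (S \<omega>)\<^sup>2)" for h
  proof -
    define \<rho> where "\<rho> \<omega> = iexp ((t + h) * S \<omega>) - iexp (t * S \<omega>) - h *\<^sub>R (\<i> * of_real (S \<omega>) * iexp (t * S \<omega>))" for \<omega>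
    have "f (t + h) - f t - h *\<^sub>R D = (CLINT \<omega>|M. \<rho> \<omega>)"
      unfolding f_def D_def \<rho>_def
      by (simp only: Bochner_Integration.integral_diff Bochner_Integration.integrable_diff ie iD
          integrable_scaleR_right integral_scaleR_right)
    then have "cmod (f (t + h) - f t - h *\<^sub>R D) \<le> expectation (\<lambda>\<omega>. cmod (\<rho> \<omega>))"
      using integral_norm_bound[of M \<rho>] by simp
    also have "\<dots> \<le> expectation (\<lambda>\<omega>. h\<^sup>2 / 2 * (S \<omega>)\<^sup>2)"
    proof (rule integral_mono')
      fix \<omega>
      let ?s = "S \<omega>"
      have "iexp ((t + h) * ?s) - iexp (t * ?s) - h *\<^sub>R (\<i> * of_real ?s * iexp (t * ?s))
          = iexp (t * ?s) * (iexp (h * ?s) - (\<Sum>k\<le>1. (\<i> * complex_of_real (h * ?s)) ^ k / fact k))"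
        by (simp add: algebra_simps scaleR_conv_of_real flip: exp_add)
      also have "cmod \<dots> \<le> \<bar>h * ?s\<bar> ^ Suc 1 / fact (Suc 1)"
        using iexp_approx1[of "h * ?s" 1] by (simp add: norm_mult)
      also have "\<dots> = h\<^sup>2 / 2 * ?s\<^sup>2" by (simp add: power2_eq_square mult_ac)
      finally show "cmod (\<rho> \<omega>) \<le> h\<^sup>2 / 2 * ?s\<^sup>2" unfolding \<rho>_def .
    qed (use S2 in auto)
    also have "\<dots> = h\<^sup>2 / 2 * expectation (\<lambda>\<omega>. (S \<omega>)\<^sup>2)" by simp
    finally show ?thesis .
  qed
  define E where "E = expectation (\<lambda>\<omega>. (S \<omega>)\<^sup>2) / 2"
  have "((\<lambda>h. norm (f (t + h) - f t - h *\<^sub>R D) / norm h) \<longlongrightarrow> 0) (at 0)"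
  proof (rule Lim_null_comparison)
    have "((\<lambda>h::real. \<bar>h\<bar> * E) \<longlongrightarrow> \<bar>0\<bar> * E) (at 0)" by (intro tendsto_intros)
    then show "((\<lambda>h::real. \<bar>h\<bar> * E) \<longlongrightarrow> 0) (at 0)" by simp
    have "norm (norm (f (t + h) - f t - h *\<^sub>R D) / norm h) \<le> \<bar>h\<bar> * E" if "h \<noteq> 0" for h
    proof -
      have "norm (norm (f (t + h) - f t - h *\<^sub>R D) / norm h) = cmod (f (t + h) - f t - h *\<^sub>R D) / \<bar>h\<bar>"
        by simp
      also have "\<dots> \<le> (h\<^sup>2 * E) / \<bar>h\<bar>" using est[of h] by (intro divide_right_mono) (auto simp: E_def)
      also have "\<dots> = \<bar>h\<bar> * E" using that by (simp add: power2_eq_square field_simps)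
      finally show ?thesis .
    qed
    then show "\<forall>\<^sub>F h in at 0. norm (norm (f (t + h) - f t - h *\<^sub>R D) / norm h) \<le> \<bar>h\<bar> * E"
      by (auto simp: eventually_at_filter)
  qed
  then have "(f has_derivative (\<lambda>h. h *\<^sub>R D)) (at t)"
    unfolding has_derivative_at by (auto intro: bounded_linear_scaleR_left)
  then show ?thesis unfolding has_vector_derivative_def char D_def .
qed

text \<open>
  If the characteristic function solves the differential equation of the standard normal one
  up to a relative error \<open>\<epsilon>\<close>, then it is close to it: differentiate its product with \<open>exp (t\<^sup>2 / 2)\<close>.
\<close>

lemma approximate_gaussian_ode:
  fixes f f' :: "real \<Rightarrow> complex"
  assumes f0: "f 0 = 1" and d: "\<And>t. (f has_vector_derivative f' t) (at t)"
    and e: "\<And>t. cmod (f' t + of_real t * f t) \<le> \<bar>t\<bar> * \<epsilon>"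
  shows "cmod (f t - of_real (exp (- (t\<^sup>2 / 2)))) \<le> \<epsilon> * t\<^sup>2"
proof -
  define E where "E t = exp (t\<^sup>2 / 2)" for t :: real
  define g where "g t = E t *\<^sub>R f t" for t
  have e0: "0 \<le> \<epsilon>" using order_trans[OF norm_ge_zero e[of 1]] by simp
  have gd: "(g has_vector_derivative (E s *\<^sub>R (f' s + of_real s * f s))) (at s)" for s
  proof -
    have "(E has_real_derivative (E s * s)) (at s)"
      unfolding E_def by (auto intro!: derivative_eq_intros)
    from has_vector_derivative_scaleR[OF this d[of s]]
    show ?thesis unfolding g_def by (simp add: algebra_simps scaleR_conv_of_real)
  qed
  let ?S = "closed_segment 0 t"
  have S: "\<bar>s\<bar> \<le> \<bar>t\<bar>" if "s \<in> ?S" for s using that by (auto simp: closed_segment_eq_real_ivl split: if_splits)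
  have "norm (g t - g 0) \<le> (E t * (\<bar>t\<bar> * \<epsilon>)) * norm (t - 0)"
  proof (rule differentiable_bound[where S = ?S and f' = "\<lambda>s h. h *\<^sub>R (E s *\<^sub>R (f' s + of_real s * f s))"])
    fix s assume s: "s \<in> ?S"
    show "(g has_derivative (\<lambda>h. h *\<^sub>R (E s *\<^sub>R (f' s + of_real s * f s)))) (at s within ?S)"
      using gd[of s] unfolding has_vector_derivative_def by (rule has_derivative_at_withinI)
    have "onorm (\<lambda>h. h *\<^sub>R (E s *\<^sub>R (f' s + of_real s * f s))) \<le> norm (E s *\<^sub>R (f' s + of_real s * f s))"
      by (rule onorm_le) (simp add: abs_mult mult_ac)
    also have "\<dots> = E s * cmod (f' s + of_real s * f s)" by (simp add: E_def)
    also have "\<dots> \<le> E t * (\<bar>t\<bar> * \<epsilon>)"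
    proof (rule mult_mono)
      have "s\<^sup>2 \<le> t\<^sup>2" using S[OF s] by (simp add: abs_le_square_iff)
      then show "E s \<le> E t" by (simp add: E_def)
      show "cmod (f' s + of_real s * f s) \<le> \<bar>t\<bar> * \<epsilon>"
        using e[of s] S[OF s] e0 by (meson mult_right_mono order_trans)
    qed (auto simp: E_def)
    finally show "onorm (\<lambda>h. h *\<^sub>R (E s *\<^sub>R (f' s + of_real s * f s))) \<le> E t * (\<bar>t\<bar> * \<epsilon>)" .
  qed auto
  then have b: "norm (g t - 1) \<le> E t * (\<epsilon> * t\<^sup>2)"
    by (simp add: g_def E_def f0 power2_eq_square mult_ac)
  have "exp (- (t\<^sup>2 / 2)) * E t = 1" by (simp add: E_def flip: exp_add)
  then have "f t - of_real (exp (- (t\<^sup>2 / 2))) = exp (- (t\<^sup>2 / 2)) *\<^sub>R (g t - 1)"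
    by (simp only: g_def scaleR_diff_right scaleR_scaleR scaleR_one) (simp add: scaleR_conv_of_real)
  then have "cmod (f t - of_real (exp (- (t\<^sup>2 / 2)))) = exp (- (t\<^sup>2 / 2)) * norm (g t - 1)" by simp
  also have "\<dots> \<le> exp (- (t\<^sup>2 / 2)) * (E t * (\<epsilon> * t\<^sup>2))" by (intro mult_left_mono b) simp
  also have "\<dots> = \<epsilon> * t\<^sup>2" by (simp add: E_def flip: exp_add mult.assoc)
  finally show ?thesis .
qed

text \<open>Integration by parts turns the derivative of the characteristic function into
  \<open>- (t / T) * E (G * e)\<close>, where \<open>G\<close> is the quadratic form with the
  covariances as coefficients. If \<open>G\<close> concentrates at its mean \<open>T\<close> with
  relative error \<epsilon>, this is the differential equation of the standard normal law up to
  \<epsilon>.\<close>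

lemma gaussian_quadratic_char_bound:
  fixes \<xi> :: "'i \<Rightarrow> 'a \<Rightarrow> real" and c :: "nat \<Rightarrow> 'i \<Rightarrow> real" and r :: "nat \<Rightarrow> nat \<Rightarrow> real" and m :: nat
  assumes I: "finite I" and ind: "indep_vars (\<lambda>_. borel) \<xi> I"
    and g: "\<And>i. i \<in> I \<Longrightarrow> centred_gaussian (v i) (\<xi> i)"
    and r: "\<And>k l. r k l = (\<Sum>i\<in>I. v i * c k i * c l i)"
  defines "\<delta> \<equiv> \<lambda>k \<omega>. \<Sum>i\<in>I. c k i * \<xi> i \<omega>"
    and "T \<equiv> (\<Sum>k<m. \<Sum>l<m. (r k l)\<^sup>2)"
  assumes T: "0 < T" and \<epsilon>: "0 \<le> \<epsilon>"
    and var: "expectation (\<lambda>\<omega>. ((\<Sum>k<m. \<Sum>l<m. r k l * (\<delta> k \<omega> * \<delta> l \<omega>)) - T)\<^sup>2) \<le> (\<epsilon> * T)\<^sup>2"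
      "integrable M (\<lambda>\<omega>. ((\<Sum>k<m. \<Sum>l<m. r k l * (\<delta> k \<omega> * \<delta> l \<omega>)) - T)\<^sup>2)"
  defines "S \<equiv> \<lambda>\<omega>. ((\<Sum>k<m. (\<delta> k \<omega>)\<^sup>2) - (\<Sum>k<m. r k k)) / sqrt (2 * T)"
  shows "cmod (char (distr M borel S) t - of_real (exp (- (t\<^sup>2 / 2)))) \<le> \<epsilon> * t\<^sup>2"
proof -
  have f\<xi>: "fourth_moment (\<xi> i)" if "i \<in> I" for i
    using centred_gaussian_even_moment(1)[OF g[OF that], of 2] g[OF that] by (simp add: fourth_moment_def centred_gaussian_def)
  have f\<delta>: "fourth_moment (\<delta> k)" for k
    unfolding \<delta>_def by (intro fourth_moment_sum fourth_moment_cmult f\<xi>)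
  note [measurable] = fourth_moment_measurable[OF f\<delta>]
  define G where "G \<omega> = (\<Sum>k<m. \<Sum>l<m. r k l * (\<delta> k \<omega> * \<delta> l \<omega>))" for \<omega>
  define s where "s = sqrt (2 * T)"
  have s: "0 < s" "s * s = 2 * T" using T by (auto simp: s_def)
  define q0 where "q0 = (\<Sum>k<m. r k k)"
  define Q where "Q \<omega> = (\<Sum>k<m. (\<delta> k \<omega>)\<^sup>2)" for \<omega>
  have S: "S \<omega> = (Q \<omega> - q0) / s" for \<omega> by (simp add: S_def Q_def q0_def s_def)
  have mS: "S \<in> borel_measurable M" unfolding S_def by measurable
  have mG: "G \<in> borel_measurable M" unfolding G_def by measurable
  have iQ: "integrable M (\<lambda>\<omega>. (\<delta> k \<omega>)\<^sup>2)" for k using fourth_moment_power[OF f\<delta>, of 2] by simp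
  have i2: "integrable M (\<lambda>\<omega>. \<delta> k \<omega> * \<delta> l \<omega>)" for k l using fourth_moment_mult2[OF f\<delta> f\<delta>] .
  have S2: "integrable M (\<lambda>\<omega>. (S \<omega>)\<^sup>2)"
  proof -
    have "(S \<omega>)\<^sup>2 = ((\<Sum>k<m. \<Sum>l<m. \<delta> k \<omega> * \<delta> k \<omega> * \<delta> l \<omega> * \<delta> l \<omega>) - 2 * q0 * (\<Sum>k<m. (\<delta> k \<omega>)\<^sup>2) + q0\<^sup>2) / s\<^sup>2" for \<omega>
      unfolding S power_divide power2_diff Q_def power2_eq_square[of "\<Sum>k<m. (\<delta> k \<omega>)\<^sup>2"] sum_product
      by (simp add: power2_eq_square mult_ac)
    moreover have "integrable M (\<lambda>\<omega>. ((\<Sum>k<m. \<Sum>l<m. \<delta> k \<omega> * \<delta> k \<omega> * \<delta> l \<omega> * \<delta> l \<omega>) - 2 * q0 * (\<Sum>k<m. (\<delta> k \<omega>)\<^sup>2) + q0\<^sup>2) / s\<^sup>2)"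
      by (intro integrable_divide Bochner_Integration.integrable_add Bochner_Integration.integrable_diff
          Bochner_Integration.integrable_sum integrable_mult_right fourth_moment_mult4 f\<delta> iQ) auto
    ultimately show ?thesis by simp
  qed
  define \<theta> where "\<theta> t = t / s" for t
  define e where "e t \<omega> = iexp (t * S \<omega>)" for t \<omega>
  have eQ: "e t \<omega> = iexp (- \<theta> t * q0) * iexp (\<theta> t * Q \<omega>)" for t \<omega>
  proof -
    have "t * S \<omega> = - \<theta> t * q0 + \<theta> t * Q \<omega>" by (simp add: S \<theta>_def diff_divide_distrib right_diff_distrib)
    then show ?thesis unfolding e_def by (simp only: of_real_add distrib_left exp_add)
  qed
  have ne: "cmod (e t \<omega>) = 1" for t \<omega> by (simp add: e_def flip: of_real_mult)
  have me: "e t \<in> borel_measurable M" for t unfolding e_def using mS by measurable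
  have ie: "integrable M (\<lambda>\<omega>. of_real (X \<omega>) * e t \<omega>)" if "integrable M X" for X t
    by (rule Bochner_Integration.integrable_bound[OF that])
      (use that me in \<open>auto simp: norm_mult ne intro!: borel_measurable_times borel_measurable_of_real\<close>)
  have ie1: "integrable M (e t)" for t using ie[of "\<lambda>_. 1"] by simp
  \<comment> \<open>One factor of the square is expanded into the coordinates and integrated by
    parts; summing over the coordinates reassembles the covariances \<open>r k l\<close>.\<close>
  have dd: "(CLINT \<omega>|M. of_real (\<delta> k \<omega> * \<delta> k \<omega>) * e t \<omega>)
      = of_real (r k k) * (CLINT \<omega>|M. e t \<omega>) + 2 * \<i> * of_real (\<theta> t) * (\<Sum>l<m. of_real (r k l) * (CLINT \<omega>|M. of_real (\<delta> k \<omega> * \<delta> l \<omega>) * e t \<omega>))" for k t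
  proof -
    let ?w = "iexp (- \<theta> t * q0)"
    have ibp: "(CLINT \<omega>|M. of_real (\<xi> j \<omega> * \<delta> k \<omega>) * e t \<omega>)
       = of_real (v j) * (of_real (c k j) * (CLINT \<omega>|M. e t \<omega>) + 2 * \<i> * of_real (\<theta> t) * (\<Sum>l<m. of_real (c l j) * (CLINT \<omega>|M. of_real (\<delta> k \<omega> * \<delta> l \<omega>) * e t \<omega>)))"
      if j: "j \<in> I" for j
    proof -
      have "(CLINT \<omega>|M. of_real (\<xi> j \<omega> * \<delta> k \<omega>) * e t \<omega>) = (CLINT \<omega>|M. ?w * (of_real (\<xi> j \<omega> * \<delta> k \<omega>) * iexp (\<theta> t * Q \<omega>)))"
        unfolding eQ by (simp only: mult_ac)
      also have "\<dots> = ?w * (CLINT \<omega>|M. of_real (\<xi> j \<omega> * \<delta> k \<omega>) * iexp (\<theta> t * Q \<omega>))"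
        by (rule integral_mult_right_zero)
      also have "(CLINT \<omega>|M. of_real (\<xi> j \<omega> * \<delta> k \<omega>) * iexp (\<theta> t * Q \<omega>))
        = of_real (v j) * (CLINT \<omega>|M. (of_real (c k j) + \<i> * of_real (2 * \<theta> t * (\<Sum>l<m. \<delta> k \<omega> * (\<delta> l \<omega> * c l j)))) * iexp (\<theta> t * Q \<omega>))"
        using gaussian_integration_by_parts[where c = c and b = "c k" and \<theta> = "\<theta> t" and K = "{..<m}", OF I j ind g]
        unfolding Q_def \<delta>_def by simp
      also have "?w * (of_real (v j) * (CLINT \<omega>|M. (of_real (c k j) + \<i> * of_real (2 * \<theta> t * (\<Sum>l<m. \<delta> k \<omega> * (\<delta> l \<omega> * c l j)))) * iexp (\<theta> t * Q \<omega>)))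
        = of_real (v j) * (CLINT \<omega>|M. ?w * ((of_real (c k j) + \<i> * of_real (2 * \<theta> t * (\<Sum>l<m. \<delta> k \<omega> * (\<delta> l \<omega> * c l j)))) * iexp (\<theta> t * Q \<omega>)))"
        by (simp only: integral_mult_right_zero mult.left_commute)
      also have "(CLINT \<omega>|M. ?w * ((of_real (c k j) + \<i> * of_real (2 * \<theta> t * (\<Sum>l<m. \<delta> k \<omega> * (\<delta> l \<omega> * c l j)))) * iexp (\<theta> t * Q \<omega>)))
        = (CLINT \<omega>|M. of_real (c k j) * e t \<omega> + 2 * \<i> * of_real (\<theta> t) * (\<Sum>l<m. of_real (c l j) * (of_real (\<delta> k \<omega> * \<delta> l \<omega>) * e t \<omega>)))"
        unfolding eQ
        by (intro Bochner_Integration.integral_cong refl) (simp add: algebra_simps sum_distrib_left sum_distrib_right)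
      also have "\<dots> = of_real (c k j) * (CLINT \<omega>|M. e t \<omega>) + 2 * \<i> * of_real (\<theta> t) * (\<Sum>l<m. of_real (c l j) * (CLINT \<omega>|M. of_real (\<delta> k \<omega> * \<delta> l \<omega>) * e t \<omega>))"
        by (simp only: Bochner_Integration.integral_add Bochner_Integration.integral_sum integral_mult_right_zero
            Bochner_Integration.integrable_sum integrable_mult_right ie1 ie[OF i2])
      finally show ?thesis .
    qed
    have "\<delta> k \<omega> * \<delta> k \<omega> = (\<Sum>j\<in>I. c k j * (\<xi> j \<omega> * \<delta> k \<omega>))" for \<omega>
      by (subst (1) \<delta>_def) (simp only: sum_distrib_right mult.assoc)
    then have "(CLINT \<omega>|M. of_real (\<delta> k \<omega> * \<delta> k \<omega>) * e t \<omega>) = (CLINT \<omega>|M. (\<Sum>j\<in>I. of_real (c k j) * (of_real (\<xi> j \<omega> * \<delta> k \<omega>) * e t \<omega>)))"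
      by (simp only: of_real_sum sum_distrib_right of_real_mult mult.assoc)
    also have "\<dots> = (\<Sum>j\<in>I. of_real (c k j) * (CLINT \<omega>|M. of_real (\<xi> j \<omega> * \<delta> k \<omega>) * e t \<omega>))"
      by (subst Bochner_Integration.integral_sum)
        (auto intro!: integrable_mult_right ie fourth_moment_mult2 f\<xi> f\<delta> simp del: of_real_mult)
    also have "\<dots> = (\<Sum>j\<in>I. of_real (c k j) * (of_real (v j) * (of_real (c k j) * (CLINT \<omega>|M. e t \<omega>) + 2 * \<i> * of_real (\<theta> t) * (\<Sum>l<m. of_real (c l j) * (CLINT \<omega>|M. of_real (\<delta> k \<omega> * \<delta> l \<omega>) * e t \<omega>)))))"
      by (intro sum.cong refl) (simp only: ibp)
    also have "\<dots> = of_real (\<Sum>j\<in>I. v j * c k j * c k j) * (CLINT \<omega>|M. e t \<omega>)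
        + 2 * \<i> * of_real (\<theta> t) * (\<Sum>j\<in>I. \<Sum>l<m. of_real (v j * c k j * c l j) * (CLINT \<omega>|M. of_real (\<delta> k \<omega> * \<delta> l \<omega>) * e t \<omega>))"
      by (simp add: sum_distrib_left sum_distrib_right sum.distrib algebra_simps)
    also have "(\<Sum>j\<in>I. \<Sum>l<m. of_real (v j * c k j * c l j) * (CLINT \<omega>|M. of_real (\<delta> k \<omega> * \<delta> l \<omega>) * e t \<omega>))
        = (\<Sum>l<m. of_real (r k l) * (CLINT \<omega>|M. of_real (\<delta> k \<omega> * \<delta> l \<omega>) * e t \<omega>))"
      unfolding r of_real_sum sum_distrib_right by (rule sum.swap)
    finally show ?thesis unfolding r by simp
  qed
  define f where "f = char (distr M borel S)"
  define f' where "f' t = (CLINT \<omega>|M. \<i> * of_real (S \<omega>) * iexp (t * S \<omega>))" for t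
  have fd: "(f has_vector_derivative f' t) (at t)" for t
    unfolding f_def f'_def by (rule char_has_derivative[OF mS S2])
  have fe: "f t = (CLINT \<omega>|M. e t \<omega>)" for t
    unfolding f_def e_def char_def using mS by (simp add: integral_distr)
  \<comment> \<open>The diagonal terms \<open>r k k\<close> cancel the centring of \<open>S\<close>,
    and \<open>s * s = 2 * T\<close> turns the constant \<open>2 * t / (s * s)\<close> into
    \<open>t / T\<close>.\<close>
  have f'G: "f' t = - of_real (t / T) * (CLINT \<omega>|M. of_real (G \<omega>) * e t \<omega>)" for t
  proof -
    have "f' t = (CLINT \<omega>|M. \<i> / of_real s * ((\<Sum>k<m. of_real (\<delta> k \<omega> * \<delta> k \<omega>) * e t \<omega>) - of_real q0 * e t \<omega>))"
      unfolding f'_def S e_def[symmetric] Q_def using s(1)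
      by (intro Bochner_Integration.integral_cong refl)
        (simp add: e_def S Q_def sum_distrib_right power2_eq_square field_simps)
    also have "\<dots> = \<i> / of_real s * ((\<Sum>k<m. (CLINT \<omega>|M. of_real (\<delta> k \<omega> * \<delta> k \<omega>) * e t \<omega>)) - of_real q0 * (CLINT \<omega>|M. e t \<omega>))"
      by (simp only: Bochner_Integration.integral_diff Bochner_Integration.integral_sum integral_mult_right_zero
            Bochner_Integration.integrable_sum integrable_mult_right ie1 ie[OF i2])
    also have "(\<Sum>k<m. (CLINT \<omega>|M. of_real (\<delta> k \<omega> * \<delta> k \<omega>) * e t \<omega>)) - of_real q0 * (CLINT \<omega>|M. e t \<omega>)
        = 2 * \<i> * of_real (\<theta> t) * (\<Sum>k<m. \<Sum>l<m. of_real (r k l) * (CLINT \<omega>|M. of_real (\<delta> k \<omega> * \<delta> l \<omega>) * e t \<omega>))"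
      unfolding dd q0_def by (simp add: sum.distrib sum_distrib_left sum_distrib_right)
    also have "(\<Sum>k<m. \<Sum>l<m. of_real (r k l) * (CLINT \<omega>|M. of_real (\<delta> k \<omega> * \<delta> l \<omega>) * e t \<omega>))
        = (CLINT \<omega>|M. (\<Sum>k<m. \<Sum>l<m. of_real (r k l) * (of_real (\<delta> k \<omega> * \<delta> l \<omega>) * e t \<omega>)))"
      by (simp only: Bochner_Integration.integral_sum integral_mult_right_zero
            Bochner_Integration.integrable_sum integrable_mult_right ie[OF i2])
    also have "\<dots> = (CLINT \<omega>|M. of_real (G \<omega>) * e t \<omega>)"
      by (intro Bochner_Integration.integral_cong refl) (simp add: G_def sum_distrib_right mult.assoc)
    finally have "f' t = \<i> / of_real s * (2 * \<i> * of_real (\<theta> t) * (CLINT \<omega>|M. of_real (G \<omega>) * e t \<omega>))" .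
    also have "\<dots> = - of_real (2 * t / (s * s)) * (CLINT \<omega>|M. of_real (G \<omega>) * e t \<omega>)"
      by (simp add: \<theta>_def field_simps)
    also have "2 * t / (s * s) = t / T" unfolding s(2) by simp
    finally show ?thesis .
  qed
  have iG: "integrable M G"
    unfolding G_def by (intro Bochner_Integration.integrable_sum integrable_mult_right i2)
  note var = var[folded G_def]
  have EG: "expectation (\<lambda>\<omega>. \<bar>G \<omega> - T\<bar>) \<le> \<epsilon> * T"
  proof -
    have "expectation (\<lambda>\<omega>. \<bar>G \<omega> - T\<bar>) \<le> sqrt (expectation (\<lambda>\<omega>. (G \<omega> - T)\<^sup>2))"
      by (rule expectation_abs_le_sqrt[OF _ var(2)]) (use mG in simp)
    also have "\<dots> \<le> sqrt ((\<epsilon> * T)\<^sup>2)" using var(1) by (rule real_sqrt_le_mono)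
    also have "\<dots> = \<epsilon> * T" using T \<epsilon> by simp
    finally show ?thesis .
  qed
  \<comment> \<open>Since \<open>|e| = 1\<close>, the defect in the differential equation is
    governed by \<open>E |G - T|\<close> alone.\<close>
  have err: "cmod (f' t + of_real t * f t) \<le> \<bar>t\<bar> * \<epsilon>" for t
  proof -
    have "f' t + of_real t * f t = - of_real (t / T) * ((CLINT \<omega>|M. of_real (G \<omega>) * e t \<omega>) - of_real T * (CLINT \<omega>|M. e t \<omega>))"
      unfolding f'G fe using T by (simp add: field_simps)
    also have "(CLINT \<omega>|M. of_real (G \<omega>) * e t \<omega>) - of_real T * (CLINT \<omega>|M. e t \<omega>) = (CLINT \<omega>|M. of_real (G \<omega> - T) * e t \<omega>)"
      using ie[OF iG, of t] ie1[of t] by (simp add: left_diff_distrib)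
    finally have "cmod (f' t + of_real t * f t) = \<bar>t\<bar> / T * cmod (CLINT \<omega>|M. of_real (G \<omega> - T) * e t \<omega>)"
      using T by (simp add: norm_mult norm_divide)
    also have "\<dots> \<le> \<bar>t\<bar> / T * expectation (\<lambda>\<omega>. \<bar>G \<omega> - T\<bar>)"
    proof (intro mult_left_mono)
      have "cmod (CLINT \<omega>|M. of_real (G \<omega> - T) * e t \<omega>) \<le> expectation (\<lambda>\<omega>. cmod (of_real (G \<omega> - T) * e t \<omega>))"
        by (rule integral_norm_bound)
      then show "cmod (CLINT \<omega>|M. of_real (G \<omega> - T) * e t \<omega>) \<le> expectation (\<lambda>\<omega>. \<bar>G \<omega> - T\<bar>)"
        by (simp only: norm_mult ne norm_of_real mult_1_right)
    qed (use T in simp)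
    also have "\<dots> \<le> \<bar>t\<bar> / T * (\<epsilon> * T)" using T by (intro mult_left_mono EG) simp
    also have "\<dots> = \<bar>t\<bar> * \<epsilon>" using T by simp
    finally show ?thesis .
  qed
  have "f 0 = 1" unfolding fe e_def by (simp add: prob_space)
  from approximate_gaussian_ode[OF this fd err] show ?thesis by (simp add: f_def)
qed

end

section \<open>Gaussian functionals and their eighth moments\<close>

context levy_basis_moments
begin

lemma ip_simple_functions:
  assumes I: "finite I" "disjoint_family_on C I" "\<And>i. i \<in> I \<Longrightarrow> C i \<in> finite_borel"
  shows "ip (\<lambda>q. \<Sum>i\<in>I. d i * indicator (C i) q) (\<lambda>q. \<Sum>i\<in>I. e i * indicator (C i) q)
    = (\<Sum>i\<in>I. measure lborel (C i) * d i * e i)"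
proof -
  have bi: "bounded_integrable (indicator (C i))" if "i \<in> I" for i
    using I(3)[OF that] by (rule bounded_integrable_indicator)
  have pw: "(\<Sum>i\<in>I. d i * indicator (C i) q) * (\<Sum>i\<in>I. e i * indicator (C i) q)
      = (\<Sum>i\<in>I. d i * e i * indicator (C i) q)" for q
  proof -
    have "(\<Sum>i\<in>I. d i * indicator (C i) q) * (\<Sum>i\<in>I. e i * indicator (C i) q)
      = (\<Sum>i\<in>I. \<Sum>j\<in>I. if j = i then d i * e i * indicator (C i) q else 0)"
      unfolding sum_product
    proof (intro sum.cong refl)
      fix i j assume "i \<in> I" "j \<in> I"
      then show "d i * indicator (C i) q * (e j * indicator (C j) q) = (if j = i then d i * e i * indicator (C i) q else 0)"
        using I(2) by (cases "j = i") (auto simp: disjoint_family_on_def indicator_def)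
    qed
    then show ?thesis using I(1) by simp
  qed
  show ?thesis
    unfolding ip_def pw using bi[THEN bounded_integrableD]
    by (subst Bochner_Integration.integral_sum) (auto intro!: sum.cong simp: mult_ac)
qed

text \<open>Over disjoint atoms the summands are independent Gaussians, so the characteristic
  functions multiply and the variances add up to \<open>ip f f\<close>.\<close>

lemma lin_centred_gaussian:
  assumes "c4 \<nu> = 0" "lin f X"
  shows "centred_gaussian (ip f f) X"
proof -
  obtain I :: "(real \<times> real) set set set" and C e where I: "finite I" "disjoint_family_on C I"
    "\<And>i. i \<in> I \<Longrightarrow> C i \<in> finite_borel"
    and fe: "\<And>k. k \<in> {()} \<Longrightarrow> f = (\<lambda>q. \<Sum>i\<in>I. e k i * indicator (C i) q)"
    and Xe: "\<And>k. k \<in> {()} \<Longrightarrow> AE \<omega> in M. X \<omega> = (\<Sum>i\<in>I. e k i * Z (C i) \<omega>)"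
    by (rule lin_common_atoms[of "{()}" "\<lambda>_. f" "\<lambda>_. X"]) (use assms in auto)
  define d where "d = e ()"
  have f: "f = (\<lambda>q. \<Sum>i\<in>I. d i * indicator (C i) q)"
    and X: "AE \<omega> in M. X \<omega> = (\<Sum>i\<in>I. d i * Z (C i) \<omega>)"
    using fe[of "()"] Xe[of "()"] by (simp_all add: d_def)
  have mZ: "random_variable borel (\<lambda>\<omega>. d i * Z (C i) \<omega>)" if "i \<in> I" for i
    using Z_measurable[OF I(3)[OF that]] by simp
  have mS: "random_variable borel (\<lambda>\<omega>. \<Sum>i\<in>I. d i * Z (C i) \<omega>)" using mZ by (intro borel_measurable_sum) auto
  have "char (distr M borel X) t = complex_of_real (exp (- (ip f f * t\<^sup>2 / 2)))" for t
  proof -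
    have "distr M borel X = distr M borel (\<lambda>\<omega>. \<Sum>i\<in>I. d i * Z (C i) \<omega>)"
      using X lin_measurable[OF assms(2)] mS by (intro distr_cong_AE) auto
    then have "char (distr M borel X) t = (\<Prod>i\<in>I. char (distr M borel (\<lambda>\<omega>. d i * Z (C i) \<omega>)) t)"
      using char_distr_sum[OF Z_scaled_indep_vars[OF I]] by simp
    also have "\<dots> = (\<Prod>i\<in>I. complex_of_real (exp (- (measure lborel (C i) * d i * d i * t\<^sup>2 / 2))))"
    proof (rule prod.cong[OF refl])
      fix i assume i: "i \<in> I"
      have "char (distr M borel (\<lambda>\<omega>. d i * Z (C i) \<omega>)) t = char (distr M borel (Z (C i))) (t * d i)"
        unfolding char_def using mZ[OF i] Z_measurable[OF I(3)[OF i]] by (simp add: integral_distr mult_ac)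
      also have "\<dots> = complex_of_real (exp (- (measure lborel (C i) * (t * d i)\<^sup>2 / 2)))"
        using Z_centred_gaussian(1)[OF assms(1) I(3)[OF i]] by (simp add: centred_gaussian_def)
      finally show "char (distr M borel (\<lambda>\<omega>. d i * Z (C i) \<omega>)) t
          = complex_of_real (exp (- (measure lborel (C i) * d i * d i * t\<^sup>2 / 2)))"
        by (simp add: power2_eq_square mult_ac)
    qed
    also have "\<dots> = complex_of_real (exp (\<Sum>i\<in>I. - (measure lborel (C i) * d i * d i * t\<^sup>2 / 2)))"
      unfolding exp_sum[OF I(1)] by simp
    also have "(\<Sum>i\<in>I. - (measure lborel (C i) * d i * d i * t\<^sup>2 / 2)) = - (ip f f * t\<^sup>2 / 2)"
    proof -
      have "ip f f = (\<Sum>i\<in>I. measure lborel (C i) * d i * d i)"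
        unfolding f by (rule ip_simple_functions[OF I])
      then show ?thesis by (simp add: sum_negf sum_distrib_right sum_divide_distrib)
    qed
    finally show ?thesis .
  qed
  then show ?thesis unfolding centred_gaussian_def using ip_nonneg lin_measurable[OF assms(2)] by blast
qed

text \<open>
  The product is a combination of the eighth powers of \<open>s * X + t * Y\<close> with
  \<open>s, t \<in> {0, \<plusminus>1, \<plusminus>2}\<close>, which are centred Gaussian with eighth moment \<open>105 * variance\<^sup>4\<close>.
\<close>

lemma gaussian_fourth_power_product:
  assumes c: "c4 \<nu> = 0" and l: "lin f X" "lin g Y" and v: "ip f f = v" "ip g g = v"
  shows "integrable M (\<lambda>\<omega>. X \<omega> ^ 4 * Y \<omega> ^ 4)"
    and "expectation (\<lambda>\<omega>. X \<omega> ^ 4 * Y \<omega> ^ 4) = 9 * v ^ 4 + 72 * v\<^sup>2 * (ip f g)\<^sup>2 + 24 * ip f g ^ 4"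
proof -
  define r where "r = ip f g"
  note bi = l[THEN lin_bounded_integrable]
  have L: "lin (\<lambda>q. s * f q + t * g q) (\<lambda>\<omega>. s * X \<omega> + t * Y \<omega>)" for s t
    by (intro lin_add lin_scale l)
  have q: "ip (\<lambda>q. s * f q + t * g q) (\<lambda>q. s * f q + t * g q) = s\<^sup>2 * v + 2 * s * t * r + t\<^sup>2 * v" for s t
    using v by (simp add: ip_add ip_add_right ip_scale ip_scale_right bi bounded_integrable_add bounded_integrable_scale
        r_def ip_commute[of g f]) (simp add: power2_eq_square algebra_simps)
  define E where "E s t \<omega> = (s * X \<omega> + t * Y \<omega>) ^ 8" for s t \<omega>
  have f8: "(fact 8 :: real) / (2 ^ 4 * fact 4) = 105" by (simp add: fact_numeral)
  have E: "integrable M (E s t)" "expectation (E s t) = 105 * (s\<^sup>2 * v + 2 * s * t * r + t\<^sup>2 * v) ^ 4" for s t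
  proof -
    note g = centred_gaussian_even_moment[OF lin_centred_gaussian[OF c L[of s t]], of 4]
    have k: "2 * 4 = (8::nat)" by simp
    show "integrable M (E s t)" "expectation (E s t) = 105 * (s\<^sup>2 * v + 2 * s * t * r + t\<^sup>2 * v) ^ 4"
      using g unfolding k q f8 E_def[abs_def] by blast+
  qed
  have pw: "X \<omega> ^ 4 * Y \<omega> ^ 4 = (378 * (E 1 0 \<omega> + E 0 1 \<omega>) + 68 * (E 1 1 \<omega> + E 1 (- 1) \<omega>)
      - (E 1 2 \<omega> + E 1 (- 2) \<omega> + E 2 1 \<omega> + E 2 (- 1) \<omega>)) / 5040" for \<omega>
  proof -
    have "x ^ 4 * y ^ 4 * 5040 = 378 * (x ^ 8 + y ^ 8) + 68 * ((x + y) ^ 8 + (x - y) ^ 8)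
      - ((x + 2 * y) ^ 8 + (x - 2 * y) ^ 8 + (2 * x + y) ^ 8 + (2 * x - y) ^ 8)" for x y :: real
      by algebra
    from this[of "X \<omega>" "Y \<omega>"] show ?thesis by (simp add: E_def)
  qed
  show "integrable M (\<lambda>\<omega>. X \<omega> ^ 4 * Y \<omega> ^ 4)"
    unfolding pw by (intro integrable_divide Bochner_Integration.integrable_diff Bochner_Integration.integrable_add
        integrable_mult_right E)
  have "expectation (\<lambda>\<omega>. X \<omega> ^ 4 * Y \<omega> ^ 4)
    = (378 * (expectation (E 1 0) + expectation (E 0 1)) + 68 * (expectation (E 1 1) + expectation (E 1 (- 1)))
      - (expectation (E 1 2) + expectation (E 1 (- 2)) + expectation (E 2 1) + expectation (E 2 (- 1)))) / 5040"
    unfolding pw by (simp only: Bochner_Integration.integral_diff Bochner_Integration.integral_add integral_mult_right_zero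
        integral_divide_zero Bochner_Integration.integrable_diff Bochner_Integration.integrable_add
        integrable_mult_right integrable_divide E(1))
  also have "\<dots> = (378 * (105 * v ^ 4 + 105 * v ^ 4) + 68 * (105 * (2 * v + 2 * r) ^ 4 + 105 * (2 * v - 2 * r) ^ 4)
      - (105 * (5 * v + 4 * r) ^ 4 + 105 * (5 * v - 4 * r) ^ 4 + 105 * (5 * v + 4 * r) ^ 4 + 105 * (5 * v - 4 * r) ^ 4)) / 5040"
    unfolding E(2) by simp
  also have "\<dots> = 9 * v ^ 4 + 72 * v\<^sup>2 * r\<^sup>2 + 24 * r ^ 4"
    by (simp add: power4_eq_xxxx power2_eq_square field_simps)
  finally show "expectation (\<lambda>\<omega>. X \<omega> ^ 4 * Y \<omega> ^ 4) = 9 * v ^ 4 + 72 * v\<^sup>2 * (ip f g)\<^sup>2 + 24 * ip f g ^ 4"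
    unfolding r_def .
qed

end

context trawl_basis
begin

text \<open>With variances \<open>2 * u\<close> the mean fourth power is \<open>12 * u^2\<close>,
  and two fourth powers with covariance \<open>r\<close> have covariance
  \<open>288 * u^2 * r^2 + 24 * r^4\<close>. As \<open>|r| <= 2 * u\<close>, the sum is controlled
  by the squared covariances.\<close>

lemma fourth_powers_variance:
  fixes m :: nat
  assumes c: "c4 \<nu> = 0" and h: "0 \<le> h"
  defines "V \<equiv> \<lambda>\<omega>. \<Sum>k<m. dX h k \<omega> ^ 4 - 12 * (u h)\<^sup>2"
  shows "integrable M (\<lambda>\<omega>. (V \<omega>)\<^sup>2)" and "expectation (\<lambda>\<omega>. (V \<omega>)\<^sup>2) \<le> 3072 * real m * u h ^ 4"
proof -
  let ?e = "12 * (u h)\<^sup>2"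
  note d = incr_cov_diag[OF h, unfolded incr_cov_def]
  have X4: "integrable M (\<lambda>\<omega>. dX h k \<omega> ^ 4)" "expectation (\<lambda>\<omega>. dX h k \<omega> ^ 4) = ?e" for k
    using lin_moments(1,4)[OF lin_dX[of h k]] Z_centred_gaussian(2)[OF c A_finite_borel]
    by (simp_all add: fourth_moment_def d power_mult_distrib)
  note X8 = gaussian_fourth_power_product[OF c lin_dX[of h] lin_dX[of h] d d, folded incr_cov_def]
  let ?t = "\<lambda>k l \<omega>. dX h k \<omega> ^ 4 * dX h l \<omega> ^ 4 - ?e * dX h k \<omega> ^ 4 - ?e * dX h l \<omega> ^ 4 + ?e\<^sup>2"
  have V2: "(V \<omega>)\<^sup>2 = (\<Sum>k<m. \<Sum>l<m. ?t k l \<omega>)" for \<omega>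
    unfolding V_def power2_eq_square sum_product
    by (intro sum.cong refl) (simp add: algebra_simps)
  have i: "integrable M (?t k l)" for k l
    by (intro Bochner_Integration.integrable_add Bochner_Integration.integrable_diff integrable_mult_right X4 X8) simp
  show "integrable M (\<lambda>\<omega>. (V \<omega>)\<^sup>2)"
    unfolding V2 by (intro Bochner_Integration.integrable_sum i)
  have e: "expectation (?t k l) \<le> 384 * (u h)\<^sup>2 * (incr_cov h k l)\<^sup>2" for k l
  proof -
    have "expectation (?t k l) = 9 * (2 * u h) ^ 4 + 72 * (2 * u h)\<^sup>2 * (incr_cov h k l)\<^sup>2 + 24 * incr_cov h k l ^ 4 - ?e * ?e - ?e * ?e + ?e\<^sup>2"
      using X4 X8[of k l] by (simp add: prob_space)
    also have "\<dots> = 72 * (2 * u h)\<^sup>2 * (incr_cov h k l)\<^sup>2 + 24 * (incr_cov h k l)\<^sup>2 * (incr_cov h k l)\<^sup>2"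
      by (simp add: power4_eq_xxxx power2_eq_square)
    also have "\<dots> \<le> 72 * (2 * u h)\<^sup>2 * (incr_cov h k l)\<^sup>2 + 24 * (2 * u h)\<^sup>2 * (incr_cov h k l)\<^sup>2"
    proof -
      have "(incr_cov h k l)\<^sup>2 \<le> (2 * u h)\<^sup>2"
        using abs_incr_cov_le[OF h, of k l] u_bounds(3)[OF h] by (subst abs_le_square_iff[symmetric]) simp
      then show ?thesis by (intro add_left_mono mult_right_mono mult_left_mono) auto
    qed
    finally show ?thesis by (simp add: power_mult_distrib)
  qed
  have "expectation (\<lambda>\<omega>. (V \<omega>)\<^sup>2) = (\<Sum>k<m. \<Sum>l<m. expectation (?t k l))"
    unfolding V2 by (simp only: Bochner_Integration.integral_sum Bochner_Integration.integrable_sum i)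
  also have "\<dots> \<le> (\<Sum>k<m. \<Sum>l<m. 384 * (u h)\<^sup>2 * (incr_cov h k l)\<^sup>2)" by (intro sum_mono e)
  also have "\<dots> = 384 * (u h)\<^sup>2 * (\<Sum>k<m. \<Sum>l<m. (incr_cov h k l)\<^sup>2)" by (simp add: sum_distrib_left)
  also have "\<dots> \<le> 384 * (u h)\<^sup>2 * (8 * real m * (u h)\<^sup>2)"
    by (intro mult_left_mono incr_cov_square_sum(1)[OF h]) simp
  also have "\<dots> = 3072 * real m * u h ^ 4" by (simp add: power4_eq_xxxx power2_eq_square)
  finally show "expectation (\<lambda>\<omega>. (V \<omega>)\<^sup>2) \<le> 3072 * real m * u h ^ 4" .
qed

text \<open>
  With \<open>\<Sigma>\<close> the covariance matrix of the increments, the variance of the quadratic form is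
  \<open>2 tr \<Sigma>\<^sup>4 \<le> 2 \<parallel>\<Sigma>\<parallel>\<^sup>2 tr \<Sigma>\<^sup>2\<close>, and the operator norm is at most the largest row sum.
\<close>

lemma covariance_form_variance:
  fixes m :: nat
  assumes c: "c4 \<nu> = 0" and h: "0 \<le> h"
  defines "T \<equiv> \<Sum>k<m. \<Sum>l<m. (incr_cov h k l)\<^sup>2"
  defines "V \<equiv> \<lambda>\<omega>. (\<Sum>k<m. \<Sum>l<m. incr_cov h k l * (dX h k \<omega> * dX h l \<omega>)) - T"
  shows "integrable M (\<lambda>\<omega>. (V \<omega>)\<^sup>2)" and "expectation (\<lambda>\<omega>. (V \<omega>)\<^sup>2) \<le> 32 * (u h)\<^sup>2 * T"
proof -
  let ?K = "{..<m} \<times> {..<m}" and ?r = "incr_cov h"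
  have K: "finite ?K" by simp
  note q = quadratic_variance[where f = "\<lambda>x. dF h (fst x)" and A = "\<lambda>x. dX h (fst x)" and g = "\<lambda>x. dF h (snd x)"
      and B = "\<lambda>x. dX h (snd x)" and s = "\<lambda>x. ?r (fst x) (snd x)", OF K lin_dX lin_dX, folded incr_cov_def]
  have V: "V \<omega> = (\<Sum>x\<in>?K. ?r (fst x) (snd x) * (dX h (fst x) \<omega> * dX h (snd x) \<omega> - ?r (fst x) (snd x)))" for \<omega>
    unfolding V_def T_def
    by (simp add: sum.cartesian_product' right_diff_distrib sum_subtractf power2_eq_square)
  show "integrable M (\<lambda>\<omega>. (V \<omega>)\<^sup>2)" unfolding V by (rule q(1))
  define \<rho> where "\<rho> = 4 * u h"
  have row: "(\<Sum>l<m. \<bar>?r k l\<bar>) \<le> \<rho>" if "k < m" for k using incr_cov_row(1)[OF h that] by (simp add: \<rho>_def)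
  have \<rho>0: "0 \<le> \<rho>" using u_bounds(3)[OF h] by (simp add: \<rho>_def)
  have T: "(\<Sum>k<m. \<Sum>l<m. (?r k l)\<^sup>2) = T" by (simp add: T_def)
  have T0: "0 \<le> T" unfolding T_def by (intro sum_nonneg) simp
  \<comment> \<open>The indices \<open>i\<close> and \<open>j\<close> occur in separate factors, so
    their sums are two row sums and only the sum of squares over \<open>k\<close>, \<open>l\<close>
    is left.\<close>
  have half: "(\<Sum>k<m. \<Sum>l<m. \<Sum>i<m. \<Sum>j<m. (?r k l)\<^sup>2 * (\<bar>?r k i\<bar> * \<bar>?r l j\<bar>)) \<le> T * \<rho>\<^sup>2"
  proof -
    have "(\<Sum>k<m. \<Sum>l<m. \<Sum>i<m. \<Sum>j<m. (?r k l)\<^sup>2 * (\<bar>?r k i\<bar> * \<bar>?r l j\<bar>))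
        = (\<Sum>k<m. \<Sum>l<m. (?r k l)\<^sup>2 * ((\<Sum>i<m. \<bar>?r k i\<bar>) * (\<Sum>j<m. \<bar>?r l j\<bar>)))"
      by (simp only: sum_product) (simp only: sum_distrib_left)
    also have "\<dots> \<le> (\<Sum>k<m. \<Sum>l<m. (?r k l)\<^sup>2 * (\<rho> * \<rho>))"
      by (intro sum_mono mult_left_mono mult_mono row sum_nonneg \<rho>0) auto
    also have "\<dots> = T * \<rho>\<^sup>2" by (simp add: T_def sum_distrib_right power2_eq_square)
    finally show ?thesis .
  qed
  \<comment> \<open>The arithmetic-geometric inequality is applied to \<open>r k l * r i j\<close>
    with the other two entries as weights; the two halves agree after relabelling, by
    symmetry.\<close>
  have S: "(\<Sum>k<m. \<Sum>l<m. \<Sum>i<m. \<Sum>j<m. \<bar>?r k l * ?r i j * (?r k i * ?r l j)\<bar>) \<le> T * \<rho>\<^sup>2"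
  proof -
    have "(\<Sum>k<m. \<Sum>l<m. \<Sum>i<m. \<Sum>j<m. \<bar>?r k l * ?r i j * (?r k i * ?r l j)\<bar>)
       \<le> (\<Sum>k<m. \<Sum>l<m. \<Sum>i<m. \<Sum>j<m. ((?r k l)\<^sup>2 * (\<bar>?r k i\<bar> * \<bar>?r l j\<bar>) + (?r i j)\<^sup>2 * (\<bar>?r k i\<bar> * \<bar>?r l j\<bar>)) / 2)"
    proof (intro sum_mono)
      fix k l i j
      have "\<bar>?r k l * ?r i j\<bar> \<le> ((?r k l)\<^sup>2 + (?r i j)\<^sup>2) / 2"
        using sum_squares_bound[of "\<bar>?r k l\<bar>" "\<bar>?r i j\<bar>"] by (simp add: abs_mult)
      from mult_right_mono[OF this, of "\<bar>?r k i\<bar> * \<bar>?r l j\<bar>"]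
      show "\<bar>?r k l * ?r i j * (?r k i * ?r l j)\<bar>
         \<le> ((?r k l)\<^sup>2 * (\<bar>?r k i\<bar> * \<bar>?r l j\<bar>) + (?r i j)\<^sup>2 * (\<bar>?r k i\<bar> * \<bar>?r l j\<bar>)) / 2"
        by (simp add: abs_mult distrib_right)
    qed
    also have "\<dots> = ((\<Sum>k<m. \<Sum>l<m. \<Sum>i<m. \<Sum>j<m. (?r k l)\<^sup>2 * (\<bar>?r k i\<bar> * \<bar>?r l j\<bar>))
        + (\<Sum>k<m. \<Sum>l<m. \<Sum>i<m. \<Sum>j<m. (?r i j)\<^sup>2 * (\<bar>?r k i\<bar> * \<bar>?r l j\<bar>))) / 2"
      by (simp add: sum.distrib flip: sum_divide_distrib)
    also have "(\<Sum>k<m. \<Sum>l<m. \<Sum>i<m. \<Sum>j<m. (?r i j)\<^sup>2 * (\<bar>?r k i\<bar> * \<bar>?r l j\<bar>))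
        = (\<Sum>i<m. \<Sum>j<m. \<Sum>k<m. \<Sum>l<m. (?r i j)\<^sup>2 * (\<bar>?r i k\<bar> * \<bar>?r j l\<bar>))"
    proof -
      have "(\<Sum>k<m. \<Sum>l<m. \<Sum>i<m. \<Sum>j<m. g i j k l) = (\<Sum>i<m. \<Sum>j<m. \<Sum>k<m. \<Sum>l<m. g i j k l)"
        for g :: "nat \<Rightarrow> nat \<Rightarrow> nat \<Rightarrow> nat \<Rightarrow> real"
      proof -
        have "(\<Sum>k<m. \<Sum>l<m. \<Sum>i<m. \<Sum>j<m. g i j k l) = (\<Sum>x\<in>?K. \<Sum>y\<in>?K. g (fst y) (snd y) (fst x) (snd x))"
          by (simp add: sum.cartesian_product')
        also have "\<dots> = (\<Sum>y\<in>?K. \<Sum>x\<in>?K. g (fst y) (snd y) (fst x) (snd x))" by (rule sum.swap)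
        finally show ?thesis by (simp add: sum.cartesian_product')
      qed
      from this[of "\<lambda>i j k l. (?r i j)\<^sup>2 * (\<bar>?r k i\<bar> * \<bar>?r l j\<bar>)"]
      show ?thesis by (simp add: incr_cov_commute)
    qed
    finally show ?thesis using half by simp
  qed
  have "expectation (\<lambda>\<omega>. (V \<omega>)\<^sup>2)
      = (\<Sum>x\<in>?K. \<Sum>y\<in>?K. ?r (fst x) (snd x) * ?r (fst y) (snd y) * (?r (fst x) (fst y) * ?r (snd x) (snd y) + ?r (fst x) (snd y) * ?r (snd x) (fst y)))"
    unfolding V using q(2) Z_centred_gaussian(2)[OF c A_finite_borel] by simp
  also have "\<dots> = (\<Sum>k<m. \<Sum>l<m. \<Sum>i<m. \<Sum>j<m. ?r k l * ?r i j * (?r k i * ?r l j))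
      + (\<Sum>k<m. \<Sum>l<m. \<Sum>i<m. \<Sum>j<m. ?r k l * ?r i j * (?r k j * ?r l i))"
    by (simp add: sum.cartesian_product' sum.distrib distrib_left)
  finally have ev: "expectation (\<lambda>\<omega>. (V \<omega>)\<^sup>2) = (\<Sum>k<m. \<Sum>l<m. \<Sum>i<m. \<Sum>j<m. ?r k l * ?r i j * (?r k i * ?r l j))
      + (\<Sum>k<m. \<Sum>l<m. \<Sum>i<m. \<Sum>j<m. ?r k l * ?r i j * (?r k j * ?r l i))" .
  have swap: "(\<Sum>k<m. \<Sum>l<m. \<Sum>i<m. \<Sum>j<m. ?r k l * ?r i j * (?r k j * ?r l i))
      = (\<Sum>k<m. \<Sum>l<m. \<Sum>i<m. \<Sum>j<m. ?r k l * ?r i j * (?r k i * ?r l j))"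
  proof (rule sum.cong[OF refl], rule sum.cong[OF refl])
    fix k l
    have "(\<Sum>i<m. \<Sum>j<m. ?r k l * ?r i j * (?r k j * ?r l i)) = (\<Sum>j<m. \<Sum>i<m. ?r k l * ?r i j * (?r k j * ?r l i))"
      by (rule sum.swap)
    also have "\<dots> = (\<Sum>j<m. \<Sum>i<m. ?r k l * ?r j i * (?r k j * ?r l i))"
      by (intro sum.cong refl) (simp add: incr_cov_commute)
    finally show "(\<Sum>i<m. \<Sum>j<m. ?r k l * ?r i j * (?r k j * ?r l i)) = (\<Sum>i<m. \<Sum>j<m. ?r k l * ?r i j * (?r k i * ?r l j))" .
  qed
  have "(\<Sum>k<m. \<Sum>l<m. \<Sum>i<m. \<Sum>j<m. ?r k l * ?r i j * (?r k i * ?r l j))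
      \<le> (\<Sum>k<m. \<Sum>l<m. \<Sum>i<m. \<Sum>j<m. \<bar>?r k l * ?r i j * (?r k i * ?r l j)\<bar>)"
    by (intro sum_mono abs_ge_self)
  also note S
  finally have "expectation (\<lambda>\<omega>. (V \<omega>)\<^sup>2) \<le> T * \<rho>\<^sup>2 + T * \<rho>\<^sup>2"
    unfolding ev swap by (intro add_mono)
  then show "expectation (\<lambda>\<omega>. (V \<omega>)\<^sup>2) \<le> 32 * (u h)\<^sup>2 * T" by (simp add: \<rho>_def power_mult_distrib mult_ac)
qed

text \<open>The increments agree almost surely with linear forms in finitely many independent
  Gaussians, to which the abstract bound applies.\<close>

lemma squared_increments_gaussian_char:
  fixes m :: nat
  assumes c: "c4 \<nu> = 0" and h: "0 \<le> h" and m: "0 < m" and u: "0 < u h"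
  defines "T \<equiv> \<Sum>k<m. \<Sum>l<m. (incr_cov h k l)\<^sup>2"
  defines "S \<equiv> \<lambda>\<omega>. ((\<Sum>k<m. (dX h k \<omega>)\<^sup>2) - (\<Sum>k<m. incr_cov h k k)) / sqrt (2 * T)"
  shows "cmod (char (distr M borel S) t - of_real (exp (- (t\<^sup>2 / 2)))) \<le> sqrt (8 / real m) * t\<^sup>2"
proof -
  obtain I :: "(real \<times> real) set set set" and C d where I: "finite I" "disjoint_family_on C I"
    "\<And>i. i \<in> I \<Longrightarrow> C i \<in> finite_borel"
    and fd: "\<And>k. k \<in> {..<m} \<Longrightarrow> dF h k = (\<lambda>q. \<Sum>i\<in>I. d k i * indicator (C i) q)"
    and Xd: "\<And>k. k \<in> {..<m} \<Longrightarrow> AE \<omega> in M. dX h k \<omega> = (\<Sum>i\<in>I. d k i * Z (C i) \<omega>)"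
    by (rule lin_common_atoms[of "{..<m}" "dF h" "dX h"]) (use lin_dX in auto)
  define r where "r k l = (\<Sum>i\<in>I. measure lborel (C i) * d k i * d l i)" for k l
  have r: "incr_cov h k l = r k l" if "k < m" "l < m" for k l
    unfolding incr_cov_def r_def using that by (simp add: fd ip_simple_functions[OF I])
  define \<delta> where "\<delta> k \<omega> = (\<Sum>i\<in>I. d k i * Z (C i) \<omega>)" for k \<omega>
  have T_r: "T = (\<Sum>k<m. \<Sum>l<m. (r k l)\<^sup>2)" unfolding T_def by (intro sum.cong refl) (simp add: r)
  have "0 < real m * (4 * (u h)\<^sup>2)" using m u by simp
  also have "\<dots> \<le> T" unfolding T_def by (rule incr_cov_square_sum(3)[OF h])
  finally have T: "0 < T" .
  have "AE \<omega> in M. \<forall>k\<in>{..<m}. dX h k \<omega> = \<delta> k \<omega>"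
    using Xd unfolding \<delta>_def by (intro AE_ball_countable[THEN iffD2] countable_finite) auto
  then have AE: "AE \<omega> in M. \<forall>k<m. dX h k \<omega> = \<delta> k \<omega>" by eventually_elim simp
  have m\<delta>: "\<delta> k \<in> borel_measurable M" for k
    unfolding \<delta>_def[abs_def] using I(3) by (intro borel_measurable_sum borel_measurable_times) (auto intro: Z_measurable)
  note [measurable] = m\<delta> lin_measurable[OF lin_dX]
  let ?V = "\<lambda>\<omega>. ((\<Sum>k<m. \<Sum>l<m. incr_cov h k l * (dX h k \<omega> * dX h l \<omega>)) - T)\<^sup>2"
  let ?V' = "\<lambda>\<omega>. ((\<Sum>k<m. \<Sum>l<m. r k l * (\<delta> k \<omega> * \<delta> l \<omega>)) - T)\<^sup>2"
  have VV: "AE \<omega> in M. ?V \<omega> = ?V' \<omega>" using AE by eventually_elim (simp add: r)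
  note cv = covariance_form_variance[OF c h, of m, folded T_def]
  have iV: "integrable M ?V'"
  proof (rule Bochner_Integration.integrable_cong_AE_imp[OF cv(1)])
    show "?V' \<in> borel_measurable M" by measurable
    show "AE \<omega> in M. ?V \<omega> = ?V' \<omega>" by (rule VV)
  qed
  have "expectation ?V' = expectation ?V"
    using VV by (intro integral_cong_AE) auto
  also have "\<dots> \<le> 32 * (u h)\<^sup>2 * T" by (rule cv(2))
  \<comment> \<open>The relative error comes from the diagonal: \<open>T >= 4 * m * u^2\<close>, so
    \<open>32 * u^2 <= (8 / m) * T\<close>.\<close>
  also have "\<dots> \<le> (sqrt (8 / real m) * T)\<^sup>2"
  proof -
    have "32 * (u h)\<^sup>2 = 8 / real m * (real m * (4 * (u h)\<^sup>2))" using m by simp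
    also have "\<dots> \<le> 8 / real m * T" unfolding T_def by (intro mult_left_mono incr_cov_square_sum(3)[OF h]) simp
    finally have "32 * (u h)\<^sup>2 * T \<le> 8 / real m * T * T" using T by (intro mult_right_mono) auto
    moreover have "(sqrt (8 / real m) * T)\<^sup>2 = 8 / real m * T * T"
      unfolding power_mult_distrib by (subst real_sqrt_pow2) (simp_all add: power2_eq_square)
    ultimately show ?thesis by simp
  qed
  finally have eV: "expectation ?V' \<le> (sqrt (8 / real m) * T)\<^sup>2" .
  have "distr M borel S = distr M borel (\<lambda>\<omega>. ((\<Sum>k<m. (\<delta> k \<omega>)\<^sup>2) - (\<Sum>k<m. r k k)) / sqrt (2 * T))"
  proof (rule distr_cong_AE)
    show "AE \<omega> in M. S \<omega> = ((\<Sum>k<m. (\<delta> k \<omega>)\<^sup>2) - (\<Sum>k<m. r k k)) / sqrt (2 * T)"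
      using AE by eventually_elim (simp add: S_def r)
    show "S \<in> borel_measurable M" unfolding S_def by measurable
  qed (auto intro: m\<delta>)
  moreover have "cmod (char (distr M borel (\<lambda>\<omega>. ((\<Sum>k<m. (\<delta> k \<omega>)\<^sup>2) - (\<Sum>k<m. r k k)) / sqrt (2 * T))) t
      - of_real (exp (- (t\<^sup>2 / 2)))) \<le> sqrt (8 / real m) * t\<^sup>2"
    unfolding \<delta>_def T_r
    by (rule gaussian_quadratic_char_bound[OF I(1) Z_indep_vars[OF I] Z_centred_gaussian(1)[OF c I(3)] r_def])
      (use T eV iV in \<open>simp_all only: \<delta>_def T_r real_sqrt_ge_zero divide_nonneg_nonneg of_nat_0_le_iff zero_le_numeral\<close>)
  ultimately show ?thesis by simp
qed

end

context trawl_basis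
begin

lemma squared_increments_variance:
  fixes m :: nat and h :: real
  assumes c: "c4 \<nu> = 0"
  defines "V \<equiv> \<lambda>\<omega>. (\<Sum>k<m. (dX h k \<omega>)\<^sup>2) - (\<Sum>k<m. incr_cov h k k)"
  shows "integrable M (\<lambda>\<omega>. (V \<omega>)\<^sup>2)" and "expectation (\<lambda>\<omega>. (V \<omega>)\<^sup>2) = 2 * (\<Sum>k<m. \<Sum>l<m. (incr_cov h k l)\<^sup>2)"
proof -
  have K: "finite {..<m}" by simp
  note q = quadratic_variance[where s = "\<lambda>_. 1", OF K lin_dX[of h] lin_dX[of h], folded incr_cov_def]
  have V: "V \<omega> = (\<Sum>k<m. 1 * (dX h k \<omega> * dX h k \<omega> - incr_cov h k k))" for \<omega>
    by (simp add: V_def sum_subtractf power2_eq_square)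
  show "integrable M (\<lambda>\<omega>. (V \<omega>)\<^sup>2)" unfolding V by (rule q(1))
  show "expectation (\<lambda>\<omega>. (V \<omega>)\<^sup>2) = 2 * (\<Sum>k<m. \<Sum>l<m. (incr_cov h k l)\<^sup>2)"
    unfolding V q(2) Z_centred_gaussian(2)[OF c A_finite_borel[of 0]]
    by (simp add: sum_distrib_left power2_eq_square)
qed

end

section \<open>Limits in the Gaussian case\<close>

context trawl_limit
begin

text \<open>The standard deviation of \<open>quadratic_statistic n\<close> when the basis is
  Gaussian.\<close>

definition gauss_scale :: "nat \<Rightarrow> real" where
  "gauss_scale n = sqrt (2 * (\<Sum>k<n - 1. \<Sum>l<n - 1. (incr_cov (\<Delta> n) k l)\<^sup>2)) / (2 * \<Delta> n * sqrt (real n))"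

definition quadratic_statistic :: "nat \<Rightarrow> 'a \<Rightarrow> real" where
  "quadratic_statistic n \<omega> = 1 / (2 * \<Delta> n * sqrt (real n)) * ((\<Sum>k<n - 1. (dX (\<Delta> n) k \<omega>)\<^sup>2) - (\<Sum>k<n - 1. incr_cov (\<Delta> n) k k))"

lemma quadratic_statistic_measurable: "random_variable borel (quadratic_statistic n)"
proof -
  note [measurable] = dX_measurable
  show ?thesis unfolding quadratic_statistic_def[abs_def] by measurable
qed

lemma gauss_scale_square: "(gauss_scale n)\<^sup>2 = (\<Sum>k<n - 1. \<Sum>l<n - 1. (incr_cov (\<Delta> n) k l)\<^sup>2) / (2 * (\<Delta> n)\<^sup>2 * real n)"
proof -
  have "0 \<le> (\<Sum>k<n - 1. \<Sum>l<n - 1. (incr_cov (\<Delta> n) k l)\<^sup>2)" by (intro sum_nonneg) simp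
  then show ?thesis by (simp add: gauss_scale_def power_divide power_mult_distrib)
qed

text \<open>Squeezed between the diagonal part of the squared covariances and the row bound; the
  off-diagonal part adds only a multiple of \<open>u (\<Delta> n)\<close>.\<close>

lemma gauss_scale_lim: "(\<lambda>n. (gauss_scale n)\<^sup>2) \<longlonglongrightarrow> 2 * (a 0)\<^sup>2"
proof (rule tendsto_sandwich)
  let ?q = "\<lambda>n. real (n - 1) / real n" and ?r = "\<lambda>n. u (\<Delta> n) / \<Delta> n"
  have "(\<lambda>n. ?q n * (2 * (?r n)\<^sup>2)) \<longlonglongrightarrow> 1 * (2 * (a 0)\<^sup>2)" by (intro tendsto_intros pred_ratio u_lim)
  then show "(\<lambda>n. ?q n * (2 * (?r n)\<^sup>2)) \<longlonglongrightarrow> 2 * (a 0)\<^sup>2" by simp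
  have "(\<lambda>n. ?q n * (2 * (?r n)\<^sup>2 + 2 * phi_sup * u (\<Delta> n))) \<longlonglongrightarrow> 1 * (2 * (a 0)\<^sup>2 + 2 * phi_sup * 0)"
    by (intro tendsto_intros pred_ratio u_lim u_lim0)
  then show "(\<lambda>n. ?q n * (2 * (?r n)\<^sup>2 + 2 * phi_sup * u (\<Delta> n))) \<longlonglongrightarrow> 2 * (a 0)\<^sup>2" by simp
  show "\<forall>\<^sub>F n in sequentially. ?q n * (2 * (?r n)\<^sup>2) \<le> (gauss_scale n)\<^sup>2"
    using ev_step
  proof eventually_elim
    case (elim n)
    define h where "h = \<Delta> n"
    have h: "0 \<le> h" "0 < h" "0 < real n" using elim by (auto simp: h_def)
    have "?q n * (2 * (?r n)\<^sup>2) = real (n - 1) * (4 * (u h)\<^sup>2) / (2 * h\<^sup>2 * real n)"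
      unfolding h_def[symmetric] using h by (simp add: field_simps)
    also have "\<dots> \<le> (gauss_scale n)\<^sup>2"
      unfolding gauss_scale_square h_def[symmetric]
      by (intro divide_right_mono incr_cov_square_sum(3)[OF h(1)]) (use h in simp)
    finally show ?case .
  qed
  show "\<forall>\<^sub>F n in sequentially. (gauss_scale n)\<^sup>2 \<le> ?q n * (2 * (?r n)\<^sup>2 + 2 * phi_sup * u (\<Delta> n))"
    using ev_step
  proof eventually_elim
    case (elim n)
    define h where "h = \<Delta> n"
    have h: "0 \<le> h" "0 < h" "0 < real n" using elim by (auto simp: h_def)
    have "(gauss_scale n)\<^sup>2 \<le> real (n - 1) * (4 * (u h)\<^sup>2 + 4 * phi_sup * h\<^sup>2 * u h) / (2 * h\<^sup>2 * real n)"
      unfolding gauss_scale_square h_def[symmetric]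
      by (intro divide_right_mono incr_cov_square_sum(2)[OF h(1)]) (use h in simp)
    also have "\<dots> = ?q n * (2 * (?r n)\<^sup>2 + 2 * phi_sup * u (\<Delta> n))"
      unfolding h_def[symmetric] using h by (simp add: field_simps)
    finally show ?case .
  qed
qed

lemma ev_u_pos: "\<forall>\<^sub>F n in sequentially. 0 < u (\<Delta> n)"
proof -
  have "\<forall>\<^sub>F n in sequentially. 0 < u (\<Delta> n) / \<Delta> n"
    using u_lim a_0_pos by (rule order_tendstoD(1))
  then show ?thesis using ev_step by eventually_elim (simp add: zero_less_divide_iff)
qed

text \<open>The statistic is \<open>gauss_scale n\<close> times the normalised form, so the
  quantitative bound is used at the argument \<open>t * gauss_scale n\<close>, whose square
  converges.\<close>

lemma quadratic_statistic_char:
  assumes c: "c4 \<nu> = 0"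
  shows "(\<lambda>n. char (distr M borel (quadratic_statistic n)) t) \<longlonglongrightarrow> complex_of_real (exp (- (2 * (a 0)\<^sup>2 * t\<^sup>2 / 2)))"
proof -
  let ?\<beta> = gauss_scale
  let ?e = "\<lambda>n. complex_of_real (exp (- ((?\<beta> n)\<^sup>2 * t\<^sup>2 / 2)))"
  have e: "?e \<longlonglongrightarrow> complex_of_real (exp (- (2 * (a 0)\<^sup>2 * t\<^sup>2 / 2)))"
    by (intro tendsto_of_real tendsto_exp tendsto_minus tendsto_divide tendsto_mult gauss_scale_lim tendsto_const) simp
  have "(\<lambda>n. char (distr M borel (quadratic_statistic n)) t - ?e n) \<longlonglongrightarrow> 0"
  proof (rule Lim_null_comparison)
    have "(\<lambda>n. 8 / real (n - 1)) \<longlonglongrightarrow> 0"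
      by (rule LIMSEQ_offset[of _ 1]) (use lim_const_over_n[of 8] LIMSEQ_ignore_initial_segment[of _ _ 0] in simp)
    then have "(\<lambda>n. sqrt (8 / real (n - 1)) * ((?\<beta> n)\<^sup>2 * t\<^sup>2)) \<longlonglongrightarrow> sqrt 0 * (2 * (a 0)\<^sup>2 * t\<^sup>2)"
      by (intro tendsto_mult tendsto_real_sqrt gauss_scale_lim tendsto_const)
    then show "(\<lambda>n. sqrt (8 / real (n - 1)) * ((?\<beta> n)\<^sup>2 * t\<^sup>2)) \<longlonglongrightarrow> 0" by simp
    show "\<forall>\<^sub>F n in sequentially. norm (char (distr M borel (quadratic_statistic n)) t - ?e n) \<le> sqrt (8 / real (n - 1)) * ((?\<beta> n)\<^sup>2 * t\<^sup>2)"
      using ev_step ev_u_pos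
    proof eventually_elim
      case (elim n)
      define h where "h = \<Delta> n"
      define T where "T = (\<Sum>k<n - 1. \<Sum>l<n - 1. (incr_cov h k l)\<^sup>2)"
      define S where "S \<omega> = ((\<Sum>k<n - 1. (dX h k \<omega>)\<^sup>2) - (\<Sum>k<n - 1. incr_cov h k k)) / sqrt (2 * T)" for \<omega>
      have h: "0 \<le> h" "0 < u h" and n: "0 < n - 1" using elim by (auto simp: h_def)
      have "0 < real (n - 1) * (4 * (u h)\<^sup>2)" using n h by simp
      also have "\<dots> \<le> T" unfolding T_def by (rule incr_cov_square_sum(3)[OF h(1)])
      finally have T: "0 < T" .
      note [measurable] = dX_measurable
      have mS: "S \<in> borel_measurable M" unfolding S_def[abs_def] by measurable
      have gaussian_statistic: "quadratic_statistic n = (\<lambda>\<omega>. ?\<beta> n * S \<omega>)"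
        unfolding quadratic_statistic_def[abs_def] gauss_scale_def S_def h_def[symmetric] T_def[symmetric] using T by (simp add: fun_eq_iff)
      have "char (distr M borel (quadratic_statistic n)) t = char (distr M borel S) (t * ?\<beta> n)"
        unfolding char_def gaussian_statistic using mS by (simp add: integral_distr mult_ac)
      moreover have "cmod (char (distr M borel S) (t * ?\<beta> n) - of_real (exp (- ((t * ?\<beta> n)\<^sup>2 / 2)))) \<le> sqrt (8 / real (n - 1)) * (t * ?\<beta> n)\<^sup>2"
        unfolding S_def T_def by (rule squared_increments_gaussian_char[OF c h(1) n h(2)])
      moreover have "(t * ?\<beta> n)\<^sup>2 = (?\<beta> n)\<^sup>2 * t\<^sup>2" by (simp add: power_mult_distrib)
      ultimately show ?case by (simp only:)
    qed
  qed
  from tendsto_add[OF this e] show ?thesis by simp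
qed

lemma quadratic_statistic_L1:
  assumes c: "c4 \<nu> = 0"
  shows "\<forall>\<^sub>F n in sequentially. integrable M (quadratic_statistic n) \<and> expectation (\<lambda>\<omega>. \<bar>quadratic_statistic n \<omega>\<bar>) \<le> sqrt (2 * (a 0)\<^sup>2 + 1)"
proof -
  have "\<forall>\<^sub>F n in sequentially. (gauss_scale n)\<^sup>2 < 2 * (a 0)\<^sup>2 + 1"
    by (rule order_tendstoD(2)[OF gauss_scale_lim]) simp
  then show ?thesis
  proof eventually_elim
    case (elim n)
    define s where "s = 1 / (2 * \<Delta> n * sqrt (real n))"
    note v = squared_increments_variance[OF c, of "\<Delta> n" "n - 1"]
    have G2: "(quadratic_statistic n \<omega>)\<^sup>2 = s\<^sup>2 * ((\<Sum>k<n - 1. (dX (\<Delta> n) k \<omega>)\<^sup>2) - (\<Sum>k<n - 1. incr_cov (\<Delta> n) k k))\<^sup>2" for \<omega>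
      unfolding quadratic_statistic_def s_def by (rule power_mult_distrib)
    have i: "integrable M (\<lambda>\<omega>. (quadratic_statistic n \<omega>)\<^sup>2)" unfolding G2 by (intro integrable_mult_right v(1))
    have "expectation (\<lambda>\<omega>. (quadratic_statistic n \<omega>)\<^sup>2) = s\<^sup>2 * (2 * (\<Sum>k<n - 1. \<Sum>l<n - 1. (incr_cov (\<Delta> n) k l)\<^sup>2))"
      unfolding G2 by (simp only: integral_mult_right_zero v(2))
    also have "\<dots> = (gauss_scale n)\<^sup>2"
      unfolding gauss_scale_square by (simp add: s_def power_divide power_mult_distrib)
    finally have e: "expectation (\<lambda>\<omega>. (quadratic_statistic n \<omega>)\<^sup>2) \<le> 2 * (a 0)\<^sup>2 + 1" using elim by simp
    show ?case
      using expectation_abs_le_sqrt[OF quadratic_statistic_measurable i] real_sqrt_le_mono[OF e] by (blast intro: order_trans)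
  qed
qed

text \<open>A Gaussian increment of variance \<open>2 * u\<close> has fourth moment
  \<open>12 * u^2\<close>, of order \<open>\<Delta>^2\<close> rather than \<Delta>; hence the extra
  division, and the constant \<open>12 / 2 = 6\<close>.\<close>

lemma Q_lim_gaussian:
  assumes c: "c4 \<nu> = 0"
  shows "vanishing (\<lambda>n \<omega>. Q_stat (\<lambda>t. trawl_process L a t \<omega>) (\<Delta> n) n / \<Delta> n - 6 * (a 0)\<^sup>2)"
proof -
  let ?r = "\<lambda>n. u (\<Delta> n) / \<Delta> n"
  define s where "s n = 1 / (2 * (\<Delta> n)\<^sup>2 * real n)" for n
  define V where "V n \<omega> = (\<Sum>k<n - 1. dX (\<Delta> n) k \<omega> ^ 4 - 12 * (u (\<Delta> n))\<^sup>2)" for n \<omega>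
  note [measurable] = dX_measurable
  have mV: "V n \<in> borel_measurable M" for n unfolding V_def[abs_def] by measurable
  have vV: "vanishing (\<lambda>n \<omega>. s n * V n \<omega>)"
  proof (rule vanishing_L2)
    show "(\<lambda>\<omega>. s n * V n \<omega>) \<in> borel_measurable M" for n using mV[of n] by measurable
    have "(\<lambda>n. 768 * ?r n ^ 4 * (1 / real n)) \<longlonglongrightarrow> 768 * a 0 ^ 4 * 0" by (intro tendsto_intros u_lim lim_const_over_n)
    then show "(\<lambda>n. 768 * ?r n ^ 4 * (1 / real n)) \<longlonglongrightarrow> 0" by simp
    show "\<forall>\<^sub>F n in sequentially. integrable M (\<lambda>\<omega>. (s n * V n \<omega>)\<^sup>2) \<and> expectation (\<lambda>\<omega>. (s n * V n \<omega>)\<^sup>2) \<le> 768 * ?r n ^ 4 * (1 / real n)"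
      using ev_step
    proof eventually_elim
      case (elim n)
      define h where "h = \<Delta> n"
      have h: "0 \<le> h" "0 < h" "0 < real n" using elim by (auto simp: h_def)
      note v = fourth_powers_variance[OF c h(1), of "n - 1", folded V_def[of n, folded h_def]]
      have "expectation (\<lambda>\<omega>. (s n * V n \<omega>)\<^sup>2) = (s n)\<^sup>2 * expectation (\<lambda>\<omega>. (V n \<omega>)\<^sup>2)"
        by (simp add: power_mult_distrib)
      also have "\<dots> \<le> (s n)\<^sup>2 * (3072 * real (n - 1) * u h ^ 4)" by (intro mult_left_mono v(2)) simp
      also have "\<dots> \<le> (s n)\<^sup>2 * (3072 * real n * u h ^ 4)" by (intro mult_left_mono mult_right_mono) auto
      also have "\<dots> = 768 * ?r n ^ 4 * (1 / real n)"
        unfolding s_def h_def[symmetric] using h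
        by (simp add: power_divide power_mult_distrib power2_eq_square power4_eq_xxxx field_simps)
      finally show ?case using v(1) by (simp add: power_mult_distrib)
    qed
  qed
  define d where "d n = 6 * (?r n)\<^sup>2 * (real (n - 1) / real n) - 6 * (a 0)\<^sup>2" for n
  have "(\<lambda>n. 6 * (?r n)\<^sup>2 * (real (n - 1) / real n) - 6 * (a 0)\<^sup>2) \<longlonglongrightarrow> 6 * (a 0)\<^sup>2 * 1 - 6 * (a 0)\<^sup>2"
    by (intro tendsto_intros u_lim pred_ratio)
  then have "d \<longlonglongrightarrow> 0" by (simp add: d_def[abs_def])
  from vanishing_add[OF vV vanishing_const[OF this]]
  show ?thesis
  proof (rule vanishing_cong)
    show "(\<lambda>\<omega>. Q_stat (\<lambda>t. trawl_process L a t \<omega>) (\<Delta> n) n / \<Delta> n - 6 * (a 0)\<^sup>2) \<in> borel_measurable M" for n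
      using Q_measurable[of "\<Delta> n" n] by measurable
    have "Q_stat (\<lambda>t. trawl_process L a t \<omega>) (\<Delta> n) n / \<Delta> n - 6 * (a 0)\<^sup>2 = s n * V n \<omega> + d n" for n \<omega>
      by (simp add: Q_stat_def increment_eq_dX s_def V_def d_def sum_subtractf power2_eq_square algebra_simps)
    then show "\<forall>\<^sub>F n in sequentially. AE \<omega> in M. Q_stat (\<lambda>t. trawl_process L a t \<omega>) (\<Delta> n) n / \<Delta> n - 6 * (a 0)\<^sup>2 = s n * V n \<omega> + d n"
      by simp
  qed
qed

section \<open>The slope estimator over blocks of steps\<close>

context
  fixes K :: "nat \<Rightarrow> nat" and \<mu>\<^sub>0 :: real
  assumes mu0: "(\<lambda>n. real n * (\<Delta> n)\<^sup>2) \<longlonglongrightarrow> \<mu>\<^sub>0"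
    and K_lim: "filterlim K at_top sequentially"
    and block_lim: "(\<lambda>n. real (K n) * \<Delta> n) \<longlonglongrightarrow> 0"
begin

text \<open>A block has vanishing length while the horizon grows, so eventually
  \<open>2 * K <= n\<close>; the incomplete block lost in the integer division then costs at most a
  factor 2.\<close>

lemma ev_blocks:
  "\<forall>\<^sub>F n in sequentially. 2 \<le> n \<and> 0 < \<Delta> n \<and> 0 < real (K n) \<and> 0 < real ((n - 1) div K n)
    \<and> real n \<le> 2 * (real ((n - 1) div K n) * real (K n))"
proof -
  have "\<forall>\<^sub>F n in sequentially. real (K n) * \<Delta> n < 1 / 2" using block_lim by (rule order_tendstoD(2)) simp
  moreover have "\<forall>\<^sub>F n in sequentially. 1 \<le> K n" using K_lim by (simp add: filterlim_at_top)
  ultimately show ?thesis using ev_step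
  proof eventually_elim
    case (elim n)
    then have "real (K n) * \<Delta> n * 2 \<le> real n * \<Delta> n" by linarith
    with elim have "real (K n) * 2 \<le> real n" by (simp add: mult.commute mult.left_commute)
    then have K2: "K n * 2 \<le> n" by linarith
    define m where "m = (n - 1) div K n"
    define r where "r = (n - 1) mod K n"
    have "m * K n + r = n - 1" unfolding m_def r_def by (rule div_mult_mod_eq)
    moreover have "r < K n" unfolding r_def using elim by (intro mod_less_divisor) simp
    ultimately have "n \<le> 2 * (m * K n)" using K2 elim by linarith
    then have "real n \<le> real (2 * (m * K n))" by (simp only: of_nat_le_iff)
    moreover from this have "0 < m" using elim by (cases "m = 0") auto
    ultimately show ?case using elim by (simp add: m_def)
  qed
qed

lemma block_at_right: "filterlim (\<lambda>n. real (K n) * \<Delta> n) (at_right 0) sequentially"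
  unfolding filterlim_at
proof
  show "\<forall>\<^sub>F n in sequentially. real (K n) * \<Delta> n \<in> {0<..} \<and> real (K n) * \<Delta> n \<noteq> 0"
    using ev_blocks by eventually_elim auto
qed (rule block_lim)

lemma inverse_K: "(\<lambda>n. 1 / real (K n)) \<longlonglongrightarrow> 0"
  by (rule tendsto_divide_0[OF tendsto_const filterlim_at_top_imp_at_infinity[OF filterlim_compose[OF filterlim_real_sequentially K_lim]]])

text \<open>There are at least \<open>n / (2 * K)\<close> blocks, and \<open>K / n\<close> is the
  ratio of the block length \<open>K * \<Delta>\<close> to the horizon
  \<open>n * \<Delta>\<close>.\<close>

lemma inverse_blocks: "(\<lambda>n. 1 / real ((n - 1) div K n)) \<longlonglongrightarrow> 0"
proof (rule tendsto_sandwich[OF _ _ tendsto_const])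
  have "(\<lambda>n. 2 * (real (K n) * \<Delta> n) * (1 / (real n * \<Delta> n))) \<longlonglongrightarrow> 2 * 0 * 0"
    by (intro tendsto_mult tendsto_const block_lim inverse_horizon)
  then show "(\<lambda>n. 2 * (real (K n) * \<Delta> n) * (1 / (real n * \<Delta> n))) \<longlonglongrightarrow> 0" by simp
  show "\<forall>\<^sub>F n in sequentially. 1 / real ((n - 1) div K n) \<le> 2 * (real (K n) * \<Delta> n) * (1 / (real n * \<Delta> n))"
    using ev_blocks by eventually_elim (simp add: field_simps)
qed simp

definition gaussian_statistic :: "nat \<Rightarrow> 'a \<Rightarrow> real" where
  "gaussian_statistic n \<omega> = (let x = (\<lambda>t. trawl_process L a t \<omega>); h = \<Delta> n in
     sqrt (real n) * (a_hat x h n - a 0 - 1 / 2 * h * a'_tilde x h (K n) n))"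

text \<open>At the scale \<open>sqrt n\<close> the centred products over blocks have variance of
  order \<open>1 / K\<close>; products over single steps would leave a contribution of order 1. The
  means cancel as before, the covariance now being taken over the block length.\<close>

lemma gaussian_statistic_approx:
  assumes c: "c4 \<nu> = 0"
  shows "vanishing (\<lambda>n \<omega>. gaussian_statistic n \<omega> - quadratic_statistic n \<omega>)"
proof -
  let ?m = "\<lambda>n. (n - 1) div K n" and ?h' = "\<lambda>n. real (K n) * \<Delta> n"
  define s where "s n = 1 / 2 * \<Delta> n * sqrt (real n) / (real (?m n) * (?h' n)\<^sup>2)" for n
  define V where "V n \<omega> = (\<Sum>k\<in>{1..<?m n}. dX (?h' n) k \<omega> * dX (?h' n) (k - 1) \<omega> + w (?h' n) 1)" for n \<omega>
  note [measurable] = dX_measurable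
  have mV: "V n \<in> borel_measurable M" for n unfolding V_def[abs_def] by measurable
  have mGS: "gaussian_statistic n \<in> borel_measurable M" for n
    unfolding gaussian_statistic_def[abs_def] Let_def a_hat_def a'_tilde_def increment_eq_dX by measurable
  have u': "(\<lambda>n. u (?h' n) / ?h' n) \<longlonglongrightarrow> a 0" by (rule filterlim_compose[OF u_over_h block_at_right])
  have w': "(\<lambda>n. w (?h' n) 1 / (?h' n)\<^sup>2) \<longlonglongrightarrow> \<phi> 0" by (rule filterlim_compose[OF w_second_order block_at_right])
  have vV: "vanishing (\<lambda>n \<omega>. s n * V n \<omega>)"
  proof (rule vanishing_L2)
    show "(\<lambda>\<omega>. s n * V n \<omega>) \<in> borel_measurable M" for n using mV[of n] by measurable
    have "(\<lambda>n. 8 * (u (?h' n) / ?h' n)\<^sup>2 * (1 / real (K n))) \<longlonglongrightarrow> 8 * (a 0)\<^sup>2 * 0"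
      by (intro tendsto_mult tendsto_power tendsto_const u' inverse_K)
    then show "(\<lambda>n. 8 * (u (?h' n) / ?h' n)\<^sup>2 * (1 / real (K n))) \<longlonglongrightarrow> 0" by simp
    show "\<forall>\<^sub>F n in sequentially. integrable M (\<lambda>\<omega>. (s n * V n \<omega>)\<^sup>2) \<and>
        expectation (\<lambda>\<omega>. (s n * V n \<omega>)\<^sup>2) \<le> 8 * (u (?h' n) / ?h' n)\<^sup>2 * (1 / real (K n))"
      using ev_blocks
    proof eventually_elim
      case (elim n)
      define m h k where "m = ?m n" and "h = \<Delta> n" and "k = real (K n)"
      have p: "0 < real m" "0 < h" "0 < k" "real n \<le> 2 * (real m * k)" using elim by (auto simp: m_def h_def k_def)
      have h': "0 \<le> k * h" using p by simp
      note v = increment_products[OF h', of m, folded V_def[of n, folded m_def h_def k_def]]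
      have "expectation (\<lambda>\<omega>. (s n * V n \<omega>)\<^sup>2) = (s n)\<^sup>2 * expectation (\<lambda>\<omega>. (V n \<omega>)\<^sup>2)"
        by (simp add: power_mult_distrib)
      also have "\<dots> \<le> (s n)\<^sup>2 * (16 * real m * (u (k * h))\<^sup>2)"
        using v(2) Z_centred_gaussian(2)[OF c A_finite_borel] by (intro mult_left_mono) auto
      also have "\<dots> = 4 * (u (k * h) / (k * h))\<^sup>2 * (real n / (real m * k\<^sup>2))"
        unfolding s_def m_def[symmetric] h_def[symmetric] k_def[symmetric] using p
        by (simp add: power_divide power_mult_distrib) (simp add: power2_eq_square power4_eq_xxxx field_simps)
      also have "\<dots> \<le> 4 * (u (k * h) / (k * h))\<^sup>2 * (2 * (1 / k))"
      proof (rule mult_left_mono)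
        have "real n / (real m * k\<^sup>2) \<le> (2 * (real m * k)) / (real m * k\<^sup>2)"
          using p by (intro divide_right_mono) auto
        also have "\<dots> = 2 * (1 / k)" using p by (simp add: power2_eq_square)
        finally show "real n / (real m * k\<^sup>2) \<le> 2 * (1 / k)" .
      qed simp
      finally show ?case using v(1) by (simp add: power_mult_distrib h_def k_def)
    qed
  qed
  \<comment> \<open>The deterministic part: the bias of the squares, the mean of the block products,
    and the one square missing from \<open>n\<close>. The first two tend to
    \<open>- sqrt \<mu>0 * \<phi> 0 / 2\<close> and its opposite, writing \<mu>0 for the limit of
    \<open>n * \<Delta>^2\<close>.\<close>
  define d where "d n = sqrt (real n * (\<Delta> n)\<^sup>2) * ((u (\<Delta> n) - a 0 * \<Delta> n) / (\<Delta> n)\<^sup>2)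
     + 1 / 2 * sqrt (real n * (\<Delta> n)\<^sup>2) * (1 - 1 / real (?m n)) * (w (?h' n) 1 / (?h' n)\<^sup>2)
     - u (\<Delta> n) / \<Delta> n * sqrt (1 / real n)" for n
  have sq: "(\<lambda>n. sqrt (real n * (\<Delta> n)\<^sup>2)) \<longlonglongrightarrow> sqrt \<mu>\<^sub>0" by (rule tendsto_real_sqrt[OF mu0])
  have "(\<lambda>n. sqrt (1 / real n)) \<longlonglongrightarrow> sqrt 0" by (intro tendsto_real_sqrt lim_const_over_n)
  then have "d \<longlonglongrightarrow> sqrt \<mu>\<^sub>0 * (- \<phi> 0 / 2) + 1 / 2 * sqrt \<mu>\<^sub>0 * (1 - 0) * \<phi> 0 - a 0 * sqrt 0"
    unfolding d_def[abs_def]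
    by (intro tendsto_diff tendsto_add tendsto_mult tendsto_const sq u2_lim w' u_lim inverse_blocks)
  then have d0: "d \<longlonglongrightarrow> 0" by simp
  from vanishing_diff[OF vanishing_const[OF d0] vV]
  show ?thesis
  proof (rule vanishing_cong)
    show "(\<lambda>\<omega>. gaussian_statistic n \<omega> - quadratic_statistic n \<omega>) \<in> borel_measurable M" for n using mGS[of n] quadratic_statistic_measurable[of n] by measurable
    show "\<forall>\<^sub>F n in sequentially. AE \<omega> in M. gaussian_statistic n \<omega> - quadratic_statistic n \<omega> = d n - s n * V n \<omega>"
      using ev_blocks
    proof eventually_elim
      case (elim n)
      define m h k h' where "m = ?m n" and "h = \<Delta> n" and "k = real (K n)" and "h' = k * h"
      define r where "r = sqrt (real n)"
      have p: "0 < real m" "0 < h" "0 < h'" "0 < r" using elim by (auto simp: m_def h_def k_def h'_def r_def)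
      have n: "real n = r * r" by (simp add: r_def)
      have n1: "real (n - 1) = r * r - 1" "real (m - 1) = real m - 1"
        using elim by (auto simp: of_nat_diff n[symmetric] m_def)
      have sqs: "sqrt (real n * h\<^sup>2) = r * h" "sqrt (1 / real n) = 1 / r"
        using p by (simp_all add: r_def real_sqrt_mult real_sqrt_divide)
      show ?case
      proof (rule AE_I2)
        fix \<omega>
        define x where "x = (\<Sum>k<n - 1. (dX h k \<omega>)\<^sup>2)"
        define y where "y = (\<Sum>k\<in>{1..<m}. dX h' k \<omega> * dX h' (k - 1) \<omega>)"
        have V: "V n \<omega> = y + (real m - 1) * w h' 1"
          unfolding V_def m_def[symmetric] h_def[symmetric] k_def[symmetric] h'_def[symmetric] y_def
          using n1(2) by (simp add: sum.distrib)
        have G: "quadratic_statistic n \<omega> = 1 / (2 * h * r) * (x - (r * r - 1) * (2 * u h))"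
          unfolding quadratic_statistic_def h_def[symmetric] r_def[symmetric] x_def incr_cov_diag[OF less_imp_le[OF p(2)]] n1(1)[symmetric] by simp
        have S: "gaussian_statistic n \<omega> = r * (1 / (2 * h * (r * r)) * x - a 0 - 1 / 2 * h * (1 / (real m * h'\<^sup>2) * y))"
          unfolding gaussian_statistic_def Let_def a_hat_def a'_tilde_def increment_eq_dX h_def[symmetric] m_def[symmetric]
            k_def[symmetric] h'_def[symmetric] r_def[symmetric] x_def y_def unfolding n ..
        have s: "s n = 1 / 2 * h * r / (real m * h'\<^sup>2)"
          unfolding s_def h_def[symmetric] m_def[symmetric] k_def[symmetric] h'_def[symmetric] r_def[symmetric] ..
        have d: "d n = r * h * ((u h - a 0 * h) / h\<^sup>2) + 1 / 2 * (r * h) * (1 - 1 / real m) * (w h' 1 / h'\<^sup>2) - u h / h * (1 / r)"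
          unfolding d_def h_def[symmetric] m_def[symmetric] k_def[symmetric] h'_def[symmetric] sqs ..
        show "gaussian_statistic n \<omega> - quadratic_statistic n \<omega> = d n - s n * V n \<omega>"
          unfolding V G S s d using p by (simp add: field_simps power2_eq_square)
      qed
    qed
  qed
qed

theorem gaussian_case:
  assumes c: "c4 \<nu> = 0"
  shows "weak_conv_m
           (\<lambda>n. distr M borel (\<lambda>\<omega>.
              let x = (\<lambda>t. trawl_process L a t \<omega>); h = \<Delta> n in
              sqrt (real n * h / Q_stat x h n) * (a_hat x h n - a 0 - 1 / 2 * h * a'_tilde x h (K n) n)))
           (density lborel (normal_density 0 (sqrt (1 / 3))))"
proof -
  have pos: "0 < 6 * (a 0)\<^sup>2" "0 < 2 * (a 0)\<^sup>2" using a_0_pos by simp_all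
  note [measurable] = dX_measurable
  have "weak_conv_m (\<lambda>n. distr M borel (\<lambda>\<omega>.
              let x = (\<lambda>t. trawl_process L a t \<omega>); h = \<Delta> n in
              sqrt (real n * h / Q_stat x h n) * (a_hat x h n - a 0 - 1 / 2 * h * a'_tilde x h (K n) n)))
      (density lborel (normal_density 0 (sqrt (2 * (a 0)\<^sup>2 / (6 * (a 0)\<^sup>2)))))"
  proof (rule slutsky_ratio[OF quadratic_statistic_measurable quadratic_statistic_char[OF c] quadratic_statistic_L1[OF c] gaussian_statistic_approx[OF c] Q_lim_gaussian[OF c] _ _ pos])
    show "(\<lambda>\<omega>. let x = (\<lambda>t. trawl_process L a t \<omega>); h = \<Delta> n in
              sqrt (real n * h / Q_stat x h n) * (a_hat x h n - a 0 - 1 / 2 * h * a'_tilde x h (K n) n)) \<in> borel_measurable M" for n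
      unfolding Let_def Q_stat_def a_hat_def a'_tilde_def increment_eq_dX by measurable
    \<comment> \<open>The factor \<Delta> moves under \<open>Q_stat\<close>, which leaves the scale
      \<open>sqrt n\<close>.\<close>
    show "\<forall>\<^sub>F n in sequentially. \<forall>\<omega>. (let x = (\<lambda>t. trawl_process L a t \<omega>); h = \<Delta> n in
              sqrt (real n * h / Q_stat x h n) * (a_hat x h n - a 0 - 1 / 2 * h * a'_tilde x h (K n) n))
          = sqrt (1 / (Q_stat (\<lambda>t. trawl_process L a t \<omega>) (\<Delta> n) n / \<Delta> n)) * gaussian_statistic n \<omega>"
      by (intro always_eventually allI) (simp add: gaussian_statistic_def Let_def real_sqrt_divide real_sqrt_mult)
  qed
  moreover have "2 * (a 0)\<^sup>2 / (6 * (a 0)\<^sup>2) = 1 / 3" using pos by simp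
  ultimately show ?thesis by (simp only:)
qed

end

end

theorem theorem4:
  fixes M :: "'a measure" and L :: "(real \<times> real) set \<Rightarrow> 'a \<Rightarrow> real"
    and \<gamma> b :: real and \<nu> :: "real measure"
    and N :: "'b measure" and L' :: "'b \<Rightarrow> real"
    and a \<phi> :: "real \<Rightarrow> real" and X :: "real \<Rightarrow> 'a \<Rightarrow> real"
    and \<Delta> :: "nat \<Rightarrow> real" and \<mu> \<alpha> p\<^sub>0 :: real
  assumes basis: "homogeneous_levy_basis M L \<gamma> b \<nu>"
    and seed: "levy_seed N L' \<gamma> b \<nu>"
    and trawl: "trawl_function a"
    and X: "X = trawl_process L a"
    and step_pos: "\<And>n. n \<ge> 1 \<Longrightarrow> \<Delta> n > 0"
    and step_lim: "\<Delta> \<longlonglongrightarrow> 0"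
    and horizon: "filterlim (\<lambda>n. real n * \<Delta> n) at_top sequentially"
    and mu_nonneg: "0 \<le> \<mu>"
    and mu_lim: "(\<lambda>n. real n * \<Delta> n ^ 3) \<longlonglongrightarrow> \<mu>"
    and a_eq: "\<And>s. s \<ge> 0 \<Longrightarrow> a s = (LINT y:{s..}|lborel. \<phi> y)"
    and phi_pos: "\<And>s. s \<ge> 0 \<Longrightarrow> \<phi> s > 0"
    and phi_cont: "continuous_on {0..} \<phi>"
    and alpha: "\<alpha> > 1"
    and phi_bigo: "\<phi> \<in> O[at_top](\<lambda>s. s powr (- \<alpha> - 1))"
    and seed_var: "prob_space.variance N L' = 1"
    and p0: "p\<^sub>0 > 4"
    and seed_moment: "integrable N (\<lambda>\<omega>. \<bar>L' \<omega>\<bar> powr p\<^sub>0)"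
  shows "(c4 \<nu> > 0 \<longrightarrow>
           weak_conv_m
             (\<lambda>n. distr M borel (\<lambda>\<omega>.
                let x = (\<lambda>t. X t \<omega>); h = \<Delta> n in
                sqrt (real n * h / Q_stat x h n) *
                  (a_hat x h n - a 0 - 1 / 2 * h * a'_hat x h n)))
             (density lborel (normal_density 0 1)))
       \<and> (c4 \<nu> = 0 \<longrightarrow>
           (\<forall>\<mu>\<^sub>0 (K :: nat \<Rightarrow> nat).
              0 \<le> \<mu>\<^sub>0 \<longrightarrow> (\<lambda>n. real n * (\<Delta> n)\<^sup>2) \<longlonglongrightarrow> \<mu>\<^sub>0 \<longrightarrow>
              filterlim K at_top sequentially \<longrightarrow> (\<lambda>n. real (K n) * \<Delta> n) \<longlonglongrightarrow> 0 \<longrightarrow>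
              weak_conv_m
                (\<lambda>n. distr M borel (\<lambda>\<omega>.
                   let x = (\<lambda>t. X t \<omega>); h = \<Delta> n in
                   sqrt (real n * h / Q_stat x h n) *
                     (a_hat x h n - a 0 - 1 / 2 * h * a'_tilde x h (K n) n)))
                (density lborel (normal_density 0 (sqrt (1 / 3))))))"
proof -
  interpret B: homogeneous_levy_basis M L \<gamma> b \<nu> by (rule basis)
  interpret S: levy_seed N L' \<gamma> b \<nu> by (rule seed)
  let ?U = "strip 0 1"
  have U: "?U \<in> finite_borel" "measure lborel ?U = 1" using strip_measure[of 1 0] by simp_all
  note mU = B.measurable_basis[OF U(1)] and mS = S.measurable_seed
  \<comment> \<open>The seed has the law of the basis on any set of area 1; its moment conditions
    can thus be read on the unit strip.\<close>
  have law: "distr N borel L' = distr M borel (L ?U)"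
  proof (rule Levy_uniqueness)
    show "char (distr N borel L') = char (distr M borel (L ?U))"
      using B.char_basis[OF U(1)] by (simp add: fun_eq_iff S.char_seed U)
  qed (use mU mS in simp_all)
  \<comment> \<open>Capped at 6 so that the Lyapunov exponent \<open>p / 2\<close> is at most 3,
    while \<open>p > 4\<close> is kept.\<close>
  define p where "p = min p\<^sub>0 6"
  have p: "4 < p" "p \<le> 6" "p \<le> p\<^sub>0" using p0 by (auto simp: p_def)
  have transfer: "integrable M (\<lambda>\<omega>. f (L ?U \<omega>)) = integrable N (\<lambda>\<omega>. f (L' \<omega>))"
      "B.expectation (\<lambda>\<omega>. f (L ?U \<omega>)) = S.expectation (\<lambda>\<omega>. f (L' \<omega>))"
    if "f \<in> borel_measurable borel" for f :: "real \<Rightarrow> real"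
    using integrable_distr_eq[OF mU that] integrable_distr_eq[OF mS that] integral_distr[OF mU that] integral_distr[OF mS that]
    by (simp_all add: law)
  have "integrable N (\<lambda>\<omega>. \<bar>L' \<omega>\<bar> powr p)"
  proof (rule Bochner_Integration.integrable_bound)
    show "integrable N (\<lambda>\<omega>. 1 + \<bar>L' \<omega>\<bar> powr p\<^sub>0)" using seed_moment by simp
    have "\<bar>x\<bar> powr p \<le> 1 + \<bar>x\<bar> powr p\<^sub>0" for x :: real
    proof (cases "1 \<le> \<bar>x\<bar>")
      case True
      then show ?thesis using powr_mono[OF p(3) True] by linarith
    next
      case False
      then have "\<bar>x\<bar> powr p \<le> 1 powr p" using p by (intro powr_mono2) auto
      also have "\<dots> \<le> 1 + \<bar>x\<bar> powr p\<^sub>0" by simp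
      finally show ?thesis .
    qed
    then show "AE \<omega> in N. norm (\<bar>L' \<omega>\<bar> powr p) \<le> norm (1 + \<bar>L' \<omega>\<bar> powr p\<^sub>0)"
      by (intro AE_I2) (simp add: add_nonneg_nonneg)
    show "(\<lambda>\<omega>. \<bar>L' \<omega>\<bar> powr p) \<in> borel_measurable N" using mS by measurable
  qed
  then have unit: "integrable M (\<lambda>\<omega>. \<bar>L ?U \<omega>\<bar> powr p)"
    by (subst transfer(1)) measurable
  have "B.expectation (L ?U) = S.expectation L'" using transfer(2)[of "\<lambda>x. x"] by simp
  then have "B.variance (L ?U) = S.variance L'"
    using transfer(2)[of "\<lambda>x. (x - S.expectation L')\<^sup>2"] by simp
  then have var: "B.variance (L ?U) = 1" using seed_var by simp
  interpret T: trawl_limit M L \<gamma> b \<nu> p a \<phi> \<alpha> \<Delta> \<mu>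
    by unfold_locales
      (use p unit var trawl a_eq phi_pos phi_cont alpha phi_bigo step_pos step_lim horizon mu_lim in auto)
  show ?thesis
    unfolding X using T.levy_case T.gaussian_case by blast
qed

end
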